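(* Let $\mathbf k$ be a field of characteristic $0$ and let $d\in\mathbb Z$. The quadratic dual of the quadratic dioperad $\mathcal V^{(d)}$ is $(\mathcal V^{(d)})^!=\mathcal V^{(-d)}$ (identification as dioperads).
   Context: **Conventions.** $\mathbf k$ is a field of characteristic $0$; dg-vector spaces are $\mathbb Z$-graded with differential of degree $+1$; $(V[k])^i=V^{i+k}$; $(V^* )^i=(V^{-i})^*$ with differential $f\mapsto (-1)^{|f|}f\circ d$; Koszul sign rule throughout. $\mathbb N=\{1,2,\dots\}$, $\mathbb N_0=\mathbb N\cup\{0\}$. $\mathbb S_n$ is the symmetric group; $\mathbb S_0=\{\phi\}$ is trivial. For $\sigma\in\mathbb S_n$, the block permutation $\sigma_{m_1,\dots,m_n}$ permutes blocks of sizes $m_1,\dots,m_n$ (empty blocks allowed) as $\sigma$ permutes $1,\dots,n$. For $\sigma_1\in \mathbb S_{n_1},\sigma_2\in\mathbb S_{n_2}$, $n_2\ge1$, $\sigma_1\circ_i\sigma_2:=(\sigma_1)_{1,\dots,1,n_2,1,\dots,1}\circ(id\times\dots\times\sigma_2\times\dots\times id)\in\mathbb S_{n_1+n_2-1}$ ($n_2$ and $\sigma_2$ in position $i$), and $\sigma_1\circ_i\phi:=\bar\rho_{\sigma_1(i)}\circ\sigma_1\circ\rho_i\in \mathbb S_{n_1-1}$, where $\rho_j(k)=k$ for $k<j$, $\rho_j(k)=k+1$ for $k\ge j$, and $\bar\rho_j(k)=k$ for $k<j$, $\bar\rho_j(k)=k-1$ for $k\ge j$. **Dioperads (zero inputs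 allowed, no unit required).** Let $\mathcal J_0=\mathbb N\times\mathbb N_0-\{(1,0),(1,1)\}$. A dioperad $\mathcal P$ consists of dg-vector spaces $\mathcal P(m,n)$, $(m,n)\in\mathcal J_0$ ($m$ outputs, $n$ inputs), which are $(\mathbb S_m,\mathbb S_n)$-bimodules (left $\mathbb S_m$-, right $\mathbb S_n$-action, written $(\pi,\sigma).x$), and degree $0$ chain maps ${}_i\circ_j:\mathcal P(m_1,n_1)\otimes\mathcal P(m_2,n_2)\to\mathcal P(m_1+m_2-1,n_1+n_2-1)$ for $n_1\ne0$, $1\le i\le n_1$, $1\le j\le m_2$ (plugging output $j$ of the second factor into input $i$ of the first), such that, whenever the expressions are defined (with $\tau$ the symmetry isomorphism on the relevant two factors): (a) ${}_i\circ_j({}_k\circ_l\otimes id)$ equals $(\sigma,1)({}_{k+n_3-1}\circ_l)({}_i\circ_j\otimes id)(id\otimes\tau)$ if $i\le k-1$; ${}_k\circ_{j+l-1}(id\otimes{}_{i-k+1}\circ_j)$ if $k\le i\le k+n_2-1$; $(\sigma,1)({}_k\circ_l)({}_{i-n_2+1}\circ_j\otimes id)(id\otimes\tau)$ if $k+n_2\le i$; with $\sigma=((12)(45))_{l-1,j-1,m_1,m_3-j,m_2-l}$. (b) ${}_i\circ_j(id\otimes{}_k\circ_l)$ equals $(1,\sigma)({}_k\circ_{l+m_1-1})(id\otimes{}_i\circ_j)(\tau\otimes id)$ if $j\le l-1$; ${}_{k+i-1}\circ_l({}_i\circ_{j-l+1}\otimes id)$ if $l\le j\le l+m_2-1$;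 $(1,\sigma)({}_k\circ_l)(id\otimes{}_i\circ_{j-m_2+1})(\tau\otimes id)$ if $l+m_2\le j$; with $\sigma=((12)(45))_{i-1,k-1,n_3,n_2-k,n_1-i}$. (c) ${}_i\circ_j((\pi_1,\sigma_1)\otimes(\pi_2,\sigma_2))=(\pi_2\circ_{\pi_2^{-1}(j)}\pi_1,\ \sigma_1\circ_i\sigma_2)({}_{\sigma_1(i)}\circ_{\pi_2^{-1}(j)})$. Morphisms are maps compatible with compositions and actions. The tensor product of dioperads is $(\mathcal P\otimes\mathcal Q)(m,n)=\mathcal P(m,n)\otimes\mathcal Q(m,n)$ with diagonal action and $(p_1\otimes q_1)\,{}_i\circ_j(p_2\otimes q_2)=(-1)^{|q_1||p_2|}(p_1\,{}_i\circ_j\,p_2)\otimes(q_1\,{}_i\circ_j\,q_2)$. **The sign dioperad $\Omega$.** $\Omega(m,n)$ is one-dimensional, concentrated in degree $3-n-2m$, spanned by $1$, with $(\pi,\sigma).1=\mathrm{sgn}(\sigma)$ and $1\,{}_i\circ_j\,1=(-1)^{(i-1)(n_2-1)+(m_1-1)(m_2-1)}$. **Trees and free dioperads.** In a finite directed tree $T$, vertices with (number of outgoing, number of incoming edges) equal to $(1,0)$ are leaves, those with $(0,1)$ are roots, and the others are internal, forming $\mathrm{Int}(T)$. $T$ is a tree$_0$ if it has at least one internal vertex, (number of roots, number of leaves)$\in\mathcal J_0$, and $(|\mathrm{Out}(v)|,|\mathrm{In}(v)|)\in\mathcal J_0$ for each internal $v$. An $(m,n)$-tree$_0$ is a tree$_0$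 with roots labeled by $1,\dots,m$ and leaves labeled by $1,\dots,n$. For a collection $E$ of $(\mathbb S_m,\mathbb S_n)$-bimodules $E(m,n)$, set $E(X,Y)=\big(\bigoplus_{f:X\cong\{1..m\},\,g:Y\cong\{1..n\}}E(m,n)\big)_{(\mathbb S_m,\mathbb S_n)}$ (coinvariants) for finite sets $X,Y$, $E(T)=\bigotimes_{v\in\mathrm{Int}(T)}E(\mathrm{Out}(v),\mathrm{In}(v))$, and $\mathcal F_0(E)(m,n)=\mathrm{colim}\,E(T)$ over the groupoid of $(m,n)$-tree$_0$s and isomorphisms (equivalently $\bigoplus_TE(T)$ over isomorphism classes). With grafting of trees as composition and relabeling as action, $\mathcal F_0(E)$ is the free dioperad on $E$. **Quadratic dioperads and quadratic dual.** Let $E(1,2)$ (right $\mathbb S_2$-module) and $E(2,0)$ (left $\mathbb S_2$-module) be graded vector spaces with zero differential, and all other $E(m,n)=0$. Given an $\mathbb S_3$-submodule $R(1,3)\subset\mathcal F_0(E)(1,3)$ and an $\mathbb S_2$-submodule $R(2,1)\subset\mathcal F_0(E)(2,1)$ (these two spaces are spanned by the trees with two internal vertices), the quadratic dioperad is $\langle E;R\rangle=\mathcal F_0(E)/(R)$, where $(R)$ is the ideal generated by $R$ (the smallest collection of sub-bimodules containing $R$ and closed under composition on either side with arbitrary elements). Its quadratic dual is $\langle E;R\rangle^!=\langle E^\vee;R^\perp\rangle$, where $E^\vee(m,n)=E(m,n)^*[-1]\otimes\Omega(m,n)\cong E(m,n)^*\otimes \mathrm{Sgn}_n$ for $(m,n)=(1,2),(2,0)$,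 and $R^\perp\subset\mathcal F_0(E^\vee)(2,1)\oplus\mathcal F_0(E^\vee)(1,3)$ is the orthogonal complement of $R\subset \mathcal F_0(E)(2,1)\oplus\mathcal F_0(E)(1,3)$ under the identification $\mathcal F_0(E^\vee)=\mathcal F_0(E^*[-1]\otimes\Omega)\cong\mathcal F_0(E^*[-1])\otimes\Omega\cong\bigoplus_T E(T)^*\otimes\bigwedge^{|\mathrm{Int}(T)|}(\mathbf k[-1])^{\mathrm{Int}(T)}\otimes\Omega$. **The dioperad $\mathcal V^{(d)}$.** $\mathcal V^{(d)}=\langle E;R\rangle$ with $E(1,2)=\mathbf k\mu\oplus\mathbf k\bar\mu$ in degree $0$, the transposition interchanging $\mu$ and $\bar\mu$; $E(2,0)=\mathbf k[-d]\cdot\nu$ concentrated in degree $d$ with trivial $\mathbb S_2$-action; and $R$ generated by associativity $\mu\,{}_1\circ_1\,\mu=\mu\,{}_2\circ_1\,\mu$ and invariance $\mu\,{}_1\circ_2\,\nu=\mu\,{}_2\circ_1\,\nu$. *)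

theory Defs
  imports
    "HOL-Algebra.Algebraic_Closure_Type"
    "HOL-Combinatorics.Permutations"
    "HOL-Library.Poly_Mapping"
begin

section \<open>Graded bimodules and dioperads\<close>

text \<open>
  The ground field is a type of class \<^class>\<open>field_char_0\<close>, turned into a ring record by
  \<^const>\<open>ring_of_type_algebra\<close> so that the modules of HOL-Algebra are available. Of a
  \<^typ>\<open>('k, 'v) module\<close> only the carrier, \<open>zero\<close>, \<open>add\<close> and \<open>smult\<close> are meaningful here.

  A graded object is a family of vector spaces, one for each degree; only homogeneous elements
  are ever handled. An index \<open>(m, n, i)\<close> stands for \<open>m\<close> outputs, \<open>n\<close> inputs and degree \<open>i\<close>.
  The symmetric group on \<open>n\<close> letters is the set of functions permuting \<open>{1..n}\<close>;
  \<open>act P (m, n, i) \<pi> \<sigma> x\<close> is \<open>(\<pi>, \<sigma>).x\<close>, a left action in \<open>\<pi>\<close> and a right action in \<open>\<sigma>\<close>.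
\<close>

abbreviation ground :: "'k::field_char_0 ring" where
  "ground \<equiv> ring_of_type_algebra"

abbreviation pinv :: "(nat \<Rightarrow> nat) \<Rightarrow> nat \<Rightarrow> nat" where
  "pinv \<equiv> inv_into UNIV"

definition ksign :: "int \<Rightarrow> 'k::field_char_0" where
  "ksign z = (if even z then 1 else - 1)"

definition J0 :: "(nat \<times> nat) set" where
  "J0 = {(m, n). 1 \<le> m} - {(1, 0), (1, 1)}"

type_synonym idx = "nat \<times> nat \<times> int"

record ('k, 'v) bimodule =
  sp  :: "idx \<Rightarrow> ('k, 'v) module"
  act :: "idx \<Rightarrow> (nat \<Rightarrow> nat) \<Rightarrow> (nat \<Rightarrow> nat) \<Rightarrow> 'v \<Rightarrow> 'v"

text \<open>
  \<open>dif P (m, n, i)\<close> is the differential from degree \<open>i\<close> to degree \<open>i + 1\<close>, and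
  \<open>pcomp P (m1, n1, p) (m2, n2, q) i j x y\<close> is the partial composition plugging output \<open>j\<close> of
  \<open>y\<close> into input \<open>i\<close> of \<open>x\<close>.
\<close>

record ('k, 'v) dioperad = "('k, 'v) bimodule" +
  dif   :: "idx \<Rightarrow> 'v \<Rightarrow> 'v"
  pcomp :: "idx \<Rightarrow> idx \<Rightarrow> nat \<Rightarrow> nat \<Rightarrow> 'v \<Rightarrow> 'v \<Rightarrow> 'v"

fun plug_idx :: "idx \<Rightarrow> idx \<Rightarrow> idx" where
  "plug_idx (m1, n1, p) (m2, n2, q) = (m1 + m2 - 1, n1 + n2 - 1, p + q)"

definition dioperad_hom ::
  "('k::field_char_0, 'v) dioperad \<Rightarrow> ('k, 'w) dioperad \<Rightarrow> (idx \<Rightarrow> 'v \<Rightarrow> 'w) \<Rightarrow> bool" where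
  "dioperad_hom P Q \<phi> \<longleftrightarrow>
    (\<forall>m n i. (m, n) \<in> J0 \<longrightarrow>
      \<phi> (m, n, i) \<in> carrier (sp P (m, n, i)) \<rightarrow> carrier (sp Q (m, n, i)) \<and>
      (\<forall>x \<in> carrier (sp P (m, n, i)). \<forall>y \<in> carrier (sp P (m, n, i)).
        \<phi> (m, n, i) (x \<oplus>\<^bsub>sp P (m, n, i)\<^esub> y)
          = \<phi> (m, n, i) x \<oplus>\<^bsub>sp Q (m, n, i)\<^esub> \<phi> (m, n, i) y) \<and>
      (\<forall>c. \<forall>x \<in> carrier (sp P (m, n, i)).
        \<phi> (m, n, i) (c \<odot>\<^bsub>sp P (m, n, i)\<^esub> x) = c \<odot>\<^bsub>sp Q (m, n, i)\<^esub> \<phi> (m, n, i) x) \<and>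
      (\<forall>x \<in> carrier (sp P (m, n, i)).
        \<phi> (m, n, i + 1) (dif P (m, n, i) x) = dif Q (m, n, i) (\<phi> (m, n, i) x)) \<and>
      (\<forall>\<pi> \<sigma>. \<pi> permutes {1..m} \<longrightarrow> \<sigma> permutes {1..n} \<longrightarrow>
        (\<forall>x \<in> carrier (sp P (m, n, i)).
          \<phi> (m, n, i) (act P (m, n, i) \<pi> \<sigma> x) = act Q (m, n, i) \<pi> \<sigma> (\<phi> (m, n, i) x)))) \<and>
    (\<forall>m1 n1 p m2 n2 q. (m1, n1) \<in> J0 \<longrightarrow> (m2, n2) \<in> J0 \<longrightarrow>
      (\<forall>i \<in> {1..n1}. \<forall>j \<in> {1..m2}.
        \<forall>x \<in> carrier (sp P (m1, n1, p)). \<forall>y \<in> carrier (sp P (m2, n2, q)).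
          \<phi> (plug_idx (m1, n1, p) (m2, n2, q)) (pcomp P (m1, n1, p) (m2, n2, q) i j x y)
            = pcomp Q (m1, n1, p) (m2, n2, q) i j (\<phi> (m1, n1, p) x) (\<phi> (m2, n2, q) y)))"

definition dioperad_iso ::
  "('k::field_char_0, 'v) dioperad \<Rightarrow> ('k, 'w) dioperad \<Rightarrow> bool" (infix \<open>\<cong>\<^sub>d\<close> 50) where
  "P \<cong>\<^sub>d Q \<longleftrightarrow> (\<exists>\<phi>. dioperad_hom P Q \<phi> \<and>
    (\<forall>m n i. (m, n) \<in> J0 \<longrightarrow>
      bij_betw (\<phi> (m, n, i)) (carrier (sp P (m, n, i))) (carrier (sp Q (m, n, i)))))"


subsection \<open>Submodules, ideals, quotients\<close>

definition lin_span :: "('k::field_char_0, 'v) module \<Rightarrow> 'v set \<Rightarrow> 'v set" where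
  "lin_span M S = \<Inter> {W. submodule W ground M \<and> S \<subseteq> W}"

definition quot_module :: "('k, 'v) module \<Rightarrow> 'v set \<Rightarrow> ('k, 'v set) module" where
  "quot_module M W =
    \<lparr>carrier = a_rcosets\<^bsub>M\<^esub> W, monoid.mult = undefined, one = undefined,
     ring.zero = W, add = set_add M,
     module.smult = (\<lambda>c A. \<Union>x\<in>A. W +>\<^bsub>M\<^esub> (c \<odot>\<^bsub>M\<^esub> x))\<rparr>"

definition quot_dioperad ::
  "('k, 'v) dioperad \<Rightarrow> (idx \<Rightarrow> 'v set) \<Rightarrow> ('k, 'v set) dioperad" where
  "quot_dioperad P I =
    \<lparr>sp = (\<lambda>\<tau>. quot_module (sp P \<tau>) (I \<tau>)),
     act = (\<lambda>\<tau> \<pi> \<sigma> A. \<Union>x\<in>A. I \<tau> +>\<^bsub>sp P \<tau>\<^esub> act P \<tau> \<pi> \<sigma> x),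
     dif = (\<lambda>(m, n, i) A. \<Union>x\<in>A. I (m, n, i + 1) +>\<^bsub>sp P (m, n, i + 1)\<^esub> dif P (m, n, i) x),
     pcomp = (\<lambda>\<tau> \<tau>' i j A B. \<Union>x\<in>A. \<Union>y\<in>B.
       I (plug_idx \<tau> \<tau>') +>\<^bsub>sp P (plug_idx \<tau> \<tau>')\<^esub> pcomp P \<tau> \<tau>' i j x y)\<rparr>"

definition subbimodule :: "('k::field_char_0, 'v) dioperad \<Rightarrow> (idx \<Rightarrow> 'v set) \<Rightarrow> bool" where
  "subbimodule P I \<longleftrightarrow> (\<forall>m n i. (m, n) \<in> J0 \<longrightarrow>
    submodule (I (m, n, i)) ground (sp P (m, n, i)) \<and>
    (\<forall>\<pi> \<sigma>. \<pi> permutes {1..m} \<longrightarrow> \<sigma> permutes {1..n} \<longrightarrow>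
      (\<forall>x \<in> I (m, n, i). act P (m, n, i) \<pi> \<sigma> x \<in> I (m, n, i))))"

definition subbimodule_gen ::
  "('k::field_char_0, 'v) dioperad \<Rightarrow> (idx \<Rightarrow> 'v set) \<Rightarrow> idx \<Rightarrow> 'v set" where
  "subbimodule_gen P S \<tau> = \<Inter> {I \<tau> | I. subbimodule P I \<and> (\<forall>\<tau>. S \<tau> \<subseteq> I \<tau>)}"

definition dioperad_ideal :: "('k::field_char_0, 'v) dioperad \<Rightarrow> (idx \<Rightarrow> 'v set) \<Rightarrow> bool" where
  "dioperad_ideal P I \<longleftrightarrow> subbimodule P I \<and>
    (\<forall>m1 n1 p m2 n2 q. (m1, n1) \<in> J0 \<longrightarrow> (m2, n2) \<in> J0 \<longrightarrow>
      (\<forall>i \<in> {1..n1}. \<forall>j \<in> {1..m2}.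
        \<forall>x \<in> carrier (sp P (m1, n1, p)). \<forall>y \<in> carrier (sp P (m2, n2, q)).
          x \<in> I (m1, n1, p) \<or> y \<in> I (m2, n2, q) \<longrightarrow>
          pcomp P (m1, n1, p) (m2, n2, q) i j x y \<in> I (plug_idx (m1, n1, p) (m2, n2, q))))"

definition ideal_gen ::
  "('k::field_char_0, 'v) dioperad \<Rightarrow> (idx \<Rightarrow> 'v set) \<Rightarrow> idx \<Rightarrow> 'v set" where
  "ideal_gen P S \<tau> = \<Inter> {I \<tau> | I. dioperad_ideal P I \<and> (\<forall>\<tau>. S \<tau> \<subseteq> I \<tau>)}"


section \<open>Decorated trees\<close>

text \<open>
  A decorated \<open>(m, n)\<close>-tree is an \<open>(m, n)\<close>-tree together with an ordering of its internal
  vertices (their position in the list, starting from 0), orderings of the outgoing and of the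
  incoming edges of each internal vertex (starting from 1), and an element of \<open>E\<close>, of recorded
  arity and degree, at each internal vertex. Thus an edge starts at a leaf or at an output
  of an internal vertex, and ends at a root or at an input of an internal vertex:
  \<open>Out a p\<close> is output \<open>p\<close> and \<open>In a q\<close> is input \<open>q\<close> of vertex number \<open>a\<close>. Leaves and roots are
  identified with their labels.
\<close>

datatype 'e vertex = Vertex (outs: nat) (ins: nat) (vdeg: int) (dec: 'e)

datatype src = Leaf nat | Out nat nat
datatype tgt = Root nat | In nat nat

datatype 'e dtree = DTree (verts: "'e vertex list") (edges: "(src \<times> tgt) set")

definition sources :: "nat \<Rightarrow> 'e vertex list \<Rightarrow> src set" where
  "sources n vs = Leaf ` {1..n} \<union> (\<Union>a<length vs. Out a ` {1..outs (vs ! a)})"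

definition targets :: "nat \<Rightarrow> 'e vertex list \<Rightarrow> tgt set" where
  "targets m vs = Root ` {1..m} \<union> (\<Union>a<length vs. In a ` {1..ins (vs ! a)})"

datatype node = LeafN nat | RootN nat | IntN nat

fun edge_tail :: "src \<Rightarrow> node" where
  "edge_tail (Leaf l) = LeafN l"
| "edge_tail (Out a p) = IntN a"

fun edge_head :: "tgt \<Rightarrow> node" where
  "edge_head (Root r) = RootN r"
| "edge_head (In a q) = IntN a"

definition nodes :: "nat \<Rightarrow> nat \<Rightarrow> 'e dtree \<Rightarrow> node set" where
  "nodes m n t = LeafN ` {1..n} \<union> RootN ` {1..m} \<union> IntN ` {..<length (verts t)}"

definition adjacent :: "'e dtree \<Rightarrow> (node \<times> node) set" where
  "adjacent t = (\<lambda>(s, r). (edge_tail s, edge_head r)) ` edges t"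

text \<open>
  The first three conditions say that every output, input, leaf and root is the end of exactly
  one edge, so that the internal vertices have the recorded arities; the last two say that the
  underlying undirected graph is connected and, being finite, without cycles.
\<close>

definition is_tree :: "nat \<Rightarrow> nat \<Rightarrow> 'e dtree \<Rightarrow> bool" where
  "is_tree m n t \<longleftrightarrow>
    edges t \<subseteq> sources n (verts t) \<times> targets m (verts t) \<and>
    (\<forall>s \<in> sources n (verts t). \<exists>!r. (s, r) \<in> edges t) \<and>
    (\<forall>r \<in> targets m (verts t). \<exists>!s. (s, r) \<in> edges t) \<and>
    (\<forall>u \<in> nodes m n t. \<forall>v \<in> nodes m n t. (u, v) \<in> (adjacent t \<union> (adjacent t)\<inverse>)\<^sup>*) \<and>
    card (nodes m n t) = card (edges t) + 1"

definition is_tree0 :: "nat \<Rightarrow> nat \<Rightarrow> 'e dtree \<Rightarrow> bool" where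
  "is_tree0 m n t \<longleftrightarrow> is_tree m n t \<and> verts t \<noteq> [] \<and> (m, n) \<in> J0 \<and>
    (\<forall>v \<in> set (verts t). (outs v, ins v) \<in> J0)"

abbreviation vidx :: "'e vertex \<Rightarrow> idx" where
  "vidx v \<equiv> (outs v, ins v, vdeg v)"

fun dtrees :: "('k, 'e) bimodule \<Rightarrow> idx \<Rightarrow> 'e dtree set" where
  "dtrees E (m, n, i) = {t. is_tree0 m n t \<and>
    (\<forall>v \<in> set (verts t). dec v \<in> carrier (sp E (vidx v))) \<and>
    sum_list (map vdeg (verts t)) = i}"

definition map_edges :: "(src \<Rightarrow> src) \<Rightarrow> (tgt \<Rightarrow> tgt) \<Rightarrow> 'e dtree \<Rightarrow> (src \<times> tgt) set" where
  "map_edges f g t = (\<lambda>(s, r). (f s, g r)) ` edges t"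

definition corolla :: "'e vertex \<Rightarrow> 'e dtree" where
  "corolla v = DTree [v]
    ((\<lambda>l. (Leaf l, In 0 l)) ` {1..ins v} \<union> (\<lambda>r. (Out 0 r, Root r)) ` {1..outs v})"

text \<open>In \<open>(\<pi>, \<sigma>).t\<close> the root \<open>r\<close> of \<open>t\<close> is labeled \<open>\<pi> r\<close>, and leaf \<open>\<sigma> l\<close> of \<open>t\<close> is labeled \<open>l\<close>.\<close>

fun relabel_src :: "(nat \<Rightarrow> nat) \<Rightarrow> src \<Rightarrow> src" where
  "relabel_src \<sigma> (Leaf l) = Leaf (pinv \<sigma> l)"
| "relabel_src \<sigma> (Out a p) = Out a p"

fun relabel_tgt :: "(nat \<Rightarrow> nat) \<Rightarrow> tgt \<Rightarrow> tgt" where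
  "relabel_tgt \<pi> (Root r) = Root (\<pi> r)"
| "relabel_tgt \<pi> (In a q) = In a q"

definition relabel :: "(nat \<Rightarrow> nat) \<Rightarrow> (nat \<Rightarrow> nat) \<Rightarrow> 'e dtree \<Rightarrow> 'e dtree" where
  "relabel \<pi> \<sigma> t = DTree (verts t) (map_edges (relabel_src \<sigma>) (relabel_tgt \<pi>) t)"

text \<open>
  \<open>graft m1 n2 i j t1 t2\<close> joins root \<open>j\<close> of \<open>t2\<close>, which has \<open>n2\<close> leaves, to leaf \<open>i\<close> of \<open>t1\<close>,
  which has \<open>m1\<close> roots. The leaves of \<open>t2\<close> replace leaf \<open>i\<close> in the order of the leaves of \<open>t1\<close>,
  and the roots of \<open>t1\<close> replace root \<open>j\<close> in the order of the roots of \<open>t2\<close>. The vertices of \<open>t1\<close>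
  come before those of \<open>t2\<close>.
\<close>

fun graft_src1 :: "nat \<Rightarrow> nat \<Rightarrow> src \<Rightarrow> src" where
  "graft_src1 n2 i (Leaf l) = Leaf (if l < i then l else l + n2 - 1)"
| "graft_src1 n2 i (Out a p) = Out a p"

fun graft_tgt1 :: "nat \<Rightarrow> tgt \<Rightarrow> tgt" where
  "graft_tgt1 j (Root r) = Root (r + j - 1)"
| "graft_tgt1 j (In a q) = In a q"

fun graft_src2 :: "nat \<Rightarrow> nat \<Rightarrow> src \<Rightarrow> src" where
  "graft_src2 k i (Leaf l) = Leaf (l + i - 1)"
| "graft_src2 k i (Out a p) = Out (k + a) p"

fun graft_tgt2 :: "nat \<Rightarrow> nat \<Rightarrow> nat \<Rightarrow> tgt \<Rightarrow> tgt" where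
  "graft_tgt2 k m1 j (Root r) = Root (if r < j then r else r + m1 - 1)"
| "graft_tgt2 k m1 j (In a q) = In (k + a) q"

definition graft :: "nat \<Rightarrow> nat \<Rightarrow> nat \<Rightarrow> nat \<Rightarrow> 'e dtree \<Rightarrow> 'e dtree \<Rightarrow> 'e dtree" where
  "graft m1 n2 i j t1 t2 = (let k = length (verts t1) in DTree (verts t1 @ verts t2)
    ({(graft_src1 n2 i s, graft_tgt1 j r) | s r. (s, r) \<in> edges t1 \<and> s \<noteq> Leaf i} \<union>
     {(graft_src2 k i s, graft_tgt2 k m1 j r) | s r. (s, r) \<in> edges t2 \<and> r \<noteq> Root j} \<union>
     {(graft_src2 k i s, graft_tgt1 j r) | s r. (s, Root j) \<in> edges t2 \<and> (Leaf i, r) \<in> edges t1}))"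


section \<open>The free dioperad\<close>

definition set_dec :: "nat \<Rightarrow> 'e \<Rightarrow> 'e dtree \<Rightarrow> 'e dtree" where
  "set_dec a x t = DTree ((verts t)[a := map_vertex (\<lambda>_. x) (verts t ! a)]) (edges t)"

text \<open>
  Action of \<open>(\<pi>, \<sigma>)\<close> simultaneously on the numberings of the outputs and inputs of vertex \<open>a\<close>
  and on its decoration.
\<close>

fun renumber_src :: "nat \<Rightarrow> (nat \<Rightarrow> nat) \<Rightarrow> src \<Rightarrow> src" where
  "renumber_src a \<pi> (Leaf l) = Leaf l"
| "renumber_src a \<pi> (Out b p) = Out b (if b = a then \<pi> p else p)"

fun renumber_tgt :: "nat \<Rightarrow> (nat \<Rightarrow> nat) \<Rightarrow> tgt \<Rightarrow> tgt" where
  "renumber_tgt a \<sigma> (Root r) = Root r"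
| "renumber_tgt a \<sigma> (In b q) = In b (if b = a then pinv \<sigma> q else q)"

definition renumber ::
  "('k, 'e) bimodule \<Rightarrow> nat \<Rightarrow> (nat \<Rightarrow> nat) \<Rightarrow> (nat \<Rightarrow> nat) \<Rightarrow> 'e dtree \<Rightarrow> 'e dtree" where
  "renumber E a \<pi> \<sigma> t = DTree
    ((verts t)[a := map_vertex (act E (vidx (verts t ! a)) \<pi> \<sigma>) (verts t ! a)])
    (map_edges (renumber_src a \<pi>) (renumber_tgt a \<sigma>) t)"

text \<open>Exchange the positions of the vertices \<open>a\<close> and \<open>a + 1\<close> in the ordering of the vertices.\<close>

fun reindex_src :: "(nat \<Rightarrow> nat) \<Rightarrow> src \<Rightarrow> src" where
  "reindex_src f (Leaf l) = Leaf l"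
| "reindex_src f (Out b p) = Out (f b) p"

fun reindex_tgt :: "(nat \<Rightarrow> nat) \<Rightarrow> tgt \<Rightarrow> tgt" where
  "reindex_tgt f (Root r) = Root r"
| "reindex_tgt f (In b q) = In (f b) q"

definition swap_verts :: "nat \<Rightarrow> 'e dtree \<Rightarrow> 'e dtree" where
  "swap_verts a t = DTree ((verts t)[a := verts t ! Suc a, Suc a := verts t ! a])
    (map_edges (reindex_src (Transposition.transpose a (Suc a)))
      (reindex_tgt (Transposition.transpose a (Suc a))) t)"

definition formal_sums :: "'t set \<Rightarrow> ('k::field_char_0, 't \<Rightarrow>\<^sub>0 'k) module" where
  "formal_sums D =
    \<lparr>carrier = {f. Poly_Mapping.keys f \<subseteq> D}, monoid.mult = undefined, one = undefined,
     ring.zero = 0, add = (+), module.smult = (\<lambda>c. Poly_Mapping.map ((*) c))\<rparr>"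

text \<open>
  Relations defining the direct sum over the isomorphism classes of trees of the spaces \<open>E(T)\<close>
  as a quotient of the space of formal sums of decorated trees: the first two give the tensor
  product over the vertices, the third one the coinvariants \<open>E(Out(v), In(v))\<close>, and the last
  one the independence, up to the Koszul sign, of the ordering of the factors. Isomorphic trees
  need no further relation: leaves and roots are their labels, internal vertices are their
  positions, and edges are given by their ends, so that two decorated trees differing only in
  the names of vertices and edges are equal.
\<close>

inductive_set tree_relators ::
  "('k::field_char_0, 'e) bimodule \<Rightarrow> idx \<Rightarrow> ('e dtree \<Rightarrow>\<^sub>0 'k) set"
  for E :: "('k::field_char_0, 'e) bimodule" and \<tau> :: idx where
  rel_add:
    "\<lbrakk>t \<in> dtrees E \<tau>; a < length (verts t);
      x \<in> carrier (sp E (vidx (verts t ! a))); y \<in> carrier (sp E (vidx (verts t ! a)))\<rbrakk> \<Longrightarrow>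
     Poly_Mapping.single (set_dec a (x \<oplus>\<^bsub>sp E (vidx (verts t ! a))\<^esub> y) t) 1
       - Poly_Mapping.single (set_dec a x t) 1 - Poly_Mapping.single (set_dec a y t) 1
     \<in> tree_relators E \<tau>"
| rel_smult:
    "\<lbrakk>t \<in> dtrees E \<tau>; a < length (verts t); x \<in> carrier (sp E (vidx (verts t ! a)))\<rbrakk> \<Longrightarrow>
     Poly_Mapping.single (set_dec a (c \<odot>\<^bsub>sp E (vidx (verts t ! a))\<^esub> x) t) 1
       - Poly_Mapping.single (set_dec a x t) c
     \<in> tree_relators E \<tau>"
| rel_renumber:
    "\<lbrakk>t \<in> dtrees E \<tau>; a < length (verts t);
      \<pi> permutes {1..outs (verts t ! a)}; \<sigma> permutes {1..ins (verts t ! a)}\<rbrakk> \<Longrightarrow>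
     Poly_Mapping.single (renumber E a \<pi> \<sigma> t) 1 - Poly_Mapping.single t 1
     \<in> tree_relators E \<tau>"
| rel_swap:
    "\<lbrakk>t \<in> dtrees E \<tau>; Suc a < length (verts t)\<rbrakk> \<Longrightarrow>
     Poly_Mapping.single (swap_verts a t) 1
       - Poly_Mapping.single t (ksign (vdeg (verts t ! a) * vdeg (verts t ! Suc a)))
     \<in> tree_relators E \<tau>"

definition lin_ext :: "('t \<Rightarrow> 'u) \<Rightarrow> ('t \<Rightarrow>\<^sub>0 'k::field_char_0) \<Rightarrow> ('u \<Rightarrow>\<^sub>0 'k)" where
  "lin_ext f A =
    (\<Sum>t \<in> Poly_Mapping.keys A. Poly_Mapping.single (f t) (Poly_Mapping.lookup A t))"

definition bilin_ext ::
  "('t \<Rightarrow> 'u \<Rightarrow> 'w) \<Rightarrow> ('t \<Rightarrow>\<^sub>0 'k::field_char_0) \<Rightarrow> ('u \<Rightarrow>\<^sub>0 'k) \<Rightarrow> ('w \<Rightarrow>\<^sub>0 'k)" where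
  "bilin_ext f A B = (\<Sum>t \<in> Poly_Mapping.keys A. \<Sum>s \<in> Poly_Mapping.keys B.
    Poly_Mapping.single (f t s) (Poly_Mapping.lookup A t * Poly_Mapping.lookup B s))"

definition tree_sums ::
  "('k::field_char_0, 'e) bimodule \<Rightarrow> ('k, 'e dtree \<Rightarrow>\<^sub>0 'k) dioperad" where
  "tree_sums E =
    \<lparr>sp = (\<lambda>\<tau>. formal_sums (dtrees E \<tau>)),
     act = (\<lambda>_ \<pi> \<sigma>. lin_ext (relabel \<pi> \<sigma>)),
     dif = (\<lambda>_ _. 0),
     pcomp = (\<lambda>(m1, n1, p) (m2, n2, q) i j. bilin_ext (graft m1 n2 i j))\<rparr>"

text \<open>The free dioperad on a collection of graded bimodules with zero differential.\<close>

definition free_dioperad ::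
  "('k::field_char_0, 'e) bimodule \<Rightarrow> ('k, ('e dtree \<Rightarrow>\<^sub>0 'k) set) dioperad" where
  "free_dioperad E = quot_dioperad (tree_sums E)
    (\<lambda>\<tau>. lin_span (sp (tree_sums E) \<tau>) (tree_relators E \<tau>))"

fun free_gen ::
  "('k::field_char_0, 'e) bimodule \<Rightarrow> idx \<Rightarrow> 'e \<Rightarrow> ('e dtree \<Rightarrow>\<^sub>0 'k) set" where
  "free_gen E (m, n, i) x =
    lin_span (sp (tree_sums E) (m, n, i)) (tree_relators E (m, n, i))
      +>\<^bsub>sp (tree_sums E) (m, n, i)\<^esub> Poly_Mapping.single (corolla (Vertex m n i x)) 1"


section \<open>Quadratic dioperads\<close>

text \<open>
  A pair \<open>(E, R)\<close>, with \<open>E\<close> concentrated in the arities \<open>(1, 2)\<close> and \<open>(2, 0)\<close>, and with \<open>R\<close> a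
  sub-bimodule of the free dioperad on \<open>E\<close>, zero outside of the arities \<open>(1, 3)\<close> and \<open>(2, 1)\<close>.
\<close>

type_synonym ('k, 'e) quadratic_data =
  "('k, 'e) bimodule \<times> (idx \<Rightarrow> ('e dtree \<Rightarrow>\<^sub>0 'k) set set)"

fun quadratic_dioperad ::
  "('k::field_char_0, 'e) quadratic_data \<Rightarrow> ('k, ('e dtree \<Rightarrow>\<^sub>0 'k) set set) dioperad" where
  "quadratic_dioperad (E, R) = quot_dioperad (free_dioperad E) (ideal_gen (free_dioperad E) R)"


subsection \<open>The sign dioperad\<close>

definition omega_deg :: "nat \<Rightarrow> nat \<Rightarrow> int" where
  "omega_deg m n = 3 - int n - 2 * int m"

definition Omega :: "('k::field_char_0, 'k) dioperad" where
  "Omega =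
    \<lparr>sp = (\<lambda>(m, n, i).
       \<lparr>carrier = (if i = omega_deg m n then UNIV else {0}), monoid.mult = undefined,
        one = undefined, ring.zero = 0, add = (+), module.smult = (*)\<rparr>),
     act = (\<lambda>_ \<pi> \<sigma> x. of_int (sign \<sigma>) * x),
     dif = (\<lambda>_ _. 0),
     pcomp = (\<lambda>(m1, n1, p) (m2, n2, q) i j x y.
       ksign ((int i - 1) * (int n2 - 1) + (int m1 - 1) * (int m2 - 1)) * (x * y))\<rparr>"


subsection \<open>The generators of the quadratic dual\<close>

definition dual_module :: "('k::field_char_0, 'v) module \<Rightarrow> ('k, 'v \<Rightarrow> 'k) module" where
  "dual_module M =
    \<lparr>carrier = {f.
       (\<forall>x \<in> carrier M. \<forall>y \<in> carrier M. f (x \<oplus>\<^bsub>M\<^esub> y) = f x + f y) \<and>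
       (\<forall>c. \<forall>x \<in> carrier M. f (c \<odot>\<^bsub>M\<^esub> x) = c * f x) \<and>
       (\<forall>x. x \<notin> carrier M \<longrightarrow> f x = 0)},
     monoid.mult = undefined, one = undefined,
     ring.zero = (\<lambda>_. 0), add = (\<lambda>f g x. f x + g x), module.smult = (\<lambda>c f x. c * f x)\<rparr>"

definition dual_bimodule :: "('k::field_char_0, 'e) bimodule \<Rightarrow> ('k, 'e \<Rightarrow> 'k) bimodule" where
  "dual_bimodule E =
    \<lparr>sp = (\<lambda>(m, n, i). dual_module (sp E (m, n, - i))),
     act = (\<lambda>(m, n, i) \<pi> \<sigma> f x. if x \<in> carrier (sp E (m, n, - i))
       then f (act E (m, n, - i) (pinv \<pi>) (pinv \<sigma>) x) else 0)\<rparr>"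

definition shift_bimodule :: "int \<Rightarrow> ('k, 'e) bimodule \<Rightarrow> ('k, 'e) bimodule" where
  "shift_bimodule k E =
    \<lparr>sp = (\<lambda>(m, n, i). sp E (m, n, i + k)), act = (\<lambda>(m, n, i). act E (m, n, i + k))\<rparr>"

text \<open>The tensor product \<open>E \<otimes> \<Omega>\<close>, with \<open>x \<otimes> 1\<close> written as \<open>x\<close>.\<close>

definition tensor_Omega :: "('k::field_char_0, 'e) bimodule \<Rightarrow> ('k, 'e) bimodule" where
  "tensor_Omega E =
    \<lparr>sp = (\<lambda>(m, n, i). sp E (m, n, i - omega_deg m n)),
     act = (\<lambda>(m, n, i) \<pi> \<sigma> x. act Omega (m, n, omega_deg m n) \<pi> \<sigma> 1
       \<odot>\<^bsub>sp E (m, n, i - omega_deg m n)\<^esub> act E (m, n, i - omega_deg m n) \<pi> \<sigma> x)\<rparr>"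

definition dual_gens :: "('k::field_char_0, 'e) bimodule \<Rightarrow> ('k, 'e \<Rightarrow> 'k) bimodule" where
  "dual_gens E = tensor_Omega (shift_bimodule (- 1) (dual_bimodule E))"


subsection \<open>The orthogonal complement\<close>

text \<open>
  All trees needed have two internal vertices, joined by one edge. They are ordered with the
  head of this edge first, like the factors of a partial composition \<open>x \<^sub>i\<circ>\<^sub>j y\<close>. For each tree
  \<open>T\<close>, this order also selects the basis \<open>s \<and> s\<close> of the exterior square of \<open>(k[-1])^Int(T)\<close>, through
  which the values of the pairing on different trees are compared.
\<close>

definition oriented :: "'e dtree \<Rightarrow> bool" where
  "oriented t \<longleftrightarrow> (\<exists>p q. (Out 1 p, In 0 q) \<in> edges t)"

definition orient :: "'e dtree \<Rightarrow> 'e dtree" where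
  "orient t = (if oriented t then t else swap_verts 0 t)"

definition orient_sign :: "'e dtree \<Rightarrow> 'k::field_char_0" where
  "orient_sign t =
    (if oriented t then 1 else ksign (vdeg (verts t ! 0) * vdeg (verts t ! 1)))"

text \<open>
  The element \<open>(\<pi>, \<sigma>).(1 \<^sub>i\<circ>\<^sub>j 1)\<close> of \<open>\<Omega>(m, n)\<close>, where the oriented tree \<open>t\<close> is
  \<open>(\<pi>, \<sigma>).(v \<^sub>i\<circ>\<^sub>j w)\<close>. The sum has exactly one term.
\<close>

definition omega_coeff :: "nat \<Rightarrow> nat \<Rightarrow> 'e dtree \<Rightarrow> 'k::field_char_0" where
  "omega_coeff m n t =
    (let v = verts t ! 0; w = verts t ! 1;
         \<tau> = (outs v, ins v, omega_deg (outs v) (ins v));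
         \<tau>' = (outs w, ins w, omega_deg (outs w) (ins w))
     in \<Sum>(i, j, \<pi>, \<sigma>) \<in> {(i, j, \<pi>, \<sigma>).
          i \<in> {1..ins v} \<and> j \<in> {1..outs w} \<and> \<pi> permutes {1..m} \<and> \<sigma> permutes {1..n} \<and>
          t = relabel \<pi> \<sigma> (graft (outs v) (ins w) i j (corolla v) (corolla w))}.
        act Omega (plug_idx \<tau> \<tau>') \<pi> \<sigma> (pcomp Omega \<tau> \<tau>' i j 1 1))"

text \<open>
  A vertex \<open>v\<close> of a tree decorated by \<open>E\<^sup>*[-1] \<otimes> \<Omega>\<close> carries \<open>f \<otimes> s \<otimes> 1\<close>, with \<open>s\<close> of degree 1
  spanning \<open>k[-1]\<close>, for a functional \<open>f\<close> of degree \<open>fdeg v\<close>.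
\<close>

definition fdeg :: "'f vertex \<Rightarrow> int" where
  "fdeg v = vdeg v - 1 - omega_deg (outs v) (ins v)"

text \<open>
  The Koszul signs of the identification of \<open>(f \<otimes> s \<otimes> 1) \<^sub>i\<circ>\<^sub>j (g \<otimes> s \<otimes> 1)\<close> with
  \<open>(f \<otimes> g) \<otimes> (s \<and> s) \<otimes> (1 \<^sub>i\<circ>\<^sub>j 1)\<close>: first exchange \<open>1\<close> and \<open>g \<otimes> s\<close>, then \<open>s\<close> and \<open>g\<close>.
\<close>

definition identification_sign :: "'f vertex \<Rightarrow> 'f vertex \<Rightarrow> 'k::field_char_0" where
  "identification_sign v w =
    ksign (omega_deg (outs v) (ins v) * (fdeg w + 1)) * ksign (fdeg w)"

text \<open>
  Evaluation of \<open>E(T)\<^sup>*\<close> on \<open>E(T')\<close> for decorated oriented trees \<open>t\<close> and \<open>s\<close> with underlying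
  trees \<open>T\<close> and \<open>T'\<close>. If these are isomorphic, there is exactly one way of renumbering the
  outputs and inputs of the vertices of \<open>s\<close>, acting on the decorations, after which \<open>s\<close> has
  the edges of \<open>t\<close>, and \<open>(f \<otimes> g)(x \<otimes> y)\<close> is \<open>f(x) g(y)\<close> up to the Koszul sign; otherwise
  the sum is empty.
\<close>

definition eval_oriented ::
  "('k::field_char_0, 'e) bimodule \<Rightarrow> ('e \<Rightarrow> 'k) dtree \<Rightarrow> 'e dtree \<Rightarrow> 'k" where
  "eval_oriented E t s =
    (if \<forall>a<2. outs (verts t ! a) = outs (verts s ! a) \<and> ins (verts t ! a) = ins (verts s ! a)
          \<and> fdeg (verts t ! a) = - vdeg (verts s ! a)
     then \<Sum>(\<pi>0, \<sigma>0, \<pi>1, \<sigma>1) \<in> {(\<pi>0, \<sigma>0, \<pi>1, \<sigma>1).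
         \<pi>0 permutes {1..outs (verts s ! 0)} \<and> \<sigma>0 permutes {1..ins (verts s ! 0)} \<and>
         \<pi>1 permutes {1..outs (verts s ! 1)} \<and> \<sigma>1 permutes {1..ins (verts s ! 1)} \<and>
         edges (renumber E 1 \<pi>1 \<sigma>1 (renumber E 0 \<pi>0 \<sigma>0 s)) = edges t}.
       (let s' = renumber E 1 \<pi>1 \<sigma>1 (renumber E 0 \<pi>0 \<sigma>0 s)
        in ksign (fdeg (verts t ! 1) * vdeg (verts s ! 0))
           * dec (verts t ! 0) (dec (verts s' ! 0)) * dec (verts t ! 1) (dec (verts s' ! 1)))
     else 0)"

definition tree_pairing ::
  "('k::field_char_0, 'e) bimodule \<Rightarrow> nat \<Rightarrow> nat \<Rightarrow> ('e \<Rightarrow> 'k) dtree \<Rightarrow> 'e dtree \<Rightarrow> 'k" where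
  "tree_pairing E m n t s =
    (if length (verts t) = 2 \<and> length (verts s) = 2
     then orient_sign t * orient_sign s
       * identification_sign (verts (orient t) ! 0) (verts (orient t) ! 1)
       * omega_coeff m n (orient t) * eval_oriented E (orient t) (orient s)
     else 0)"

definition sum_pairing ::
  "('k::field_char_0, 'e) bimodule \<Rightarrow> nat \<Rightarrow> nat
    \<Rightarrow> (('e \<Rightarrow> 'k) dtree \<Rightarrow>\<^sub>0 'k) \<Rightarrow> ('e dtree \<Rightarrow>\<^sub>0 'k) \<Rightarrow> 'k" where
  "sum_pairing E m n A B = (\<Sum>t \<in> Poly_Mapping.keys A. \<Sum>s \<in> Poly_Mapping.keys B.
    Poly_Mapping.lookup A t * Poly_Mapping.lookup B s * tree_pairing E m n t s)"

text \<open>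
  The pairing respects the relations between decorated trees, so that the choice of the
  representatives \<open>A\<close> and \<open>B\<close> does not matter.
\<close>

fun quadratic_perp ::
  "('k::field_char_0, 'e) quadratic_data \<Rightarrow> idx \<Rightarrow> (('e \<Rightarrow> 'k) dtree \<Rightarrow>\<^sub>0 'k) set set" where
  "quadratic_perp (E, R) (m, n, i) =
    (if (m, n) = (1, 3) \<or> (m, n) = (2, 1)
     then {C \<in> carrier (sp (free_dioperad (dual_gens E)) (m, n, i)).
            \<forall>q. \<forall>D \<in> R (m, n, q). \<forall>A \<in> C. \<forall>B \<in> D. sum_pairing E m n A B = 0}
     else {\<zero>\<^bsub>sp (free_dioperad (dual_gens E)) (m, n, i)\<^esub>})"

fun quadratic_dual ::
  "('k::field_char_0, 'e) quadratic_data \<Rightarrow> ('k, 'e \<Rightarrow> 'k) quadratic_data" where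
  "quadratic_dual (E, R) = (dual_gens E, quadratic_perp (E, R))"


section \<open>The dioperad of associative algebras with a symmetric invariant co-inner product\<close>

datatype gen = Mu | MuBar | Nu

fun V_basis :: "int \<Rightarrow> idx \<Rightarrow> gen set" where
  "V_basis d (m, n, i) =
    (if (m, n, i) = (1, 2, 0) then {Mu, MuBar} else if (m, n, i) = (2, 0, d) then {Nu} else {})"

fun swap_gen :: "gen \<Rightarrow> gen" where
  "swap_gen Mu = MuBar"
| "swap_gen MuBar = Mu"
| "swap_gen Nu = Nu"

definition V_gens :: "int \<Rightarrow> ('k::field_char_0, gen \<Rightarrow> 'k) bimodule" where
  "V_gens d =
    \<lparr>sp = (\<lambda>\<tau>.
       \<lparr>carrier = {f. \<forall>g. g \<notin> V_basis d \<tau> \<longrightarrow> f g = 0}, monoid.mult = undefined,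
        one = undefined, ring.zero = (\<lambda>_. 0), add = (\<lambda>f h g. f g + h g),
        module.smult = (\<lambda>c f g. c * f g)\<rparr>),
     act = (\<lambda>(m, n, i) \<pi> \<sigma> f. if (m, n) = (1, 2) \<and> \<sigma> 1 = 2 then f \<circ> swap_gen else f)\<rparr>"

definition unit_gen :: "gen \<Rightarrow> gen \<Rightarrow> 'k::field_char_0" where
  "unit_gen g h = (if h = g then 1 else 0)"

text \<open>
  The generating relations \<open>\<mu> \<^sub>1\<circ>\<^sub>1 \<mu> = \<mu> \<^sub>2\<circ>\<^sub>1 \<mu>\<close> and \<open>\<mu> \<^sub>1\<circ>\<^sub>2 \<nu> = \<mu> \<^sub>2\<circ>\<^sub>1 \<nu>\<close>.
\<close>

definition V_relators ::
  "int \<Rightarrow> idx \<Rightarrow> ((gen \<Rightarrow> 'k::field_char_0) dtree \<Rightarrow>\<^sub>0 'k) set set" where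
  "V_relators d \<tau> =
    (let F = free_dioperad (V_gens d);
         \<mu> = free_gen (V_gens d) (1, 2, 0) (unit_gen Mu);
         \<nu> = free_gen (V_gens d) (2, 0, d) (unit_gen Nu)
     in if \<tau> = (1, 3, 0) then
          {pcomp F (1, 2, 0) (1, 2, 0) 1 1 \<mu> \<mu> \<ominus>\<^bsub>sp F \<tau>\<^esub> pcomp F (1, 2, 0) (1, 2, 0) 2 1 \<mu> \<mu>}
        else if \<tau> = (2, 1, d) then
          {pcomp F (1, 2, 0) (2, 0, d) 1 2 \<mu> \<nu> \<ominus>\<^bsub>sp F \<tau>\<^esub> pcomp F (1, 2, 0) (2, 0, d) 2 1 \<mu> \<nu>}
        else {})"

definition V_data :: "int \<Rightarrow> ('k::field_char_0, gen \<Rightarrow> 'k) quadratic_data" where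
  "V_data d = (V_gens d, subbimodule_gen (free_dioperad (V_gens d)) (V_relators d))"

definition V_dioperad ::
  "int \<Rightarrow> ('k::field_char_0, ((gen \<Rightarrow> 'k) dtree \<Rightarrow>\<^sub>0 'k) set set) dioperad" where
  "V_dioperad d = quadratic_dioperad (V_data d)"

end

theory Submission
  imports Defs
begin

text \<open>
  The linear map sending \<open>\<mu>\<^sup>*\<close> to \<open>\<mu>\<close>, the functional dual to \<open>\<mu>-bar\<close> to \<open>- \<mu>-bar\<close> and \<open>\<nu>\<^sup>*\<close> to \<open>\<nu>\<close>
  identifies the generators of the quadratic dual with those of \<open>V\<close> for \<open>- d\<close>, hence also the free
  dioperads. The component of arity \<open>(1, 3)\<close> of the free dioperad has a basis consisting of the
  trees \<open>\<mu> \<^sub>1\<circ>\<^sub>1 \<mu>\<close> and \<open>\<mu> \<^sub>2\<circ>\<^sub>1 \<mu>\<close> with permuted leaves, and the relations identify the two trees with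
  the same order of the leaves; so they are cut out by the sums \<open>ev\<close> of the two coordinates
  belonging to one order. In these coordinates the pairing is, up to the sign of the order and an
  overall sign, the standard one on the first half of the basis and minus the standard one on the
  second half. Therefore the orthogonal complement of the relations is cut out by the same sums.
  The same holds in arity \<open>(2, 1)\<close> for \<open>\<mu> \<^sub>1\<circ>\<^sub>2 \<nu>\<close> and \<open>\<mu> \<^sub>2\<circ>\<^sub>1 \<nu>\<close> with permuted roots.
\<close>

text \<open>The degree \<open>- d\<close> arises because \<open>1 + omega_deg\<close> vanishes in
  both generating arities: shift and \<open>Omega\<close> cancel in degree, and only the change of
  sign of degrees under duality remains. The minus on the second half of the basis is the exponent
  \<open>(i - 1) * (n2 - 1)\<close> in the composition of \<open>Omega\<close>, odd for
  \<open>i = 2\<close> whether \<open>n2\<close> is 2 or 0. It is exactly what makes the complement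
  agree with the kernel of the sums: where \<open>y = - x\<close>, the form
  \<open>a * x - b * y\<close> equals \<open>(a + b) * x\<close>. The Koszul signs that depend on
  \<open>d\<close> cancel and leave one overall sign. Two obstacles shape the proof. Elements of the
  dioperads are cosets, at two levels, and their operations are unions over representatives, so
  isomorphisms have to be carried through quotients as image maps. And \<open>dtrees\<close>
  contains trees with zero decorations at vertices of arbitrary arity, so normal forms exist only
  once these trees have been split off.\<close>

lemma J0_iff: "(m, n) \<in> J0 \<longleftrightarrow> 1 \<le> m \<and> (m, n) \<noteq> (1, 0) \<and> (m, n) \<noteq> (1, 1)"
  by (auto simp: J0_def)

text \<open>A composite has a single output only if both factors do; each factor then has at least
  two inputs, so the composite has at least three and avoids both excluded pairs.\<close>

lemma J0_plug:
  assumes "(m1, n1) \<in> J0" "(m2, n2) \<in> J0" "1 \<le> n1"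
  shows "(m1 + m2 - 1, n1 + n2 - 1) \<in> J0"
  using assms by (auto simp: J0_iff)

section \<open>Modules and their quotients\<close>

lemma ground_simps [simp]:
  "carrier ground = UNIV" "\<one>\<^bsub>ground\<^esub> = 1" "\<zero>\<^bsub>ground\<^esub> = 0"
  "x \<otimes>\<^bsub>ground\<^esub> y = x * y" "x \<oplus>\<^bsub>ground\<^esub> y = x + y"
  by (simp_all add: ring_of_type_algebra_def)

lemma smult_minus_one:
  fixes M :: "('k::field_char_0, 'v) module"
  assumes "module ground M" "x \<in> carrier M"
  shows "(- 1) \<odot>\<^bsub>M\<^esub> x = \<ominus>\<^bsub>M\<^esub> x"
proof -
  interpret module ground M by fact
  have "\<zero>\<^bsub>M\<^esub> = (1 + - 1) \<odot>\<^bsub>M\<^esub> x"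
    using smult_l_null[of x] assms(2) by simp
  also have "\<dots> = x \<oplus>\<^bsub>M\<^esub> (- 1) \<odot>\<^bsub>M\<^esub> x"
    using smult_l_distr[of 1 "- 1" x] smult_one[of x] assms(2) by simp
  finally show ?thesis
    using assms(2) smult_closed[of "-1" x] M.minus_equality[of "(- 1) \<odot>\<^bsub>M\<^esub> x" x] M.a_comm
    by (metis ground_simps(1) UNIV_I)
qed

text \<open>Over \<open>ground\<close> negation is multiplication by \<open>- 1\<close>, so closure
  under negation disappears from all later verifications. The zero is listed to rule out the empty
  set.\<close>

lemma submodule_iff:
  fixes M :: "('k::field_char_0, 'v) module"
  assumes "module ground M"
  shows "submodule W ground M \<longleftrightarrow> W \<subseteq> carrier M \<and> \<zero>\<^bsub>M\<^esub> \<in> W \<and>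
    (\<forall>x \<in> W. \<forall>y \<in> W. x \<oplus>\<^bsub>M\<^esub> y \<in> W) \<and> (\<forall>c. \<forall>x \<in> W. c \<odot>\<^bsub>M\<^esub> x \<in> W)" (is "?L \<longleftrightarrow> ?R")
proof
  interpret module ground M by fact
  assume L: ?L
  then have "\<zero>\<^bsub>M\<^esub> \<in> W"
    using subgroup.one_closed[OF submodule.axioms(1)[OF L]] by simp
  then show ?R using submoduleE[OF L] by auto
next
  interpret module ground M by fact
  assume R: ?R
  show ?L
  proof (rule submoduleI)
    fix a assume "a \<in> W"
    then show "\<ominus>\<^bsub>M\<^esub> a \<in> W"
      using R smult_minus_one[OF assms, of a] by (metis subsetD)
  qed (use R in auto)
qed

lemma submoduleD:
  fixes M :: "('k::field_char_0, 'v) module"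
  assumes "module ground M" "submodule W ground M"
  shows "x \<in> W \<Longrightarrow> x \<in> carrier M" "\<zero>\<^bsub>M\<^esub> \<in> W"
    "x \<in> W \<Longrightarrow> y \<in> W \<Longrightarrow> x \<oplus>\<^bsub>M\<^esub> y \<in> W" "x \<in> W \<Longrightarrow> c \<odot>\<^bsub>M\<^esub> x \<in> W"
    "x \<in> W \<Longrightarrow> \<ominus>\<^bsub>M\<^esub> x \<in> W"
  using assms submodule_iff[OF assms(1)] module.submoduleE(3)[OF assms] by auto

lemma abelian_subgroup_submodule:
  fixes M :: "('k::field_char_0, 'v) module"
  assumes "module ground M" "submodule W ground M"
  shows "abelian_subgroup W M"
proof -
  interpret module ground M by fact
  show ?thesis
    using abelian_subgroupI3 additive_subgroup.intro submodule.axioms(1)[OF assms(2)]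
      abelian_group_axioms by blast
qed

lemma quot_module_simps [simp]:
  "carrier (quot_module M W) = a_rcosets\<^bsub>M\<^esub> W"
  "\<zero>\<^bsub>quot_module M W\<^esub> = W"
  "A \<oplus>\<^bsub>quot_module M W\<^esub> B = A <+>\<^bsub>M\<^esub> B"
  "c \<odot>\<^bsub>quot_module M W\<^esub> A = (\<Union>x\<in>A. W +>\<^bsub>M\<^esub> (c \<odot>\<^bsub>M\<^esub> x))"
  by (simp_all add: quot_module_def)

lemma coset_eq: "W +>\<^bsub>M\<^esub> a = (\<lambda>h. h \<oplus>\<^bsub>M\<^esub> a) ` W"
  by (auto simp: a_r_coset_def')

lemma set_add_eq: "A <+>\<^bsub>M\<^esub> B = (\<Union>a\<in>A. \<Union>b\<in>B. {a \<oplus>\<^bsub>M\<^esub> b})"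
  by (simp add: set_add_def')

lemma rcosets_eq: "a_rcosets\<^bsub>M\<^esub> W = (\<lambda>a. W +>\<^bsub>M\<^esub> a) ` carrier M"
  by (auto simp: A_RCOSETS_def')

lemma mem_rcosets_iff: "A \<in> a_rcosets\<^bsub>M\<^esub> W \<longleftrightarrow> (\<exists>a \<in> carrier M. A = W +>\<^bsub>M\<^esub> a)"
  by (auto simp: A_RCOSETS_def')

locale quotient_module =
  fixes M :: "('k::field_char_0, 'v) module" and W
  assumes module: "module ground M" and submodule: "submodule W ground M"
begin

sublocale module ground M by (rule module)
sublocale abelian_subgroup W M by (rule abelian_subgroup_submodule[OF module submodule])

lemmas W_simps [simp] = submoduleD[OF module submodule]

lemma coset_in [simp]: "a \<in> carrier M \<Longrightarrow> W +>\<^bsub>M\<^esub> a \<in> a_rcosets\<^bsub>M\<^esub> W"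
  by (auto simp: mem_rcosets_iff)

lemma coset_self [simp]: "a \<in> carrier M \<Longrightarrow> a \<in> W +>\<^bsub>M\<^esub> a"
  by (rule a_rcos_self)

lemma coset_subset: "a \<in> carrier M \<Longrightarrow> W +>\<^bsub>M\<^esub> a \<subseteq> carrier M"
  by (auto simp: coset_eq)

lemma mem_coset_iff:
  assumes "a \<in> carrier M"
  shows "b \<in> W +>\<^bsub>M\<^esub> a \<longleftrightarrow> b \<in> carrier M \<and> b \<ominus>\<^bsub>M\<^esub> a \<in> W"
  using assms a_rcos_module_imp[of a b] a_rcos_module_rev[of a b] coset_subset[of a]
  by (auto simp: a_minus_def)

lemma coset_repr: "b \<in> W +>\<^bsub>M\<^esub> a \<Longrightarrow> a \<in> carrier M \<Longrightarrow> W +>\<^bsub>M\<^esub> b = W +>\<^bsub>M\<^esub> a"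
  using a_repr_independence[of b W a] a_subgroup by simp

lemma coset_eq_iff:
  assumes "a \<in> carrier M" "b \<in> carrier M"
  shows "W +>\<^bsub>M\<^esub> a = W +>\<^bsub>M\<^esub> b \<longleftrightarrow> a \<ominus>\<^bsub>M\<^esub> b \<in> W"
proof
  assume "W +>\<^bsub>M\<^esub> a = W +>\<^bsub>M\<^esub> b"
  then have "a \<in> W +>\<^bsub>M\<^esub> b" using coset_self[OF assms(1)] by simp
  then show "a \<ominus>\<^bsub>M\<^esub> b \<in> W" using mem_coset_iff assms by simp
next
  assume "a \<ominus>\<^bsub>M\<^esub> b \<in> W"
  then show "W +>\<^bsub>M\<^esub> a = W +>\<^bsub>M\<^esub> b" using coset_repr[of a b] mem_coset_iff assms by simp
qed

lemma coset_add [simp]: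
  "a \<in> carrier M \<Longrightarrow> b \<in> carrier M \<Longrightarrow> (W +>\<^bsub>M\<^esub> a) <+>\<^bsub>M\<^esub> (W +>\<^bsub>M\<^esub> b) = W +>\<^bsub>M\<^esub> (a \<oplus>\<^bsub>M\<^esub> b)"
  by (rule a_rcos_sum)

text \<open>The operations of \<open>quot_module\<close> and \<open>quot_dioperad\<close> are unions
  of cosets over all representatives. Independence of the representative makes the family constant,
  and a nonempty union of a constant family is that constant.\<close>

lemma UN_coset:
  assumes "\<And>x. x \<in> A \<Longrightarrow> f x = b" "a \<in> A"
  shows "(\<Union>x\<in>A. f x) = b"
  using assms by auto

lemma coset_smult [simp]:
  assumes "a \<in> carrier M"
  shows "(\<Union>x \<in> W +>\<^bsub>M\<^esub> a. W +>\<^bsub>M\<^esub> (c \<odot>\<^bsub>M\<^esub> x)) = W +>\<^bsub>M\<^esub> (c \<odot>\<^bsub>M\<^esub> a)"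
proof (rule UN_coset[where a = a])
  fix x assume x: "x \<in> W +>\<^bsub>M\<^esub> a"
  then obtain h where h: "h \<in> W" "x = h \<oplus>\<^bsub>M\<^esub> a" by (auto simp: coset_eq)
  have "c \<odot>\<^bsub>M\<^esub> x = c \<odot>\<^bsub>M\<^esub> h \<oplus>\<^bsub>M\<^esub> c \<odot>\<^bsub>M\<^esub> a"
    using h assms by (simp add: smult_r_distr)
  then have "c \<odot>\<^bsub>M\<^esub> x \<in> W +>\<^bsub>M\<^esub> (c \<odot>\<^bsub>M\<^esub> a)" using h by (auto simp: coset_eq)
  then show "W +>\<^bsub>M\<^esub> (c \<odot>\<^bsub>M\<^esub> x) = W +>\<^bsub>M\<^esub> (c \<odot>\<^bsub>M\<^esub> a)"
    using coset_repr assms by simp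
qed (use assms in simp)

lemma quot_module: "module ground (quot_module M W)"
proof (rule moduleI)
  \<comment> \<open>The zero of the quotient is recorded as \<open>W\<close> itself; writing it as a
    coset makes the coset rules applicable.\<close>
  have zero: "W = W +>\<^bsub>M\<^esub> \<zero>\<^bsub>M\<^esub>"
    by (auto simp: coset_eq intro!: image_eqI[where x = "x" for x])
  show "abelian_group (quot_module M W)"
  proof (rule abelian_groupI)
    fix A assume "A \<in> carrier (quot_module M W)"
    then obtain a where a: "a \<in> carrier M" "A = W +>\<^bsub>M\<^esub> a" by (auto simp: mem_rcosets_iff)
    show "\<zero>\<^bsub>quot_module M W\<^esub> \<oplus>\<^bsub>quot_module M W\<^esub> A = A"
      using a by (subst (2) a(2), subst quot_module_simps, subst zero) simp
    show "\<exists>B \<in> carrier (quot_module M W). B \<oplus>\<^bsub>quot_module M W\<^esub> A = \<zero>\<^bsub>quot_module M W\<^esub>"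
      using a by (intro bexI[of _ "W +>\<^bsub>M\<^esub> (\<ominus>\<^bsub>M\<^esub> a)"]) (auto simp: M.l_neg zero[symmetric])
  next
    show "\<zero>\<^bsub>quot_module M W\<^esub> \<in> carrier (quot_module M W)"
      using coset_in[of "\<zero>\<^bsub>M\<^esub>"] zero by simp
  qed (auto simp: mem_rcosets_iff M.a_ac)
next
  have C: "\<exists>a \<in> carrier M. A = W +>\<^bsub>M\<^esub> a" if "A \<in> carrier (quot_module M W)" for A
    using that by (simp add: mem_rcosets_iff)
  fix c :: 'k and A assume "A \<in> carrier (quot_module M W)"
  then obtain a where a: "a \<in> carrier M" "A = W +>\<^bsub>M\<^esub> a" using C by blast
  show "c \<odot>\<^bsub>quot_module M W\<^esub> A \<in> carrier (quot_module M W)"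
    using a by simp
  show "\<one>\<^bsub>ground\<^esub> \<odot>\<^bsub>quot_module M W\<^esub> A = A"
    using a smult_one[of a] by simp
  fix e :: 'k
  show "(c \<oplus>\<^bsub>ground\<^esub> e) \<odot>\<^bsub>quot_module M W\<^esub> A
      = c \<odot>\<^bsub>quot_module M W\<^esub> A \<oplus>\<^bsub>quot_module M W\<^esub> e \<odot>\<^bsub>quot_module M W\<^esub> A"
    using a smult_l_distr[of c e a] by simp
  show "(c \<otimes>\<^bsub>ground\<^esub> e) \<odot>\<^bsub>quot_module M W\<^esub> A
      = c \<odot>\<^bsub>quot_module M W\<^esub> (e \<odot>\<^bsub>quot_module M W\<^esub> A)"
    using a smult_assoc1[of c e a] by simp
  fix B assume "B \<in> carrier (quot_module M W)"
  then obtain b where "b \<in> carrier M" "B = W +>\<^bsub>M\<^esub> b" using C by blast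
  then show "c \<odot>\<^bsub>quot_module M W\<^esub> (A \<oplus>\<^bsub>quot_module M W\<^esub> B)
      = c \<odot>\<^bsub>quot_module M W\<^esub> A \<oplus>\<^bsub>quot_module M W\<^esub> c \<odot>\<^bsub>quot_module M W\<^esub> B"
    using a smult_r_distr[of c a b] by simp
qed (rule R.is_cring)

lemma coset_uminus [simp]:
  assumes "a \<in> carrier M"
  shows "\<ominus>\<^bsub>quot_module M W\<^esub> (W +>\<^bsub>M\<^esub> a) = W +>\<^bsub>M\<^esub> (\<ominus>\<^bsub>M\<^esub> a)"
  using smult_minus_one[OF quot_module, of "W +>\<^bsub>M\<^esub> a"] smult_minus_one[OF module, of a] assms
  by simp

lemma coset_minus [simp]:
  assumes "a \<in> carrier M" "b \<in> carrier M"
  shows "(W +>\<^bsub>M\<^esub> a) \<ominus>\<^bsub>quot_module M W\<^esub> (W +>\<^bsub>M\<^esub> b) = W +>\<^bsub>M\<^esub> (a \<ominus>\<^bsub>M\<^esub> b)"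
  using assms by (simp add: a_minus_def)

text \<open>An additive map taking \<open>W\<close> into \<open>V\<close> changes its value by an
  element of \<open>V\<close> when the representative changes, so all terms of the union are the
  same coset.\<close>

lemma UN_cosets_act:
  assumes N: "quotient_module N V"
    and f: "\<And>x. x \<in> carrier M \<Longrightarrow> f x \<in> carrier N"
    and add: "\<And>x y. x \<in> carrier M \<Longrightarrow> y \<in> carrier M \<Longrightarrow> f (x \<oplus>\<^bsub>M\<^esub> y) = f x \<oplus>\<^bsub>N\<^esub> f y"
    and W: "\<And>x. x \<in> W \<Longrightarrow> f x \<in> V" and a: "a \<in> carrier M"
  shows "(\<Union>x \<in> W +>\<^bsub>M\<^esub> a. V +>\<^bsub>N\<^esub> f x) = V +>\<^bsub>N\<^esub> f a"
proof (rule UN_coset[where a = a])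
  interpret N: quotient_module N V by fact
  fix x assume x: "x \<in> W +>\<^bsub>M\<^esub> a"
  then obtain h where h: "h \<in> W" "x = h \<oplus>\<^bsub>M\<^esub> a" by (auto simp: coset_eq)
  then have "f x \<in> V +>\<^bsub>N\<^esub> f a"
    using add[of h a] W[of h] a by (auto simp: coset_eq)
  then show "V +>\<^bsub>N\<^esub> f x = V +>\<^bsub>N\<^esub> f a"
    using N.coset_repr a f by blast
qed (use a in simp)

end

section \<open>Linear spans\<close>

lemma lin_span_submodule:
  fixes M :: "('k::field_char_0, 'v) module"
  assumes M: "module ground M" and S: "S \<subseteq> carrier M"
  shows "submodule (lin_span M S) ground M"
proof -
  \<comment> \<open>The carrier is one of the submodules intersected, since it contains
    \<open>S\<close>; this keeps the span inside it.\<close>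
  have *: "submodule (carrier M) ground M" using module.carrier_is_submodule[OF M] .
  show ?thesis
    unfolding submodule_iff[OF M]
  proof (intro conjI ballI allI)
    show "lin_span M S \<subseteq> carrier M" using * S by (auto simp: lin_span_def)
  qed (auto simp: lin_span_def submodule_iff[OF M])
qed

lemma lin_span_incl: "S \<subseteq> lin_span M S"
  by (auto simp: lin_span_def)

lemma lin_span_least: "submodule W ground M \<Longrightarrow> S \<subseteq> W \<Longrightarrow> lin_span M S \<subseteq> W"
  by (auto simp: lin_span_def)

text \<open>The preimage of \<open>W\<close> is a submodule containing \<open>S\<close>, hence
  contains the span. This replaces an induction over linear combinations.\<close>

lemma lin_span_image:
  fixes M :: "('k::field_char_0, 'v) module" and N :: "('k, 'w) module"
  assumes M: "module ground M" and N: "module ground N" and S: "S \<subseteq> carrier M"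
    and f: "\<And>x. x \<in> carrier M \<Longrightarrow> f x \<in> carrier N"
    and add: "\<And>x y. x \<in> carrier M \<Longrightarrow> y \<in> carrier M \<Longrightarrow> f (x \<oplus>\<^bsub>M\<^esub> y) = f x \<oplus>\<^bsub>N\<^esub> f y"
    and smult: "\<And>c x. x \<in> carrier M \<Longrightarrow> f (c \<odot>\<^bsub>M\<^esub> x) = c \<odot>\<^bsub>N\<^esub> f x"
    and W: "submodule W ground N" "f ` S \<subseteq> W" and x: "x \<in> lin_span M S"
  shows "f x \<in> W"
proof -
  interpret M: module ground M by fact
  interpret N: module ground N by fact
  let ?V = "{x \<in> carrier M. f x \<in> W}"
  have z: "f \<zero>\<^bsub>M\<^esub> = \<zero>\<^bsub>N\<^esub>"
    using smult[of "\<zero>\<^bsub>M\<^esub>" 0] f[of "\<zero>\<^bsub>M\<^esub>"] M.smult_l_null N.smult_l_null by simp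
  have "submodule ?V ground M"
    unfolding submodule_iff[OF M] using W z add smult
    by (auto simp: submodule_iff[OF N])
  then have "lin_span M S \<subseteq> ?V" by (rule lin_span_least) (use S W in auto)
  then show ?thesis using x by auto
qed

section \<open>Transport of quotients and ideals along isomorphisms\<close>

text \<open>
  An isomorphism \<open>\<phi>\<close> defined on sets \<open>U \<tau>\<close> that may be larger than the carriers. Passing to a
  quotient replaces \<open>U \<tau>\<close> by its power set and \<open>\<phi> \<tau>\<close> by the image map; since the operations of a
  quotient are unions over arbitrary sets of representatives, no compatibility of the
  operations with the subspaces divided out is needed.
\<close>

locale dioperad_transport =
  fixes P :: "('k::field_char_0, 'v) dioperad" and Q :: "('k, 'w) dioperad"
    and U :: "idx \<Rightarrow> 'v set" and \<phi> :: "idx \<Rightarrow> 'v \<Rightarrow> 'w"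
  assumes inj: "(m, n) \<in> J0 \<Longrightarrow> inj_on (\<phi> (m, n, i)) (U (m, n, i))"
    and carrier_sub: "(m, n) \<in> J0 \<Longrightarrow> carrier (sp P (m, n, i)) \<subseteq> U (m, n, i)"
    and carrier_image: "(m, n) \<in> J0 \<Longrightarrow> \<phi> (m, n, i) ` carrier (sp P (m, n, i)) = carrier (sp Q (m, n, i))"
    and zero: "(m, n) \<in> J0 \<Longrightarrow> \<zero>\<^bsub>sp P (m, n, i)\<^esub> \<in> U (m, n, i)"
      "(m, n) \<in> J0 \<Longrightarrow> \<phi> (m, n, i) \<zero>\<^bsub>sp P (m, n, i)\<^esub> = \<zero>\<^bsub>sp Q (m, n, i)\<^esub>"
    and add: "\<lbrakk>(m, n) \<in> J0; x \<in> U (m, n, i); y \<in> U (m, n, i)\<rbrakk> \<Longrightarrow> x \<oplus>\<^bsub>sp P (m, n, i)\<^esub> y \<in> U (m, n, i)"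
      "\<lbrakk>(m, n) \<in> J0; x \<in> U (m, n, i); y \<in> U (m, n, i)\<rbrakk> \<Longrightarrow>
        \<phi> (m, n, i) (x \<oplus>\<^bsub>sp P (m, n, i)\<^esub> y) = \<phi> (m, n, i) x \<oplus>\<^bsub>sp Q (m, n, i)\<^esub> \<phi> (m, n, i) y"
    and smult: "\<lbrakk>(m, n) \<in> J0; x \<in> U (m, n, i)\<rbrakk> \<Longrightarrow> c \<odot>\<^bsub>sp P (m, n, i)\<^esub> x \<in> U (m, n, i)"
      "\<lbrakk>(m, n) \<in> J0; x \<in> U (m, n, i)\<rbrakk> \<Longrightarrow>
        \<phi> (m, n, i) (c \<odot>\<^bsub>sp P (m, n, i)\<^esub> x) = c \<odot>\<^bsub>sp Q (m, n, i)\<^esub> \<phi> (m, n, i) x"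
    and dif: "\<lbrakk>(m, n) \<in> J0; x \<in> U (m, n, i)\<rbrakk> \<Longrightarrow> dif P (m, n, i) x \<in> U (m, n, i + 1)"
      "\<lbrakk>(m, n) \<in> J0; x \<in> U (m, n, i)\<rbrakk> \<Longrightarrow>
        \<phi> (m, n, i + 1) (dif P (m, n, i) x) = dif Q (m, n, i) (\<phi> (m, n, i) x)"
    and act: "\<lbrakk>(m, n) \<in> J0; x \<in> U (m, n, i); \<pi> permutes {1..m}; \<sigma> permutes {1..n}\<rbrakk> \<Longrightarrow>
        act P (m, n, i) \<pi> \<sigma> x \<in> U (m, n, i)"
      "\<lbrakk>(m, n) \<in> J0; x \<in> U (m, n, i); \<pi> permutes {1..m}; \<sigma> permutes {1..n}\<rbrakk> \<Longrightarrow>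
        \<phi> (m, n, i) (act P (m, n, i) \<pi> \<sigma> x) = act Q (m, n, i) \<pi> \<sigma> (\<phi> (m, n, i) x)"
    and pcomp: "\<lbrakk>(m1, n1) \<in> J0; (m2, n2) \<in> J0; a \<in> {1..n1}; b \<in> {1..m2};
        x \<in> U (m1, n1, p); y \<in> U (m2, n2, q)\<rbrakk> \<Longrightarrow>
        pcomp P (m1, n1, p) (m2, n2, q) a b x y \<in> U (m1 + m2 - 1, n1 + n2 - 1, p + q)"
      "\<lbrakk>(m1, n1) \<in> J0; (m2, n2) \<in> J0; a \<in> {1..n1}; b \<in> {1..m2};
        x \<in> U (m1, n1, p); y \<in> U (m2, n2, q)\<rbrakk> \<Longrightarrow>
        \<phi> (m1 + m2 - 1, n1 + n2 - 1, p + q) (pcomp P (m1, n1, p) (m2, n2, q) a b x y)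
          = pcomp Q (m1, n1, p) (m2, n2, q) a b (\<phi> (m1, n1, p) x) (\<phi> (m2, n2, q) y)"
begin

lemma iso: "P \<cong>\<^sub>d Q"
proof -
  have sub: "x \<in> carrier (sp P (m, n, i)) \<Longrightarrow> (m, n) \<in> J0 \<Longrightarrow> x \<in> U (m, n, i)" for x m n i
    using carrier_sub by blast
  have img: "\<phi> (m, n, i) x \<in> carrier (sp Q (m, n, i))"
    if "x \<in> carrier (sp P (m, n, i))" "(m, n) \<in> J0" for x m n i
    using carrier_image that by blast
  have "dioperad_hom P Q \<phi>"
    unfolding dioperad_hom_def
    using img by (auto simp: sub add smult dif act pcomp simp del: One_nat_def)
  moreover have "(m, n) \<in> J0 \<Longrightarrow>
      bij_betw (\<phi> (m, n, i)) (carrier (sp P (m, n, i))) (carrier (sp Q (m, n, i)))" for m n i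
    using carrier_image inj_on_subset[OF inj carrier_sub] by (auto simp: bij_betw_def)
  ultimately show ?thesis unfolding dioperad_iso_def by blast
qed

text \<open>\<open>U\<close> is closed under addition, so \<phi> is additive on the whole coset,
  even where the coset leaves the carrier.\<close>

lemma coset_image:
  assumes "(m, n) \<in> J0" "I \<subseteq> U (m, n, i)" "x \<in> U (m, n, i)"
  shows "I +>\<^bsub>sp P (m, n, i)\<^esub> x \<subseteq> U (m, n, i)"
    "\<phi> (m, n, i) ` (I +>\<^bsub>sp P (m, n, i)\<^esub> x) = (\<phi> (m, n, i) ` I) +>\<^bsub>sp Q (m, n, i)\<^esub> (\<phi> (m, n, i) x)"
proof -
  have *: "h \<in> I \<Longrightarrow> h \<in> U (m, n, i)" for h using assms by blast
  show "I +>\<^bsub>sp P (m, n, i)\<^esub> x \<subseteq> U (m, n, i)"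
    using assms by (auto simp: coset_eq * add)
  show "\<phi> (m, n, i) ` (I +>\<^bsub>sp P (m, n, i)\<^esub> x) = (\<phi> (m, n, i) ` I) +>\<^bsub>sp Q (m, n, i)\<^esub> (\<phi> (m, n, i) x)"
    using assms by (simp add: coset_eq * add image_image cong: image_cong)
qed

text \<open>The conclusion has the form of the locale again because quotients are taken twice:
  formal sums are divided by the tree relators, then the free dioperad by an ideal.\<close>

lemma quot:
  assumes I: "\<And>m n i. (m, n) \<in> J0 \<Longrightarrow> I (m, n, i) \<subseteq> U (m, n, i)"
    and J: "\<And>m n i. (m, n) \<in> J0 \<Longrightarrow> \<phi> (m, n, i) ` I (m, n, i) = J (m, n, i)"
  shows "dioperad_transport (quot_dioperad P I) (quot_dioperad Q J)
    (\<lambda>\<tau>. Pow (U \<tau>)) (\<lambda>\<tau>. image (\<phi> \<tau>))"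
proof
  fix m n i assume mn: "(m, n) \<in> J0"
  note C = coset_image[OF mn I[OF mn], unfolded J[OF mn]]
  show "inj_on ((`) (\<phi> (m, n, i))) (Pow (U (m, n, i)))"
    using inj[OF mn] by (rule inj_on_image_Pow)
  show "carrier (sp (quot_dioperad P I) (m, n, i)) \<subseteq> Pow (U (m, n, i))"
    using C(1)[OF subsetD[OF carrier_sub[OF mn]]]
    by (fastforce simp: quot_dioperad_def mem_rcosets_iff)
  show "(`) (\<phi> (m, n, i)) ` carrier (sp (quot_dioperad P I) (m, n, i))
      = carrier (sp (quot_dioperad Q J) (m, n, i))"
  proof -
    have "(`) (\<phi> (m, n, i)) ` (\<lambda>x. I (m, n, i) +>\<^bsub>sp P (m, n, i)\<^esub> x) ` carrier (sp P (m, n, i))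
        = (\<lambda>x. J (m, n, i) +>\<^bsub>sp Q (m, n, i)\<^esub> x) ` \<phi> (m, n, i) ` carrier (sp P (m, n, i))"
      unfolding image_image using carrier_sub[OF mn] by (intro image_cong C(2)) auto
    then show ?thesis
      by (simp add: quot_dioperad_def rcosets_eq carrier_image[OF mn])
  qed
  show "\<zero>\<^bsub>sp (quot_dioperad P I) (m, n, i)\<^esub> \<in> Pow (U (m, n, i))"
    using I[OF mn] by (simp add: quot_dioperad_def)
  show "\<phi> (m, n, i) ` \<zero>\<^bsub>sp (quot_dioperad P I) (m, n, i)\<^esub> = \<zero>\<^bsub>sp (quot_dioperad Q J) (m, n, i)\<^esub>"
    using J[OF mn] by (simp add: quot_dioperad_def)
  fix A assume A: "A \<in> Pow (U (m, n, i))"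
  then have A': "x \<in> A \<Longrightarrow> x \<in> U (m, n, i)" for x by auto
  {
    fix B assume "B \<in> Pow (U (m, n, i))"
    then have B': "x \<in> B \<Longrightarrow> x \<in> U (m, n, i)" for x by auto
    show "A \<oplus>\<^bsub>sp (quot_dioperad P I) (m, n, i)\<^esub> B \<in> Pow (U (m, n, i))"
      by (auto simp: quot_dioperad_def set_add_eq A' B' add mn)
    show "\<phi> (m, n, i) ` (A \<oplus>\<^bsub>sp (quot_dioperad P I) (m, n, i)\<^esub> B)
        = (\<phi> (m, n, i) ` A) \<oplus>\<^bsub>sp (quot_dioperad Q J) (m, n, i)\<^esub> (\<phi> (m, n, i) ` B)"
      by (simp add: quot_dioperad_def set_add_eq A' B' add mn image_UN cong: SUP_cong)
  }
  show "c \<odot>\<^bsub>sp (quot_dioperad P I) (m, n, i)\<^esub> A \<in> Pow (U (m, n, i))" for c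
    using C(1)[OF smult(1)[OF mn A']] by (simp add: quot_dioperad_def UN_subset_iff)
  show "\<phi> (m, n, i) ` (c \<odot>\<^bsub>sp (quot_dioperad P I) (m, n, i)\<^esub> A)
      = c \<odot>\<^bsub>sp (quot_dioperad Q J) (m, n, i)\<^esub> (\<phi> (m, n, i) ` A)" for c
    by (simp add: quot_dioperad_def C(2) A' smult mn image_UN cong: SUP_cong)
  show "dif (quot_dioperad P I) (m, n, i) A \<in> Pow (U (m, n, i + 1))"
    using coset_image(1)[OF mn I[OF mn] dif(1)[OF mn A']]
    by (simp add: quot_dioperad_def UN_subset_iff)
  show "\<phi> (m, n, i + 1) ` dif (quot_dioperad P I) (m, n, i) A
      = dif (quot_dioperad Q J) (m, n, i) (\<phi> (m, n, i) ` A)"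
    by (simp add: quot_dioperad_def coset_image(2)[OF mn I[OF mn]] J mn A' dif image_UN cong: SUP_cong)
  fix \<pi> \<sigma> assume p: "\<pi> permutes {1..m}" "\<sigma> permutes {1..n}"
  show "act (quot_dioperad P I) (m, n, i) \<pi> \<sigma> A \<in> Pow (U (m, n, i))"
    using C(1)[OF act(1)[OF mn A' p]] by (simp add: quot_dioperad_def UN_subset_iff)
  show "\<phi> (m, n, i) ` act (quot_dioperad P I) (m, n, i) \<pi> \<sigma> A
      = act (quot_dioperad Q J) (m, n, i) \<pi> \<sigma> (\<phi> (m, n, i) ` A)"
    by (simp add: quot_dioperad_def C(2) A' act p mn image_UN del: One_nat_def cong: SUP_cong)
next
  fix m1 n1 p m2 n2 q a b A B
  assume mn: "(m1, n1) \<in> J0" "(m2, n2) \<in> J0" and ab: "a \<in> {1..n1}" "b \<in> {1..m2}"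
    and "A \<in> Pow (U (m1, n1, p))" "B \<in> Pow (U (m2, n2, q))"
  then have A': "x \<in> A \<Longrightarrow> x \<in> U (m1, n1, p)" and B': "y \<in> B \<Longrightarrow> y \<in> U (m2, n2, q)" for x y by auto
  have mn': "(m1 + m2 - 1, n1 + n2 - 1) \<in> J0" using J0_plug mn ab by auto
  note C = coset_image[OF mn' I[OF mn'], unfolded J[OF mn']]
  show "pcomp (quot_dioperad P I) (m1, n1, p) (m2, n2, q) a b A B
      \<in> Pow (U (m1 + m2 - 1, n1 + n2 - 1, p + q))"
    using C(1)[OF pcomp(1)[OF mn ab A' B']] by (simp add: quot_dioperad_def UN_subset_iff)
  show "\<phi> (m1 + m2 - 1, n1 + n2 - 1, p + q) ` pcomp (quot_dioperad P I) (m1, n1, p) (m2, n2, q) a b A B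
      = pcomp (quot_dioperad Q J) (m1, n1, p) (m2, n2, q) a b (\<phi> (m1, n1, p) ` A) (\<phi> (m2, n2, q) ` B)"
  proof -
    have "\<phi> (m1 + m2 - 1, n1 + n2 - 1, p + q) ` (I (m1 + m2 - 1, n1 + n2 - 1, p + q)
          +>\<^bsub>sp P (m1 + m2 - 1, n1 + n2 - 1, p + q)\<^esub> pcomp P (m1, n1, p) (m2, n2, q) a b x y)
        = J (m1 + m2 - 1, n1 + n2 - 1, p + q) +>\<^bsub>sp Q (m1 + m2 - 1, n1 + n2 - 1, p + q)\<^esub>
          pcomp Q (m1, n1, p) (m2, n2, q) a b (\<phi> (m1, n1, p) x) (\<phi> (m2, n2, q) y)"
      if "x \<in> A" "y \<in> B" for x y
      using C(2)[OF pcomp(1)[OF mn ab A'[OF that(1)] B'[OF that(2)]]]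
        pcomp(2)[OF mn ab A'[OF that(1)] B'[OF that(2)]] by simp
    then show ?thesis
      unfolding quot_dioperad_def dioperad.simps plug_idx.simps image_UN UN_simps
      by (intro SUP_cong refl)
  qed
qed

end

section \<open>Ideals along an isomorphism\<close>

lemma ideal_submodule:
  "dioperad_ideal P I \<Longrightarrow> (m, n) \<in> J0 \<Longrightarrow> submodule (I (m, n, i)) ground (sp P (m, n, i))"
  unfolding dioperad_ideal_def subbimodule_def by blast

text \<open>\<open>ideal_gen\<close> asks for \<open>S \<tau> \<subseteq> I \<tau>\<close> at every
  index, whereas ideals are constrained only on \<open>J0\<close>. Enlarging \<open>I\<close> to
  everything outside of \<open>J0\<close> keeps it an ideal, because compositions of indices in
  \<open>J0\<close> stay there.\<close>

lemma ideal_genD: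
  assumes x: "x \<in> ideal_gen P S (m, n, i)" and I: "dioperad_ideal P I"
    and S: "\<And>m n i. (m, n) \<in> J0 \<Longrightarrow> S (m, n, i) \<subseteq> I (m, n, i)" and mn: "(m, n) \<in> J0"
  shows "x \<in> I (m, n, i)"
proof -
  define I' where "I' \<tau> = (if (fst \<tau>, fst (snd \<tau>)) \<in> J0 then I \<tau> else UNIV)" for \<tau>
  have J0: "I' (m, n, i) = I (m, n, i)" if "(m, n) \<in> J0" for m n i
    using that by (simp add: I'_def)
  have "dioperad_ideal P I'"
    using I J0_plug unfolding dioperad_ideal_def subbimodule_def by (simp add: J0)
  moreover have "\<forall>\<tau>. S \<tau> \<subseteq> I' \<tau>"
    using S by (auto simp: I'_def)
  ultimately have "x \<in> I' (m, n, i)"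
    using x unfolding ideal_gen_def by blast
  then show ?thesis using mn by (simp add: J0)
qed

locale module_transport = dioperad_transport +
  assumes P_module: "(m, n) \<in> J0 \<Longrightarrow> module ground (sp P (m, n, i))"
    and Q_module: "(m, n) \<in> J0 \<Longrightarrow> module ground (sp Q (m, n, i))"
begin

lemma ideal_image:
  assumes I: "dioperad_ideal P I"
  shows "dioperad_ideal Q (\<lambda>\<tau>. \<phi> \<tau> ` I \<tau>)"
proof -
  have Isub: "x \<in> carrier (sp P (m, n, i))" if "(m, n) \<in> J0" "x \<in> I (m, n, i)" for m n i x
    using submoduleD(1)[OF P_module ideal_submodule[OF I]] that by blast
  then have IU: "x \<in> U (m, n, i)" if "(m, n) \<in> J0" "x \<in> I (m, n, i)" for m n i x
    using that carrier_sub by blast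
  \<comment> \<open>One preimage for both uses: it is chosen in \<open>I\<close> whenever
    \<open>y\<close> lies in the image of \<open>I\<close>, so it inherits whichever alternative of
    the ideal condition holds.\<close>
  have Q: "\<exists>x \<in> carrier (sp P (m, n, i)). y = \<phi> (m, n, i) x \<and> (y \<in> \<phi> (m, n, i) ` I (m, n, i) \<longrightarrow> x \<in> I (m, n, i))"
    if "(m, n) \<in> J0" "y \<in> carrier (sp Q (m, n, i))" for y m n i
    using carrier_image[OF that(1), of i] that(2) Isub[OF that(1)] by (cases "y \<in> \<phi> (m, n, i) ` I (m, n, i)") auto
  show ?thesis
    unfolding dioperad_ideal_def subbimodule_def
  proof (intro conjI allI impI ballI)
    fix m n i assume mn: "(m, n) \<in> J0"
    have "submodule (I (m, n, i)) ground (sp P (m, n, i))"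
      using I mn unfolding dioperad_ideal_def subbimodule_def by blast
    then have s: "I (m, n, i) \<subseteq> carrier (sp P (m, n, i))" "\<zero>\<^bsub>sp P (m, n, i)\<^esub> \<in> I (m, n, i)"
      "\<And>x y. x \<in> I (m, n, i) \<Longrightarrow> y \<in> I (m, n, i) \<Longrightarrow> x \<oplus>\<^bsub>sp P (m, n, i)\<^esub> y \<in> I (m, n, i)"
      "\<And>c x. x \<in> I (m, n, i) \<Longrightarrow> c \<odot>\<^bsub>sp P (m, n, i)\<^esub> x \<in> I (m, n, i)"
      by (auto simp: submodule_iff[OF P_module[OF mn]])
    show "submodule (\<phi> (m, n, i) ` I (m, n, i)) ground (sp Q (m, n, i))"
      unfolding submodule_iff[OF Q_module[OF mn]]
    proof (intro conjI ballI allI)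
      show "\<phi> (m, n, i) ` I (m, n, i) \<subseteq> carrier (sp Q (m, n, i))"
        using carrier_image[OF mn] s(1) by blast
      show "\<zero>\<^bsub>sp Q (m, n, i)\<^esub> \<in> \<phi> (m, n, i) ` I (m, n, i)"
        using zero(2)[OF mn] s(2) by (metis imageI)
    qed (use s in \<open>auto simp: add(2)[symmetric] smult(2)[symmetric] IU mn\<close>)
  next
    fix m n i \<pi> \<sigma> y
    assume mn: "(m, n) \<in> J0" and p: "\<pi> permutes {1..m}" "\<sigma> permutes {1..n}"
      and "y \<in> \<phi> (m, n, i) ` I (m, n, i)"
    then obtain x where x: "x \<in> I (m, n, i)" "y = \<phi> (m, n, i) x" by blast
    then have "act P (m, n, i) \<pi> \<sigma> x \<in> I (m, n, i)"
      using I mn p unfolding dioperad_ideal_def subbimodule_def by blast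
    then show "act Q (m, n, i) \<pi> \<sigma> y \<in> \<phi> (m, n, i) ` I (m, n, i)"
      using x act(2)[OF mn IU[OF mn x(1)] p] by (metis imageI)
  next
    fix m1 n1 p m2 n2 q a b x y
    assume mn: "(m1, n1) \<in> J0" "(m2, n2) \<in> J0" and ab: "a \<in> {1..n1}" "b \<in> {1..m2}"
      and x: "x \<in> carrier (sp Q (m1, n1, p))" and y: "y \<in> carrier (sp Q (m2, n2, q))"
      and xy: "x \<in> \<phi> (m1, n1, p) ` I (m1, n1, p) \<or> y \<in> \<phi> (m2, n2, q) ` I (m2, n2, q)"
    obtain x' where x': "x' \<in> carrier (sp P (m1, n1, p))" "x = \<phi> (m1, n1, p) x'"
        "x \<in> \<phi> (m1, n1, p) ` I (m1, n1, p) \<longrightarrow> x' \<in> I (m1, n1, p)"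
      using Q[OF mn(1) x] by blast
    obtain y' where y': "y' \<in> carrier (sp P (m2, n2, q))" "y = \<phi> (m2, n2, q) y'"
        "y \<in> \<phi> (m2, n2, q) ` I (m2, n2, q) \<longrightarrow> y' \<in> I (m2, n2, q)"
      using Q[OF mn(2) y] by blast
    have "pcomp P (m1, n1, p) (m2, n2, q) a b x' y' \<in> I (m1 + m2 - 1, n1 + n2 - 1, p + q)"
      using I mn ab x' y' xy unfolding dioperad_ideal_def plug_idx.simps by blast
    moreover have "x' \<in> U (m1, n1, p)" "y' \<in> U (m2, n2, q)"
      using x'(1) y'(1) carrier_sub mn by blast+
    ultimately show "pcomp Q (m1, n1, p) (m2, n2, q) a b x y
        \<in> \<phi> (plug_idx (m1, n1, p) (m2, n2, q)) ` I (plug_idx (m1, n1, p) (m2, n2, q))"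
      using pcomp(2)[OF mn ab, of x' p y' q] x'(2) y'(2) by (metis imageI plug_idx.simps)
  qed
qed

lemma ideal_vimage:
  assumes I: "dioperad_ideal Q I"
  shows "dioperad_ideal P (\<lambda>\<tau>. {x \<in> carrier (sp P \<tau>). \<phi> \<tau> x \<in> I \<tau>})"
proof -
  have U: "x \<in> U (m, n, i)" if "(m, n) \<in> J0" "x \<in> carrier (sp P (m, n, i))" for m n i x
    using that carrier_sub by blast
  have C: "\<phi> (m, n, i) x \<in> carrier (sp Q (m, n, i))"
    if "(m, n) \<in> J0" "x \<in> carrier (sp P (m, n, i))" for m n i x
    using that carrier_image by blast
  have s: "submodule (I (m, n, i)) ground (sp Q (m, n, i))" if "(m, n) \<in> J0" for m n i
    using I that unfolding dioperad_ideal_def subbimodule_def by blast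
  \<comment> \<open>Operations of \<open>P\<close> are only known to land in \<open>U\<close>, which
    may exceed the carrier. Membership in the carrier is recovered from the image by injectivity on
    \<open>U\<close>.\<close>
  have inC: "x \<in> carrier (sp P (m, n, i))"
    if "(m, n) \<in> J0" "x \<in> U (m, n, i)" "\<phi> (m, n, i) x \<in> I (m, n, i)" for m n i x
  proof -
    have "\<phi> (m, n, i) x \<in> \<phi> (m, n, i) ` carrier (sp P (m, n, i))"
      using submoduleD(1)[OF Q_module s] that carrier_image by blast
    then show ?thesis
      using inj_on_image_mem_iff[OF inj[OF that(1)] that(2) carrier_sub[OF that(1)]] by blast
  qed
  show ?thesis
    unfolding dioperad_ideal_def subbimodule_def
  proof (intro conjI allI impI ballI)
    fix m n i assume mn: "(m, n) \<in> J0"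
    interpret Pm: module ground "sp P (m, n, i)" by (rule P_module[OF mn])
    show "submodule {x \<in> carrier (sp P (m, n, i)). \<phi> (m, n, i) x \<in> I (m, n, i)} ground (sp P (m, n, i))"
      unfolding submodule_iff[OF P_module[OF mn]]
      using submoduleD[OF Q_module[OF mn] s[OF mn]]
      by (auto simp: zero add(2) smult(2) mn U)
  next
    fix m n i \<pi> \<sigma> x
    assume mn: "(m, n) \<in> J0" and p: "\<pi> permutes {1..m}" "\<sigma> permutes {1..n}"
      and x: "x \<in> {x \<in> carrier (sp P (m, n, i)). \<phi> (m, n, i) x \<in> I (m, n, i)}"
    then have "\<phi> (m, n, i) (act P (m, n, i) \<pi> \<sigma> x) \<in> I (m, n, i)"
      using I act(2)[OF mn U[OF mn] p] unfolding dioperad_ideal_def subbimodule_def by auto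
    then show "act P (m, n, i) \<pi> \<sigma> x \<in> {x \<in> carrier (sp P (m, n, i)). \<phi> (m, n, i) x \<in> I (m, n, i)}"
      using inC[OF mn act(1)[OF mn U[OF mn] p]] x by auto
  next
    fix m1 n1 p m2 n2 q a b x y
    assume mn: "(m1, n1) \<in> J0" "(m2, n2) \<in> J0" and ab: "a \<in> {1..n1}" "b \<in> {1..m2}"
      and x: "x \<in> carrier (sp P (m1, n1, p))" and y: "y \<in> carrier (sp P (m2, n2, q))"
      and xy: "x \<in> {x \<in> carrier (sp P (m1, n1, p)). \<phi> (m1, n1, p) x \<in> I (m1, n1, p)}
        \<or> y \<in> {x \<in> carrier (sp P (m2, n2, q)). \<phi> (m2, n2, q) x \<in> I (m2, n2, q)}"
    have mn': "(m1 + m2 - 1, n1 + n2 - 1) \<in> J0" using J0_plug mn ab by auto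
    have "pcomp Q (m1, n1, p) (m2, n2, q) a b (\<phi> (m1, n1, p) x) (\<phi> (m2, n2, q) y)
        \<in> I (m1 + m2 - 1, n1 + n2 - 1, p + q)"
      using I mn ab C[OF mn(1) x] C[OF mn(2) y] xy unfolding dioperad_ideal_def plug_idx.simps by blast
    then show "pcomp P (m1, n1, p) (m2, n2, q) a b x y
        \<in> {x \<in> carrier (sp P (plug_idx (m1, n1, p) (m2, n2, q))).
          \<phi> (plug_idx (m1, n1, p) (m2, n2, q)) x \<in> I (plug_idx (m1, n1, p) (m2, n2, q))}"
      using pcomp[OF mn ab U[OF mn(1) x] U[OF mn(2) y]] inC[OF mn'] by simp
  qed
qed

text \<open>The universal property in both directions: ideals of \<open>Q\<close> are pulled back,
  ideals of \<open>P\<close> are pushed forward. \<open>K\<close> supplies one ideal containing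
  \<open>S\<close>; over an empty family the intersection in \<open>ideal_gen\<close> would be the
  whole type.\<close>

lemma ideal_gen_image:
  assumes K: "dioperad_ideal P (\<lambda>\<tau>. carrier (sp P \<tau>))"
    and S: "\<And>m n i. (m, n) \<in> J0 \<Longrightarrow> S (m, n, i) \<subseteq> carrier (sp P (m, n, i))"
    and S': "\<And>m n i. (m, n) \<in> J0 \<Longrightarrow> \<phi> (m, n, i) ` S (m, n, i) = S' (m, n, i)"
    and mn: "(m, n) \<in> J0"
  shows "ideal_gen P S (m, n, i) \<subseteq> carrier (sp P (m, n, i))"
    "\<phi> (m, n, i) ` ideal_gen P S (m, n, i) = ideal_gen Q S' (m, n, i)"
proof -
  note genD = ideal_genD[OF _ _ _ mn]
  show sub: "ideal_gen P S (m, n, i) \<subseteq> carrier (sp P (m, n, i))"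
    using genD[OF _ K S] by blast
  show "\<phi> (m, n, i) ` ideal_gen P S (m, n, i) = ideal_gen Q S' (m, n, i)"
  proof (intro equalityI subsetI)
    fix y assume "y \<in> \<phi> (m, n, i) ` ideal_gen P S (m, n, i)"
    then obtain x where x: "x \<in> ideal_gen P S (m, n, i)" "y = \<phi> (m, n, i) x" by blast
    have "\<phi> (m, n, i) x \<in> I (m, n, i)" if I: "dioperad_ideal Q I" "\<forall>\<tau>. S' \<tau> \<subseteq> I \<tau>" for I
      using genD[OF x(1) ideal_vimage[OF I(1)]] I(2) S S' by blast
    then show "y \<in> ideal_gen Q S' (m, n, i)"
      unfolding ideal_gen_def x(2) by blast
  next
    fix y assume y: "y \<in> ideal_gen Q S' (m, n, i)"
    have "y \<in> \<phi> (m, n, i) ` carrier (sp P (m, n, i))"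
      using genD[OF y ideal_image[OF K]] S S' by (metis image_mono)
    then obtain x where x: "x \<in> carrier (sp P (m, n, i))" "y = \<phi> (m, n, i) x" by blast
    have "x \<in> I (m, n, i)" if I: "dioperad_ideal P I" "\<forall>\<tau>. S \<tau> \<subseteq> I \<tau>" for I
    proof -
      have "y \<in> \<phi> (m, n, i) ` I (m, n, i)"
        using genD[OF y ideal_image[OF I(1)]] I(2) S' by (metis image_mono)
      moreover have "I (m, n, i) \<subseteq> U (m, n, i)"
        using submoduleD(1)[OF P_module ideal_submodule[OF I(1)]] mn carrier_sub[OF mn] by blast
      ultimately show ?thesis
        using inj_on_image_mem_iff[OF inj[OF mn]] carrier_sub[OF mn] x by blast
    qed
    then show "y \<in> \<phi> (m, n, i) ` ideal_gen P S (m, n, i)"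
      unfolding x(2) ideal_gen_def by blast
  qed
qed

end

section \<open>Formal sums\<close>

abbreviation scale :: "'k::field_char_0 \<Rightarrow> ('t \<Rightarrow>\<^sub>0 'k) \<Rightarrow> 't \<Rightarrow>\<^sub>0 'k" where
  "scale c \<equiv> Poly_Mapping.map ((*) c)"

lemma lookup_scale [simp]: "Poly_Mapping.lookup (scale c A) t = c * Poly_Mapping.lookup A t"
  by (simp add: map.rep_eq when_def)

lemma keys_scale: "Poly_Mapping.keys (scale c A) \<subseteq> Poly_Mapping.keys A"
  by (auto simp: in_keys_iff)

lemma scale_single: "scale c (Poly_Mapping.single t b) = Poly_Mapping.single t (c * b)"
  by (rule poly_mapping_eqI) (simp add: lookup_single when_def)

lemma scale_algebra:
  "scale c (A + B) = scale c A + scale c B" "scale (c + e) A = scale c A + scale e A"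
  "scale (c * e) A = scale c (scale e A)" "scale 1 A = A" "scale 0 A = 0" "scale c 0 = 0"
  "scale (- c) A = - scale c A" "scale c (A - B) = scale c A - scale c B"
  by (rule poly_mapping_eqI; simp add: lookup_add lookup_minus algebra_simps)+

lemma formal_sums_simps [simp]:
  "carrier (formal_sums D) = {A. Poly_Mapping.keys A \<subseteq> D}" "\<zero>\<^bsub>formal_sums D\<^esub> = 0"
  "A \<oplus>\<^bsub>formal_sums D\<^esub> B = A + B" "c \<odot>\<^bsub>formal_sums D\<^esub> A = scale c A"
  by (simp_all add: formal_sums_def)

lemma module_formal_sums: "module ground (formal_sums D :: ('k::field_char_0, 't \<Rightarrow>\<^sub>0 'k) module)"
proof (rule moduleI)
  show "abelian_group (formal_sums D :: ('k, 't \<Rightarrow>\<^sub>0 'k) module)"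
  proof (rule abelian_groupI)
    fix A assume "A \<in> carrier (formal_sums D :: ('k, 't \<Rightarrow>\<^sub>0 'k) module)"
    then show "\<exists>B \<in> carrier (formal_sums D :: ('k, 't \<Rightarrow>\<^sub>0 'k) module).
        B \<oplus>\<^bsub>formal_sums D\<^esub> A = \<zero>\<^bsub>formal_sums D\<^esub>"
      by (intro bexI[of _ "- A"]) auto
  qed (use Poly_Mapping.keys_add in \<open>fastforce simp: algebra_simps\<close>)+
  fix c :: 'k and A assume "A \<in> carrier (formal_sums D :: ('k, 't \<Rightarrow>\<^sub>0 'k) module)"
  then show "c \<odot>\<^bsub>formal_sums D\<^esub> A \<in> carrier (formal_sums D)"
    using keys_scale[of c A] by auto
qed (auto simp: scale_algebra)

lemma formal_sums_minus [simp]: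
  assumes "Poly_Mapping.keys A \<subseteq> D" "Poly_Mapping.keys B \<subseteq> D"
  shows "A \<ominus>\<^bsub>formal_sums D\<^esub> B = A - (B :: 't \<Rightarrow>\<^sub>0 'k::field_char_0)"
  using smult_minus_one[OF module_formal_sums, of B D] assms
  by (simp add: a_minus_def scale_algebra)

lemma submodule_formal_sums_iff:
  "submodule W ground (formal_sums D) \<longleftrightarrow> (\<forall>A \<in> W. Poly_Mapping.keys A \<subseteq> D) \<and> 0 \<in> W \<and>
    (\<forall>A \<in> W. \<forall>B \<in> W. A + B \<in> W) \<and> (\<forall>c. \<forall>A \<in> W. scale c A \<in> W)"
  by (auto simp: submodule_iff[OF module_formal_sums])

lemma formal_sum_eq: "A = (\<Sum>t \<in> Poly_Mapping.keys A. Poly_Mapping.single t (Poly_Mapping.lookup A t))"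
  by (rule poly_mapping_eqI) (auto simp: lookup_sum lookup_single when_def in_keys_iff)

text \<open>Induction over linear combinations. With a set comprehension for \<open>W\<close> it
  reduces linear identities and closure properties to single trees with coefficient 1.\<close>

lemma formal_sum_mem:
  assumes W: "0 \<in> W" "\<And>A B. A \<in> W \<Longrightarrow> B \<in> W \<Longrightarrow> A + B \<in> W" "\<And>c A. A \<in> W \<Longrightarrow> scale c A \<in> W"
    and A: "\<And>t. t \<in> Poly_Mapping.keys A \<Longrightarrow> Poly_Mapping.single t 1 \<in> W"
  shows "(A :: 't \<Rightarrow>\<^sub>0 'k::field_char_0) \<in> W"
proof -
  have "(\<Sum>t \<in> S. Poly_Mapping.single t (Poly_Mapping.lookup A t)) \<in> W"
    if "finite S" "S \<subseteq> Poly_Mapping.keys A" for S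
    using that
  proof (induction S)
    case (insert t S)
    then show ?case
      using W(2) W(3)[OF A[of t], of "Poly_Mapping.lookup A t"]
      by (simp add: scale_single)
  qed (use W in simp)
  from this[OF finite_keys order_refl] show ?thesis
    using formal_sum_eq[of A] by simp
qed

section \<open>Linear functionals and linear extensions\<close>

definition lin_form :: "('t \<Rightarrow> 'k::field_char_0) \<Rightarrow> ('t \<Rightarrow>\<^sub>0 'k) \<Rightarrow> 'k" where
  "lin_form h A = (\<Sum>t \<in> Poly_Mapping.keys A. Poly_Mapping.lookup A t * h t)"

text \<open>Cancellation can shrink the keys of a sum; a common finite index set makes the values on
  \<open>A\<close>, \<open>B\<close> and \<open>A + B\<close> comparable.\<close>

lemma lin_form_superset:
  "finite S \<Longrightarrow> Poly_Mapping.keys A \<subseteq> S \<Longrightarrow> lin_form h A = (\<Sum>t \<in> S. Poly_Mapping.lookup A t * h t)"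
  unfolding lin_form_def by (rule sum.mono_neutral_left) (auto simp: in_keys_iff)

lemma lin_form_single [simp]: "lin_form h (Poly_Mapping.single t c) = c * h t"
  by (simp add: lin_form_superset[of "{t}"])

lemma lin_form_zero [simp]: "lin_form h 0 = 0"
  by (simp add: lin_form_def)

lemma lin_form_add [simp]: "lin_form h (A + B) = lin_form h A + lin_form h B"
proof -
  let ?S = "Poly_Mapping.keys A \<union> Poly_Mapping.keys B"
  have "lin_form h C = (\<Sum>t \<in> ?S. Poly_Mapping.lookup C t * h t)" if "Poly_Mapping.keys C \<subseteq> ?S" for C
    using that by (intro lin_form_superset) auto
  then show ?thesis
    using Poly_Mapping.keys_add[of A B] by (simp add: lookup_add distrib_right sum.distrib)
qed

lemma lin_form_scale [simp]: "lin_form h (scale c A) = c * lin_form h A"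
  using lin_form_superset[OF finite_keys keys_scale, of h c A]
  by (simp add: lin_form_def sum_distrib_left mult.assoc)

lemma lin_form_uminus [simp]: "lin_form h (- A) = - lin_form h A"
  using lin_form_scale[of h "- 1" A] by (simp add: scale_algebra)

lemma lin_form_minus [simp]: "lin_form h (A - B) = lin_form h A - lin_form h B"
  using lin_form_add[of h A "- B"] by simp

lemma lin_form_fun:
  "lin_form (\<lambda>t. g t + h t) A = lin_form g A + lin_form h A"
  "lin_form (\<lambda>t. c * h t) A = c * lin_form h A"
  "lin_form (\<lambda>t. 0) A = 0" "lin_form (\<lambda>t. - h t) A = - lin_form h A"
  by (simp_all add: lin_form_def distrib_left sum.distrib sum_distrib_left mult.left_commute sum_negf)

lemma lin_form_sum_fun: "lin_form (\<lambda>t. \<Sum>i\<in>S. f i t) A = (\<Sum>i\<in>S. lin_form (f i) A)"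
  by (induction S rule: infinite_finite_induct) (simp_all add: lin_form_fun)

lemma lin_form_cong:
  "(\<And>t. t \<in> Poly_Mapping.keys A \<Longrightarrow> g t = h t) \<Longrightarrow> lin_form g A = lin_form h A"
  by (simp add: lin_form_def)

text \<open>Coefficients of an extended map are linear forms, so its linearity follows
  coefficientwise from that of \<open>lin_form\<close>, without any bookkeeping of keys.\<close>

lemma lookup_lin_ext:
  "Poly_Mapping.lookup (lin_ext f A) u = lin_form (\<lambda>t. if f t = u then 1 else 0) A"
  by (auto simp: lin_ext_def lin_form_def lookup_sum lookup_single when_def intro!: sum.cong)

lemma lin_ext_simps [simp]:
  "lin_ext f (A + B) = lin_ext f A + lin_ext f B" "lin_ext f (scale c A) = scale c (lin_ext f A)"
  "lin_ext f 0 = 0" "lin_ext f (A - B) = lin_ext f A - lin_ext f B"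
  "lin_ext f (Poly_Mapping.single t c) = Poly_Mapping.single (f t) c"
  by (rule poly_mapping_eqI; simp add: lookup_lin_ext lookup_add lookup_minus lookup_single when_def)+

lemma keys_lin_ext: "Poly_Mapping.keys (lin_ext f A) \<subseteq> f ` Poly_Mapping.keys A"
proof
  fix u assume "u \<in> Poly_Mapping.keys (lin_ext f A)"
  then have "lin_form (\<lambda>t. if f t = u then 1 else 0) A \<noteq> 0"
    by (simp add: in_keys_iff lookup_lin_ext)
  then show "u \<in> f ` Poly_Mapping.keys A"
    unfolding lin_form_def by (rule contrapos_np) (auto intro!: sum.neutral)
qed

lemma lin_form_lin_ext: "lin_form h (lin_ext f A) = lin_form (\<lambda>t. h (f t)) A"
proof -
  have "A \<in> {A. lin_form h (lin_ext f A) = lin_form (\<lambda>t. h (f t)) A}"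
    by (rule formal_sum_mem) auto
  then show ?thesis by simp
qed

lemma lin_ext_lin_ext: "lin_ext g (lin_ext f A) = lin_ext (\<lambda>t. g (f t)) A"
  by (rule poly_mapping_eqI) (simp add: lookup_lin_ext lin_form_lin_ext)

lemma lin_ext_id: "(\<And>t. t \<in> Poly_Mapping.keys A \<Longrightarrow> f t = t) \<Longrightarrow> lin_ext f A = A"
  using formal_sum_eq[of A] by (simp add: lin_ext_def)

lemma lookup_bilin_ext:
  "Poly_Mapping.lookup (bilin_ext f A B) w
    = lin_form (\<lambda>t. lin_form (\<lambda>s. if f t s = w then 1 else 0) B) A"
  by (auto simp: bilin_ext_def lin_form_def lookup_sum lookup_single when_def sum_distrib_left
    intro!: sum.cong)

lemma bilin_ext_simps [simp]:
  "bilin_ext f (A + A') B = bilin_ext f A B + bilin_ext f A' B"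
  "bilin_ext f A (B + B') = bilin_ext f A B + bilin_ext f A B'"
  "bilin_ext f (A - A') B = bilin_ext f A B - bilin_ext f A' B"
  "bilin_ext f A (B - B') = bilin_ext f A B - bilin_ext f A B'"
  "bilin_ext f (scale c A) B = scale c (bilin_ext f A B)"
  "bilin_ext f A (scale c B) = scale c (bilin_ext f A B)"
  "bilin_ext f 0 B = 0" "bilin_ext f A 0 = 0"
  "bilin_ext f (Poly_Mapping.single t b) (Poly_Mapping.single s c) = Poly_Mapping.single (f t s) (b * c)"
  by (rule poly_mapping_eqI; simp add: lookup_bilin_ext lookup_add lookup_minus lookup_single when_def
      lin_form_fun diff_conv_add_uminus
      del: add_uminus_conv_diff)+

lemma keys_bilin_ext:
  "Poly_Mapping.keys (bilin_ext f A B) \<subseteq> {f t s | t s. t \<in> Poly_Mapping.keys A \<and> s \<in> Poly_Mapping.keys B}"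
proof
  fix u assume u: "u \<in> Poly_Mapping.keys (bilin_ext f A B)"
  show "u \<in> {f t s | t s. t \<in> Poly_Mapping.keys A \<and> s \<in> Poly_Mapping.keys B}"
  proof (rule ccontr)
    assume "\<not> ?thesis"
    then have "lin_form (\<lambda>t. lin_form (\<lambda>s. if f t s = u then 1 else 0) B) A = 0"
      unfolding lin_form_def by (auto intro!: sum.neutral)
    with u show False by (simp add: in_keys_iff lookup_bilin_ext)
  qed
qed

lemma lin_ext_bilin_ext:
  assumes "\<And>t s. t \<in> Poly_Mapping.keys A \<Longrightarrow> s \<in> Poly_Mapping.keys B \<Longrightarrow> h (f t s) = g (k t) (l s)"
  shows "lin_ext h (bilin_ext f A B) = bilin_ext g (lin_ext k A) (lin_ext l B)"
proof (rule poly_mapping_eqI)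
  fix u
  \<comment> \<open>Proved by linear induction in \<open>A\<close> and, for a single tree in its
    place, in \<open>B\<close>.\<close>
  have "lin_form h' (bilin_ext f A B) = lin_form (\<lambda>t. lin_form (\<lambda>s. h' (f t s)) B) A" for h'
  proof -
    have "A \<in> {A. lin_form h' (bilin_ext f A B) = lin_form (\<lambda>t. lin_form (\<lambda>s. h' (f t s)) B) A}"
    proof (rule formal_sum_mem)
      fix t
      have "B \<in> {B. lin_form h' (bilin_ext f (Poly_Mapping.single t 1) B) = lin_form (\<lambda>s. h' (f t s)) B}"
        by (rule formal_sum_mem) auto
      then show "Poly_Mapping.single t 1 \<in> {A. lin_form h' (bilin_ext f A B) = lin_form (\<lambda>t. lin_form (\<lambda>s. h' (f t s)) B) A}"
        by simp
    qed auto
    then show ?thesis by simp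
  qed
  then have "Poly_Mapping.lookup (lin_ext h (bilin_ext f A B)) u
      = lin_form (\<lambda>t. lin_form (\<lambda>s. if h (f t s) = u then 1 else 0) B) A"
    by (simp add: lookup_lin_ext)
  also have "\<dots> = lin_form (\<lambda>t. lin_form (\<lambda>s. if g (k t) (l s) = u then 1 else 0) B) A"
    using assms by (intro lin_form_cong) simp
  also have "\<dots> = Poly_Mapping.lookup (bilin_ext g (lin_ext k A) (lin_ext l B)) u"
    by (simp add: lookup_bilin_ext lin_form_lin_ext)
  finally show "Poly_Mapping.lookup (lin_ext h (bilin_ext f A B)) u
      = Poly_Mapping.lookup (bilin_ext g (lin_ext k A) (lin_ext l B)) u" .
qed

lemma sum_pairing_eq:
  "sum_pairing E m n A B = lin_form (\<lambda>t. lin_form (tree_pairing E m n t) B) A"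
  by (simp add: sum_pairing_def lin_form_def sum_distrib_left mult.assoc)

section \<open>Operations on trees\<close>

definition bijrel :: "'a set \<Rightarrow> 'b set \<Rightarrow> ('a \<times> 'b) set \<Rightarrow> bool" where
  "bijrel S T E \<longleftrightarrow> E \<subseteq> S \<times> T \<and> (\<forall>s \<in> S. \<exists>!r. (s, r) \<in> E) \<and> (\<forall>r \<in> T. \<exists>!s. (s, r) \<in> E)"

lemma bijrelD:
  assumes "bijrel S T E"
  shows "(s, r) \<in> E \<Longrightarrow> s \<in> S" "(s, r) \<in> E \<Longrightarrow> r \<in> T"
    "s \<in> S \<Longrightarrow> \<exists>r. (s, r) \<in> E" "r \<in> T \<Longrightarrow> \<exists>s. (s, r) \<in> E"
    "(s, r) \<in> E \<Longrightarrow> (s, r') \<in> E \<Longrightarrow> r = r'" "(s, r) \<in> E \<Longrightarrow> (s', r) \<in> E \<Longrightarrow> s = s'"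
  using assms unfolding bijrel_def by blast+

lemma bijrelI:
  assumes "\<And>s r. (s, r) \<in> E \<Longrightarrow> s \<in> S \<and> r \<in> T"
    and "\<And>s. s \<in> S \<Longrightarrow> \<exists>r. (s, r) \<in> E" "\<And>r. r \<in> T \<Longrightarrow> \<exists>s. (s, r) \<in> E"
    and "\<And>s r r'. (s, r) \<in> E \<Longrightarrow> (s, r') \<in> E \<Longrightarrow> r = r'" "\<And>s s' r. (s, r) \<in> E \<Longrightarrow> (s', r) \<in> E \<Longrightarrow> s = s'"
  shows "bijrel S T E"
  unfolding bijrel_def
proof (intro conjI ballI)
  show "E \<subseteq> S \<times> T" using assms(1) by auto
  show "\<exists>!r. (s, r) \<in> E" if "s \<in> S" for s using assms(2)[OF that] assms(4) by blast
  show "\<exists>!s. (s, r) \<in> E" if "r \<in> T" for r using assms(3)[OF that] assms(5) by blast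
qed

lemma bijrel_image:
  assumes E: "bijrel S T E" and f: "inj_on f S" and g: "inj_on g T"
  shows "bijrel (f ` S) (g ` T) ((\<lambda>(s, r). (f s, g r)) ` E)"
proof (rule bijrelI)
  fix s r assume "(s, r) \<in> (\<lambda>(s, r). (f s, g r)) ` E"
  then show "s \<in> f ` S \<and> r \<in> g ` T" using bijrelD(1,2)[OF E] by auto
next
  fix s assume "s \<in> f ` S"
  then obtain s' where "s' \<in> S" "s = f s'" by blast
  then show "\<exists>r. (s, r) \<in> (\<lambda>(s, r). (f s, g r)) ` E"
    using bijrelD(3)[OF E, of s'] by (force simp: image_iff)
next
  fix r assume "r \<in> g ` T"
  then obtain r' where "r' \<in> T" "r = g r'" by blast
  then show "\<exists>s. (s, r) \<in> (\<lambda>(s, r). (f s, g r)) ` E"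
    using bijrelD(4)[OF E, of r'] by (force simp: image_iff)
next
  fix s r r' assume "(s, r) \<in> (\<lambda>(s, r). (f s, g r)) ` E" "(s, r') \<in> (\<lambda>(s, r). (f s, g r)) ` E"
  then obtain a b a' b' where *: "(a, b) \<in> E" "(a', b') \<in> E" "s = f a" "s = f a'" "r = g b" "r' = g b'"
    by auto
  then have "a = a'" using inj_onD[OF f, of a a'] bijrelD(1)[OF E] by auto
  then show "r = r'" using * bijrelD(5)[OF E] by auto
next
  fix s s' r assume "(s, r) \<in> (\<lambda>(s, r). (f s, g r)) ` E" "(s', r) \<in> (\<lambda>(s, r). (f s, g r)) ` E"
  then obtain a b a' b' where *: "(a, b) \<in> E" "(a', b') \<in> E" "s = f a" "s' = f a'" "r = g b" "r = g b'"
    by auto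
  then have "b = b'" using inj_onD[OF g, of b b'] bijrelD(2)[OF E] by auto
  then show "s = s'" using * bijrelD(6)[OF E] by auto
qed

lemma bijrel_remove:
  assumes E: "bijrel S T E" and sr: "(s, r) \<in> E"
  shows "bijrel (S - {s}) (T - {r}) (E - {(s, r)})"
proof (rule bijrelI)
  fix a b assume "(a, b) \<in> E - {(s, r)}"
  then show "a \<in> S - {s} \<and> b \<in> T - {r}"
    using sr bijrelD(1,2,5,6)[OF E] by blast
next
  fix a assume "a \<in> S - {s}"
  then show "\<exists>b. (a, b) \<in> E - {(s, r)}" using bijrelD(3)[OF E] by blast
next
  fix b assume "b \<in> T - {r}"
  then show "\<exists>a. (a, b) \<in> E - {(s, r)}" using bijrelD(4)[OF E] by blast
qed (use bijrelD(5,6)[OF E] in blast)+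

lemma bijrel_union:
  assumes E: "bijrel S T E" "bijrel S' T' E'" and disj: "S \<inter> S' = {}" "T \<inter> T' = {}"
  shows "bijrel (S \<union> S') (T \<union> T') (E \<union> E')"
proof (rule bijrelI)
  fix s r assume "(s, r) \<in> E \<union> E'"
  then show "s \<in> S \<union> S' \<and> r \<in> T \<union> T'" using bijrelD(1,2)[OF E(1)] bijrelD(1,2)[OF E(2)] by blast
next
  fix s assume "s \<in> S \<union> S'"
  then show "\<exists>r. (s, r) \<in> E \<union> E'" using bijrelD(3)[OF E(1)] bijrelD(3)[OF E(2)] by blast
next
  fix r assume "r \<in> T \<union> T'"
  then show "\<exists>s. (s, r) \<in> E \<union> E'" using bijrelD(4)[OF E(1)] bijrelD(4)[OF E(2)] by blast
next
  fix s r r' assume "(s, r) \<in> E \<union> E'" "(s, r') \<in> E \<union> E'"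
  then show "r = r'"
    using bijrelD(1,5)[OF E(1)] bijrelD(1,5)[OF E(2)] disj(1) by blast
next
  fix s s' r assume "(s, r) \<in> E \<union> E'" "(s', r) \<in> E \<union> E'"
  then show "s = s'"
    using bijrelD(2,6)[OF E(1)] bijrelD(2,6)[OF E(2)] disj(2) by blast
qed

lemma bijrel_single: "bijrel {s} {r} {(s, r)}"
  by (auto simp: bijrel_def)

lemma bijrel_card:
  assumes "bijrel S T E"
  shows "card E = card S" "card E = card T"
proof -
  note D = bijrelD[OF assms]
  have "inj_on fst E" using D(5) by (auto simp: inj_on_def)
  moreover have "fst ` E = S" using D(1,3) by force
  moreover have "inj_on snd E" using D(6) by (auto simp: inj_on_def)
  moreover have "snd ` E = T" using D(2,4) by force
  ultimately have "bij_betw fst E S" "bij_betw snd E T"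
    by (auto simp: bij_betw_def)
  then show "card E = card S" "card E = card T" using bij_betw_same_card by blast+
qed

lemma card_sources: "card (sources n vs) = n + sum_list (map outs vs)"
proof -
  have "card (\<Union>a<length vs. Out a ` {1..outs (vs ! a)}) = (\<Sum>a<length vs. outs (vs ! a))"
    by (subst card_UN_disjoint) (auto simp: card_image inj_on_def)
  moreover have "Leaf ` {1..n} \<inter> (\<Union>a<length vs. Out a ` {1..outs (vs ! a)}) = {}" by auto
  ultimately show ?thesis
    by (simp add: sources_def card_Un_disjoint card_image inj_on_def sum_list_sum_nth atLeast0LessThan)
qed

lemma card_targets: "card (targets m vs) = m + sum_list (map ins vs)"
proof -
  have "card (\<Union>a<length vs. In a ` {1..ins (vs ! a)}) = (\<Sum>a<length vs. ins (vs ! a))"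
    by (subst card_UN_disjoint) (auto simp: card_image inj_on_def)
  moreover have "Root ` {1..m} \<inter> (\<Union>a<length vs. In a ` {1..ins (vs ! a)}) = {}" by auto
  ultimately show ?thesis
    by (simp add: targets_def card_Un_disjoint card_image inj_on_def sum_list_sum_nth atLeast0LessThan)
qed

lemma card_nodes: "card (nodes m n t) = n + m + length (verts t)"
proof -
  have "LeafN ` {1..n} \<inter> RootN ` {1..m} = {}"
    "(LeafN ` {1..n} \<union> RootN ` {1..m}) \<inter> IntN ` {..<length (verts t)} = {}" by auto
  then show ?thesis
    by (simp add: nodes_def card_Un_disjoint card_image inj_on_def)
qed

definition joined :: "'e dtree \<Rightarrow> (node \<times> node) set" where
  "joined t = (adjacent t \<union> (adjacent t)\<inverse>)\<^sup>*"

text \<open>Every source starts exactly one edge, so edges can be counted as leaves plus outputs of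
  vertices. The number of leaves then cancels from the Euler condition.\<close>

lemma is_tree_iff:
  "is_tree m n t \<longleftrightarrow> bijrel (sources n (verts t)) (targets m (verts t)) (edges t) \<and>
    (\<forall>u \<in> nodes m n t. \<forall>v \<in> nodes m n t. (u, v) \<in> joined t) \<and>
    m + length (verts t) = sum_list (map outs (verts t)) + 1"
proof -
  have "card (nodes m n t) = card (edges t) + 1 \<longleftrightarrow> m + length (verts t) = sum_list (map outs (verts t)) + 1"
    if "bijrel (sources n (verts t)) (targets m (verts t)) (edges t)"
    using bijrel_card(1)[OF that] by (simp add: card_sources card_nodes)
  then show ?thesis unfolding is_tree_def bijrel_def joined_def by blast
qed

text \<open>The edges match sources with targets bijectively, so the count of outputs turns into one
  of inputs. The two counts together determine the number of vertices of each kind in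
  \<open>zero_dec_or_std\<close>.\<close>

lemma is_tree_card_ins:
  assumes "is_tree m n t"
  shows "n + length (verts t) = sum_list (map ins (verts t)) + 1"
  using assms bijrel_card[of "sources n (verts t)" "targets m (verts t)" "edges t"]
  by (simp add: is_tree_iff card_sources card_targets)

lemma joined_sym: "(u, v) \<in> joined t \<Longrightarrow> (v, u) \<in> joined t"
  unfolding joined_def by (rule symD[OF sym_rtrancl]) (auto simp: sym_def)

lemma joined_trans: "(u, v) \<in> joined t \<Longrightarrow> (v, w) \<in> joined t \<Longrightarrow> (u, w) \<in> joined t"
  unfolding joined_def by (rule rtrancl_trans)

lemma joined_edge: "(s, r) \<in> edges t \<Longrightarrow> (edge_tail s, edge_head r) \<in> joined t"
  unfolding joined_def adjacent_def by (rule r_into_rtrancl) force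

text \<open>The ends of an edge need only become joined nodes, so \<nu> may send a node to one of
  another kind. Grafting does this to the leaf and the root that disappear.\<close>

lemma joined_map:
  assumes "\<And>s r. (s, r) \<in> edges t \<Longrightarrow> (\<nu> (edge_tail s), \<nu> (edge_head r)) \<in> joined t'"
    and "(u, v) \<in> joined t"
  shows "(\<nu> u, \<nu> v) \<in> joined t'"
  using assms(2) unfolding joined_def
proof (induction rule: rtrancl_induct)
  case (step v w)
  then have "(\<nu> v, \<nu> w) \<in> joined t'"
    using assms(1) joined_sym by (fastforce simp: adjacent_def)
  with step show ?case using joined_trans unfolding joined_def by blast
qed simp

text \<open>Used by contradiction: a hypothetical extra component is exhibited as a set
  \<open>Z\<close> that no edge enters or leaves, together with a vertex outside of it.\<close>

lemma is_tree_closed: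
  assumes "is_tree m n t" "u \<in> Z" "u \<in> nodes m n t" "v \<in> nodes m n t"
    and Z: "\<And>s r. (s, r) \<in> edges t \<Longrightarrow> edge_tail s \<in> Z \<longleftrightarrow> edge_head r \<in> Z"
  shows "v \<in> Z"
proof -
  have "(u, v) \<in> joined t" using assms by (auto simp: is_tree_iff)
  then show ?thesis
    using \<open>u \<in> Z\<close> unfolding joined_def
    by (induction rule: rtrancl_induct) (use Z in \<open>fastforce simp: adjacent_def\<close>)+
qed

section \<open>Invariance of the tree conditions under renaming\<close>

lemma tail_in_nodes: "s \<in> sources n (verts t) \<Longrightarrow> edge_tail s \<in> nodes m n t"
  by (auto simp: sources_def nodes_def)

lemma head_in_nodes: "r \<in> targets m (verts t) \<Longrightarrow> edge_head r \<in> nodes m n t"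
  by (auto simp: targets_def nodes_def)

text \<open>Relabelling, renumbering and exchange of vertices only rename the ends of edges:
  \<open>f\<close> and \<open>g\<close> transport the incidence conditions, and the induced map
  \<nu> of nodes transports connectedness.\<close>

lemma is_tree_map:
  assumes t: "is_tree m n t"
    and f: "inj_on f (sources n (verts t))" "f ` sources n (verts t) = sources n (verts t')"
    and g: "inj_on g (targets m (verts t))" "g ` targets m (verts t) = targets m (verts t')"
    and edges: "edges t' = map_edges f g t"
    and \<nu>: "\<And>s. \<nu> (edge_tail s) = edge_tail (f s)" "\<And>r. \<nu> (edge_head r) = edge_head (g r)"
      "\<nu> ` nodes m n t = nodes m n t'"
    and outs: "length (verts t') = length (verts t)" "sum_list (map outs (verts t')) = sum_list (map outs (verts t))"
  shows "is_tree m n t'"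
  unfolding is_tree_iff
proof (intro conjI ballI)
  have t': "bijrel (sources n (verts t)) (targets m (verts t)) (edges t)"
    "\<And>u v. u \<in> nodes m n t \<Longrightarrow> v \<in> nodes m n t \<Longrightarrow> (u, v) \<in> joined t"
    "m + length (verts t) = sum_list (map vertex.outs (verts t)) + 1"
    using t by (auto simp: is_tree_iff)
  show "bijrel (sources n (verts t')) (targets m (verts t')) (edges t')"
    using bijrel_image[OF t'(1) f(1) g(1)] unfolding f(2) g(2) edges map_edges_def .
  show "m + length (verts t') = sum_list (map vertex.outs (verts t')) + 1"
    using t'(3) outs by simp
  fix u v assume "u \<in> nodes m n t'" "v \<in> nodes m n t'"
  then obtain u0 v0 where "u0 \<in> nodes m n t" "v0 \<in> nodes m n t" "u = \<nu> u0" "v = \<nu> v0"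
    unfolding \<nu>(3)[symmetric] by blast
  moreover have "(\<nu> (edge_tail s), \<nu> (edge_head r)) \<in> joined t'" if "(s, r) \<in> edges t" for s r
    unfolding \<nu> by (rule joined_edge) (use that in \<open>force simp: edges map_edges_def\<close>)
  ultimately show "(u, v) \<in> joined t'" using joined_map t'(2) by metis
qed

lemma is_tree_relabel:
  assumes t: "is_tree m n t" and p: "\<pi> permutes {1..m}" "\<sigma> permutes {1..n}"
  shows "is_tree m n (relabel \<pi> \<sigma> t)"
proof (rule is_tree_map[OF t, where f = "relabel_src \<sigma>" and g = "relabel_tgt \<pi>"])
  note p' = permutes_inv[OF p(2)]
  have "inj (relabel_src \<sigma>)"
  proof (rule injI)
    fix x y assume "relabel_src \<sigma> x = relabel_src \<sigma> y"
    then show "x = y" using permutes_inj[OF p'] by (cases x; cases y) (auto dest: injD)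
  qed
  then show "inj_on (relabel_src \<sigma>) (sources n (verts t))" by (rule inj_on_subset) simp
  have "inj (relabel_tgt \<pi>)"
  proof (rule injI)
    fix x y assume "relabel_tgt \<pi> x = relabel_tgt \<pi> y"
    then show "x = y" using permutes_inj[OF p(1)] by (cases x; cases y) (auto dest: injD)
  qed
  then show "inj_on (relabel_tgt \<pi>) (targets m (verts t))" by (rule inj_on_subset) simp
  show "relabel_src \<sigma> ` sources n (verts t) = sources n (verts (relabel \<pi> \<sigma> t))"
  proof -
    have "(\<lambda>l. Leaf (pinv \<sigma> l)) ` {1..n} = Leaf ` {1..n}"
      using permutes_image[OF p'] by (metis image_image)
    then show ?thesis
      by (simp add: relabel_def sources_def image_Un image_UN image_image)
  qed
  show "relabel_tgt \<pi> ` targets m (verts t) = targets m (verts (relabel \<pi> \<sigma> t))"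
  proof -
    have "(\<lambda>r. Root (\<pi> r)) ` {1..m} = Root ` {1..m}"
      using permutes_image[OF p(1)] by (metis image_image)
    then show ?thesis
      by (simp add: relabel_def targets_def image_Un image_UN image_image)
  qed
  define \<nu> where "\<nu> u = (case u of LeafN l \<Rightarrow> LeafN (pinv \<sigma> l) | RootN r \<Rightarrow> RootN (\<pi> r) | IntN a \<Rightarrow> IntN a)" for u
  show "\<nu> (edge_tail s) = edge_tail (relabel_src \<sigma> s)" for s by (cases s) (simp_all add: \<nu>_def)
  show "\<nu> (edge_head r) = edge_head (relabel_tgt \<pi> r)" for r by (cases r) (simp_all add: \<nu>_def)
  have "(\<lambda>l. LeafN (pinv \<sigma> l)) ` {1..n} = LeafN ` {1..n}"
    "(\<lambda>r. RootN (\<pi> r)) ` {1..m} = RootN ` {1..m}"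
    using permutes_image[OF p'] permutes_image[OF p(1)] by (metis image_image)+
  then show "\<nu> ` nodes m n t = nodes m n (relabel \<pi> \<sigma> t)"
    by (simp add: nodes_def relabel_def image_Un image_image \<nu>_def)
qed (simp_all add: relabel_def)

lemma is_tree_renumber:
  assumes t: "is_tree m n t" and a: "a < length (verts t)"
    and p: "\<pi> permutes {1..outs (verts t ! a)}" "\<sigma> permutes {1..ins (verts t ! a)}"
  shows "is_tree m n (renumber E a \<pi> \<sigma> t)"
proof (rule is_tree_map[OF t, where f = "renumber_src a \<pi>" and g = "renumber_tgt a \<sigma>" and \<nu> = id])
  note p' = permutes_inv[OF p(2)]
  have "inj (renumber_src a \<pi>)"
  proof (rule injI)
    fix x y assume "renumber_src a \<pi> x = renumber_src a \<pi> y"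
    then show "x = y" using permutes_inj[OF p(1)] by (cases x; cases y) (auto dest: injD split: if_splits)
  qed
  then show "inj_on (renumber_src a \<pi>) (sources n (verts t))" by (rule inj_on_subset) simp
  have "inj (renumber_tgt a \<sigma>)"
  proof (rule injI)
    fix x y assume "renumber_tgt a \<sigma> x = renumber_tgt a \<sigma> y"
    then show "x = y" using permutes_inj[OF p'] by (cases x; cases y) (auto dest: injD split: if_splits)
  qed
  then show "inj_on (renumber_tgt a \<sigma>) (targets m (verts t))" by (rule inj_on_subset) simp
  let ?v = "\<lambda>b. (verts t)[a := map_vertex (act E (vidx (verts t ! a)) \<pi> \<sigma>) (verts t ! a)] ! b"
  have v: "outs (?v b) = outs (verts t ! b)" "ins (?v b) = ins (verts t ! b)" for b
    using a by (auto simp: nth_list_update vertex.map_sel)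
  show "renumber_src a \<pi> ` sources n (verts t) = sources n (verts (renumber E a \<pi> \<sigma> t))"
  proof -
    have "renumber_src a \<pi> ` Out b ` {1..outs (verts t ! b)} = Out b ` {1..outs (?v b)}" for b
      using permutes_image[OF p(1)] by (cases "b = a") (simp_all add: image_image v image_image[of "Out a" \<pi>, symmetric])
    then show ?thesis
      by (simp add: renumber_def sources_def image_Un image_UN image_image)
  qed
  show "renumber_tgt a \<sigma> ` targets m (verts t) = targets m (verts (renumber E a \<pi> \<sigma> t))"
  proof -
    have "renumber_tgt a \<sigma> ` In b ` {1..ins (verts t ! b)} = In b ` {1..ins (?v b)}" for b
      using permutes_image[OF p'] by (cases "b = a") (simp_all add: image_image v image_image[of "In a" "pinv \<sigma>", symmetric])
    then show ?thesis
      by (simp add: renumber_def targets_def image_Un image_UN image_image)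
  qed
  show "id (edge_tail s) = edge_tail (renumber_src a \<pi> s)" for s by (cases s) simp_all
  show "id (edge_head r) = edge_head (renumber_tgt a \<sigma> r)" for r by (cases r) simp_all
  have "map vertex.outs (verts (renumber E a \<pi> \<sigma> t)) = map vertex.outs (verts t)"
    using v(1) by (intro nth_equalityI) (auto simp: renumber_def)
  then show "sum_list (map vertex.outs (verts (renumber E a \<pi> \<sigma> t))) = sum_list (map vertex.outs (verts t))"
    by simp
qed (simp_all add: renumber_def nodes_def)

lemma swap_verts_nth:
  assumes "Suc a < length vs" "b < length vs"
  shows "vs[a := vs ! Suc a, Suc a := vs ! a] ! b = vs ! Transposition.transpose a (Suc a) b"
  using assms by (auto simp: nth_list_update transpose_def)

lemma mset_swap_verts:
  assumes "Suc a < length vs"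
  shows "mset (vs[a := vs ! Suc a, Suc a := vs ! a]) = mset vs"
  using assms mset_swap[of "Suc a" vs a] by simp

lemma is_tree_swap_verts:
  assumes t: "is_tree m n t" and a: "Suc a < length (verts t)"
  shows "is_tree m n (swap_verts a t)"
proof (rule is_tree_map[OF t])
  let ?\<tau> = "Transposition.transpose a (Suc a)"
  let ?vs = "(verts t)[a := verts t ! Suc a, Suc a := verts t ! a]"
  have inj: "?\<tau> b = ?\<tau> c \<Longrightarrow> b = c" for b c by (metis transpose_involutory)
  have "inj (reindex_src ?\<tau>)"
  proof (rule injI)
    fix x y assume "reindex_src ?\<tau> x = reindex_src ?\<tau> y"
    then show "x = y" by (cases x; cases y) (auto dest: inj)
  qed
  then show "inj_on (reindex_src ?\<tau>) (sources n (verts t))" by (rule inj_on_subset) simp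
  have "inj (reindex_tgt ?\<tau>)"
  proof (rule injI)
    fix x y assume "reindex_tgt ?\<tau> x = reindex_tgt ?\<tau> y"
    then show "x = y" by (cases x; cases y) (auto dest: inj)
  qed
  then show "inj_on (reindex_tgt ?\<tau>) (targets m (verts t))" by (rule inj_on_subset) simp
  have img: "?\<tau> ` {..<length (verts t)} = {..<length (verts t)}"
    using a by (intro permutes_image permutes_swap_id) auto
  have reindex: "(\<Union>b<length (verts t). F b) = (\<Union>b<length (verts t). F (?\<tau> b))" for F :: "nat \<Rightarrow> 'x set"
    using img by (metis image_image)
  show "reindex_src ?\<tau> ` sources n (verts t) = sources n (verts (swap_verts a t))"
  proof -
    have "(\<Union>b<length (verts t). Out b ` {1..outs (?vs ! b)})
        = (\<Union>b<length (verts t). Out (?\<tau> b) ` {1..outs (verts t ! b)})"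
      by (subst reindex) (use a img in \<open>auto simp: swap_verts_nth\<close>)
    then show ?thesis
      by (simp add: swap_verts_def sources_def image_Un image_UN image_image)
  qed
  show "reindex_tgt ?\<tau> ` targets m (verts t) = targets m (verts (swap_verts a t))"
  proof -
    have "(\<Union>b<length (verts t). In b ` {1..ins (?vs ! b)})
        = (\<Union>b<length (verts t). In (?\<tau> b) ` {1..ins (verts t ! b)})"
      by (subst reindex) (use a img in \<open>auto simp: swap_verts_nth\<close>)
    then show ?thesis
      by (simp add: swap_verts_def targets_def image_Un image_UN image_image)
  qed
  define \<nu> where "\<nu> u = (case u of LeafN l \<Rightarrow> LeafN l | RootN r \<Rightarrow> RootN r | IntN a \<Rightarrow> IntN (?\<tau> a))" for u
  show "\<nu> (edge_tail s) = edge_tail (reindex_src ?\<tau> s)" for s by (cases s) (simp_all add: \<nu>_def)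
  show "\<nu> (edge_head r) = edge_head (reindex_tgt ?\<tau> r)" for r by (cases r) (simp_all add: \<nu>_def)
  have "(\<lambda>b. IntN (?\<tau> b)) ` {..<length (verts t)} = IntN ` {..<length (verts t)}"
    using img by (metis image_image)
  then show "\<nu> ` nodes m n t = nodes m n (swap_verts a t)"
    by (simp add: nodes_def swap_verts_def image_Un image_image \<nu>_def)
  show "sum_list (map vertex.outs (verts (swap_verts a t))) = sum_list (map vertex.outs (verts t))"
    using mset_swap_verts[OF a] by (metis dtree.sel(1) mset_map sum_mset_sum_list swap_verts_def)
qed (simp_all add: swap_verts_def)

lemma is_tree_corolla: "is_tree (outs v) (ins v) (corolla v)"
proof -
  have "bijrel (sources (ins v) [v]) (targets (outs v) [v]) (edges (corolla v))"
    by (rule bijrelI) (auto simp: sources_def targets_def corolla_def)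
  moreover have "(IntN 0, u) \<in> joined (corolla v)" if u: "u \<in> nodes (outs v) (ins v) (corolla v)" for u
  proof (cases u)
    case (LeafN l)
    then have "(u, IntN 0) \<in> joined (corolla v)"
      using u joined_edge[of "Leaf l" "In 0 l" "corolla v"] by (auto simp: nodes_def corolla_def)
    then show ?thesis by (rule joined_sym)
  next
    case (RootN r)
    then show ?thesis
      using u joined_edge[of "Out 0 r" "Root r" "corolla v"] by (auto simp: nodes_def corolla_def)
  next
    case (IntN a)
    then show ?thesis using u by (auto simp: nodes_def corolla_def joined_def)
  qed
  then have "\<forall>u \<in> nodes (outs v) (ins v) (corolla v). \<forall>w \<in> nodes (outs v) (ins v) (corolla v).
      (u, w) \<in> joined (corolla v)"
    using joined_sym joined_trans by metis
  ultimately show ?thesis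
    unfolding is_tree_iff by (auto simp: corolla_def)
qed

section \<open>Grafting\<close>

lemma UN_lessThan_add:
  "(\<Union>a<k + l. F a) = (\<Union>a<k. F a) \<union> (\<Union>a<(l::nat). F (k + a))"
proof -
  have "{..<k + l} = {..<k} \<union> (\<lambda>a. k + a) ` {..<l}"
  proof (intro equalityI subsetI)
    fix x assume "x \<in> {..<k + l}"
    then show "x \<in> {..<k} \<union> (\<lambda>a. k + a) ` {..<l}"
      by (cases "x < k") (auto intro!: image_eqI[of _ _ "x - k"])
  qed auto
  then show ?thesis by (simp add: UN_Un)
qed

text \<open>Labels below \<open>i\<close> stay, the new labels fill \<open>i\<close> to
  \<open>i + n2 - 1\<close>, and labels above \<open>i\<close> move by \<open>n2 - 1\<close>, that
  is, down by one if \<open>n2 = 0\<close>. The subtractions never truncate since all labels are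
  positive. The same count serves the roots with the two trees exchanged.\<close>

lemma graft_interval:
  fixes i n1 n2 :: nat
  assumes "i \<in> {1..n1}"
  shows "{1..n1 + n2 - 1}
    = (\<lambda>l. if l < i then l else l + n2 - 1) ` ({1..n1} - {i}) \<union> (\<lambda>l. l + i - 1) ` {1..n2}" (is "?L = ?R")
proof (intro equalityI subsetI)
  fix x assume x: "x \<in> ?L"
  consider "x < i" | "i \<le> x" "x < i + n2" | "i + n2 \<le> x" by linarith
  then show "x \<in> ?R"
  proof cases
    case 1
    then have "x \<in> (\<lambda>l. if l < i then l else l + n2 - 1) ` ({1..n1} - {i})"
      using x assms by (intro image_eqI[of _ _ x]) auto
    then show ?thesis ..
  next
    case 2
    then have "x \<in> (\<lambda>l. l + i - 1) ` {1..n2}"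
      using x assms by (intro image_eqI[of _ _ "x + 1 - i"]) auto
    then show ?thesis ..
  next
    case 3
    then have "x \<in> (\<lambda>l. if l < i then l else l + n2 - 1) ` ({1..n1} - {i})"
      using x assms by (intro image_eqI[of _ _ "x + 1 - n2"]) auto
    then show ?thesis ..
  qed
qed (use assms in \<open>auto split: if_splits\<close>)

locale grafting =
  fixes m1 n1 m2 n2 i j :: nat and t1 t2 :: "'e dtree"
  assumes t1: "is_tree m1 n1 t1" and t2: "is_tree m2 n2 t2" and i: "i \<in> {1..n1}" and j: "j \<in> {1..m2}"
begin

abbreviation "t \<equiv> graft m1 n2 i j t1 t2"
abbreviation "k \<equiv> length (verts t1)"

lemma bij1: "bijrel (sources n1 (verts t1)) (targets m1 (verts t1)) (edges t1)"
  and bij2: "bijrel (sources n2 (verts t2)) (targets m2 (verts t2)) (edges t2)"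
  using t1 t2 by (auto simp: is_tree_iff)

lemma sources_graft:
  "sources (n1 + n2 - 1) (verts t) =
    graft_src1 n2 i ` (sources n1 (verts t1) - {Leaf i}) \<union> graft_src2 k i ` sources n2 (verts t2)"
proof -
  let ?O1 = "\<Union>a<k. Out a ` {1..outs (verts t1 ! a)}"
    and ?O2 = "\<Union>a<length (verts t2). Out a ` {1..outs (verts t2 ! a)}"
  have "(\<Union>a<length (verts t). Out a ` {1..outs (verts t ! a)}) =
      graft_src1 n2 i ` ?O1 \<union> graft_src2 k i ` ?O2"
    by (simp add: graft_def Let_def UN_lessThan_add image_UN image_image nth_append)
  moreover have "Leaf ` {1..n1 + n2 - 1} =
      graft_src1 n2 i ` (Leaf ` ({1..n1} - {i})) \<union> graft_src2 k i ` (Leaf ` {1..n2})"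
    by (subst graft_interval[OF i]) (simp only: image_Un image_image graft_src1.simps graft_src2.simps)
  moreover have "sources n1 (verts t1) - {Leaf i} = Leaf ` ({1..n1} - {i}) \<union> ?O1"
    by (auto simp: sources_def)
  ultimately show ?thesis
    by (simp only: sources_def image_Un) blast
qed

lemma targets_graft:
  "targets (m1 + m2 - 1) (verts t) =
    graft_tgt1 j ` targets m1 (verts t1) \<union> graft_tgt2 k m1 j ` (targets m2 (verts t2) - {Root j})"
proof -
  let ?O1 = "\<Union>a<k. In a ` {1..ins (verts t1 ! a)}"
    and ?O2 = "\<Union>a<length (verts t2). In a ` {1..ins (verts t2 ! a)}"
  have "(\<Union>a<length (verts t). In a ` {1..ins (verts t ! a)}) =
      graft_tgt1 j ` ?O1 \<union> graft_tgt2 k m1 j ` ?O2"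
    by (simp add: graft_def Let_def UN_lessThan_add image_UN image_image nth_append)
  moreover have "Root ` {1..m1 + m2 - 1} =
      graft_tgt1 j ` (Root ` {1..m1}) \<union> graft_tgt2 k m1 j ` (Root ` ({1..m2} - {j}))"
    by (subst add.commute, subst graft_interval[OF j])
       (simp only: image_Un image_image graft_tgt1.simps graft_tgt2.simps Un_commute)
  moreover have "targets m2 (verts t2) - {Root j} = Root ` ({1..m2} - {j}) \<union> ?O2"
    by (auto simp: targets_def)
  ultimately show ?thesis
    by (simp only: targets_def image_Un) blast
qed

lemma graft_inj:
  "inj_on (graft_src1 n2 i) (sources n1 (verts t1) - {Leaf i})"
  "inj_on (graft_src2 k i) (sources n2 (verts t2))"
  "inj_on (graft_tgt1 j) (targets m1 (verts t1))"
  "inj_on (graft_tgt2 k m1 j) (targets m2 (verts t2) - {Root j})"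
proof -
  show "inj_on (graft_src1 n2 i) (sources n1 (verts t1) - {Leaf i})"
  proof (rule inj_onI)
    fix x y assume "x \<in> sources n1 (verts t1) - {Leaf i}" "y \<in> sources n1 (verts t1) - {Leaf i}"
      "graft_src1 n2 i x = graft_src1 n2 i y"
    then show "x = y" using i by (cases x; cases y) (auto simp: sources_def split: if_splits)
  qed
  show "inj_on (graft_src2 k i) (sources n2 (verts t2))"
  proof (rule inj_onI)
    fix x y assume "x \<in> sources n2 (verts t2)" "y \<in> sources n2 (verts t2)"
      "graft_src2 k i x = graft_src2 k i y"
    then show "x = y" using i by (cases x; cases y) (auto simp: sources_def split: if_splits)
  qed
  show "inj_on (graft_tgt1 j) (targets m1 (verts t1))"
  proof (rule inj_onI)
    fix x y assume "x \<in> targets m1 (verts t1)" "y \<in> targets m1 (verts t1)"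
      "graft_tgt1 j x = graft_tgt1 j y"
    then show "x = y" using j by (cases x; cases y) (auto simp: targets_def split: if_splits)
  qed
  show "inj_on (graft_tgt2 k m1 j) (targets m2 (verts t2) - {Root j})"
  proof (rule inj_onI)
    fix x y assume "x \<in> targets m2 (verts t2) - {Root j}" "y \<in> targets m2 (verts t2) - {Root j}"
      "graft_tgt2 k m1 j x = graft_tgt2 k m1 j y"
    then show "x = y" using j by (cases x; cases y) (auto simp: targets_def split: if_splits)
  qed
qed

lemma graft_disjoint:
  "graft_src1 n2 i ` (sources n1 (verts t1) - {Leaf i}) \<inter> graft_src2 k i ` sources n2 (verts t2) = {}"
  "graft_tgt1 j ` targets m1 (verts t1) \<inter> graft_tgt2 k m1 j ` (targets m2 (verts t2) - {Root j}) = {}"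
  using i j by (auto simp: sources_def targets_def split: if_splits)

text \<open>The edge starting at leaf \<open>i\<close> and the edge ending at root \<open>j\<close>
  are fused into one; all others are copied. Incidence is assembled from the two trees with these
  edges removed, plus the fused edge.\<close>

lemma is_tree_graft: "is_tree (m1 + m2 - 1) (n1 + n2 - 1) t"
proof -
  have "Leaf i \<in> sources n1 (verts t1)" "Root j \<in> targets m2 (verts t2)"
    using i j by (auto simp: sources_def targets_def)
  then obtain s0 r0 where r0: "(Leaf i, r0) \<in> edges t1" and s0: "(s0, Root j) \<in> edges t2"
    using bijrelD(3)[OF bij1] bijrelD(4)[OF bij2] by blast
  have r0': "r0 \<in> targets m1 (verts t1)" and s0': "s0 \<in> sources n2 (verts t2)"
    using r0 s0 bijrelD(2)[OF bij1] bijrelD(1)[OF bij2] by blast+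
  let ?f1 = "graft_src1 n2 i" and ?f2 = "graft_src2 k i"
    and ?g1 = "graft_tgt1 j" and ?g2 = "graft_tgt2 k m1 j"
  let ?E1 = "(\<lambda>(s, r). (?f1 s, ?g1 r)) ` (edges t1 - {(Leaf i, r0)})"
    and ?E2 = "(\<lambda>(s, r). (?f2 s, ?g2 r)) ` (edges t2 - {(s0, Root j)})"
  have edges: "edges t = ?E1 \<union> ?E2 \<union> {(?f2 s0, ?g1 r0)}"
  proof -
    have "{(?f1 s, ?g1 r) | s r. (s, r) \<in> edges t1 \<and> s \<noteq> Leaf i} = ?E1"
      using bijrelD(5)[OF bij1] r0 by (force simp: image_iff)
    moreover have "{(?f2 s, ?g2 r) | s r. (s, r) \<in> edges t2 \<and> r \<noteq> Root j} = ?E2"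
      using bijrelD(6)[OF bij2] s0 by (force simp: image_iff)
    moreover have "{(?f2 s, ?g1 r) | s r. (s, Root j) \<in> edges t2 \<and> (Leaf i, r) \<in> edges t1} = {(?f2 s0, ?g1 r0)}"
      using bijrelD(5)[OF bij1] bijrelD(6)[OF bij2] s0 r0 by blast
    ultimately show ?thesis by (simp add: graft_def Let_def)
  qed
  have "bijrel (sources (n1 + n2 - 1) (verts t)) (targets (m1 + m2 - 1) (verts t)) (edges t)"
  proof -
    let ?S1 = "sources n1 (verts t1) - {Leaf i}" and ?T1 = "targets m1 (verts t1)"
      and ?S2 = "sources n2 (verts t2)" and ?T2 = "targets m2 (verts t2) - {Root j}"
    have "bijrel (?f1 ` ?S1) (?g1 ` (?T1 - {r0})) ?E1"
      using graft_inj by (intro bijrel_image bijrel_remove bij1 r0) (auto elim: inj_on_subset)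
    moreover have "bijrel (?f2 ` (?S2 - {s0})) (?g2 ` ?T2) ?E2"
      using graft_inj by (intro bijrel_image bijrel_remove bij2 s0) (auto elim: inj_on_subset)
    ultimately have "bijrel (?f1 ` ?S1 \<union> ?f2 ` (?S2 - {s0})) (?g1 ` (?T1 - {r0}) \<union> ?g2 ` ?T2) (?E1 \<union> ?E2)"
      by (rule bijrel_union) (use graft_disjoint in blast)+
    then have "bijrel (?f1 ` ?S1 \<union> ?f2 ` (?S2 - {s0}) \<union> {?f2 s0}) (?g1 ` (?T1 - {r0}) \<union> ?g2 ` ?T2 \<union> {?g1 r0})
        (?E1 \<union> ?E2 \<union> {(?f2 s0, ?g1 r0)})"
    proof (rule bijrel_union[OF _ bijrel_single])
      show "(?f1 ` ?S1 \<union> ?f2 ` (?S2 - {s0})) \<inter> {?f2 s0} = {}"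
        using graft_disjoint(1) s0' inj_onD[OF graft_inj(2)] by blast
      show "(?g1 ` (?T1 - {r0}) \<union> ?g2 ` ?T2) \<inter> {?g1 r0} = {}"
        using graft_disjoint(2) r0' inj_onD[OF graft_inj(3)] by blast
    qed
    moreover have "?f1 ` ?S1 \<union> ?f2 ` (?S2 - {s0}) \<union> {?f2 s0} = sources (n1 + n2 - 1) (verts t)"
      unfolding sources_graft using s0' by blast
    moreover have "?g1 ` (?T1 - {r0}) \<union> ?g2 ` ?T2 \<union> {?g1 r0} = targets (m1 + m2 - 1) (verts t)"
      unfolding targets_graft using r0' by blast
    ultimately show ?thesis by (simp add: edges)
  qed
  moreover have "(u, v) \<in> joined t"
    if uv: "u \<in> nodes (m1 + m2 - 1) (n1 + n2 - 1) t" "v \<in> nodes (m1 + m2 - 1) (n1 + n2 - 1) t" for u v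
  proof -
    \<comment> \<open>The vanishing leaf \<open>i\<close> is sent to the tail of the fused edge, and
      \<nu>2 sends the vanishing root \<open>j\<close> to its head, so that every edge of either
      tree maps to an edge of the graft.\<close>
    define \<nu>1 where "\<nu>1 u = (case u of LeafN l \<Rightarrow> if l = i then edge_tail (?f2 s0) else edge_tail (?f1 (Leaf l))
      | RootN r \<Rightarrow> edge_head (?g1 (Root r)) | IntN a \<Rightarrow> IntN a)" for u
    define \<nu>2 where "\<nu>2 u = (case u of LeafN l \<Rightarrow> edge_tail (?f2 (Leaf l))
      | RootN r \<Rightarrow> if r = j then edge_head (?g1 r0) else edge_head (?g2 (Root r)) | IntN a \<Rightarrow> IntN (k + a))" for u
    have \<nu>1: "\<nu>1 (edge_tail s) = (if s = Leaf i then edge_tail (?f2 s0) else edge_tail (?f1 s))"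
      "\<nu>1 (edge_head r) = edge_head (?g1 r)" for s r
      by (cases s; cases r; simp add: \<nu>1_def)+
    have \<nu>2: "\<nu>2 (edge_tail s) = edge_tail (?f2 s)"
      "\<nu>2 (edge_head r) = (if r = Root j then edge_head (?g1 r0) else edge_head (?g2 r))" for s r
      by (cases s; cases r; simp add: \<nu>2_def)+
    \<comment> \<open>The tail of the fused edge is an image of nodes of both trees; every node of
      the graft is shown to be joined to it.\<close>
    let ?z = "\<nu>1 (LeafN i)"
    have z: "?z = \<nu>2 (edge_tail s0)" by (simp add: \<nu>2) (simp add: \<nu>1_def)
    have e1: "(\<nu>1 (edge_tail s), \<nu>1 (edge_head r)) \<in> joined t" if "(s, r) \<in> edges t1" for s r
    proof (cases "s = Leaf i")
      case True
      then have "r = r0" using that r0 bijrelD(5)[OF bij1] by blast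
      then show ?thesis using True unfolding \<nu>1 by (auto simp: edges intro!: joined_edge)
    next
      case False
      then show ?thesis unfolding \<nu>1 using that by (auto simp: edges intro!: joined_edge)
    qed
    have e2: "(\<nu>2 (edge_tail s), \<nu>2 (edge_head r)) \<in> joined t" if "(s, r) \<in> edges t2" for s r
    proof (cases "r = Root j")
      case True
      then have "s = s0" using that s0 bijrelD(6)[OF bij2] by blast
      then show ?thesis using True unfolding \<nu>2 by (auto simp: edges intro!: joined_edge)
    next
      case False
      then show ?thesis unfolding \<nu>2 using that by (auto simp: edges intro!: joined_edge)
    qed
    have j1: "(\<nu>1 u, ?z) \<in> joined t" if "u \<in> nodes m1 n1 t1" for u
      using e1 by (rule joined_map) (use t1 that i in \<open>auto simp: is_tree_iff nodes_def\<close>)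
    have j2: "(\<nu>2 u, ?z) \<in> joined t" if "u \<in> nodes m2 n2 t2" for u
      unfolding z
      using e2 by (rule joined_map) (use t2 that tail_in_nodes[OF s0'] in \<open>auto simp: is_tree_iff\<close>)
    have "(u, ?z) \<in> joined t" if u: "u \<in> nodes (m1 + m2 - 1) (n1 + n2 - 1) t" for u
    proof -
      consider s where "s \<in> sources (n1 + n2 - 1) (verts t)" "u = edge_tail s"
        | r where "r \<in> targets (m1 + m2 - 1) (verts t)" "u = edge_head r"
        | a where "a < k + length (verts t2)" "u = IntN a"
      proof (cases u)
        case (LeafN l)
        then have "Leaf l \<in> sources (n1 + n2 - 1) (verts t)" using u by (auto simp: nodes_def sources_def)
        then show ?thesis using that(1)[of "Leaf l"] LeafN by simp
      next
        case (RootN r)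
        then have "Root r \<in> targets (m1 + m2 - 1) (verts t)" using u by (auto simp: nodes_def targets_def)
        then show ?thesis using that(2)[of "Root r"] RootN by simp
      next
        case (IntN a)
        then show ?thesis using that(3)[of a] u by (auto simp: nodes_def graft_def Let_def)
      qed
      then show ?thesis
      proof cases
        case 1
        then consider s' where "s' \<in> sources n1 (verts t1) - {Leaf i}" "s = ?f1 s'"
          | s' where "s' \<in> sources n2 (verts t2)" "s = ?f2 s'"
          unfolding sources_graft by blast
        then show ?thesis
        proof cases
          case (1 s')
          then show ?thesis using j1[OF tail_in_nodes, of s'] \<open>u = edge_tail s\<close> by (simp add: \<nu>1)
        next
          case (2 s')
          then show ?thesis using j2[OF tail_in_nodes, of s'] \<open>u = edge_tail s\<close> by (simp add: \<nu>2)
        qed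
      next
        case 2
        then consider r' where "r' \<in> targets m1 (verts t1)" "r = ?g1 r'"
          | r' where "r' \<in> targets m2 (verts t2) - {Root j}" "r = ?g2 r'"
          unfolding targets_graft by blast
        then show ?thesis
        proof cases
          case (1 r')
          then show ?thesis using j1[OF head_in_nodes, of r'] \<open>u = edge_head r\<close> by (simp add: \<nu>1)
        next
          case (2 r')
          then show ?thesis using j2[OF head_in_nodes, of r'] \<open>u = edge_head r\<close> by (simp add: \<nu>2)
        qed
      next
        case 3
        show ?thesis
        proof (cases "a < k")
          case True
          then show ?thesis using j1[of "IntN a"] 3 by (simp add: nodes_def \<nu>1_def)
        next
          case False
          then show ?thesis using j2[of "IntN (a - k)"] 3 by (simp add: nodes_def \<nu>2_def)
        qed
      qed
    qed
    then show ?thesis using uv joined_sym joined_trans by metis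
  qed
  moreover have "m1 + m2 - 1 + length (verts t) = sum_list (map vertex.outs (verts t)) + 1"
    using t1 t2 j by (auto simp: is_tree_iff graft_def Let_def)
  ultimately show ?thesis unfolding is_tree_iff by blast
qed

end

section \<open>The free dioperad\<close>

lemma dtreesI:
  assumes "is_tree m n t" "verts t \<noteq> []" "(m, n) \<in> J0"
    "\<And>v. v \<in> set (verts t) \<Longrightarrow> (outs v, ins v) \<in> J0 \<and> dec v \<in> carrier (sp E (vidx v))"
    "sum_list (map vdeg (verts t)) = i"
  shows "t \<in> dtrees E (m, n, i)"
  using assms by (simp add: dtrees.simps is_tree0_def)

lemma dtreesD:
  assumes "t \<in> dtrees E (m, n, i)"
  shows "is_tree m n t" "verts t \<noteq> []" "(m, n) \<in> J0"
    "v \<in> set (verts t) \<Longrightarrow> (outs v, ins v) \<in> J0" "v \<in> set (verts t) \<Longrightarrow> dec v \<in> carrier (sp E (vidx v))"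
    "sum_list (map vdeg (verts t)) = i"
  using assms by (simp_all add: dtrees.simps is_tree0_def)

lemma dtrees_idx: "t \<in> dtrees E \<tau> \<Longrightarrow> \<exists>m n i. \<tau> = (m, n, i) \<and> (m, n) \<in> J0"
  using dtreesD(3)[of t E] by (cases \<tau>) blast

declare dtrees.simps [simp del]

lemma set_dec_simps [simp]:
  "edges (set_dec a x t) = edges t" "length (verts (set_dec a x t)) = length (verts t)"
  "verts (set_dec a x t) = (verts t)[a := map_vertex (\<lambda>_. x) (verts t ! a)]"
  by (simp_all add: set_dec_def)

lemma relabel_simps [simp]:
  "verts (relabel \<pi> \<sigma> t) = verts t"
  "edges (relabel \<pi> \<sigma> t) = map_edges (relabel_src \<sigma>) (relabel_tgt \<pi>) t"
  by (simp_all add: relabel_def)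

lemma renumber_simps [simp]:
  "verts (renumber E a \<pi> \<sigma> t) = (verts t)[a := map_vertex (act E (vidx (verts t ! a)) \<pi> \<sigma>) (verts t ! a)]"
  "edges (renumber E a \<pi> \<sigma> t) = map_edges (renumber_src a \<pi>) (renumber_tgt a \<sigma>) t"
  by (simp_all add: renumber_def)

lemma swap_verts_simps [simp]:
  "verts (swap_verts a t) = (verts t)[a := verts t ! Suc a, Suc a := verts t ! a]"
  "edges (swap_verts a t) = map_edges (reindex_src (Transposition.transpose a (Suc a)))
    (reindex_tgt (Transposition.transpose a (Suc a))) t"
  by (simp_all add: swap_verts_def)

lemma graft_verts [simp]: "verts (graft m1 n2 i j t1 t2) = verts t1 @ verts t2"
  by (simp add: graft_def Let_def)

lemma edges_graft: "edges (graft m1 n2 i j t1 t2) =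
    {(graft_src1 n2 i s, graft_tgt1 j r) | s r. (s, r) \<in> edges t1 \<and> s \<noteq> Leaf i} \<union>
    {(graft_src2 (length (verts t1)) i s, graft_tgt2 (length (verts t1)) m1 j r) | s r. (s, r) \<in> edges t2 \<and> r \<noteq> Root j} \<union>
    {(graft_src2 (length (verts t1)) i s, graft_tgt1 j r) | s r. (s, Root j) \<in> edges t2 \<and> (Leaf i, r) \<in> edges t1}"
  by (simp add: graft_def Let_def)

section \<open>Compatibility of grafting and relabelling with the operations on trees\<close>

lemma map_edges_comp:
  assumes "edges t = map_edges f g t'"
  shows "map_edges h k t = map_edges (h \<circ> f) (k \<circ> g) t'"
  using assms by (simp add: map_edges_def image_image case_prod_beta)

lemma image_pairs:
  assumes "\<And>s r. (s, r) \<in> A \<Longrightarrow> h (f s) = f (h1 s) \<and> k (g r) = g (k1 r) \<and> (C (h1 s) (k1 r) \<longleftrightarrow> C s r)"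
  shows "{(f s, g r) | s r. (s, r) \<in> (\<lambda>(s, r). (h1 s, k1 r)) ` A \<and> C s r}
    = (\<lambda>(s, r). (h s, k r)) ` {(f s, g r) | s r. (s, r) \<in> A \<and> C s r}" (is "?L = ?R")
proof (intro equalityI subsetI)
  fix x assume "x \<in> ?L"
  then obtain s r where "x = (f (h1 s), g (k1 r))" "(s, r) \<in> A" "C (h1 s) (k1 r)" by auto
  then have "(f s, g r) \<in> {(f s, g r) | s r. (s, r) \<in> A \<and> C s r}" "x = (h (f s), k (g r))"
    using assms[of s r] by auto
  then show "x \<in> ?R" by (intro image_eqI[of _ _ "(f s, g r)"]) auto
next
  fix x assume "x \<in> ?R"
  then obtain s r where "x = (h (f s), k (g r))" "(s, r) \<in> A" "C s r" by auto
  then have "x = (f (h1 s), g (k1 r))" "(h1 s, k1 r) \<in> (\<lambda>(s, r). (h1 s, k1 r)) ` A" "C (h1 s) (k1 r)"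
    using assms[of s r] by auto
  then show "x \<in> ?L" by blast
qed

text \<open>All operations act on edges by mapping their ends, so compatibility with grafting
  reduces to identities for single ends. \<open>fx\<close> ensures that the two ends being fused are
  neither moved nor hit by another end.\<close>

lemma graft_map:
  assumes E: "edges t1' = map_edges h1 k1 t1" "edges t2' = map_edges h2 k2 t2"
    and len: "length (verts t1') = length (verts t1)"
    and fx: "\<And>s. h1 s = Leaf i \<longleftrightarrow> s = Leaf i" "\<And>r. k2 r = Root j \<longleftrightarrow> r = Root j"
    and 1: "\<And>s r. (s, r) \<in> edges t1 \<Longrightarrow> h (graft_src1 n2 i s) = graft_src1 n2 i (h1 s)
      \<and> k (graft_tgt1 j r) = graft_tgt1 j (k1 r)"
    and 2: "\<And>s r. (s, r) \<in> edges t2 \<Longrightarrow> h (graft_src2 (length (verts t1)) i s) = graft_src2 (length (verts t1)) i (h2 s)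
      \<and> k (graft_tgt2 (length (verts t1)) m1 j r) = graft_tgt2 (length (verts t1)) m1 j (k2 r)"
  shows "edges (graft m1 n2 i j t1' t2') = map_edges h k (graft m1 n2 i j t1 t2)"
proof -
  let ?l = "length (verts t1)"
  have A: "{(graft_src1 n2 i s, graft_tgt1 j r) | s r. (s, r) \<in> edges t1' \<and> s \<noteq> Leaf i}
      = (\<lambda>(s, r). (h s, k r)) ` {(graft_src1 n2 i s, graft_tgt1 j r) | s r. (s, r) \<in> edges t1 \<and> s \<noteq> Leaf i}"
    unfolding E map_edges_def by (rule image_pairs) (use 1 fx(1) in auto)
  have B: "{(graft_src2 ?l i s, graft_tgt2 ?l m1 j r) | s r. (s, r) \<in> edges t2' \<and> r \<noteq> Root j}
      = (\<lambda>(s, r). (h s, k r)) ` {(graft_src2 ?l i s, graft_tgt2 ?l m1 j r) | s r. (s, r) \<in> edges t2 \<and> r \<noteq> Root j}"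
    unfolding E map_edges_def by (rule image_pairs) (use 2 fx(2) in auto)
  have *: "(s, Root j) \<in> edges t2' \<longleftrightarrow> (\<exists>s'. s = h2 s' \<and> (s', Root j) \<in> edges t2)" for s
    using fx(2) unfolding E map_edges_def by (force simp: image_iff)
  have **: "(Leaf i, r) \<in> edges t1' \<longleftrightarrow> (\<exists>r'. r = k1 r' \<and> (Leaf i, r') \<in> edges t1)" for r
    using fx(1) unfolding E map_edges_def by (force simp: image_iff)
  have C: "{(graft_src2 ?l i s, graft_tgt1 j r) | s r. (s, Root j) \<in> edges t2' \<and> (Leaf i, r) \<in> edges t1'}
      = (\<lambda>(s, r). (h s, k r)) ` {(graft_src2 ?l i s, graft_tgt1 j r) | s r. (s, Root j) \<in> edges t2 \<and> (Leaf i, r) \<in> edges t1}"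
(is "?L = ?R")
  proof (intro equalityI subsetI)
    fix x assume "x \<in> ?L"
    then obtain s r where x: "x = (graft_src2 ?l i (h2 s), graft_tgt1 j (k1 r))"
      and sr: "(s, Root j) \<in> edges t2" "(Leaf i, r) \<in> edges t1"
      using * ** by auto
    then have "x = (h (graft_src2 ?l i s), k (graft_tgt1 j r))" using 1 2 by metis
    then show "x \<in> ?R" using sr by (intro image_eqI[of _ _ "(graft_src2 ?l i s, graft_tgt1 j r)"]) auto
  next
    fix x assume "x \<in> ?R"
    then obtain s r where x: "x = (h (graft_src2 ?l i s), k (graft_tgt1 j r))"
      and sr: "(s, Root j) \<in> edges t2" "(Leaf i, r) \<in> edges t1" by auto
    then have "x = (graft_src2 ?l i (h2 s), graft_tgt1 j (k1 r))" using 1 2 by metis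
    then show "x \<in> ?L" using sr * ** by blast
  qed
  show ?thesis
    unfolding edges_graft len A B C map_edges_def by (simp add: image_Un)
qed

lemma dtree_eqI: "verts t = verts t' \<Longrightarrow> edges t = edges t' \<Longrightarrow> t = t'"
  by (cases t; cases t') simp

lemma map_edges_id: "map_edges id id t = edges t"
  by (simp add: map_edges_def)

lemma edge_bounds:
  assumes "is_tree m n t" "(s, r) \<in> edges t"
  shows "s = Out b p \<Longrightarrow> b < length (verts t)" "r = In c q \<Longrightarrow> c < length (verts t)"
proof -
  have "s \<in> sources n (verts t)" "r \<in> targets m (verts t)"
    using assms by (auto simp: is_tree_def)
  then show "s = Out b p \<Longrightarrow> b < length (verts t)" "r = In c q \<Longrightarrow> c < length (verts t)"
    by (auto simp: sources_def targets_def)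
qed

lemma graft_set_dec1:
  "a < length (verts t) \<Longrightarrow> graft m1 n2 i j (set_dec a x t) s = set_dec a x (graft m1 n2 i j t s)"
  by (rule dtree_eqI) (simp_all add: edges_graft list_update_append nth_append)

lemma graft_set_dec2:
  "graft m1 n2 i j s (set_dec a x t) = set_dec (length (verts s) + a) x (graft m1 n2 i j s t)"
  by (rule dtree_eqI) (simp_all add: edges_graft list_update_append nth_append)

lemma graft_renumber1:
  assumes "a < length (verts t)"
  shows "graft m1 n2 i j (renumber E a \<pi> \<sigma> t) s = renumber E a \<pi> \<sigma> (graft m1 n2 i j t s)"
proof (rule dtree_eqI)
  show "verts (graft m1 n2 i j (renumber E a \<pi> \<sigma> t) s) = verts (renumber E a \<pi> \<sigma> (graft m1 n2 i j t s))"
    using assms by (simp add: list_update_append nth_append)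
  have "renumber_src a \<pi> s = Leaf i \<longleftrightarrow> s = Leaf i" for s by (cases s) auto
  moreover have "renumber_src a \<pi> (graft_src1 n2 i s) = graft_src1 n2 i (renumber_src a \<pi> s)"
    "renumber_src a \<pi> (graft_src2 (length (verts t)) i s) = graft_src2 (length (verts t)) i s" for s
    using assms by (cases s; simp)+
  moreover have "renumber_tgt a \<sigma> (graft_tgt1 j r) = graft_tgt1 j (renumber_tgt a \<sigma> r)"
    "renumber_tgt a \<sigma> (graft_tgt2 (length (verts t)) m1 j r) = graft_tgt2 (length (verts t)) m1 j r" for r
    using assms by (cases r; simp)+
  ultimately show "edges (graft m1 n2 i j (renumber E a \<pi> \<sigma> t) s) = edges (renumber E a \<pi> \<sigma> (graft m1 n2 i j t s))"
    by (simp only: renumber_simps)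
       (rule graft_map[OF renumber_simps(2) map_edges_id[symmetric]]; simp)
qed

text \<open>Being a tree, \<open>s\<close> has edges only at vertices below
  \<open>length (verts s)\<close>, so renumbering at the shifted vertex leaves them alone.\<close>

lemma graft_renumber2:
  assumes "is_tree m n s"
  shows "graft m1 n2 i j s (renumber E a \<pi> \<sigma> t)
    = renumber E (length (verts s) + a) \<pi> \<sigma> (graft m1 n2 i j s t)"
proof (rule dtree_eqI)
  let ?a = "length (verts s) + a"
  show "verts (graft m1 n2 i j s (renumber E a \<pi> \<sigma> t)) = verts (renumber E ?a \<pi> \<sigma> (graft m1 n2 i j s t))"
    by (simp add: list_update_append nth_append)
  have "renumber_tgt a \<sigma> r = Root j \<longleftrightarrow> r = Root j" for r by (cases r) auto
  moreover have "renumber_src ?a \<pi> (graft_src2 (length (verts s)) i u) = graft_src2 (length (verts s)) i (renumber_src a \<pi> u)"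
    "renumber_tgt ?a \<sigma> (graft_tgt2 (length (verts s)) m1 j r) = graft_tgt2 (length (verts s)) m1 j (renumber_tgt a \<sigma> r)" for u r
    by (cases u; simp) (cases r; simp)
  moreover have "renumber_src ?a \<pi> (graft_src1 n2 i u) = graft_src1 n2 i u" if "(u, r) \<in> edges s" for u r
  proof (cases u)
    case (Out b p)
    then show ?thesis using edge_bounds(1)[OF assms that, of b p] by auto
  qed simp
  moreover have "renumber_tgt ?a \<sigma> (graft_tgt1 j r) = graft_tgt1 j r" if "(u, r) \<in> edges s" for u r
  proof (cases r)
    case (In b q)
    then show ?thesis using edge_bounds(2)[OF assms that, of b q] by auto
  qed simp
  ultimately show "edges (graft m1 n2 i j s (renumber E a \<pi> \<sigma> t)) = edges (renumber E ?a \<pi> \<sigma> (graft m1 n2 i j s t))"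
    by (simp only: renumber_simps)
       (rule graft_map[OF map_edges_id[symmetric] renumber_simps(2)]; simp)
qed

lemma transpose_Suc: "Transposition.transpose (l + a) (Suc (l + a)) (l + b) = l + Transposition.transpose a (Suc a) b"
  by (auto simp: transpose_def)

lemma graft_swap_verts1:
  assumes "Suc a < length (verts t)"
  shows "graft m1 n2 i j (swap_verts a t) s = swap_verts a (graft m1 n2 i j t s)"
proof (rule dtree_eqI)
  let ?\<tau> = "Transposition.transpose a (Suc a)"
  show "verts (graft m1 n2 i j (swap_verts a t) s) = verts (swap_verts a (graft m1 n2 i j t s))"
    using assms by (simp add: list_update_append nth_append)
  have "reindex_src ?\<tau> s = Leaf i \<longleftrightarrow> s = Leaf i" for s by (cases s) auto
  moreover have "reindex_src ?\<tau> (graft_src1 n2 i s) = graft_src1 n2 i (reindex_src ?\<tau> s)"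
    "reindex_src ?\<tau> (graft_src2 (length (verts t)) i s) = graft_src2 (length (verts t)) i s" for s
    using assms by (cases s; simp)+
  moreover have "reindex_tgt ?\<tau> (graft_tgt1 j r) = graft_tgt1 j (reindex_tgt ?\<tau> r)"
    "reindex_tgt ?\<tau> (graft_tgt2 (length (verts t)) m1 j r) = graft_tgt2 (length (verts t)) m1 j r" for r
    using assms by (cases r; simp)+
  ultimately show "edges (graft m1 n2 i j (swap_verts a t) s) = edges (swap_verts a (graft m1 n2 i j t s))"
    by (simp only: swap_verts_simps)
       (rule graft_map[OF swap_verts_simps(2) map_edges_id[symmetric]]; simp)
qed

lemma graft_swap_verts2:
  assumes "is_tree m n s"
  shows "graft m1 n2 i j s (swap_verts a t) = swap_verts (length (verts s) + a) (graft m1 n2 i j s t)"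
proof (rule dtree_eqI)
  let ?a = "length (verts s) + a"
  let ?\<tau> = "Transposition.transpose a (Suc a)" and ?\<tau>' = "Transposition.transpose ?a (Suc ?a)"
  show "verts (graft m1 n2 i j s (swap_verts a t)) = verts (swap_verts ?a (graft m1 n2 i j s t))"
    by (simp add: list_update_append nth_append)
  have "reindex_tgt ?\<tau> r = Root j \<longleftrightarrow> r = Root j" for r by (cases r) auto
  moreover have "reindex_src ?\<tau>' (graft_src2 (length (verts s)) i u) = graft_src2 (length (verts s)) i (reindex_src ?\<tau> u)"
    "reindex_tgt ?\<tau>' (graft_tgt2 (length (verts s)) m1 j r) = graft_tgt2 (length (verts s)) m1 j (reindex_tgt ?\<tau> r)" for u r
    by (cases u; simp add: transpose_Suc) (cases r; simp add: transpose_Suc)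
  moreover have "reindex_src ?\<tau>' (graft_src1 n2 i u) = graft_src1 n2 i u" if "(u, r) \<in> edges s" for u r
  proof (cases u)
    case (Out b p)
    then show ?thesis using edge_bounds(1)[OF assms that, of b p] by auto
  qed simp
  moreover have "reindex_tgt ?\<tau>' (graft_tgt1 j r) = graft_tgt1 j r" if "(u, r) \<in> edges s" for u r
  proof (cases r)
    case (In b q)
    then show ?thesis using edge_bounds(2)[OF assms that, of b q] by auto
  qed simp
  ultimately show "edges (graft m1 n2 i j s (swap_verts a t)) = edges (swap_verts ?a (graft m1 n2 i j s t))"
    by (simp only: swap_verts_simps)
       (rule graft_map[OF map_edges_id[symmetric] swap_verts_simps(2)]; simp)
qed

lemma relabel_set_dec: "relabel \<pi> \<sigma> (set_dec a x t) = set_dec a x (relabel \<pi> \<sigma> t)"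
  by (rule dtree_eqI) (simp_all add: map_edges_def)

text \<open>Relabelling moves only leaves and roots, renumbering only ends at internal vertices, so
  the two commute end by end.\<close>

lemma relabel_renumber: "relabel \<pi> \<sigma> (renumber E a \<rho> \<rho>' t) = renumber E a \<rho> \<rho>' (relabel \<pi> \<sigma> t)"
proof (rule dtree_eqI)
  have "relabel_src \<sigma> \<circ> renumber_src a \<rho> = renumber_src a \<rho> \<circ> relabel_src \<sigma>"
    "relabel_tgt \<pi> \<circ> renumber_tgt a \<rho>' = renumber_tgt a \<rho>' \<circ> relabel_tgt \<pi>"
    by (rule ext, case_tac x; simp)+
  then show "edges (relabel \<pi> \<sigma> (renumber E a \<rho> \<rho>' t)) = edges (renumber E a \<rho> \<rho>' (relabel \<pi> \<sigma> t))"
    by (simp add: map_edges_comp[OF renumber_simps(2)] map_edges_comp[OF relabel_simps(2)])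
qed simp

lemma relabel_swap_verts: "relabel \<pi> \<sigma> (swap_verts a t) = swap_verts a (relabel \<pi> \<sigma> t)"
proof (rule dtree_eqI)
  let ?\<tau> = "Transposition.transpose a (Suc a)"
  have "relabel_src \<sigma> \<circ> reindex_src ?\<tau> = reindex_src ?\<tau> \<circ> relabel_src \<sigma>"
    "relabel_tgt \<pi> \<circ> reindex_tgt ?\<tau> = reindex_tgt ?\<tau> \<circ> relabel_tgt \<pi>"
    by (rule ext, case_tac x; simp)+
  then show "edges (relabel \<pi> \<sigma> (swap_verts a t)) = edges (swap_verts a (relabel \<pi> \<sigma> t))"
    by (simp add: map_edges_comp[OF swap_verts_simps(2)] map_edges_comp[OF relabel_simps(2)])
qed simp

section \<open>Decorated trees and stability of the tree relators\<close>

lemma dtrees_relabel: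
  assumes "t \<in> dtrees E (m, n, i)" "\<pi> permutes {1..m}" "\<sigma> permutes {1..n}"
  shows "relabel \<pi> \<sigma> t \<in> dtrees E (m, n, i)"
  using dtreesD[OF assms(1)] by (intro dtreesI is_tree_relabel assms) auto

lemma dtrees_swap_verts:
  assumes "t \<in> dtrees E (m, n, i)" "Suc a < length (verts t)"
  shows "swap_verts a t \<in> dtrees E (m, n, i)"
proof -
  \<comment> \<open>Decorations and total degree depend on the vertices only as a multiset, which
    the exchange preserves.\<close>
  have m: "mset (verts (swap_verts a t)) = mset (verts t)"
    using mset_swap_verts[OF assms(2)] by simp
  have *: "set (verts (swap_verts a t)) = set (verts t)"
    using mset_eq_setD[OF m] .
  have **: "sum_list (map vdeg (verts (swap_verts a t))) = sum_list (map vdeg (verts t))"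
    using m by (metis mset_map sum_mset_sum_list)
  show ?thesis
    using dtreesD[OF assms(1)] * ** mset_eq_setD[OF m] m
    by (intro dtreesI is_tree_swap_verts assms) (auto simp del: swap_verts_simps)
qed

lemma dtrees_graft:
  assumes t: "t \<in> dtrees E (m1, n1, p)" and s: "s \<in> dtrees E (m2, n2, q)" and ij: "i \<in> {1..n1}" "j \<in> {1..m2}"
  shows "graft m1 n2 i j t s \<in> dtrees E (m1 + m2 - 1, n1 + n2 - 1, p + q)"
proof -
  interpret grafting m1 n1 m2 n2 i j t s
    by unfold_locales (use ij dtreesD(1)[OF t] dtreesD(1)[OF s] in auto)
  show ?thesis
    using dtreesD[OF t] dtreesD[OF s] ij by (intro dtreesI is_tree_graft J0_plug) auto
qed

locale graded_bimodule =
  fixes E :: "('k::field_char_0, 'e) bimodule"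
  assumes sp_module: "(m, n) \<in> J0 \<Longrightarrow> module ground (sp E (m, n, i))"
    and act_closed: "\<lbrakk>(m, n) \<in> J0; \<pi> permutes {1..m}; \<sigma> permutes {1..n}; x \<in> carrier (sp E (m, n, i))\<rbrakk>
      \<Longrightarrow> act E (m, n, i) \<pi> \<sigma> x \<in> carrier (sp E (m, n, i))"
begin

lemma map_vdeg_update: "a < length vs \<Longrightarrow> map vdeg (vs[a := map_vertex f (vs ! a)]) = map vdeg vs"
  by (rule nth_equalityI) (auto simp: nth_list_update vertex.map_sel)

lemma dtrees_update:
  assumes t: "t \<in> dtrees E (m, n, i)" and a: "a < length (verts t)"
    and x: "f (dec (verts t ! a)) \<in> carrier (sp E (vidx (verts t ! a)))"
    and tree: "is_tree m n t'" and vs: "verts t' = (verts t)[a := map_vertex f (verts t ! a)]"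
  shows "t' \<in> dtrees E (m, n, i)"
proof (rule dtreesI[OF tree])
  fix v assume "v \<in> set (verts t')"
  then consider "v = map_vertex f (verts t ! a)" | "v \<in> set (verts t)"
    unfolding vs using set_update_subset_insert by fastforce
  then show "(outs v, ins v) \<in> J0 \<and> dec v \<in> carrier (sp E (vidx v))"
    by cases (use x a dtreesD[OF t] in \<open>auto simp: vertex.map_sel\<close>)
qed (use dtreesD[OF t] a in \<open>auto simp: vs map_vdeg_update\<close>)

lemma is_tree_set_dec: "is_tree m n t \<Longrightarrow> a < length (verts t) \<Longrightarrow> is_tree m n (set_dec a x t)"
  by (rule is_tree_map[where f = id and g = id and \<nu> = id])
     (auto simp: map_edges_id nodes_def sources_def targets_def nth_list_update vertex.map_sel
       intro!: arg_cong[where f = sum_list] nth_equalityI split: if_splits)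

lemma dtrees_set_dec:
  assumes "t \<in> dtrees E (m, n, i)" "a < length (verts t)" "x \<in> carrier (sp E (vidx (verts t ! a)))"
  shows "set_dec a x t \<in> dtrees E (m, n, i)"
  by (rule dtrees_update[OF assms(1,2), where f = "\<lambda>_. x"]) (use assms dtreesD(1)[OF assms(1)] is_tree_set_dec in auto)

lemma dtrees_renumber:
  assumes t: "t \<in> dtrees E (m, n, i)" and a: "a < length (verts t)"
    and p: "\<pi> permutes {1..outs (verts t ! a)}" "\<sigma> permutes {1..ins (verts t ! a)}"
  shows "renumber E a \<pi> \<sigma> t \<in> dtrees E (m, n, i)"
  by (rule dtrees_update[OF t a _ is_tree_renumber[OF dtreesD(1)[OF t] a p]])
     (use dtreesD(4,5)[OF t, of "verts t ! a"] a p in \<open>auto intro!: act_closed\<close>)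

abbreviation N :: "idx \<Rightarrow> ('e dtree \<Rightarrow>\<^sub>0 'k) set" where
  "N \<tau> \<equiv> lin_span (formal_sums (dtrees E \<tau>)) (tree_relators E \<tau>)"

lemma keys_single_sub: "t \<in> D \<Longrightarrow> Poly_Mapping.keys (Poly_Mapping.single t c) \<subseteq> D"
  by simp

lemma keys_diff_sub:
  "Poly_Mapping.keys A \<subseteq> D \<Longrightarrow> Poly_Mapping.keys B \<subseteq> D \<Longrightarrow> Poly_Mapping.keys (A - B :: _ \<Rightarrow>\<^sub>0 'k) \<subseteq> D"
  using keys_diff[of A B] by blast

lemma tree_relators_carrier: "tree_relators E \<tau> \<subseteq> carrier (formal_sums (dtrees E \<tau>))"
proof
  fix A assume "A \<in> tree_relators E \<tau>"
  then show "A \<in> carrier (formal_sums (dtrees E \<tau>))"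
  proof cases
    case (rel_add t a x y)
    obtain m n i where \<tau>: "\<tau> = (m, n, i)" using dtrees_idx rel_add by blast
    interpret Ea: module ground "sp E (vidx (verts t ! a))"
      using rel_add \<tau> dtreesD(4)[of t E m n i] by (intro sp_module) auto
    show ?thesis
      using rel_add unfolding \<tau> formal_sums_simps mem_Collect_eq rel_add(1)
      by (intro keys_diff_sub keys_single_sub dtrees_set_dec) auto
  next
    case (rel_smult t a x c)
    obtain m n i where \<tau>: "\<tau> = (m, n, i)" using dtrees_idx rel_smult by blast
    interpret Ea: module ground "sp E (vidx (verts t ! a))"
      using rel_smult \<tau> dtreesD(4)[of t E m n i] by (intro sp_module) auto
    show ?thesis
      using rel_smult unfolding \<tau> formal_sums_simps mem_Collect_eq rel_smult(1)
      by (intro keys_diff_sub keys_single_sub dtrees_set_dec) auto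
  next
    case (rel_renumber t a \<pi> \<sigma>)
    obtain m n i where \<tau>: "\<tau> = (m, n, i)" using dtrees_idx rel_renumber by blast
    show ?thesis
      using rel_renumber unfolding \<tau> formal_sums_simps mem_Collect_eq rel_renumber(1)
      by (intro keys_diff_sub keys_single_sub dtrees_renumber) auto
  next
    case (rel_swap t a)
    obtain m n i where \<tau>: "\<tau> = (m, n, i)" using dtrees_idx rel_swap by blast
    show ?thesis
      using rel_swap unfolding \<tau> formal_sums_simps mem_Collect_eq rel_swap(1)
      by (intro keys_diff_sub keys_single_sub dtrees_swap_verts) auto
  qed
qed

lemma N_submodule: "submodule (N \<tau>) ground (formal_sums (dtrees E \<tau>))"
  by (rule lin_span_submodule[OF module_formal_sums tree_relators_carrier])

sublocale Fm: quotient_module "formal_sums (dtrees E \<tau>)" "N \<tau>" for \<tau>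
  by (rule quotient_module.intro) (rule module_formal_sums N_submodule)+

lemma tree_relators_N: "A \<in> tree_relators E \<tau> \<Longrightarrow> A \<in> N \<tau>"
  by (rule subsetD[OF lin_span_incl])

lemma keys_lin_ext_sub:
  "Poly_Mapping.keys A \<subseteq> D \<Longrightarrow> (\<And>t. t \<in> D \<Longrightarrow> f t \<in> D') \<Longrightarrow> Poly_Mapping.keys (lin_ext f (A :: _ \<Rightarrow>\<^sub>0 'k)) \<subseteq> D'"
  using keys_lin_ext[of f A] by blast

lemma N_image:
  assumes rel: "\<And>A. A \<in> tree_relators E \<tau> \<Longrightarrow> lin_ext f A \<in> tree_relators E \<tau>'"
    and dt: "\<And>t. t \<in> dtrees E \<tau> \<Longrightarrow> f t \<in> dtrees E \<tau>'" and A: "A \<in> N \<tau>"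
  shows "lin_ext f A \<in> N \<tau>'"
proof (rule lin_span_image[OF module_formal_sums module_formal_sums tree_relators_carrier _ _ _ N_submodule _ A])
  show "x \<in> carrier (formal_sums (dtrees E \<tau>)) \<Longrightarrow> lin_ext f x \<in> carrier (formal_sums (dtrees E \<tau>'))" for x :: "'e dtree \<Rightarrow>\<^sub>0 'k"
    using keys_lin_ext_sub[where f = f and D = "dtrees E \<tau>", OF _ dt] by simp
  show "lin_ext f ` tree_relators E \<tau> \<subseteq> N \<tau>'" using rel tree_relators_N by blast
qed auto

lemma relabel_relator:
  assumes p: "\<pi> permutes {1..m}" "\<sigma> permutes {1..n}" and A: "A \<in> tree_relators E (m, n, i)"
  shows "lin_ext (relabel \<pi> \<sigma>) A \<in> tree_relators E (m, n, i)"
  using A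
proof cases
  case (rel_add t a x y)
  then show ?thesis
    using tree_relators.rel_add[of "relabel \<pi> \<sigma> t" E "(m, n, i)" a x y] dtrees_relabel[OF rel_add(2) p]
    by (simp add: relabel_set_dec)
next
  case (rel_smult t a x c)
  then show ?thesis
    using tree_relators.rel_smult[of "relabel \<pi> \<sigma> t" E "(m, n, i)" a x c] dtrees_relabel[OF rel_smult(2) p]
    by (simp add: relabel_set_dec)
next
  case (rel_renumber t a \<rho> \<rho>')
  then show ?thesis
    using tree_relators.rel_renumber[of "relabel \<pi> \<sigma> t" E "(m, n, i)" a \<rho> \<rho>'] dtrees_relabel[OF rel_renumber(2) p]
    by (simp add: relabel_renumber)
next
  case (rel_swap t a)
  then show ?thesis
    using tree_relators.rel_swap[of "relabel \<pi> \<sigma> t" E "(m, n, i)" a] dtrees_relabel[OF rel_swap(2) p]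
    by (simp add: relabel_swap_verts)
qed

text \<open>Grafting on a fixed tree commutes with each operation occurring in a relator, so a
  relator goes to one of the same kind. No Koszul sign appears because the vertex lists are simply
  concatenated.\<close>

lemma graft_relator1:
  assumes A: "A \<in> tree_relators E (m1, n1, p)" and s: "s \<in> dtrees E (m2, n2, q)"
    and ij: "i \<in> {1..n1}" "j \<in> {1..m2}"
  shows "lin_ext (\<lambda>t. graft m1 n2 i j t s) A \<in> tree_relators E (m1 + m2 - 1, n1 + n2 - 1, p + q)"
  using A
proof cases
  case (rel_add t a x y)
  then show ?thesis
    using tree_relators.rel_add[OF dtrees_graft[OF rel_add(2) s ij], of a x y]
    by (simp add: graft_set_dec1 nth_append)
next
  case (rel_smult t a x c)
  then show ?thesis
    using tree_relators.rel_smult[OF dtrees_graft[OF rel_smult(2) s ij], of a x c]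
    by (simp add: graft_set_dec1 nth_append)
next
  case (rel_renumber t a \<rho> \<rho>')
  then show ?thesis
    using tree_relators.rel_renumber[OF dtrees_graft[OF rel_renumber(2) s ij], of a \<rho> \<rho>']
    by (simp add: graft_renumber1 nth_append)
next
  case (rel_swap t a)
  then show ?thesis
    using tree_relators.rel_swap[OF dtrees_graft[OF rel_swap(2) s ij], of a]
    by (simp add: graft_swap_verts1 nth_append)
qed

text \<open>As for the first factor, with vertex numbers shifted by the number of vertices of the
  fixed tree.\<close>

lemma graft_relator2:
  assumes A: "A \<in> tree_relators E (m2, n2, q)" and s: "s \<in> dtrees E (m1, n1, p)"
    and ij: "i \<in> {1..n1}" "j \<in> {1..m2}"
  shows "lin_ext (\<lambda>t. graft m1 n2 i j s t) A \<in> tree_relators E (m1 + m2 - 1, n1 + n2 - 1, p + q)"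
  using A
proof cases
  case (rel_add t a x y)
  then show ?thesis
    using tree_relators.rel_add[OF dtrees_graft[OF s rel_add(2) ij], of "length (verts s) + a" x y]
    by (simp add: graft_set_dec2)
next
  case (rel_smult t a x c)
  then show ?thesis
    using tree_relators.rel_smult[OF dtrees_graft[OF s rel_smult(2) ij], of "length (verts s) + a" x c]
    by (simp add: graft_set_dec2)
next
  case (rel_renumber t a \<rho> \<rho>')
  then show ?thesis
    using tree_relators.rel_renumber[OF dtrees_graft[OF s rel_renumber(2) ij], of "length (verts s) + a" \<rho> \<rho>']
    by (simp add: graft_renumber2[OF dtreesD(1)[OF s]])
next
  case (rel_swap t a)
  then show ?thesis
    using tree_relators.rel_swap[OF dtrees_graft[OF s rel_swap(2) ij], of "length (verts s) + a"]
    by (simp add: graft_swap_verts2[OF dtreesD(1)[OF s]] nth_append)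
qed

lemma N_relabel:
  assumes p: "\<pi> permutes {1..m}" "\<sigma> permutes {1..n}" and A: "A \<in> N (m, n, i)"
  shows "lin_ext (relabel \<pi> \<sigma>) A \<in> N (m, n, i)"
  by (rule N_image[OF relabel_relator[OF p] dtrees_relabel[OF _ p] A])

lemma keys_relabel:
  assumes p: "\<pi> permutes {1..m}" "\<sigma> permutes {1..n}" and A: "Poly_Mapping.keys A \<subseteq> dtrees E (m, n, i)"
  shows "Poly_Mapping.keys (lin_ext (relabel \<pi> \<sigma>) (A :: _ \<Rightarrow>\<^sub>0 'k)) \<subseteq> dtrees E (m, n, i)"
  by (rule keys_lin_ext_sub[where f = "relabel \<pi> \<sigma>", OF A dtrees_relabel[OF _ p]])

lemma bilin_ext_single:
  "bilin_ext f A (Poly_Mapping.single s 1) = lin_ext (\<lambda>t. f t s) (A :: _ \<Rightarrow>\<^sub>0 'k)"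
  "bilin_ext f (Poly_Mapping.single s 1) A = lin_ext (\<lambda>t. f s t) A"
  by (rule poly_mapping_eqI; simp add: lookup_bilin_ext lookup_lin_ext)+

lemma N_graft1:
  assumes A: "A \<in> N (m1, n1, p)" and B: "Poly_Mapping.keys B \<subseteq> dtrees E (m2, n2, q)"
    and ij: "i \<in> {1..n1}" "j \<in> {1..m2}"
  shows "bilin_ext (graft m1 n2 i j) A B \<in> N (m1 + m2 - 1, n1 + n2 - 1, p + q)"
proof -
  let ?N = "N (m1 + m2 - 1, n1 + n2 - 1, p + q)"
  note sub = N_submodule[of "(m1 + m2 - 1, n1 + n2 - 1, p + q)", unfolded submodule_formal_sums_iff]
  have "B \<in> {B. bilin_ext (graft m1 n2 i j) A B \<in> ?N}"
  proof (rule formal_sum_mem)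
    fix s assume "s \<in> Poly_Mapping.keys B"
    then have s: "s \<in> dtrees E (m2, n2, q)" using B by blast
    have "lin_ext (\<lambda>t. graft m1 n2 i j t s) A \<in> ?N"
      by (rule N_image[OF graft_relator1[OF _ s ij] dtrees_graft[OF _ s ij] A])
    then show "Poly_Mapping.single s 1 \<in> {B. bilin_ext (graft m1 n2 i j) A B \<in> ?N}"
      by (simp add: bilin_ext_single)
  qed (use sub in auto)
  then show ?thesis by simp
qed

lemma N_graft2:
  assumes A: "A \<in> N (m2, n2, q)" and B: "Poly_Mapping.keys B \<subseteq> dtrees E (m1, n1, p)"
    and ij: "i \<in> {1..n1}" "j \<in> {1..m2}"
  shows "bilin_ext (graft m1 n2 i j) B A \<in> N (m1 + m2 - 1, n1 + n2 - 1, p + q)"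
proof -
  let ?N = "N (m1 + m2 - 1, n1 + n2 - 1, p + q)"
  note sub = N_submodule[of "(m1 + m2 - 1, n1 + n2 - 1, p + q)", unfolded submodule_formal_sums_iff]
  have "B \<in> {B. bilin_ext (graft m1 n2 i j) B A \<in> ?N}"
  proof (rule formal_sum_mem)
    fix s assume "s \<in> Poly_Mapping.keys B"
    then have s: "s \<in> dtrees E (m1, n1, p)" using B by blast
    have "lin_ext (\<lambda>t. graft m1 n2 i j s t) A \<in> ?N"
      by (rule N_image[OF graft_relator2[OF _ s ij] dtrees_graft[OF s _ ij] A])
    then show "Poly_Mapping.single s 1 \<in> {B. bilin_ext (graft m1 n2 i j) B A \<in> ?N}"
      by (simp add: bilin_ext_single)
  qed (use sub in auto)
  then show ?thesis by simp
qed

lemma keys_graft: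
  assumes "Poly_Mapping.keys A \<subseteq> dtrees E (m1, n1, p)" "Poly_Mapping.keys B \<subseteq> dtrees E (m2, n2, q)"
    and ij: "i \<in> {1..n1}" "j \<in> {1..m2}"
  shows "Poly_Mapping.keys (bilin_ext (graft m1 n2 i j) A (B :: _ \<Rightarrow>\<^sub>0 'k))
    \<subseteq> dtrees E (m1 + m2 - 1, n1 + n2 - 1, p + q)"
  using keys_bilin_ext[of "graft m1 n2 i j" A B] assms(1,2) dtrees_graft[OF _ _ ij] by blast

section \<open>Classes of formal sums and the operations of the free dioperad\<close>

abbreviation "F \<equiv> free_dioperad E"

definition cls :: "idx \<Rightarrow> ('e dtree \<Rightarrow>\<^sub>0 'k) \<Rightarrow> ('e dtree \<Rightarrow>\<^sub>0 'k) set" where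
  "cls \<tau> A = N \<tau> +>\<^bsub>formal_sums (dtrees E \<tau>)\<^esub> A"

lemma tree_sums_sp [simp]: "sp (tree_sums E) \<tau> = formal_sums (dtrees E \<tau>)"
  by (simp add: tree_sums_def)

lemma F_sp: "sp F \<tau> = quot_module (formal_sums (dtrees E \<tau>)) (N \<tau>)"
  by (simp add: free_dioperad_def quot_dioperad_def)

lemma F_module: "module ground (sp F \<tau>)"
  unfolding F_sp by (rule Fm.quot_module)

lemma carrier_F: "C \<in> carrier (sp F \<tau>) \<longleftrightarrow> (\<exists>A. Poly_Mapping.keys A \<subseteq> dtrees E \<tau> \<and> C = cls \<tau> A)"
  by (auto simp: F_sp cls_def mem_rcosets_iff)

lemma mem_cls: "Poly_Mapping.keys A \<subseteq> dtrees E \<tau> \<Longrightarrow>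
    B \<in> cls \<tau> A \<longleftrightarrow> Poly_Mapping.keys B \<subseteq> dtrees E \<tau> \<and> B - A \<in> N \<tau>"
  using Fm.mem_coset_iff[of A \<tau> B] by (auto simp: cls_def)

lemma cls_self: "Poly_Mapping.keys A \<subseteq> dtrees E \<tau> \<Longrightarrow> A \<in> cls \<tau> A"
  using Fm.coset_self[of A \<tau>] by (simp add: cls_def)

lemma cls_eq_iff: "Poly_Mapping.keys A \<subseteq> dtrees E \<tau> \<Longrightarrow> Poly_Mapping.keys B \<subseteq> dtrees E \<tau> \<Longrightarrow>
    cls \<tau> A = cls \<tau> B \<longleftrightarrow> A - B \<in> N \<tau>"
  using Fm.coset_eq_iff[of A \<tau> B] by (simp add: cls_def)

lemma F_add: "Poly_Mapping.keys A \<subseteq> dtrees E \<tau> \<Longrightarrow> Poly_Mapping.keys B \<subseteq> dtrees E \<tau> \<Longrightarrow>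
    cls \<tau> A \<oplus>\<^bsub>sp F \<tau>\<^esub> cls \<tau> B = cls \<tau> (A + B)"
  using Fm.coset_add[of A \<tau> B] by (simp add: F_sp cls_def)

lemma F_minus: "Poly_Mapping.keys A \<subseteq> dtrees E \<tau> \<Longrightarrow> Poly_Mapping.keys B \<subseteq> dtrees E \<tau> \<Longrightarrow>
    cls \<tau> A \<ominus>\<^bsub>sp F \<tau>\<^esub> cls \<tau> B = cls \<tau> (A - B)"
  using Fm.coset_minus[of A \<tau> B] by (simp add: F_sp cls_def)

lemma F_smult: "Poly_Mapping.keys A \<subseteq> dtrees E \<tau> \<Longrightarrow> c \<odot>\<^bsub>sp F \<tau>\<^esub> cls \<tau> A = cls \<tau> (scale c A)"
  using Fm.coset_smult[of A \<tau> c] by (simp add: F_sp cls_def)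

lemma F_zero: "\<zero>\<^bsub>sp F \<tau>\<^esub> = cls \<tau> 0"
  by (auto simp: F_sp cls_def coset_eq)

lemma F_act:
  assumes p: "\<pi> permutes {1..m}" "\<sigma> permutes {1..n}" and A: "Poly_Mapping.keys A \<subseteq> dtrees E (m, n, i)"
  shows "act F (m, n, i) \<pi> \<sigma> (cls (m, n, i) A) = cls (m, n, i) (lin_ext (relabel \<pi> \<sigma>) A)"
proof -
  have "(\<Union>x \<in> cls (m, n, i) A. cls (m, n, i) (lin_ext (relabel \<pi> \<sigma>) x)) = cls (m, n, i) (lin_ext (relabel \<pi> \<sigma>) A)"
    unfolding cls_def
    by (rule Fm.UN_cosets_act[OF Fm.quotient_module_axioms])
       (use N_relabel[OF p] A keys_relabel[OF p] in auto)
  then show ?thesis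
    by (simp add: free_dioperad_def quot_dioperad_def cls_def tree_sums_def)
qed

lemma F_pcomp:
  assumes A: "Poly_Mapping.keys A \<subseteq> dtrees E (m1, n1, p)" and B: "Poly_Mapping.keys B \<subseteq> dtrees E (m2, n2, q)"
    and ij: "i \<in> {1..n1}" "j \<in> {1..m2}"
  shows "pcomp F (m1, n1, p) (m2, n2, q) i j (cls (m1, n1, p) A) (cls (m2, n2, q) B)
    = cls (m1 + m2 - 1, n1 + n2 - 1, p + q) (bilin_ext (graft m1 n2 i j) A B)"
proof -
  let ?\<tau> = "(m1 + m2 - 1, n1 + n2 - 1, p + q)" and ?g = "bilin_ext (graft m1 n2 i j) :: _ \<Rightarrow> _ \<Rightarrow> _ \<Rightarrow>\<^sub>0 'k"
  have *: "cls ?\<tau> (?g A' B') = cls ?\<tau> (?g A B)" if A': "A' \<in> cls (m1, n1, p) A" and B': "B' \<in> cls (m2, n2, q) B" for A' B'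
  proof -
    have k: "Poly_Mapping.keys A' \<subseteq> dtrees E (m1, n1, p)" "A' - A \<in> N (m1, n1, p)"
      "Poly_Mapping.keys B' \<subseteq> dtrees E (m2, n2, q)" "B' - B \<in> N (m2, n2, q)"
      using A' B' mem_cls A B by blast+
    \<comment> \<open>Changing one representative at a time: these two terms telescope to the
      difference of the composites.\<close>
    have "?g (A' - A) B' + ?g A (B' - B) \<in> N ?\<tau>"
      using N_graft1[OF k(2,3) ij] N_graft2[OF k(4) A ij] N_submodule[of ?\<tau>]
      by (auto simp: submodule_formal_sums_iff simp del: bilin_ext_simps)
    then have "?g A' B' - ?g A B \<in> N ?\<tau>" by simp
    then show ?thesis
      using cls_eq_iff[OF keys_graft[OF k(1,3) ij] keys_graft[OF A B ij]] by simp
  qed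
  have "pcomp F (m1, n1, p) (m2, n2, q) i j (cls (m1, n1, p) A) (cls (m2, n2, q) B)
      = (\<Union>x \<in> cls (m1, n1, p) A. \<Union>y \<in> cls (m2, n2, q) B. cls ?\<tau> (?g x y))"
    by (simp add: free_dioperad_def quot_dioperad_def cls_def tree_sums_def)
  also have "\<dots> = (\<Union>x \<in> cls (m1, n1, p) A. \<Union>y \<in> cls (m2, n2, q) B. cls ?\<tau> (?g A B))"
    using * by (intro SUP_cong refl) auto
  also have "\<dots> = cls ?\<tau> (?g A B)"
    using cls_self[OF A] cls_self[OF B] by auto
  finally show ?thesis .
qed

text \<open>Expresses that the operations of the free dioperad preserve the carriers, in the form
  needed as hypothesis \<open>K\<close> of \<open>ideal_gen_image\<close>.\<close>

lemma F_carrier_ideal: "dioperad_ideal F (\<lambda>\<tau>. carrier (sp F \<tau>))"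
  unfolding dioperad_ideal_def subbimodule_def
proof (intro conjI allI impI ballI)
  fix m n i
  show "submodule (carrier (sp F (m, n, i))) ground (sp F (m, n, i))"
    by (rule module.carrier_is_submodule[OF F_module])
next
  fix m n i \<pi> \<sigma> x
  assume p: "\<pi> permutes {1..m}" "\<sigma> permutes {1..n}" and "x \<in> carrier (sp F (m, n, i))"
  then obtain A where A: "Poly_Mapping.keys A \<subseteq> dtrees E (m, n, i)" "x = cls (m, n, i) A"
    by (auto simp: carrier_F)
  then show "act F (m, n, i) \<pi> \<sigma> x \<in> carrier (sp F (m, n, i))"
    using F_act[OF p A(1)] keys_relabel[OF p A(1)]
    by (auto simp only: carrier_F)
next
  fix m1 n1 p m2 n2 q i j x y
  assume ij: "i \<in> {1..n1}" "j \<in> {1..m2}" and "x \<in> carrier (sp F (m1, n1, p))" "y \<in> carrier (sp F (m2, n2, q))"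
  then obtain A B where "Poly_Mapping.keys A \<subseteq> dtrees E (m1, n1, p)" "x = cls (m1, n1, p) A"
    "Poly_Mapping.keys B \<subseteq> dtrees E (m2, n2, q)" "y = cls (m2, n2, q) B"
    unfolding carrier_F by blast
  then show "pcomp F (m1, n1, p) (m2, n2, q) i j x y \<in> carrier (sp F (plug_idx (m1, n1, p) (m2, n2, q)))"
    using F_pcomp[OF _ _ ij] keys_graft[OF _ _ ij] unfolding carrier_F plug_idx.simps by metis
qed

end

section \<open>Functoriality of the free dioperad\<close>

lemma inj_on_lin_ext:
  assumes "inj_on f D"
  shows "inj_on (lin_ext f) {A :: 't \<Rightarrow>\<^sub>0 'k::field_char_0. Poly_Mapping.keys A \<subseteq> D}"
proof (rule inj_on_inverseI)
  fix A :: "'t \<Rightarrow>\<^sub>0 'k" assume A: "A \<in> {A. Poly_Mapping.keys A \<subseteq> D}"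
  then show "lin_ext (inv_into D f) (lin_ext f A) = A"
    unfolding lin_ext_lin_ext using assms by (intro lin_ext_id) (auto intro: inv_into_f_f)
qed

lemma lin_ext_image:
  assumes "f ` D = D'"
  shows "lin_ext f ` {A :: 't \<Rightarrow>\<^sub>0 'k::field_char_0. Poly_Mapping.keys A \<subseteq> D} = {A. Poly_Mapping.keys A \<subseteq> D'}"
proof (intro equalityI subsetI)
  fix B assume "B \<in> lin_ext f ` {A :: 't \<Rightarrow>\<^sub>0 'k. Poly_Mapping.keys A \<subseteq> D}"
  then show "B \<in> {A. Poly_Mapping.keys A \<subseteq> D'}"
    using keys_lin_ext[of f] assms by blast
next
  fix B :: "_ \<Rightarrow>\<^sub>0 'k" assume B: "B \<in> {A. Poly_Mapping.keys A \<subseteq> D'}"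
  have "B = lin_ext f (lin_ext (inv_into D f) B)"
    unfolding lin_ext_lin_ext
    by (rule sym, rule lin_ext_id) (use B assms in \<open>auto intro!: f_inv_into_f\<close>)
  moreover have "Poly_Mapping.keys (lin_ext (inv_into D f) B) \<subseteq> D"
    using keys_lin_ext[of "inv_into D f" B] B assms by (auto dest!: subsetD intro!: inv_into_into)
  ultimately show "B \<in> lin_ext f ` {A. Poly_Mapping.keys A \<subseteq> D}" by blast
qed

lemma map_dtree_simps [simp]:
  "verts (map_dtree \<theta> t) = map (map_vertex \<theta>) (verts t)" "edges (map_dtree \<theta> t) = edges t"
  by (cases t; simp)+

lemma map_vertex_simps [simp]:
  "outs (map_vertex \<theta> v) = outs v" "ins (map_vertex \<theta> v) = ins v" "vdeg (map_vertex \<theta> v) = vdeg v"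
  "dec (map_vertex \<theta> v) = \<theta> (dec v)"
  by (cases v; simp)+

lemma is_tree_map_dtree: "is_tree m n (map_dtree \<theta> t) \<longleftrightarrow> is_tree m n t"
  by (simp add: is_tree_def sources_def targets_def nodes_def adjacent_def)

lemma map_dtree_relabel: "map_dtree \<theta> (relabel \<pi> \<sigma> t) = relabel \<pi> \<sigma> (map_dtree \<theta> t)"
  by (rule dtree_eqI) (simp_all add: map_edges_def)

lemma map_dtree_graft: "map_dtree \<theta> (graft m1 n2 i j t s) = graft m1 n2 i j (map_dtree \<theta> t) (map_dtree \<theta> s)"
  by (rule dtree_eqI) (simp_all add: edges_graft)

lemma map_dtree_set_dec:
  "a < length (verts t) \<Longrightarrow> map_dtree \<theta> (set_dec a x t) = set_dec a (\<theta> x) (map_dtree \<theta> t)"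
  by (rule dtree_eqI) (simp_all add: map_update vertex.map_comp o_def)

lemma map_dtree_swap_verts:
  "Suc a < length (verts t) \<Longrightarrow> map_dtree \<theta> (swap_verts a t) = swap_verts a (map_dtree \<theta> t)"
  by (rule dtree_eqI) (simp_all add: map_update map_edges_def)

locale bimodule_iso = E1: graded_bimodule E1 + E2: graded_bimodule E2
  for E1 :: "('k::field_char_0, 'e) bimodule" and E2 :: "('k, 'f) bimodule" +
  fixes \<theta> :: "'e \<Rightarrow> 'f"
  assumes bij: "(m, n) \<in> J0 \<Longrightarrow> bij_betw \<theta> (carrier (sp E1 (m, n, i))) (carrier (sp E2 (m, n, i)))"
    and \<theta>_add: "\<lbrakk>(m, n) \<in> J0; x \<in> carrier (sp E1 (m, n, i)); y \<in> carrier (sp E1 (m, n, i))\<rbrakk> \<Longrightarrow>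
      \<theta> (x \<oplus>\<^bsub>sp E1 (m, n, i)\<^esub> y) = \<theta> x \<oplus>\<^bsub>sp E2 (m, n, i)\<^esub> \<theta> y"
    and \<theta>_smult: "\<lbrakk>(m, n) \<in> J0; x \<in> carrier (sp E1 (m, n, i))\<rbrakk> \<Longrightarrow>
      \<theta> (c \<odot>\<^bsub>sp E1 (m, n, i)\<^esub> x) = c \<odot>\<^bsub>sp E2 (m, n, i)\<^esub> \<theta> x"
    and \<theta>_act: "\<lbrakk>(m, n) \<in> J0; x \<in> carrier (sp E1 (m, n, i)); \<pi> permutes {1..m}; \<sigma> permutes {1..n}\<rbrakk> \<Longrightarrow>
      \<theta> (act E1 (m, n, i) \<pi> \<sigma> x) = act E2 (m, n, i) \<pi> \<sigma> (\<theta> x)"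
begin

abbreviation "\<Theta> \<equiv> map_dtree \<theta>"

lemma \<theta>_closed: "(m, n) \<in> J0 \<Longrightarrow> x \<in> carrier (sp E1 (m, n, i)) \<Longrightarrow> \<theta> x \<in> carrier (sp E2 (m, n, i))"
  using bij_betw_apply[OF bij] by blast

text \<open>\<theta> is injective only on each carrier, so trees are compared vertex by vertex:
  equal recorded arities and degrees put both decorations into one carrier.\<close>

lemma inj_\<Theta>: "inj_on \<Theta> (dtrees E1 (m, n, i))"
proof (rule inj_onI)
  fix t t' assume t: "t \<in> dtrees E1 (m, n, i)" "t' \<in> dtrees E1 (m, n, i)" and eq: "\<Theta> t = \<Theta> t'"
  have eqs: "map (map_vertex \<theta>) (verts t) = map (map_vertex \<theta>) (verts t')" "edges t = edges t'"
    using arg_cong[OF eq, of verts] arg_cong[OF eq, of edges] by simp_all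
  have "verts t = verts t'"
  proof (rule nth_equalityI)
    show len: "length (verts t) = length (verts t')" using map_eq_imp_length_eq[OF eqs(1)] .
    fix a assume a: "a < length (verts t)"
    let ?v = "verts t ! a" and ?v' = "verts t' ! a"
    have v: "map_vertex \<theta> ?v = map_vertex \<theta> ?v'"
      using arg_cong[OF eqs(1), of "\<lambda>l. l ! a"] a len by simp
    have idx: "outs ?v = outs ?v'" "ins ?v = ins ?v'" "vdeg ?v = vdeg ?v'" "\<theta> (dec ?v) = \<theta> (dec ?v')"
      using arg_cong[OF v, of outs] arg_cong[OF v, of ins] arg_cong[OF v, of vdeg] arg_cong[OF v, of dec]
      by simp_all
    have "dec ?v = dec ?v'"
      using bij[of "outs ?v" "ins ?v" "vdeg ?v"] dtreesD(4,5)[OF t(1), of ?v] dtreesD(5)[OF t(2), of ?v'] idx a len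
      by (auto simp: bij_betw_def dest: inj_onD)
    then show "?v = ?v'" using idx by (cases ?v; cases ?v') auto
  qed
  then show "t = t'" using eqs(2) by (rule dtree_eqI)
qed

lemma \<Theta>_dtrees: "t \<in> dtrees E1 (m, n, i) \<Longrightarrow> \<Theta> t \<in> dtrees E2 (m, n, i)"
  by (rule dtreesI) (auto simp: is_tree_map_dtree o_def dest: dtreesD intro!: \<theta>_closed)

lemma \<Theta>_image: "\<Theta> ` dtrees E1 (m, n, i) = dtrees E2 (m, n, i)"
proof (intro equalityI subsetI)
  fix t assume t: "t \<in> dtrees E2 (m, n, i)"
  \<comment> \<open>The inverse of \<theta> depends on the component, so it is taken at the index
    recorded in each vertex.\<close>
  define g where "g v = map_vertex (inv_into (carrier (sp E1 (vidx v))) \<theta>) v" for v :: "'f vertex"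
  have g: "outs (g v) = outs v" "ins (g v) = ins v" "vdeg (g v) = vdeg v" for v by (simp_all add: g_def)
  let ?t' = "DTree (map g (verts t)) (edges t)"
  have inv: "inv_into (carrier (sp E1 (vidx v))) \<theta> (dec v) \<in> carrier (sp E1 (vidx v))"
    "\<theta> (inv_into (carrier (sp E1 (vidx v))) \<theta> (dec v)) = dec v" if "v \<in> set (verts t)" for v
    using bij[of "outs v" "ins v" "vdeg v"] dtreesD(4,5)[OF t that]
    by (auto simp: bij_betw_def intro!: inv_into_into f_inv_into_f)
  have "is_tree m n ?t'"
    using dtreesD(1)[OF t] by (simp add: is_tree_def sources_def targets_def nodes_def adjacent_def g)
  then have "?t' \<in> dtrees E1 (m, n, i)"
    using inv(1) dtreesD[OF t] by (intro dtreesI) (auto simp: g o_def g_def)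
  moreover have "map_vertex \<theta> (g v) = v" if "v \<in> set (verts t)" for v
    using inv(2)[OF that] by (cases v) (simp add: g_def)
  then have "\<Theta> ?t' = t"
    by (intro dtree_eqI) (auto simp: o_def intro!: map_idI)
  ultimately show "t \<in> \<Theta> ` dtrees E1 (m, n, i)" by (metis imageI)
qed (use \<Theta>_dtrees in blast)

lemma \<Theta>_renumber:
  assumes t: "t \<in> dtrees E1 (m, n, i)" and a: "a < length (verts t)"
    and p: "\<pi> permutes {1..outs (verts t ! a)}" "\<sigma> permutes {1..ins (verts t ! a)}"
  shows "\<Theta> (renumber E1 a \<pi> \<sigma> t) = renumber E2 a \<pi> \<sigma> (\<Theta> t)"
proof (rule dtree_eqI)
  have "\<theta> (act E1 (vidx (verts t ! a)) \<pi> \<sigma> (dec (verts t ! a))) = act E2 (vidx (verts t ! a)) \<pi> \<sigma> (\<theta> (dec (verts t ! a)))"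
    using dtreesD(4,5)[OF t, of "verts t ! a"] a by (intro \<theta>_act p) auto
  then show "verts (\<Theta> (renumber E1 a \<pi> \<sigma> t)) = verts (renumber E2 a \<pi> \<sigma> (\<Theta> t))"
    using a by (cases "verts t ! a") (simp add: map_update)
qed (simp add: map_edges_def)

text \<open>The inclusion from right to left lifts a relator by lifting its tree and its decorations
  through \<theta>. Having equality here gives equality for the spans in
  \<open>N_image\<close>.\<close>

lemma relators_image: "lin_ext \<Theta> ` tree_relators E1 (m, n, i) = tree_relators E2 (m, n, i)"
proof (intro equalityI subsetI)
  fix B assume "B \<in> lin_ext \<Theta> ` tree_relators E1 (m, n, i)"
  then obtain A where A: "A \<in> tree_relators E1 (m, n, i)" and B: "B = lin_ext \<Theta> A" by blast
  show "B \<in> tree_relators E2 (m, n, i)"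
    using A
  proof cases
    case (rel_add t a x y)
    have J: "(outs (verts t ! a), ins (verts t ! a)) \<in> J0" using dtreesD(4)[OF rel_add(2)] rel_add(3) by auto
    show ?thesis
      using tree_relators.rel_add[OF \<Theta>_dtrees[OF rel_add(2)], of a "\<theta> x" "\<theta> y"] rel_add
      by (simp add: B map_dtree_set_dec \<theta>_add[OF J] \<theta>_closed[OF J])
  next
    case (rel_smult t a x c)
    have J: "(outs (verts t ! a), ins (verts t ! a)) \<in> J0" using dtreesD(4)[OF rel_smult(2)] rel_smult(3) by auto
    show ?thesis
      using tree_relators.rel_smult[OF \<Theta>_dtrees[OF rel_smult(2)], of a "\<theta> x" c] rel_smult
      by (simp add: B map_dtree_set_dec \<theta>_smult[OF J] \<theta>_closed[OF J])
  next
    case (rel_renumber t a \<pi> \<sigma>)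
    then show ?thesis
      using tree_relators.rel_renumber[OF \<Theta>_dtrees[OF rel_renumber(2)], of a \<pi> \<sigma>]
      by (simp add: B \<Theta>_renumber)
  next
    case (rel_swap t a)
    then show ?thesis
      using tree_relators.rel_swap[OF \<Theta>_dtrees[OF rel_swap(2)], of a]
      by (simp add: B map_dtree_swap_verts)
  qed
next
  fix B assume "B \<in> tree_relators E2 (m, n, i)"
  then show "B \<in> lin_ext \<Theta> ` tree_relators E1 (m, n, i)"
  proof cases
    case (rel_add t a x y)
    obtain t' where t': "t' \<in> dtrees E1 (m, n, i)" "t = \<Theta> t'" using rel_add(2) \<Theta>_image by blast
    have a: "a < length (verts t')" using rel_add(3) t'(2) by simp
    have J: "(outs (verts t' ! a), ins (verts t' ! a)) \<in> J0" using dtreesD(4)[OF t'(1)] a by auto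
    have "x \<in> \<theta> ` carrier (sp E1 (vidx (verts t' ! a)))" "y \<in> \<theta> ` carrier (sp E1 (vidx (verts t' ! a)))"
      using rel_add(4,5) bij[OF J] a by (auto simp: t' bij_betw_def)
    then obtain x' y' where xy: "x' \<in> carrier (sp E1 (vidx (verts t' ! a)))" "x = \<theta> x'"
      "y' \<in> carrier (sp E1 (vidx (verts t' ! a)))" "y = \<theta> y'" by blast
    show ?thesis
      using imageI[OF tree_relators.rel_add[OF t'(1) a xy(1,3)], of "lin_ext \<Theta>"]
      by (simp add: rel_add(1) t' map_dtree_set_dec a \<theta>_add[OF J] xy)
  next
    case (rel_smult t a x c)
    obtain t' where t': "t' \<in> dtrees E1 (m, n, i)" "t = \<Theta> t'" using rel_smult(2) \<Theta>_image by blast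
    have a: "a < length (verts t')" using rel_smult(3) t'(2) by simp
    have J: "(outs (verts t' ! a), ins (verts t' ! a)) \<in> J0" using dtreesD(4)[OF t'(1)] a by auto
    have "x \<in> \<theta> ` carrier (sp E1 (vidx (verts t' ! a)))"
      using rel_smult(4) bij[OF J] a by (auto simp: t' bij_betw_def)
    then obtain x' where x: "x' \<in> carrier (sp E1 (vidx (verts t' ! a)))" "x = \<theta> x'" by blast
    show ?thesis
      using imageI[OF tree_relators.rel_smult[OF t'(1) a x(1), of c], of "lin_ext \<Theta>"]
      by (simp add: rel_smult(1) t' map_dtree_set_dec a \<theta>_smult[OF J] x)
  next
    case (rel_renumber t a \<pi> \<sigma>)
    obtain t' where t': "t' \<in> dtrees E1 (m, n, i)" "t = \<Theta> t'" using rel_renumber(2) \<Theta>_image by blast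
    have a: "a < length (verts t')" using rel_renumber(3) t'(2) by simp
    have p: "\<pi> permutes {1..outs (verts t' ! a)}" "\<sigma> permutes {1..ins (verts t' ! a)}"
      using rel_renumber(4,5) a by (simp_all add: t')
    show ?thesis
      using imageI[OF tree_relators.rel_renumber[OF t'(1) a p], of "lin_ext \<Theta>"]
      by (simp add: rel_renumber(1) t' \<Theta>_renumber[OF t'(1) a p])
  next
    case (rel_swap t a)
    obtain t' where t': "t' \<in> dtrees E1 (m, n, i)" "t = \<Theta> t'" using rel_swap(2) \<Theta>_image by blast
    have a: "Suc a < length (verts t')" using rel_swap(3) t'(2) by simp
    show ?thesis
      using imageI[OF tree_relators.rel_swap[OF t'(1) a], of "lin_ext \<Theta>"] a
      by (simp add: rel_swap(1) t' map_dtree_swap_verts[OF a])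
  qed
qed

lemma keys_\<Theta>: "Poly_Mapping.keys A \<subseteq> dtrees E1 (m, n, i) \<Longrightarrow>
    Poly_Mapping.keys (lin_ext \<Theta> A :: _ \<Rightarrow>\<^sub>0 'k) \<subseteq> dtrees E2 (m, n, i)"
  using keys_lin_ext[of \<Theta> A] \<Theta>_dtrees by blast

lemma N_image: "lin_ext \<Theta> ` E1.N (m, n, i) = E2.N (m, n, i)"
proof
  have "lin_ext \<Theta> x \<in> E2.N (m, n, i)" if "x \<in> E1.N (m, n, i)" for x
    by (rule lin_span_image[OF module_formal_sums module_formal_sums E1.tree_relators_carrier _ _ _ E2.N_submodule _ that])
       (use keys_\<Theta> relators_image E2.tree_relators_N in auto)
  then show "lin_ext \<Theta> ` E1.N (m, n, i) \<subseteq> E2.N (m, n, i)" by blast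
  show "E2.N (m, n, i) \<subseteq> lin_ext \<Theta> ` E1.N (m, n, i)"
  proof (rule lin_span_least)
    note s = E1.N_submodule[of "(m, n, i)", unfolded submodule_formal_sums_iff]
    show "submodule (lin_ext \<Theta> ` E1.N (m, n, i)) ground (formal_sums (dtrees E2 (m, n, i)))"
      unfolding submodule_formal_sums_iff
    proof (intro conjI ballI allI)
      fix A B c assume "A \<in> lin_ext \<Theta> ` E1.N (m, n, i)" "B \<in> lin_ext \<Theta> ` E1.N (m, n, i)"
      then obtain A' B' where AB: "A' \<in> E1.N (m, n, i)" "B' \<in> E1.N (m, n, i)" "A = lin_ext \<Theta> A'" "B = lin_ext \<Theta> B'"
        by blast
      show "A + B \<in> lin_ext \<Theta> ` E1.N (m, n, i)"
        using s AB by (intro image_eqI[of _ _ "A' + B'"]) auto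
      show "scale c A \<in> lin_ext \<Theta> ` E1.N (m, n, i)"
        using s AB by (intro image_eqI[of _ _ "scale c A'"]) auto
      show "Poly_Mapping.keys A \<subseteq> dtrees E2 (m, n, i)" using s AB(1) keys_\<Theta>[of A'] unfolding AB(3) by blast
    next
      show "0 \<in> lin_ext \<Theta> ` E1.N (m, n, i)" using s by (intro image_eqI[of _ _ 0]) auto
    qed
    show "tree_relators E2 (m, n, i) \<subseteq> lin_ext \<Theta> ` E1.N (m, n, i)"
      unfolding relators_image[symmetric] using lin_span_incl by (rule image_mono)
  qed
qed

sublocale sums: dioperad_transport "tree_sums E1" "tree_sums E2"
    "\<lambda>\<tau>. carrier (sp (tree_sums E1) \<tau>)" "\<lambda>_. lin_ext \<Theta>"
proof
  fix m n i assume mn: "(m, n) \<in> J0"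
  show "inj_on (lin_ext \<Theta>) (carrier (sp (tree_sums E1) (m, n, i)))"
    using inj_on_lin_ext[OF inj_\<Theta>] by simp
  show "lin_ext \<Theta> ` carrier (sp (tree_sums E1) (m, n, i)) = carrier (sp (tree_sums E2) (m, n, i))"
    using lin_ext_image[OF \<Theta>_image] by simp
  fix A assume A: "A \<in> carrier (sp (tree_sums E1) (m, n, i))"
  show "B \<in> carrier (sp (tree_sums E1) (m, n, i)) \<Longrightarrow>
      A \<oplus>\<^bsub>sp (tree_sums E1) (m, n, i)\<^esub> B \<in> carrier (sp (tree_sums E1) (m, n, i))" for B
    using A Poly_Mapping.keys_add[of A B] by auto
  show "c \<odot>\<^bsub>sp (tree_sums E1) (m, n, i)\<^esub> A \<in> carrier (sp (tree_sums E1) (m, n, i))" for c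
    using A keys_scale[of c A] by auto
  fix \<pi> \<sigma> assume p: "\<pi> permutes {1..m}" "\<sigma> permutes {1..n}"
  show "act (tree_sums E1) (m, n, i) \<pi> \<sigma> A \<in> carrier (sp (tree_sums E1) (m, n, i))"
    using E1.keys_relabel[OF p] A by (simp add: tree_sums_def)
  show "lin_ext \<Theta> (act (tree_sums E1) (m, n, i) \<pi> \<sigma> A) = act (tree_sums E2) (m, n, i) \<pi> \<sigma> (lin_ext \<Theta> A)"
    by (simp add: tree_sums_def lin_ext_lin_ext map_dtree_relabel)
next
  fix m1 n1 p m2 n2 q a b A B
  assume "(m1, n1) \<in> J0" "(m2, n2) \<in> J0" "a \<in> {1..n1}" "b \<in> {1..m2}"
    "A \<in> carrier (sp (tree_sums E1) (m1, n1, p))" "B \<in> carrier (sp (tree_sums E1) (m2, n2, q))"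
  then show "pcomp (tree_sums E1) (m1, n1, p) (m2, n2, q) a b A B
      \<in> carrier (sp (tree_sums E1) (m1 + m2 - 1, n1 + n2 - 1, p + q))"
    using E1.keys_graft[of A m1 n1 p B m2 n2 q a b] by (simp add: tree_sums_def)
  show "lin_ext \<Theta> (pcomp (tree_sums E1) (m1, n1, p) (m2, n2, q) a b A B)
      = pcomp (tree_sums E2) (m1, n1, p) (m2, n2, q) a b (lin_ext \<Theta> A) (lin_ext \<Theta> B)"
    by (simp add: tree_sums_def lin_ext_bilin_ext map_dtree_graft)
qed (auto simp: tree_sums_def)

text \<open>The first of the two quotients. The module structure is added because ideals of the free
  dioperads are transported next.\<close>

sublocale free: module_transport "free_dioperad E1" "free_dioperad E2"
    "\<lambda>\<tau>. Pow (carrier (sp (tree_sums E1) \<tau>))" "\<lambda>_. image (lin_ext \<Theta>)"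
proof (rule module_transport.intro)
  show "dioperad_transport (free_dioperad E1) (free_dioperad E2)
      (\<lambda>\<tau>. Pow (carrier (sp (tree_sums E1) \<tau>))) (\<lambda>_. image (lin_ext \<Theta>))"
    unfolding free_dioperad_def
  proof (rule sums.quot)
    show "lin_span (sp (tree_sums E1) (m, n, i)) (tree_relators E1 (m, n, i)) \<subseteq> carrier (sp (tree_sums E1) (m, n, i))"
      for m n i
      using E1.N_submodule[of "(m, n, i)"] unfolding submodule_formal_sums_iff by auto
  qed (use N_image in simp)
  show "module_transport_axioms (free_dioperad E1) (free_dioperad E2)"
    by (rule module_transport_axioms.intro) (rule E1.F_module E2.F_module)+
qed

text \<open>The second quotient: the generated ideals correspond by \<open>ideal_gen_image\<close>.
  What remains for the theorem is to compare the spaces of relations, one component at a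
  time.\<close>

lemma quotients_iso:
  assumes S: "\<And>m n i. (m, n) \<in> J0 \<Longrightarrow> S (m, n, i) \<subseteq> carrier (sp (free_dioperad E1) (m, n, i))"
    and S': "\<And>m n i. (m, n) \<in> J0 \<Longrightarrow> image (lin_ext \<Theta>) ` S (m, n, i) = S' (m, n, i)"
  shows "quadratic_dioperad (E1, S) \<cong>\<^sub>d quadratic_dioperad (E2, S')"
proof -
  note gen = free.ideal_gen_image[OF E1.F_carrier_ideal S S']
  have "dioperad_transport (quadratic_dioperad (E1, S)) (quadratic_dioperad (E2, S'))
      (\<lambda>\<tau>. Pow (Pow (carrier (sp (tree_sums E1) \<tau>)))) (\<lambda>_. image (image (lin_ext \<Theta>)))"
    unfolding quadratic_dioperad.simps
  proof (rule free.quot)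
    fix m n i assume mn: "(m, n) \<in> J0"
    show "ideal_gen (free_dioperad E1) S (m, n, i) \<subseteq> Pow (carrier (sp (tree_sums E1) (m, n, i)))"
      using gen(1)[OF _ _ mn] free.carrier_sub[OF mn] by (rule order_trans)
    show "image (lin_ext \<Theta>) ` ideal_gen (free_dioperad E1) S (m, n, i) = ideal_gen (free_dioperad E2) S' (m, n, i)"
      using gen(2)[OF _ _ mn] .
  qed
  then show ?thesis by (rule dioperad_transport.iso)
qed

end

section \<open>The generators and their duals\<close>

lemma permutes_2:
  assumes "\<sigma> permutes {1..(2::nat)}"
  shows "\<sigma> = id \<and> \<sigma> 1 = 1 \<or> \<sigma> = Transposition.transpose 1 2 \<and> \<sigma> 1 = 2"
proof -
  have "{1..2} = {1, 2::nat}" by auto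
  then have "\<sigma> = id \<or> \<sigma> = Transposition.transpose 1 2"
    using assms by (simp only: permutes_doubleton_iff)
  then show ?thesis by auto
qed

lemma module_dual: "module ground (dual_module (M :: ('k::field_char_0, 'v) module))"
proof (rule moduleI)
  show "abelian_group (dual_module M)"
  proof (rule abelian_groupI)
    fix f assume "f \<in> carrier (dual_module M)"
    then show "\<exists>g \<in> carrier (dual_module M). g \<oplus>\<^bsub>dual_module M\<^esub> f = \<zero>\<^bsub>dual_module M\<^esub>"
      by (intro bexI[of _ "\<lambda>x. - f x"]) (auto simp: dual_module_def)
  qed (auto simp: dual_module_def algebra_simps)
qed (auto simp: dual_module_def algebra_simps)

text \<open>The component is separated from its index, so that the linear algebra depends only on
  which of the three possible bases occurs (\<open>V_basis_alt\<close>).\<close>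

definition V_space :: "gen set \<Rightarrow> ('k::field_char_0, gen \<Rightarrow> 'k) module" where
  "V_space B = \<lparr>carrier = {f. \<forall>g. g \<notin> B \<longrightarrow> f g = 0}, monoid.mult = undefined,
        one = undefined, ring.zero = (\<lambda>_. 0), add = (\<lambda>f h g. f g + h g),
        module.smult = (\<lambda>c f g. c * f g)\<rparr>"

lemma V_space_simps [simp]:
  "f \<in> carrier (V_space B) \<longleftrightarrow> (\<forall>g. g \<notin> B \<longrightarrow> f g = 0)" "\<zero>\<^bsub>V_space B\<^esub> = (\<lambda>_. 0)"
  "f \<oplus>\<^bsub>V_space B\<^esub> h = (\<lambda>g. f g + h g)" "c \<odot>\<^bsub>V_space B\<^esub> f = (\<lambda>g. c * f g)"
  by (simp_all add: V_space_def)

lemma module_V_space: "module ground (V_space B :: ('k::field_char_0, gen \<Rightarrow> 'k) module)"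
proof (rule moduleI)
  show "abelian_group (V_space B :: ('k::field_char_0, gen \<Rightarrow> 'k) module)"
  proof (rule abelian_groupI)
    fix f :: "gen \<Rightarrow> 'k" assume "f \<in> carrier (V_space B)"
    then show "\<exists>g \<in> carrier (V_space B). g \<oplus>\<^bsub>V_space B\<^esub> f = \<zero>\<^bsub>V_space B\<^esub>"
      by (intro bexI[of _ "\<lambda>x. - f x"]) auto
  qed (auto simp: algebra_simps)
qed (auto simp: algebra_simps)

lemma V_gens_sp [simp]: "sp (V_gens d) \<tau> = V_space (V_basis d \<tau>)"
  by (simp add: V_gens_def V_space_def)

lemma V_gens_act: "act (V_gens d) (m, n, i) \<pi> \<sigma> f = (if (m, n) = (1, 2) \<and> \<sigma> 1 = 2 then f \<circ> swap_gen else f)"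
  by (simp add: V_gens_def)

lemma swap_gen_basis [simp]: "swap_gen g \<in> V_basis d (1, 2, i) \<longleftrightarrow> g \<in> V_basis d (1, 2, i)"
  by (cases g) (auto simp: V_basis.simps)

declare V_basis.simps [simp del]

lemma V_gens_act_closed:
  "f \<in> carrier (V_space (V_basis d (m, n, i))) \<Longrightarrow>
    act (V_gens d) (m, n, i) \<pi> \<sigma> f \<in> carrier (V_space (V_basis d (m, n, i)))"
  unfolding V_gens_act V_space_simps using swap_gen_basis[of _ d i] by (auto simp del: swap_gen_basis)

lemma graded_bimodule_V_gens: "graded_bimodule (V_gens d)"
  by (rule graded_bimodule.intro) (simp_all only: V_gens_sp V_gens_act_closed module_V_space)

section \<open>The generators of the quadratic dual\<close>

lemma dual_gens_sp: "sp (dual_gens E) (m, n, i) = dual_module (sp E (m, n, 1 + omega_deg m n - i))"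
  by (simp add: dual_gens_def tensor_Omega_def shift_bimodule_def dual_bimodule_def algebra_simps)

lemma dual_gens_act: "act (dual_gens E) (m, n, i) \<pi> \<sigma> f =
    (\<lambda>x. of_int (sign \<sigma>) * (if x \<in> carrier (sp E (m, n, 1 + omega_deg m n - i))
      then f (act E (m, n, 1 + omega_deg m n - i) (pinv \<pi>) (pinv \<sigma>) x) else 0))"
  by (simp add: dual_gens_def tensor_Omega_def shift_bimodule_def dual_bimodule_def dual_module_def
      Omega_def algebra_simps cong: if_cong)

text \<open>\<open>1 + omega_deg m n\<close> is 0 for (1, 2) and for (2, 0). What is left is the
  change of sign of degrees, which fixes degree 0 and turns \<open>d\<close> into
  \<open>- d\<close>.\<close>

lemma dual_basis:
  assumes "(m, n) \<in> J0"
  shows "V_basis d (m, n, 1 + omega_deg m n - i) = V_basis (- d) (m, n, i)"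
  by (auto simp: V_basis.simps omega_deg_def)

lemma unit_gen_mem: "(unit_gen g :: gen \<Rightarrow> 'k::field_char_0) \<in> carrier (V_space B) \<longleftrightarrow> g \<in> B"
  by (auto simp: unit_gen_def)

lemma dual_expand:
  assumes B: "B = {} \<or> B = {Mu, MuBar} \<or> B = {Nu}"
    and f: "f \<in> carrier (dual_module (V_space B))" and x: "x \<in> carrier (V_space B)"
  shows "f x = (\<Sum>g \<in> B. x g * f (unit_gen g :: gen \<Rightarrow> 'k::field_char_0))"
proof -
  have add: "y \<in> carrier (V_space B) \<Longrightarrow> z \<in> carrier (V_space B) \<Longrightarrow> f (\<lambda>g. y g + z g) = f y + f z" for y z
    using f by (auto simp: dual_module_def)
  have smult: "y \<in> carrier (V_space B) \<Longrightarrow> f (\<lambda>g. c * y g) = c * f y" for y c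
    using f by (auto simp: dual_module_def)
  consider "B = {}" | "B = {Mu, MuBar}" | "B = {Nu}" using B by blast
  then show ?thesis
  proof cases
    case 1
    then have "x = (\<lambda>g. 0 * x g)" using x by auto
    then have "f x = 0 * f x" using smult[OF x, of 0] by simp
    then show ?thesis using 1 by simp
  next
    case 2
    have "x = (\<lambda>g. x Mu * unit_gen Mu g + x MuBar * unit_gen MuBar g)"
    proof
      show "x g = x Mu * unit_gen Mu g + x MuBar * unit_gen MuBar g" for g
        using x 2 by (cases g) (auto simp: unit_gen_def)
    qed
    then have "f x = f (\<lambda>g. x Mu * unit_gen Mu g + x MuBar * unit_gen MuBar g)" by simp
    also have "\<dots> = x Mu * f (unit_gen Mu) + x MuBar * f (unit_gen MuBar)"
      using smult[of "unit_gen Mu" "x Mu"] smult[of "unit_gen MuBar" "x MuBar"] unit_gen_mem[of Mu B] unit_gen_mem[of MuBar B]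
      by (subst add) (auto simp: 2)
    finally show ?thesis using 2 by simp
  next
    case 3
    have "x = (\<lambda>g. x Nu * unit_gen Nu g)"
    proof
      show "x g = x Nu * unit_gen Nu g" for g
        using x 3 by (cases g) (auto simp: unit_gen_def)
    qed
    then have "f x = f (\<lambda>g. x Nu * unit_gen Nu g)" by simp
    also have "\<dots> = x Nu * f (unit_gen Nu)"
      using smult[of "unit_gen Nu" "x Nu"] unit_gen_mem[of Nu B] by (auto simp: 3)
    finally show ?thesis using 3 by simp
  qed
qed

definition gen_sign :: "gen \<Rightarrow> 'k::field_char_0" where
  "gen_sign g = (if g = MuBar then - 1 else 1)"

text \<open>
  Under the sign twist of \<open>E(1, 2)\<^sup>*\<close> the transposition maps \<open>\<mu>\<^sup>*\<close> to \<open>- \<mu>\<^sup>*\<close> precomposed with the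
  swap, so \<open>\<mu>\<close> and \<open>\<mu>-bar\<close> correspond to \<open>\<mu>\<^sup>*\<close> and to minus the functional dual to \<open>\<mu>-bar\<close>.
\<close>

definition undual :: "((gen \<Rightarrow> 'k::field_char_0) \<Rightarrow> 'k) \<Rightarrow> gen \<Rightarrow> 'k" where
  "undual f g = gen_sign g * f (unit_gen g)"

lemma dual_unit_zero:
  "f \<in> carrier (dual_module (V_space B)) \<Longrightarrow> g \<notin> B \<Longrightarrow> f (unit_gen g :: gen \<Rightarrow> 'k::field_char_0) = 0"
  using unit_gen_mem[of g B] by (auto simp: dual_module_def simp del: V_space_simps)

lemma bij_undual:
  fixes B :: "gen set"
  assumes B: "B = {} \<or> B = {Mu, MuBar} \<or> B = {Nu}"
  shows "bij_betw undual (carrier (dual_module (V_space B))) (carrier (V_space B :: ('k::field_char_0, gen \<Rightarrow> 'k) module))"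
proof (rule bij_betw_imageI)
  have sq: "gen_sign g * (gen_sign g * c) = c" for g and c :: 'k by (simp add: gen_sign_def)
  show "inj_on undual (carrier (dual_module (V_space B :: ('k, gen \<Rightarrow> 'k) module)))"
  proof (rule inj_onI, rule ext)
    fix f h :: "(gen \<Rightarrow> 'k) \<Rightarrow> 'k" and x :: "gen \<Rightarrow> 'k"
    assume f: "f \<in> carrier (dual_module (V_space B))" and h: "h \<in> carrier (dual_module (V_space B))"
      and eq: "undual f = undual h"
    have "f (unit_gen g) = h (unit_gen g)" for g
      using fun_cong[OF eq, of g] by (auto simp: undual_def gen_sign_def split: if_splits)
    then show "f x = h x"
      using dual_expand[OF B f, of x] dual_expand[OF B h, of x] f h
      by (cases "x \<in> carrier (V_space B)") (auto simp: dual_module_def)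
  qed
  show "undual ` carrier (dual_module (V_space B)) = carrier (V_space B :: ('k, gen \<Rightarrow> 'k) module)"
  proof (intro equalityI subsetI)
    fix y assume "y \<in> undual ` carrier (dual_module (V_space B :: ('k, gen \<Rightarrow> 'k) module))"
    then obtain f where f: "f \<in> carrier (dual_module (V_space B :: ('k, gen \<Rightarrow> 'k) module))" "y = undual f" by blast
    then show "y \<in> carrier (V_space B)" using dual_unit_zero[OF f(1)] by (simp add: undual_def)
  next
    fix y :: "gen \<Rightarrow> 'k" assume y: "y \<in> carrier (V_space B)"
    \<comment> \<open>The preimage of \<open>y\<close> under \<open>undual\<close>: its values on
      the basis are \<open>gen_sign g * y g\<close>, the sign being its own inverse. Off the space
      it is 0, as \<open>dual_module\<close> prescribes.\<close>
    define f where "f x = (if x \<in> carrier (V_space B) then \<Sum>g \<in> B. x g * (gen_sign g * y g) else 0)" for x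
    have "f \<in> carrier (dual_module (V_space B))"
      by (auto simp: f_def dual_module_def sum.distrib distrib_right sum_distrib_left mult.assoc)
    moreover have "undual f = y"
    proof
      fix g
      have "finite B" using B by auto
      show "undual f g = y g"
      proof (cases "g \<in> B")
        case True
        then have "f (unit_gen g) = (\<Sum>h \<in> B. if h = g then gen_sign g * y g else 0)"
          unfolding f_def by (simp only: unit_gen_mem if_True) (auto simp: unit_gen_def intro!: sum.cong)
        then show ?thesis using True \<open>finite B\<close> by (simp add: undual_def sq)
      next
        case False
        then have "unit_gen g \<notin> carrier (V_space B :: ('k, gen \<Rightarrow> 'k) module)" using unit_gen_mem[of g B] by blast
        then have "f (unit_gen g) = 0" unfolding f_def by (rule if_not_P)
        then show ?thesis using y False by (simp add: undual_def)
      qed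
    qed
    ultimately show "y \<in> undual ` carrier (dual_module (V_space B))" by blast
  qed
qed

lemma V_basis_alt: "V_basis d \<tau> = {} \<or> V_basis d \<tau> = {Mu, MuBar} \<or> V_basis d \<tau> = {Nu}"
  by (cases \<tau>) (auto simp: V_basis.simps)

lemma unit_gen_swap: "unit_gen g \<circ> swap_gen = unit_gen (swap_gen g)"
proof
  show "(unit_gen g \<circ> swap_gen) h = unit_gen (swap_gen g) h" for h
    by (cases g; cases h) (simp_all add: unit_gen_def)
qed

text \<open>The sign of \<open>Omega\<close> matters only for the transposition in arity (1, 2),
  where it is absorbed by \<open>gen_sign\<close> taking opposite values on \<open>Mu\<close> and
  \<open>MuBar\<close>.\<close>

lemma undual_act:
  assumes mn: "(m, n) \<in> J0" and f: "f \<in> carrier (sp (dual_gens (V_gens d)) (m, n, i))"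
    and p: "\<pi> permutes {1..m}" "\<sigma> permutes {1..n}"
  shows "undual (act (dual_gens (V_gens d)) (m, n, i) \<pi> \<sigma> f) = act (V_gens (- d)) (m, n, i) \<pi> \<sigma> (undual f :: gen \<Rightarrow> 'k::field_char_0)"
proof
  fix g
  let ?B = "V_basis (- d) (m, n, i)"
  have f': "f \<in> carrier (dual_module (V_space ?B))"
    using f by (simp only: dual_gens_sp V_gens_sp dual_basis[OF mn])
  have act: "act (dual_gens (V_gens d)) (m, n, i) \<pi> \<sigma> f (unit_gen g) =
      of_int (sign \<sigma>) * (if g \<in> ?B then f (if (m, n) = (1, 2) \<and> pinv \<sigma> 1 = 2 then unit_gen (swap_gen g) else unit_gen g) else 0)"
    unfolding dual_gens_act V_gens_act V_gens_sp dual_basis[OF mn] unit_gen_mem by (simp add: unit_gen_swap)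
  show "undual (act (dual_gens (V_gens d)) (m, n, i) \<pi> \<sigma> f) g = act (V_gens (- d)) (m, n, i) \<pi> \<sigma> (undual f) g"
  proof (cases "g \<in> ?B")
    case False
    moreover have "swap_gen g \<notin> ?B" if "(m, n) = (1, 2)"
      using swap_gen_basis[of g "- d" i] False that by simp
    ultimately show ?thesis
      using dual_unit_zero[OF f', of g] dual_unit_zero[OF f', of "swap_gen g"]
      by (auto simp: undual_def act V_gens_act)
  next
    case True
    then consider "m = 1" "n = 2" "g = Mu \<or> g = MuBar" | "m = 2" "n = 0" "g = Nu"
      by (auto simp: V_basis.simps split: if_splits)
    then show ?thesis
    proof cases
      case 1
      then have "\<sigma> = id \<and> \<sigma> 1 = 1 \<or> \<sigma> = Transposition.transpose 1 2 \<and> \<sigma> 1 = 2"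
        using permutes_2 p(2) by blast
      then show ?thesis
        using 1 True unfolding undual_def act V_gens_act
        by (auto simp: gen_sign_def sign_swap_id inv_swap_id)
    next
      case 2
      then have "\<sigma> = id" using p(2) by simp
      then show ?thesis using 2 True unfolding undual_def act V_gens_act by simp
    qed
  qed
qed

lemma graded_bimodule_dual_gens: "graded_bimodule (dual_gens (V_gens d) :: ('k::field_char_0, (gen \<Rightarrow> 'k) \<Rightarrow> 'k) bimodule)"
proof (rule graded_bimodule.intro)
  fix m n i assume mn: "(m, n) \<in> J0"
  show "module ground (sp (dual_gens (V_gens d) :: ('k::field_char_0, (gen \<Rightarrow> 'k) \<Rightarrow> 'k) bimodule) (m, n, i))"
    by (simp only: dual_gens_sp module_dual)
  fix \<pi> \<sigma> and f :: "(gen \<Rightarrow> 'k) \<Rightarrow> 'k"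
  assume "\<pi> permutes {1..m}" "\<sigma> permutes {1..n}"
    and f: "f \<in> carrier (sp (dual_gens (V_gens d) :: ('k::field_char_0, (gen \<Rightarrow> 'k) \<Rightarrow> 'k) bimodule) (m, n, i))"
  let ?B = "V_basis (- d) (m, n, i)"
  have act: "act (dual_gens (V_gens d)) (m, n, i) \<pi> \<sigma> f =
      (\<lambda>x. of_int (sign \<sigma>) * (if x \<in> carrier (V_space ?B)
      then f (if (m, n) = (1, 2) \<and> pinv \<sigma> 1 = 2 then x \<circ> swap_gen else x) else 0))"
    unfolding dual_gens_act V_gens_act V_gens_sp dual_basis[OF mn] ..
  have "x \<in> carrier (V_space ?B) \<Longrightarrow> m = 1 \<Longrightarrow> n = 2 \<Longrightarrow> x \<circ> swap_gen \<in> carrier (V_space ?B)" for x :: "gen \<Rightarrow> 'k"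
    \<comment> \<open>The action inspects a permutation only at 1, so the constant 2 stands in for
      the transposition.\<close>
    using V_gens_act_closed[of x "- d" 1 2 i id "\<lambda>_. 2"] by (simp only: V_gens_act) auto
  then show "act (dual_gens (V_gens d)) (m, n, i) \<pi> \<sigma> f \<in> carrier (sp (dual_gens (V_gens d)) (m, n, i))"
    using f unfolding act unfolding dual_gens_sp V_gens_sp dual_basis[OF mn]
    by (auto simp: dual_module_def o_def distrib_left)
qed

interpretation V: graded_bimodule "V_gens d" for d
  by (rule graded_bimodule_V_gens)

interpretation dual: bimodule_iso "dual_gens (V_gens d) :: ('k::field_char_0, (gen \<Rightarrow> 'k) \<Rightarrow> 'k) bimodule" "V_gens (- d)" undual
  for d
proof -
  show "bimodule_iso (dual_gens (V_gens d) :: ('k::field_char_0, (gen \<Rightarrow> 'k) \<Rightarrow> 'k) bimodule) (V_gens (- d)) undual"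
  proof (intro bimodule_iso.intro bimodule_iso_axioms.intro)
    show "graded_bimodule (dual_gens (V_gens d) :: ('k::field_char_0, (gen \<Rightarrow> 'k) \<Rightarrow> 'k) bimodule)"
      by (rule graded_bimodule_dual_gens)
    show "graded_bimodule (V_gens (- d) :: ('k, gen \<Rightarrow> 'k) bimodule)" by (rule graded_bimodule_V_gens)
    fix m n i assume mn: "(m, n) \<in> J0"
    show "bij_betw undual (carrier (sp (dual_gens (V_gens d)) (m, n, i)))
        (carrier (sp (V_gens (- d) :: ('k, gen \<Rightarrow> 'k) bimodule) (m, n, i)))"
      unfolding dual_gens_sp V_gens_sp dual_basis[OF mn] using V_basis_alt by (rule bij_undual)
  qed (auto simp: undual_act, auto simp: dual_gens_sp undual_def fun_eq_iff dual_module_def algebra_simps)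
qed

section \<open>Trees with two internal vertices\<close>

text \<open>
  The edge between the two vertices ends at input \<open>i\<close> of the first one, and the other input of the
  first vertex is \<open>3 - i\<close>. In \<open>tree21\<close> the first vertex is joined to root \<open>r\<close>, and the inner
  edge starts at output \<open>p\<close> of the second vertex.
\<close>

definition tree13 :: "'e \<Rightarrow> 'e \<Rightarrow> nat \<Rightarrow> nat \<Rightarrow> nat \<Rightarrow> nat \<Rightarrow> 'e dtree" where
  "tree13 f g i a b c = DTree [Vertex 1 2 0 f, Vertex 1 2 0 g]
    {(Out 0 1, Root 1), (Out 1 1, In 0 i), (Leaf a, In 0 (3 - i)), (Leaf b, In 1 1), (Leaf c, In 1 2)}"

definition tree21 :: "int \<Rightarrow> 'e \<Rightarrow> 'e \<Rightarrow> nat \<Rightarrow> nat \<Rightarrow> nat \<Rightarrow> 'e dtree" where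
  "tree21 d f h i r p = DTree [Vertex 1 2 0 f, Vertex 2 0 d h]
    {(Out 0 1, Root r), (Out 1 p, In 0 i), (Out 1 (3 - p), Root (3 - r)), (Leaf 1, In 0 (3 - i))}"

abbreviation one_two :: "nat \<Rightarrow> bool" where
  "one_two i \<equiv> i = 1 \<or> i = 2"

text \<open>Listed explicitly so that statements about orders of three labels split into six
  cases.\<close>

definition word3 :: "nat \<Rightarrow> nat \<Rightarrow> nat \<Rightarrow> bool" where
  "word3 a b c \<longleftrightarrow> (a, b, c) \<in> {(1, 2, 3), (1, 3, 2), (2, 1, 3), (2, 3, 1), (3, 1, 2), (3, 2, 1)}"

lemma word3I:
  assumes "a \<in> {1..3}" "b \<in> {1..3}" "c \<in> {1..3}" "a \<noteq> b" "a \<noteq> c" "b \<noteq> c"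
  shows "word3 a b c"
proof -
  have "x = 1 \<or> x = 2 \<or> x = 3" if "x \<in> {1..3}" for x :: nat using that by auto
  from this[OF assms(1)] this[OF assms(2)] this[OF assms(3)] show ?thesis
    using assms(4-6) unfolding word3_def by (elim disjE) simp_all
qed

lemma verts_tree [simp]:
  "verts (tree13 f g i a b c) = [Vertex 1 2 0 f, Vertex 1 2 0 g]"
  "verts (tree21 d f h i r p) = [Vertex 1 2 0 f, Vertex 2 0 d h]"
  by (simp_all add: tree13_def tree21_def)

lemma edges_tree:
  "edges (tree13 f g i a b c) =
    {(Out 0 1, Root 1), (Out 1 1, In 0 i), (Leaf a, In 0 (3 - i)), (Leaf b, In 1 1), (Leaf c, In 1 2)}"
  "edges (tree21 d f h i r p) =
    {(Out 0 1, Root r), (Out 1 p, In 0 i), (Out 1 (3 - p), Root (3 - r)), (Leaf 1, In 0 (3 - i))}"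
  by (simp_all add: tree13_def tree21_def)

text \<open>The parameters can be read off from the edges. This is the uniqueness that makes the
  sums in \<open>omega_coeff\<close> and \<open>eval_oriented\<close> have at most one term.\<close>

lemma edges_tree13_eq:
  assumes "one_two i" "one_two i'" "word3 a b c" "word3 a' b' c'"
  shows "edges (tree13 f g i a b c) = edges (tree13 f' g' i' a' b' c') \<longleftrightarrow> i = i' \<and> a = a' \<and> b = b' \<and> c = c'"
    (is "?E = ?E' \<longleftrightarrow> _")
proof
  assume eq: "?E = ?E'"
  have "(Out 1 1, In 0 i) \<in> ?E'" "(Leaf a, In 0 (3 - i)) \<in> ?E'" "(Leaf b, In 1 1) \<in> ?E'" "(Leaf c, In 1 2) \<in> ?E'"
    unfolding eq[symmetric] by (simp_all add: edges_tree)
  then show "i = i' \<and> a = a' \<and> b = b' \<and> c = c'"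
    using assms(1,2) by (auto simp: edges_tree)
qed (simp add: edges_tree)

lemma edges_tree21_eq:
  assumes "one_two i" "one_two i'" "one_two r" "one_two r'" "one_two p" "one_two p'"
  shows "edges (tree21 d f h i r p) = edges (tree21 d' f' h' i' r' p') \<longleftrightarrow> i = i' \<and> r = r' \<and> p = p'"
    (is "?E = ?E' \<longleftrightarrow> _")
proof
  assume eq: "?E = ?E'"
  have "(Out 1 p, In 0 i) \<in> ?E'" "(Out 0 1, Root r) \<in> ?E'"
    unfolding eq[symmetric] by (simp_all add: edges_tree)
  then show "i = i' \<and> r = r' \<and> p = p'"
    using assms by (auto simp: edges_tree)
qed (simp add: edges_tree)

lemma oriented_tree:
  "oriented (tree13 f g i a b c)" "\<not> oriented (swap_verts 0 (tree13 f g i a b c))"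
  "oriented (tree21 d f h i r p)" "\<not> oriented (swap_verts 0 (tree21 d f h i r p))"
  by (auto simp: oriented_def edges_tree map_edges_def image_iff)

lemma swap_verts_twice:
  assumes "length (verts t) = 2"
  shows "swap_verts 0 (swap_verts 0 t) = t"
proof (rule dtree_eqI)
  obtain v w where "verts t = [v, w]"
    using assms by (auto simp: length_Suc_conv numeral_2_eq_2)
  then show "verts (swap_verts 0 (swap_verts 0 t)) = verts t" by simp
  let ?\<tau> = "Transposition.transpose 0 (Suc 0)"
  have "reindex_src ?\<tau> \<circ> reindex_src ?\<tau> = id" "reindex_tgt ?\<tau> \<circ> reindex_tgt ?\<tau> = id"
    by (rule ext, case_tac x; simp)+
  then show "edges (swap_verts 0 (swap_verts 0 t)) = edges t"
    by (simp add: map_edges_comp[OF swap_verts_simps(2)] map_edges_id)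
qed

lemma orient_tree [simp]:
  "orient (tree13 f g i a b c) = tree13 f g i a b c"
  "orient (swap_verts 0 (tree13 f g i a b c)) = tree13 f g i a b c"
  "orient (tree21 d f h i r p) = tree21 d f h i r p"
  "orient (swap_verts 0 (tree21 d f h i r p)) = tree21 d f h i r p"
  by (simp_all add: orient_def oriented_tree swap_verts_twice)

section \<open>Compositions and group actions on trees with two vertices\<close>

lemma edges_graft': "edges (graft m1 n2 i j t1 t2) =
    (\<lambda>(s, r). (graft_src1 n2 i s, graft_tgt1 j r)) ` {e \<in> edges t1. fst e \<noteq> Leaf i} \<union>
    (\<lambda>(s, r). (graft_src2 (length (verts t1)) i s, graft_tgt2 (length (verts t1)) m1 j r)) ` {e \<in> edges t2. snd e \<noteq> Root j} \<union>
    (\<lambda>(s, r). (graft_src2 (length (verts t1)) i s, graft_tgt1 j r)) ` ({s. (s, Root j) \<in> edges t2} \<times> {r. (Leaf i, r) \<in> edges t1})"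
  unfolding edges_graft by (intro arg_cong2[where f = "(\<union>)"]) force+

lemma Collect_insert:
  "{x \<in> insert a A. P x} = (if P a then insert a {x \<in> A. P x} else {x \<in> A. P x})"
  by auto

lemma edges_corolla:
  "edges (corolla (Vertex 1 2 e f)) = {(Out 0 1, Root 1), (Leaf 1, In 0 1), (Leaf 2, In 0 2)}"
  "edges (corolla (Vertex 2 0 e f)) = {(Out 0 1, Root 1), (Out 0 2, Root 2)}"
proof -
  have "{Suc 0..2} = {1, 2}" by auto
  then show "edges (corolla (Vertex 1 2 e f)) = {(Out 0 1, Root 1), (Leaf 1, In 0 1), (Leaf 2, In 0 2)}"
    "edges (corolla (Vertex 2 0 e f)) = {(Out 0 1, Root 1), (Out 0 2, Root 2)}"
    by (auto simp: corolla_def)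
qed

lemma verts_corolla [simp]: "verts (corolla v) = [v]"
  by (simp add: corolla_def)

text \<open>The word starts with the leaf at the head vertex: composing at input 1 leaves it the
  last label 3, composing at input 2 the first label 1.\<close>

lemma graft_tree13:
  "graft 1 2 1 1 (corolla (Vertex 1 2 0 f)) (corolla (Vertex 1 2 0 g)) = tree13 f g 1 3 1 2"
  "graft 1 2 2 1 (corolla (Vertex 1 2 0 f)) (corolla (Vertex 1 2 0 g)) = tree13 f g 2 1 2 3"
  by (rule dtree_eqI, simp, simp only: edges_graft' edges_corolla Collect_insert, force simp: edges_tree)+

text \<open>The head vertex has one output, which takes over the label of the plugged root
  \<open>p\<close>, and the other root keeps its label; hence \<open>r = p\<close>.\<close>

lemma graft_tree21:
  assumes "one_two i" "one_two p"
  shows "graft 1 0 i p (corolla (Vertex 1 2 0 f)) (corolla (Vertex 2 0 d h)) = tree21 d f h i p p"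
proof (rule dtree_eqI)
  show "edges (graft 1 0 i p (corolla (Vertex 1 2 0 f)) (corolla (Vertex 2 0 d h))) = edges (tree21 d f h i p p)"
    unfolding edges_graft' edges_corolla Collect_insert using assms
    by (elim disjE; force simp: edges_tree)
qed simp

lemma relabel_tree13:
  "relabel id \<sigma> (tree13 f g i a b c) = tree13 f g i (pinv \<sigma> a) (pinv \<sigma> b) (pinv \<sigma> c)"
  by (rule dtree_eqI) (simp_all add: edges_tree map_edges_def)

lemma permutes_2_minus: "\<pi> permutes {1..(2::nat)} \<Longrightarrow> one_two r \<Longrightarrow> \<pi> (3 - r) = 3 - \<pi> r \<and> one_two (\<pi> r)"
  using permutes_2[of \<pi>] by auto

lemma relabel_tree21:
  assumes "\<pi> permutes {1..2}" "one_two r"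
  shows "relabel \<pi> id (tree21 d f h i r p) = tree21 d f h i (\<pi> r) p"
  using permutes_2_minus[OF assms] by (intro dtree_eqI) (simp_all add: edges_tree map_edges_def)

text \<open>At the head vertex a transposition moves the inner edge, and the leaf follows because it
  sits at input \<open>3 - i\<close>. At the other vertex the leaves \<open>b\<close> and
  \<open>c\<close> change places.\<close>

lemma renumber_tree13:
  assumes "one_two i" "\<sigma> permutes {1..2}"
  shows "renumber E 0 id \<sigma> (tree13 f g i a b c) = tree13 (act E (1, 2, 0) id \<sigma> f) g (\<sigma> i) a b c"
    "renumber E 1 id \<sigma> (tree13 f g i a b c)
      = tree13 f (act E (1, 2, 0) id \<sigma> g) i a (if \<sigma> 1 = 1 then b else c) (if \<sigma> 1 = 1 then c else b)"
proof -
  consider "\<sigma> = id" | "\<sigma> = Transposition.transpose 1 2" using permutes_2[OF assms(2)] by blast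
  then have "edges (renumber E 0 id \<sigma> (tree13 f g i a b c)) = edges (tree13 (act E (1, 2, 0) id \<sigma> f) g (\<sigma> i) a b c) \<and>
    edges (renumber E 1 id \<sigma> (tree13 f g i a b c))
      = edges (tree13 f (act E (1, 2, 0) id \<sigma> g) i a (if \<sigma> 1 = 1 then b else c) (if \<sigma> 1 = 1 then c else b))"
  proof cases
    case 1
    then show ?thesis by (simp add: edges_tree map_edges_def)
  next
    case 2
    then show ?thesis using assms(1)
      by (elim disjE) (simp_all add: edges_tree map_edges_def inv_swap_id insert_commute)
  qed
  then show "renumber E 0 id \<sigma> (tree13 f g i a b c) = tree13 (act E (1, 2, 0) id \<sigma> f) g (\<sigma> i) a b c"
    "renumber E 1 id \<sigma> (tree13 f g i a b c)
      = tree13 f (act E (1, 2, 0) id \<sigma> g) i a (if \<sigma> 1 = 1 then b else c) (if \<sigma> 1 = 1 then c else b)"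
    by (auto intro!: dtree_eqI)
qed

lemma renumber_tree21:
  assumes "one_two i" "one_two p" "\<sigma> permutes {1..2}"
  shows "renumber E 0 id \<sigma> (tree21 d f h i r p) = tree21 d (act E (1, 2, 0) id \<sigma> f) h (\<sigma> i) r p"
    "renumber E 1 \<sigma> id (tree21 d f h i r p) = tree21 d f (act E (2, 0, d) \<sigma> id h) i r (\<sigma> p)"
proof -
  consider "\<sigma> = id" | "\<sigma> = Transposition.transpose 1 2" using permutes_2[OF assms(3)] by blast
  then have "edges (renumber E 0 id \<sigma> (tree21 d f h i r p)) = edges (tree21 d (act E (1, 2, 0) id \<sigma> f) h (\<sigma> i) r p) \<and>
    edges (renumber E 1 \<sigma> id (tree21 d f h i r p)) = edges (tree21 d f (act E (2, 0, d) \<sigma> id h) i r (\<sigma> p))"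
  proof cases
    case 1
    then show ?thesis by (simp add: edges_tree map_edges_def)
  next
    case 2
    then show ?thesis using assms(1,2)
      by (elim disjE) (simp_all add: edges_tree map_edges_def inv_swap_id insert_commute)
  qed
  then show "renumber E 0 id \<sigma> (tree21 d f h i r p) = tree21 d (act E (1, 2, 0) id \<sigma> f) h (\<sigma> i) r p"
    "renumber E 1 \<sigma> id (tree21 d f h i r p) = tree21 d f (act E (2, 0, d) \<sigma> id h) i r (\<sigma> p)"
    by (auto intro!: dtree_eqI)
qed

section \<open>Classification of the trees of arities (1, 3) and (2, 1)\<close>

lemma sources_two: "sources n [v, w] = Leaf ` {1..n} \<union> Out 0 ` {1..outs v} \<union> Out 1 ` {1..outs w}"
  and targets_two: "targets m [v, w] = Root ` {1..m} \<union> In 0 ` {1..ins v} \<union> In 1 ` {1..ins w}"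
  by (auto simp: sources_def targets_def lessThan_Suc)

text \<open>Such an edge with its two ends would be a component without internal vertices.\<close>

lemma no_leaf_root:
  assumes t: "is_tree m n t" "verts t \<noteq> []"
  shows "(Leaf l, Root r) \<notin> edges t"
proof
  assume e: "(Leaf l, Root r) \<in> edges t"
  have b: "bijrel (sources n (verts t)) (targets m (verts t)) (edges t)" using t(1) by (simp add: is_tree_iff)
  have "IntN 0 \<in> {LeafN l, RootN r}"
  proof (rule is_tree_closed[OF t(1), of "LeafN l"])
    show "LeafN l \<in> nodes m n t"
      using tail_in_nodes[OF bijrelD(1)[OF b e], of m] by simp
    show "IntN 0 \<in> nodes m n t" using t(2) by (simp add: nodes_def)
    fix s r' assume s: "(s, r') \<in> edges t"
    show "edge_tail s \<in> {LeafN l, RootN r} \<longleftrightarrow> edge_head r' \<in> {LeafN l, RootN r}"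
    proof (cases "s = Leaf l \<or> r' = Root r")
      case True
      then have "s = Leaf l" "r' = Root r" using bijrelD(5,6)[OF b] s e by blast+
      then show ?thesis by simp
    next
      case False
      then show ?thesis by (cases s; cases r') auto
    qed
  qed simp
  then show False by simp
qed

text \<open>Let \<open>x\<close> be the vertex at the root. Connectedness forces the output of the
  other vertex \<open>y\<close> into \<open>x\<close>, and the three inputs left over belong to the
  leaves. The two alternatives are \<open>x = 0\<close> and \<open>x = 1\<close>.\<close>

lemma classify_13:
  assumes t: "is_tree 1 3 t" and vs: "verts t = [Vertex 1 2 0 f, Vertex 1 2 0 g]"
  shows "\<exists>i a b c. one_two i \<and> word3 a b c \<and> (t = tree13 f g i a b c \<or> t = swap_verts 0 (tree13 g f i a b c))"
proof -
  let ?E = "edges t"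
  have b: "bijrel (sources 3 (verts t)) (targets 1 (verts t)) ?E" using t by (simp add: is_tree_iff)
  have S: "s \<in> sources 3 (verts t) \<longleftrightarrow> (\<exists>l \<in> {1..3}. s = Leaf l) \<or> s = Out 0 1 \<or> s = Out 1 1" for s
    by (auto simp: sources_two vs)
  have 12: "{Suc 0..2} = {Suc 0, 2}" by auto
  have T: "r \<in> targets 1 (verts t) \<longleftrightarrow> r = Root 1 \<or> r = In 0 1 \<or> r = In 0 2 \<or> r = In 1 1 \<or> r = In 1 2" for r
    by (auto simp: targets_two vs 12)
  obtain s0 where s0: "(s0, Root 1) \<in> ?E" using bijrelD(4)[OF b, of "Root 1"] T by blast
  have "s0 \<noteq> Leaf l" for l using no_leaf_root[OF t] s0 vs by auto
  then obtain x where x: "s0 = Out x 1" "x = 0 \<or> x = 1" using S[of s0] bijrelD(1)[OF b s0] by auto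
  define y where "y = 1 - x"
  have y: "y = 0 \<or> y = 1" "x \<noteq> y" using x by (auto simp: y_def)
  have S': "s \<in> sources 3 (verts t) \<Longrightarrow> (\<exists>l \<in> {1..3}. s = Leaf l) \<or> s = Out x 1 \<or> s = Out y 1" for s
    using S[of s] x y by auto
  have T': "r \<in> targets 1 (verts t) \<longleftrightarrow> r = Root 1 \<or> r = In x 1 \<or> r = In x 2 \<or> r = In y 1 \<or> r = In y 2" for r
    using T[of r] x y by auto
  have ex: "(Out x 1, Root 1) \<in> ?E" using s0 x by simp
  have ux: "r = Root 1" if "(Out x 1, r) \<in> ?E" for r using bijrelD(5)[OF b that ex] .
  have "Out y 1 \<in> sources 3 (verts t)" using S y by auto
  then obtain r1 where r1: "(Out y 1, r1) \<in> ?E" using bijrelD(3)[OF b] by blast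
  have uy: "r = r1" if "(Out y 1, r) \<in> ?E" for r using bijrelD(5)[OF b that r1] .
  have "r1 \<noteq> Root 1" using bijrelD(6)[OF b ex] r1 y by auto
  moreover have "r1 \<noteq> In y q" for q
  proof
    assume r1y: "r1 = In y q"
    \<comment> \<open>If \<open>y\<close> fed its output into itself, it would form a component
      avoiding \<open>x\<close> together with the leaves at its inputs.\<close>
    let ?Z = "{u. u = IntN y \<or> (\<exists>l q. u = LeafN l \<and> (Leaf l, In y q) \<in> ?E)}"
    have "IntN x \<in> ?Z"
    proof (rule is_tree_closed[OF t, of "IntN y"])
      show "IntN y \<in> nodes 1 3 t" "IntN x \<in> nodes 1 3 t" using x y by (auto simp: nodes_def vs)
      fix s r assume e: "(s, r) \<in> ?E"
      show "edge_tail s \<in> ?Z \<longleftrightarrow> edge_head r \<in> ?Z"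
      proof (cases s)
        case (Leaf l)
        show ?thesis
        proof
          assume "edge_tail s \<in> ?Z"
          then obtain q where "(Leaf l, In y q) \<in> ?E" using Leaf by auto
          then have "r = In y q" using e Leaf bijrelD(5)[OF b] by blast
          then show "edge_head r \<in> ?Z" by simp
        next
          assume "edge_head r \<in> ?Z"
          then show "edge_tail s \<in> ?Z" using e Leaf by (cases r) auto
        qed
      next
        case (Out z p)
        then consider "s = Out x 1" | "s = Out y 1" using S' bijrelD(1)[OF b e] by blast
        then show ?thesis
        proof cases
          case 1
          then have "r = Root 1" using e ux by blast
          then show ?thesis using 1 y by simp
        next
          case 2
          then have "r = In y q" using e uy r1y by blast
          then show ?thesis using 2 by simp
        qed
      qed
    qed simp
    then show False using y by simp
  qed
  ultimately obtain i where i: "r1 = In x i" "one_two i" using T' bijrelD(2)[OF b r1] by blast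
  have leaf: "\<exists>l \<in> {1..3}. (Leaf l, r) \<in> ?E" if r: "r \<in> targets 1 (verts t)" "r \<noteq> Root 1" "r \<noteq> In x i" for r
  proof -
    obtain s where s: "(s, r) \<in> ?E" using bijrelD(4)[OF b r(1)] by blast
    then have "s \<noteq> Out x 1" "s \<noteq> Out y 1" using ux uy r i by auto
    then show ?thesis using S' bijrelD(1)[OF b s] s by blast
  qed
  have i': "In x (3 - i) \<in> targets 1 (verts t)" "3 - i \<noteq> i"
    using T'[of "In x (3 - i)"] i(2) by (elim disjE, simp_all)+
  obtain a where a: "a \<in> {1..3}" "(Leaf a, In x (3 - i)) \<in> ?E" using leaf[OF i'(1)] i' by auto
  obtain b' where b': "b' \<in> {1..3}" "(Leaf b', In y 1) \<in> ?E" using leaf[of "In y 1"] T' y by auto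
  obtain c where c: "c \<in> {1..3}" "(Leaf c, In y 2) \<in> ?E" using leaf[of "In y 2"] T' y by auto
  have "a \<noteq> b'" "a \<noteq> c" "b' \<noteq> c"
    using bijrelD(5)[OF b a(2), of "In y 1"] bijrelD(5)[OF b a(2), of "In y 2"]
      bijrelD(5)[OF b b'(2), of "In y 2"] b'(2) c(2) y by auto
  then have word: "word3 a b' c" using a b' c by (intro word3I)
  have E: "?E = {(Out x 1, Root 1), (Out y 1, In x i), (Leaf a, In x (3 - i)), (Leaf b', In y 1), (Leaf c, In y 2)}" (is "_ = ?R")
  proof (intro equalityI subsetI)
    fix e assume e: "e \<in> ?E"
    obtain s r where sr: "e = (s, r)" by (cases e)
    then have "r = Root 1 \<or> r = In x i \<or> r = In x (3 - i) \<or> r = In y 1 \<or> r = In y 2"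
      using T'[of r] bijrelD(2)[OF b, of s r] e i(2) by auto
    then show "e \<in> ?R"
      using bijrelD(6)[OF b _ ex, of s] bijrelD(6)[OF b _ r1, of s] bijrelD(6)[OF b _ a(2), of s]
        bijrelD(6)[OF b _ b'(2), of s] bijrelD(6)[OF b _ c(2), of s] e sr i(1) by auto
  next
    fix e assume "e \<in> ?R"
    then show "e \<in> ?E" using ex r1 i(1) a(2) b'(2) c(2) by auto
  qed
  show ?thesis
  proof (cases "x = 0")
    case True
    then have "t = tree13 f g i a b' c"
      using E vs by (intro dtree_eqI) (simp_all add: edges_tree y_def)
    then show ?thesis using i(2) word by blast
  next
    case False
    then have "x = 1" "y = 0" using x y by auto
    then have "t = swap_verts 0 (tree13 g f i a b' c)"
      using E vs by (intro dtree_eqI) (simp_all add: edges_tree map_edges_def)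
    then show ?thesis using i(2) word by blast
  qed
qed

text \<open>\<open>x\<close> and \<open>y\<close> are the positions of the vertices of arities (1,
  2) and (2, 0), so that both orders are treated at once. Connectedness forces the output of
  \<open>x\<close> to a root; then \<open>y\<close> serves the other root and one input of
  \<open>x\<close>.\<close>

lemma classify_21:
  fixes x y :: nat
  assumes t: "is_tree 2 1 t"
    and vs: "verts t = [Vertex 1 2 0 f, Vertex 2 0 d h] \<and> x = 0 \<and> y = 1 \<or> verts t = [Vertex 2 0 d h, Vertex 1 2 0 f] \<and> x = 1 \<and> y = (0::nat)"
  shows "\<exists>i r p. one_two i \<and> one_two r \<and> one_two p \<and> (t = tree21 d f h i r p \<or> t = swap_verts 0 (tree21 d f h i r p))"
proof -
  let ?E = "edges t"
  have b: "bijrel (sources 1 (verts t)) (targets 2 (verts t)) ?E" using t by (simp add: is_tree_iff)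
  have 12: "{Suc 0..2} = {Suc 0, 2}" by auto
  have S: "s \<in> sources 1 (verts t) \<longleftrightarrow> s = Leaf 1 \<or> s = Out x 1 \<or> s = Out y 1 \<or> s = Out y 2" for s
    using vs by (elim disjE) (auto simp: sources_two 12)
  have T: "r \<in> targets 2 (verts t) \<longleftrightarrow> r = Root 1 \<or> r = Root 2 \<or> r = In x 1 \<or> r = In x 2" for r
    using vs by (elim disjE) (auto simp: targets_two 12)
  have xy: "x \<noteq> y" "x < 2" "y < 2" using vs by auto
  have noleaf: "(Leaf l, Root r) \<notin> ?E" for l r using no_leaf_root[OF t] vs by auto
  have "Out x 1 \<in> sources 1 (verts t)" using S by blast
  then obtain r1 where r1: "(Out x 1, r1) \<in> ?E" using bijrelD(3)[OF b] by blast
  have ux: "r = r1" if "(Out x 1, r) \<in> ?E" for r using bijrelD(5)[OF b that r1] .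
  have "r1 \<noteq> In x q" for q
  proof
    assume r1x: "r1 = In x q"
    have root: "\<exists>p. (p = 1 \<or> p = 2) \<and> (Out y p, Root r) \<in> ?E" if "one_two r" for r
    proof -
      obtain s where s: "(s, Root r) \<in> ?E" using bijrelD(4)[OF b, of "Root r"] T \<open>one_two r\<close> by blast
      then have "s \<noteq> Leaf 1" "s \<noteq> Out x 1" using noleaf ux r1x by auto
      then show ?thesis using s S bijrelD(1)[OF b s] by blast
    qed
    obtain p1 p2 where p: "one_two p1" "one_two p2" "(Out y p1, Root 1) \<in> ?E" "(Out y p2, Root 2) \<in> ?E"
      using root[of 1] root[of 2] by blast
    have "p1 \<noteq> p2" using bijrelD(5)[OF b p(3), of "Root 2"] p(4) by auto
    then have yroot: "\<exists>r. r' = Root r" if "(Out y p', r') \<in> ?E" for p' r'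
    proof -
      have "one_two p'" using S bijrelD(1)[OF b that] xy by auto
      then have "p' = p1 \<or> p' = p2" using \<open>p1 \<noteq> p2\<close> p(1,2) by auto
      then show ?thesis using bijrelD(5)[OF b that] p(3,4) by blast
    qed
    \<comment> \<open>If \<open>x\<close> fed itself, both roots would hang on \<open>y\<close>; as
      \<open>y\<close> has no inputs, it would form a component with them that avoids
      \<open>x\<close>.\<close>
    let ?Z = "{u. u = IntN y \<or> (\<exists>r. u = RootN r)}"
    have "IntN x \<in> ?Z"
    proof (rule is_tree_closed[OF t, of "IntN y"])
      show "IntN y \<in> nodes 2 1 t" "IntN x \<in> nodes 2 1 t" using vs by (auto simp: nodes_def)
      fix s r assume e: "(s, r) \<in> ?E"
      consider "s = Leaf 1" | "s = Out x 1" | p' where "s = Out y p'" using S bijrelD(1)[OF b e] by blast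
      then show "edge_tail s \<in> ?Z \<longleftrightarrow> edge_head r \<in> ?Z"
      proof cases
        case 1
        then have "\<exists>q. r = In x q" using T[of r] bijrelD(2)[OF b e] noleaf e by auto
        then show ?thesis using 1 xy by auto
      next
        case 2
        then have "r = In x q" using ux e r1x by blast
        then show ?thesis using 2 xy by auto
      next
        case 3
        then show ?thesis using yroot[of p' r] e by auto
      qed
    qed simp
    then show False using xy by simp
  qed
  then obtain r where r: "r1 = Root r" "one_two r" using T bijrelD(2)[OF b r1] by blast
  then have r3: "one_two (3 - r)" "3 - r \<noteq> r" by auto
  obtain s where s: "(s, Root (3 - r)) \<in> ?E" using bijrelD(4)[OF b, of "Root (3 - r)"] T r3 by blast
  then have "s \<noteq> Leaf 1" "s \<noteq> Out x 1" using noleaf ux r r3 by auto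
  then obtain p' where p': "s = Out y p'" "one_two p'" using S bijrelD(1)[OF b s] by blast
  \<comment> \<open>Output \<open>p'\<close> goes to the second root, so the inner edge starts at
    the other output.\<close>
  define p where "p = 3 - p'"
  have p: "one_two p" "p' = 3 - p" "p \<noteq> p'" using p'(2) by (auto simp: p_def)
  have eq: "(Out y (3 - p), Root (3 - r)) \<in> ?E" using s p' p by simp
  obtain r2 where r2: "(Out y p, r2) \<in> ?E" using bijrelD(3)[OF b, of "Out y p"] S p(1) by blast
  have "r2 \<noteq> Root r" using bijrelD(6)[OF b r2, of "Out x 1"] r1 r(1) xy by auto
  moreover have "r2 \<noteq> Root (3 - r)" using bijrelD(6)[OF b r2, of "Out y (3 - p)"] eq p by auto
  ultimately have "r2 \<noteq> Root r'" if "one_two r'" for r' using that r(2) by auto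
  then obtain i where i: "r2 = In x i" "one_two i" using T bijrelD(2)[OF b r2] by blast
  have i3: "one_two (3 - i)" "3 - i \<noteq> i" using i(2) by auto
  obtain s' where s': "(s', In x (3 - i)) \<in> ?E" using bijrelD(4)[OF b, of "In x (3 - i)"] T i3 by blast
  have "s' \<noteq> Out x 1" using ux s' r(1) by auto
  moreover have "s' \<noteq> Out y p" using bijrelD(5)[OF b r2, of "In x (3 - i)"] s' i(1) i3 by auto
  moreover have "s' \<noteq> Out y (3 - p)" using bijrelD(5)[OF b eq, of "In x (3 - i)"] s' by auto
  moreover have "s' = Leaf 1 \<or> s' = Out x 1 \<or> s' = Out y 1 \<or> s' = Out y 2"
    using S[of s'] bijrelD(1)[OF b s'] by simp
  ultimately have "s' = Leaf 1" using p(1) by (elim disjE) simp_all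
  then have leaf: "(Leaf 1, In x (3 - i)) \<in> ?E" using s' by simp
  have E: "?E = {(Out x 1, Root r), (Out y p, In x i), (Out y (3 - p), Root (3 - r)), (Leaf 1, In x (3 - i))}" (is "_ = ?R")
  proof (intro equalityI subsetI)
    fix e assume e: "e \<in> ?E"
    obtain s r' where sr: "e = (s, r')" by (cases e)
    then have "r' = Root r \<or> r' = Root (3 - r) \<or> r' = In x i \<or> r' = In x (3 - i)"
      using T[of r'] bijrelD(2)[OF b, of s r'] e i(2) r(2) by auto
    then show "e \<in> ?R"
      using bijrelD(6)[OF b _ r1, of s] bijrelD(6)[OF b _ eq, of s] bijrelD(6)[OF b _ r2, of s]
        bijrelD(6)[OF b _ leaf, of s] e sr r(1) i(1) by auto
  next
    fix e assume "e \<in> ?R"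
    then show "e \<in> ?E" using r1 r(1) eq r2 i(1) leaf by auto
  qed
  from vs have "t = tree21 d f h i r p \<or> t = swap_verts 0 (tree21 d f h i r p)"
  proof
    assume "verts t = [Vertex 1 2 0 f, Vertex 2 0 d h] \<and> x = 0 \<and> y = 1"
    then have "t = tree21 d f h i r p" using E by (intro dtree_eqI) (simp_all add: edges_tree)
    then show ?thesis ..
  next
    assume "verts t = [Vertex 2 0 d h, Vertex 1 2 0 f] \<and> x = 1 \<and> y = 0"
    then have "t = swap_verts 0 (tree21 d f h i r p)"
      using E by (intro dtree_eqI) (simp_all add: edges_tree map_edges_def)
    then show ?thesis ..
  qed
  then show ?thesis using i(2) r(2) p(1) by blast
qed

text \<open>From here on arities and labels are matched as the literal \<open>1\<close>, which must
  not be rewritten to \<open>Suc 0\<close>.\<close>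

declare One_nat_def [simp del]

section \<open>The relations\<close>

definition rel_deg :: "int \<Rightarrow> nat \<Rightarrow> int" where
  "rel_deg d m = (if m = 1 then 0 else d)"

definition std :: "int \<Rightarrow> nat \<Rightarrow> nat \<Rightarrow> 'e dtree \<Rightarrow> bool" where
  "std d m n t \<longleftrightarrow>
    (m, n) = (1, 3) \<and> (\<exists>f g i a b c. one_two i \<and> word3 a b c \<and> t = tree13 f g i a b c) \<or>
    (m, n) = (2, 1) \<and> (\<exists>f h i r p. one_two i \<and> one_two r \<and> one_two p \<and> t = tree21 d f h i r p)"

lemma std13: "one_two i \<Longrightarrow> word3 a b c \<Longrightarrow> std d 1 3 (tree13 f g i a b c)"
  and std21: "one_two i \<Longrightarrow> one_two r \<Longrightarrow> one_two p \<Longrightarrow> std d 2 1 (tree21 d f h i r p)"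
  unfolding std_def by blast+

lemma std_cases:
  assumes "std d m n t"
  obtains (tree13) f g i a b c where "m = 1" "n = 3" "one_two i" "word3 a b c" "t = tree13 f g i a b c"
    | (tree21) f h i r p where "m = 2" "n = 1" "one_two i" "one_two r" "one_two p" "t = tree21 d f h i r p"
  using assms unfolding std_def by blast

lemma word3_perm:
  assumes "\<rho> permutes {1..3}"
  shows "word3 (\<rho> 1) (\<rho> 2) (\<rho> 3)"
proof (rule word3I)
  show "\<rho> 1 \<in> {1..3}" "\<rho> 2 \<in> {1..3}" "\<rho> 3 \<in> {1..3}"
    by (simp_all only: permutes_in_image[OF assms]) simp_all
  show "\<rho> 1 \<noteq> \<rho> 2" "\<rho> 1 \<noteq> \<rho> 3" "\<rho> 2 \<noteq> \<rho> 3"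
    using permutes_inj[OF assms] by (simp_all add: inj_eq)
qed

lemma word3_other:
  assumes "word3 a b c" "word3 x y z"
  shows "z = a \<Longrightarrow> x = b \<or> x = c" "x = a \<Longrightarrow> y = b \<or> y = c"
  using assms by (auto simp: word3_def)

abbreviation rel_arity :: "nat \<Rightarrow> nat \<Rightarrow> bool" where
  "rel_arity m n \<equiv> (m, n) = (1, 3) \<or> (m, n) = (2, 1)"

lemma std_simps:
  assumes "std d m n t"
  shows "length (verts t) = 2" "orient t = t" "orient (swap_verts 0 t) = t" "swap_verts 0 (swap_verts 0 t) = t"
    "sum_list (map vdeg (verts t)) = rel_deg d m" "rel_arity m n" "oriented t" "\<not> oriented (swap_verts 0 t)"
    "vdeg (verts t ! 0) = 0"
  using assms by (auto simp: std_def swap_verts_twice rel_deg_def oriented_tree)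

lemma V_basis_nonempty: "V_basis d (m, n, i) \<noteq> {} \<Longrightarrow> (m, n, i) = (1, 2, 0) \<or> (m, n, i) = (2, 0, d)"
  by (auto simp: V_basis.simps split: if_splits)

text \<open>A zero decoration is possible at a vertex of any arity and degree, hence
  \<open>nz\<close>. Otherwise only (1, 2, 0) and (2, 0, d) occur, say \<open>A\<close> and
  \<open>B\<close> times; counting outputs and inputs gives \<open>B = m - 1\<close> and
  \<open>A = n + B - 1\<close>, so there are two vertices in both arities.\<close>

lemma zero_dec_or_std:
  fixes t :: "(gen \<Rightarrow> 'k::field_char_0) dtree"
  assumes t: "t \<in> dtrees (V_gens d) (m, n, i)" and mn: "rel_arity m n"
    and nz: "\<And>v. v \<in> set (verts t) \<Longrightarrow> dec v \<noteq> (\<lambda>_. 0)"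
  shows "\<exists>u. std d m n u \<and> (t = u \<or> t = swap_verts 0 u)"
proof -
  have kind: "vidx v = (1, 2, 0) \<or> vidx v = (2, 0, d)" if v: "v \<in> set (verts t)" for v
  proof (rule V_basis_nonempty)
    have "\<exists>g. dec v g \<noteq> 0" using nz[OF v] by auto
    then show "V_basis d (vidx v) \<noteq> {}" using dtreesD(5)[OF t v] by auto
  qed
  have "\<exists>A B. length vs = A + B \<and> sum_list (map outs vs) = A + 2 * B \<and> sum_list (map ins vs) = 2 * A"
    if "\<forall>v \<in> set vs. vidx v = (1, 2, 0) \<or> vidx v = (2, 0, d)" for vs :: "(gen \<Rightarrow> 'k) vertex list"
    using that
  proof (induction vs)
    case (Cons v vs)
    then obtain A B where "length vs = A + B" "sum_list (map outs vs) = A + 2 * B" "sum_list (map ins vs) = 2 * A"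
      by auto
    then show ?case
      using Cons.prems by (auto intro: exI[of _ "Suc A"] exI[of _ A] exI[of _ B] exI[of _ "Suc B"])
  qed auto
  then obtain A B where AB: "length (verts t) = A + B" "sum_list (map outs (verts t)) = A + 2 * B"
      "sum_list (map ins (verts t)) = 2 * A"
    using kind by blast
  have card: "m + length (verts t) = sum_list (map outs (verts t)) + 1" "n + length (verts t) = sum_list (map ins (verts t)) + 1"
    using dtreesD(1)[OF t] is_tree_card_ins[OF dtreesD(1)[OF t]] by (simp_all add: is_tree_iff)
  have "length (verts t) = 2" using AB card mn by auto
  then obtain v w where vs: "verts t = [v, w]" by (auto simp: length_Suc_conv numeral_2_eq_2)
  note k = kind[of v] kind[of w]
  show ?thesis
  proof (cases "m = 1")
    case True
    then have n: "n = 3" using mn by auto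
    have "outs v + outs w = 2" using card vs True by simp
    then have "vidx v = (1, 2, 0)" "vidx w = (1, 2, 0)" using k vs by auto
    then have "verts t = [Vertex 1 2 0 (dec v), Vertex 1 2 0 (dec w)]"
      using vs by (cases v; cases w) simp
    then show ?thesis
      using classify_13[of t "dec v" "dec w"] dtreesD(1)[OF t] True n std13 by metis
  next
    case False
    then have mn': "m = 2" "n = 1" using mn by auto
    have "outs v + outs w = 3" using card vs mn' by simp
    then consider "vidx v = (1, 2, 0)" "vidx w = (2, 0, d)" | "vidx v = (2, 0, d)" "vidx w = (1, 2, 0)"
      using k vs by auto
    then show ?thesis
    proof cases
      case 1
      then have "verts t = [Vertex 1 2 0 (dec v), Vertex 2 0 d (dec w)]"
        using vs by (cases v; cases w) simp
      then obtain i r p where irp: "one_two i" "one_two r" "one_two p"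
          "t = tree21 d (dec v) (dec w) i r p \<or> t = swap_verts 0 (tree21 d (dec v) (dec w) i r p)"
        using classify_21[of t "dec v" d "dec w" 0 1] dtreesD(1)[OF t] mn' by blast
      then show ?thesis
        using std21[OF irp(1-3), of d "dec v" "dec w"] mn' by blast
    next
      case 2
      then have "verts t = [Vertex 2 0 d (dec v), Vertex 1 2 0 (dec w)]"
        using vs by (cases v; cases w) simp
      then obtain i r p where irp: "one_two i" "one_two r" "one_two p"
          "t = tree21 d (dec w) (dec v) i r p \<or> t = swap_verts 0 (tree21 d (dec w) (dec v) i r p)"
        using classify_21[of t "dec w" d "dec v" 1 0] dtreesD(1)[OF t] mn' by blast
      then show ?thesis
        using std21[OF irp(1-3), of d "dec w" "dec v"] mn' by blast
    qed
  qed
qed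

text \<open>
  The coordinate functions attached to the trees \<open>(\<pi>, \<rho>\<^sup>-\<^sup>1).(\<mu> \<^sub>1\<circ>\<^sub>1 \<mu>)\<close> and \<open>(\<pi>, \<rho>\<^sup>-\<^sup>1).(\<mu> \<^sub>2\<circ>\<^sub>1 \<mu>)\<close>
  in arity \<open>(1, 3)\<close>, and \<open>(\<pi>, \<rho>\<^sup>-\<^sup>1).(\<mu> \<^sub>1\<circ>\<^sub>2 \<nu>)\<close> and \<open>(\<pi>, \<rho>\<^sup>-\<^sup>1).(\<mu> \<^sub>2\<circ>\<^sub>1 \<nu>)\<close> in arity \<open>(2, 1)\<close>. These
  trees form a basis of the component of the free dioperad, since every monomial can be written
  without \<open>\<mu>-bar\<close>.
\<close>

definition coord :: "((src \<times> tgt) set \<Rightarrow> bool) \<Rightarrow> ((src \<times> tgt) set \<Rightarrow> gen) \<Rightarrow> ((src \<times> tgt) set \<Rightarrow> gen)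
    \<Rightarrow> (gen \<Rightarrow> 'k::field_char_0) dtree \<Rightarrow> 'k" where
  "coord C G H t = (if length (verts t) = 2 \<and> C (edges (orient t))
    then dec (verts (orient t) ! 0) (G (edges (orient t))) * dec (verts (orient t) ! 1) (H (edges (orient t))) else 0)"

text \<open>In the left tree leaf \<open>\<rho> 3\<close> (for \<open>m = 2\<close>, root
  \<open>\<pi> 2\<close>) is attached to the head vertex. An input order opposite to the standard
  one is compensated by reading the decoration at \<open>MuBar\<close>, which builds the
  coinvariants into the formula.\<close>

definition coordL :: "nat \<Rightarrow> (nat \<Rightarrow> nat) \<Rightarrow> (nat \<Rightarrow> nat) \<Rightarrow> (gen \<Rightarrow> 'k::field_char_0) dtree \<Rightarrow> 'k" where
  "coordL m \<pi> \<rho> = coord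
    (\<lambda>A. if m = 1 then \<exists>q. (Leaf (\<rho> 3), In 0 q) \<in> A else (Out 0 1, Root (\<pi> 2)) \<in> A)
    (\<lambda>A. if \<exists>p. (Out 1 p, In 0 1) \<in> A then Mu else MuBar)
    (\<lambda>A. if m = 1 then if (Leaf (\<rho> 1), In 1 1) \<in> A then Mu else MuBar else Nu)"

text \<open>In the right tree the inner edge ends at input 2, so \<open>Mu\<close> and
  \<open>MuBar\<close> change roles at the head vertex, which is now attached to leaf
  \<open>\<rho> 1\<close> or root \<open>\<pi> 1\<close>.\<close>

definition coordR :: "nat \<Rightarrow> (nat \<Rightarrow> nat) \<Rightarrow> (nat \<Rightarrow> nat) \<Rightarrow> (gen \<Rightarrow> 'k::field_char_0) dtree \<Rightarrow> 'k" where
  "coordR m \<pi> \<rho> = coord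
    (\<lambda>A. if m = 1 then \<exists>q. (Leaf (\<rho> 1), In 0 q) \<in> A else (Out 0 1, Root (\<pi> 1)) \<in> A)
    (\<lambda>A. if \<exists>p. (Out 1 p, In 0 1) \<in> A then MuBar else Mu)
    (\<lambda>A. if m = 1 then if (Leaf (\<rho> 2), In 1 1) \<in> A then Mu else MuBar else Nu)"

section \<open>Invariance of the coordinates under the tree relations\<close>

lemma coord_tree13:
  assumes "one_two i"
  shows "coordL 1 \<pi> \<rho> (tree13 f g i a b c) =
      (if \<rho> 3 = a then f (if i = 1 then Mu else MuBar) * g (if \<rho> 1 = b then Mu else MuBar) else 0)"
    "coordR 1 \<pi> \<rho> (tree13 f g i a b c) =
      (if \<rho> 1 = a then f (if i = 1 then MuBar else Mu) * g (if \<rho> 2 = b then Mu else MuBar) else 0)"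
  using assms by (auto simp: coordL_def coordR_def coord_def edges_tree)

lemma coord_tree21:
  assumes "one_two i" "one_two r" "one_two p"
  shows "coordL 2 \<pi> \<rho> (tree21 d f h i r p) = (if \<pi> 2 = r then f (if i = 1 then Mu else MuBar) * h Nu else 0)"
    "coordR 2 \<pi> \<rho> (tree21 d f h i r p) = (if \<pi> 1 = r then f (if i = 1 then MuBar else Mu) * h Nu else 0)"
  using assms by (auto simp: coordL_def coordR_def coord_def edges_tree)

lemma coord_orient:
  assumes "std d m n t"
  shows "coord C G H (swap_verts 0 t) = coord C G H t"
  using std_simps[OF assms] by (simp add: coord_def)

lemma orient_verts:
  assumes "verts t = [v, w]"
  shows "verts (orient t) = (if oriented t then [v, w] else [w, v])"
  using assms by (simp add: orient_def)

lemma coord_zero_dec: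
  assumes "v \<in> set (verts t)" "dec v = (\<lambda>_. 0)"
  shows "coord C G H t = 0"
proof (cases "length (verts t) = 2")
  case True
  then obtain x y where "verts t = [x, y]" by (auto simp: length_Suc_conv numeral_2_eq_2)
  then show ?thesis using assms by (auto simp: coord_def orient_verts)
qed (simp add: coord_def)

lemma coord_set_dec:
  assumes "a < length (verts t)"
  shows "coord C G H (set_dec a (\<lambda>g. x g + y g) t) = coord C G H (set_dec a x t) + coord C G H (set_dec a y t)"
    "coord C G H (set_dec a (\<lambda>g. c * x g) t) = c * coord C G H (set_dec a x t)"
proof -
  have or: "oriented (set_dec a z t) = oriented t" "edges (orient (set_dec a z t)) = edges (orient t)" for z
    by (simp_all add: oriented_def orient_def map_edges_def)
  have "coord C G H (set_dec a (\<lambda>g. x g + y g) t) = coord C G H (set_dec a x t) + coord C G H (set_dec a y t)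
    \<and> coord C G H (set_dec a (\<lambda>g. c * x g) t) = c * coord C G H (set_dec a x t)"
  proof (cases "length (verts t) = 2")
    case True
    then obtain v w where vs: "verts t = [v, w]" by (auto simp: length_Suc_conv numeral_2_eq_2)
    have "verts (orient (set_dec a z t)) = (let u = (verts t)[a := map_vertex (\<lambda>_. z) (verts t ! a)] in
        if oriented t then [u ! 0, u ! 1] else [u ! 1, u ! 0])" for z
      using vs assms by (auto simp: orient_def or less_Suc_eq Let_def)
    then show ?thesis
      using vs assms by (auto simp: coord_def or less_Suc_eq Let_def algebra_simps)
  qed (simp_all add: coord_def)
  then show "coord C G H (set_dec a (\<lambda>g. x g + y g) t) = coord C G H (set_dec a x t) + coord C G H (set_dec a y t)"
    "coord C G H (set_dec a (\<lambda>g. c * x g) t) = c * coord C G H (set_dec a x t)" by blast+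
qed

text \<open>A transposition of inputs composes the decoration with \<open>swap_gen\<close> and also
  exchanges \<open>Mu\<close> and \<open>MuBar\<close> in the rule for reading it; the effects
  cancel. Exchanging the outputs of \<nu> affects neither its decoration nor the edges that are
  read.\<close>

lemma coord_renumber_std:
  fixes t :: "(gen \<Rightarrow> 'k::field_char_0) dtree"
  assumes t: "std d m n t" and a: "a < 2" and \<rho>: "\<rho> permutes {1..n}"
    and p: "\<pi>' permutes {1..outs (verts t ! a)}" "\<sigma>' permutes {1..ins (verts t ! a)}"
  shows "coordL m \<pi> \<rho> (renumber (V_gens d) a \<pi>' \<sigma>' t) = coordL m \<pi> \<rho> t"
    "coordR m \<pi> \<rho> (renumber (V_gens d) a \<pi>' \<sigma>' t) = coordR m \<pi> \<rho> t"
    "std d m n (renumber (V_gens d) a \<pi>' \<sigma>' t)"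
proof -
  have *: "coordL m \<pi> \<rho> (renumber (V_gens d) a \<pi>' \<sigma>' t) = coordL m \<pi> \<rho> t \<and>
    coordR m \<pi> \<rho> (renumber (V_gens d) a \<pi>' \<sigma>' t) = coordR m \<pi> \<rho> t \<and>
    std d m n (renumber (V_gens d) a \<pi>' \<sigma>' t)"
    using t
  proof (cases rule: std_cases)
    case (tree13 f g i x y z)
    then have mn: "(m, n) = (1, 3)" and i: "one_two i" and w: "word3 x y z" and t: "t = tree13 f g i x y z" by simp_all
    have i': "one_two (3 - i)" using i by auto
    have "verts t ! a = Vertex 1 2 0 (if a = 0 then f else g)" using a t by (auto simp: less_2_cases_iff)
    then have \<pi>': "\<pi>' = id" and \<sigma>': "\<sigma>' permutes {1..2}" using p by simp_all
    have w': "word3 x z y" using w by (auto simp: word3_def)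
    have w\<rho>: "word3 (\<rho> 1) (\<rho> 2) (\<rho> 3)" using word3_perm \<rho> mn by simp
    note w\<rho>_other = word3_other[OF w w\<rho>]
    have yz: "y \<noteq> z" using w by (auto simp: word3_def)
    consider "\<sigma>' = id" | "\<sigma>' = Transposition.transpose 1 2" using permutes_2[OF \<sigma>'] by blast
    then show ?thesis
    proof cases
      case 1
      from a consider "a = 0" | "a = 1" by linarith
      then have "renumber (V_gens d) a \<pi>' \<sigma>' t = t"
        using renumber_tree13[OF i permutes_id, of "V_gens d" f g x y z]
        by cases (simp_all add: t \<pi>' 1 V_gens_act)
      then show ?thesis using mn std13[OF i w] t by auto
    next
      case 2
      from a consider "a = 0" | "a = 1" by linarith
      then show ?thesis
      proof cases
        case 1
        have "renumber (V_gens d) a \<pi>' \<sigma>' t = tree13 (f \<circ> swap_gen) g (3 - i) x y z"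
          using i renumber_tree13(1)[OF i \<sigma>', of "V_gens d"] by (auto simp: t \<pi>' 1 2 V_gens_act One_nat_def)
        then show ?thesis
          using mn i by (elim disjE) (simp_all add: t coord_tree13 std13 w One_nat_def[symmetric])
      next
        \<comment> \<open>If the head leaf passes the test, the leaf tested at the second vertex is
          one of the two attached there (\<open>word3_other\<close>), so the exchange reverses the
          outcome of that test.\<close>
        case a1: 2
        have "renumber (V_gens d) a \<pi>' \<sigma>' t = tree13 f (g \<circ> swap_gen) i x z y"
          using renumber_tree13(2)[OF i \<sigma>', of "V_gens d"] by (simp add: t \<pi>' a1 2 V_gens_act)
        then show ?thesis
          using mn i w' w\<rho>_other yz
          by (auto simp: t coord_tree13 std13)
      qed
    qed
  next
    case (tree21 f h i r q)
    then have mn: "(m, n) = (2, 1)" and i: "one_two i" and r: "one_two r" and q: "one_two q"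
      and t: "t = tree21 d f h i r q" by simp_all
    have i': "one_two (3 - i)" "one_two (3 - q)" using i q by auto
    from a consider "a = 0" | "a = 1" by linarith
    then show ?thesis
    proof cases
      case 1
      then have \<pi>': "\<pi>' = id" and \<sigma>': "\<sigma>' permutes {1..2}" using p t by simp_all
      consider "\<sigma>' = id" | "\<sigma>' = Transposition.transpose 1 2" using permutes_2[OF \<sigma>'] by blast
      then have "renumber (V_gens d) a \<pi>' \<sigma>' t = tree21 d f h i r q \<or>
          renumber (V_gens d) a \<pi>' \<sigma>' t = tree21 d (f \<circ> swap_gen) h (3 - i) r q"
        using renumber_tree21(1)[OF i q \<sigma>', of "V_gens d"] i
        by cases (auto simp: t \<pi>' 1 V_gens_act One_nat_def[symmetric])
      then show ?thesis
      proof
        assume "renumber (V_gens d) a \<pi>' \<sigma>' t = tree21 d f h i r q"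
        then show ?thesis using std21[OF i r q] mn t by simp
      next
        assume A: "renumber (V_gens d) a \<pi>' \<sigma>' t = tree21 d (f \<circ> swap_gen) h (3 - i) r q"
        have "coordL 2 \<pi> \<rho> (tree21 d (f \<circ> swap_gen) h (3 - i) r q) = coordL 2 \<pi> \<rho> (tree21 d f h i r q)"
          "coordR 2 \<pi> \<rho> (tree21 d (f \<circ> swap_gen) h (3 - i) r q) = coordR 2 \<pi> \<rho> (tree21 d f h i r q)"
          unfolding coord_tree21[OF i r q] coord_tree21[OF i'(1) r q] using i by (elim disjE; simp)+
        then show ?thesis using A std21[OF i'(1) r q] mn t by simp
      qed
    next
      case 2
      then have \<sigma>': "\<sigma>' = id" and \<pi>': "\<pi>' permutes {1..2}" using p t by simp_all
      have q': "one_two (\<pi>' q)" using permutes_2_minus[OF \<pi>' q] by blast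
      moreover have "renumber (V_gens d) a \<pi>' \<sigma>' t = tree21 d f h i r (\<pi>' q)"
        using renumber_tree21(2)[OF i q \<pi>', of "V_gens d"] by (simp add: t \<sigma>' 2 V_gens_act)
      ultimately show ?thesis
        using mn std21[OF i r q'] by (simp add: t coord_tree21[OF i r q] coord_tree21[OF i r q'])
    qed
  qed
  then show "coordL m \<pi> \<rho> (renumber (V_gens d) a \<pi>' \<sigma>' t) = coordL m \<pi> \<rho> t"
    "coordR m \<pi> \<rho> (renumber (V_gens d) a \<pi>' \<sigma>' t) = coordR m \<pi> \<rho> t"
    "std d m n (renumber (V_gens d) a \<pi>' \<sigma>' t)" by blast+
qed

text \<open>Carries invariance under renumbering from standard trees to those with their two
  vertices exchanged.\<close>

lemma renumber_swap_verts:
  assumes "verts t = [v, w]" "a < 2"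
  shows "renumber E a \<pi> \<sigma> (swap_verts 0 t) = swap_verts 0 (renumber E (1 - a) \<pi> \<sigma> t)"
proof (rule dtree_eqI)
  show "verts (renumber E a \<pi> \<sigma> (swap_verts 0 t)) = verts (swap_verts 0 (renumber E (1 - a) \<pi> \<sigma> t))"
    using assms by (auto simp: less_2_cases_iff One_nat_def)
  let ?\<tau> = "Transposition.transpose 0 (Suc 0)"
  from assms(2) have a: "a = 0 \<or> a = 1" by linarith
  have "(renumber_src a \<pi> \<circ> reindex_src ?\<tau>) u = (reindex_src ?\<tau> \<circ> renumber_src (1 - a) \<pi>) u" for u
    using a by (cases u) (auto simp: transpose_def One_nat_def)
  moreover have "(renumber_tgt a \<sigma> \<circ> reindex_tgt ?\<tau>) r = (reindex_tgt ?\<tau> \<circ> renumber_tgt (1 - a) \<sigma>) r" for r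
    using a by (cases r) (auto simp: transpose_def One_nat_def)
  ultimately have "renumber_src a \<pi> \<circ> reindex_src ?\<tau> = reindex_src ?\<tau> \<circ> renumber_src (1 - a) \<pi>"
    "renumber_tgt a \<sigma> \<circ> reindex_tgt ?\<tau> = reindex_tgt ?\<tau> \<circ> renumber_tgt (1 - a) \<sigma>" by blast+
  then show "edges (renumber E a \<pi> \<sigma> (swap_verts 0 t)) = edges (swap_verts 0 (renumber E (1 - a) \<pi> \<sigma> t))"
    unfolding renumber_simps(2)[of E a] swap_verts_simps(2)[of 0 "renumber E (1 - a) \<pi> \<sigma> t"]
    by (simp only: map_edges_comp[OF swap_verts_simps(2)] map_edges_comp[OF renumber_simps(2)])
qed

text \<open>Linearity in a decoration holds on all trees. Renumbering and exchange need checking on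
  standard trees only: any other tree has a zero decoration, which both operations preserve, and its
  coordinates vanish.\<close>

lemma coord_relators:
  fixes A :: "(gen \<Rightarrow> 'k::field_char_0) dtree \<Rightarrow>\<^sub>0 'k"
  assumes A: "A \<in> tree_relators (V_gens d) (m, n, i)" and mn: "rel_arity m n" and \<rho>: "\<rho> permutes {1..n}"
  shows "lin_form (coordL m \<pi> \<rho>) A = 0" "lin_form (coordR m \<pi> \<rho>) A = 0"
proof -
  have "lin_form h A = 0"
    if h: "h = coord C G H" and ren: "\<And>t a \<pi>' \<sigma>'. \<lbrakk>std d m n t; a < 2; \<pi>' permutes {1..outs (verts t ! a)};
        \<sigma>' permutes {1..ins (verts t ! a)}\<rbrakk> \<Longrightarrow> h (renumber (V_gens d) a \<pi>' \<sigma>' t) = h t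
        \<and> std d m n (renumber (V_gens d) a \<pi>' \<sigma>' t)" for h C G H
    using A
  proof cases
    case (rel_add t a x y)
    then show ?thesis by (simp add: h coord_set_dec)
  next
    case (rel_smult t a x c)
    then show ?thesis by (simp add: h coord_set_dec)
  next
    case (rel_renumber t a \<pi>' \<sigma>')
    let ?t' = "renumber (V_gens d) a \<pi>' \<sigma>' t"
    show ?thesis
    proof (cases "\<exists>v \<in> set (verts t). dec v = (\<lambda>_. 0)")
      case True
      then obtain b where b: "b < length (verts t)" "dec (verts t ! b) = (\<lambda>_. 0)" by (auto simp: in_set_conv_nth)
      have "act (V_gens d) (vidx (verts t ! b)) \<pi>' \<sigma>' (\<lambda>_. 0) = (\<lambda>_. 0)"
        by (simp add: V_gens_act o_def)
      then have "dec (verts ?t' ! b) = (\<lambda>_. 0)"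
        using b by (cases "b = a") auto
      then have "h ?t' = 0" using b coord_zero_dec[of "verts ?t' ! b" ?t'] by (simp add: h del: renumber_simps) simp
      moreover have "h t = 0" using True coord_zero_dec by (auto simp: h)
      ultimately show ?thesis by (simp add: rel_renumber)
    next
      case False
      then obtain u where u: "std d m n u" "t = u \<or> t = swap_verts 0 u"
        using zero_dec_or_std[OF rel_renumber(2) mn] by blast
      have "length (verts u) = 2" using std_simps(1)[OF u(1)] .
      then obtain v w where vs: "verts u = [v, w]" by (auto simp: length_Suc_conv numeral_2_eq_2)
      have a: "a < 2" using rel_renumber(3) u(2) vs by auto
      have "h ?t' = h t"
        using u(2)
      proof
        assume "t = u"
        then show ?thesis using ren[OF u(1) a] rel_renumber(4,5) by simp
      next
        assume t: "t = swap_verts 0 u"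
        have "verts t ! a = verts u ! (1 - a)" using a by (auto simp: t vs less_2_cases_iff)
        then have r: "h (renumber (V_gens d) (1 - a) \<pi>' \<sigma>' u) = h u" "std d m n (renumber (V_gens d) (1 - a) \<pi>' \<sigma>' u)"
          using ren[OF u(1), of "1 - a" \<pi>' \<sigma>'] rel_renumber(4,5) by auto
        show ?thesis
          unfolding t renumber_swap_verts[OF vs a] using r coord_orient[OF r(2)] coord_orient[OF u(1)] by (simp add: h)
      qed
      then show ?thesis by (simp add: rel_renumber)
    qed
  next
    case (rel_swap t a)
    show ?thesis
    proof (cases "\<exists>v \<in> set (verts t). dec v = (\<lambda>_. 0)")
      case True
      have "set (verts (swap_verts a t)) = set (verts t)"
        using mset_eq_setD[OF mset_swap_verts[OF rel_swap(3)]] by simp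
      then have "h (swap_verts a t) = 0" "h t = 0"
        using True coord_zero_dec unfolding h by metis+
      then show ?thesis by (simp add: rel_swap)
    next
      case False
      then obtain u where u: "std d m n u" "t = u \<or> t = swap_verts 0 u"
        using zero_dec_or_std[OF rel_swap(2) mn] by blast
      note s = std_simps[OF u(1)]
      obtain v w where vs: "verts u = [v, w]" using s(1) by (auto simp: length_Suc_conv numeral_2_eq_2)
      have a: "a = 0" using rel_swap(3) u(2) vs by auto
      \<comment> \<open>One of the two vertices has arity (1, 2) and hence degree 0, so
        \<open>d\<close> never enters the sign.\<close>
      have "ksign (vdeg (verts t ! a) * vdeg (verts t ! Suc a)) = (1 :: 'k)"
        using u(2) s(9) vs by (auto simp: a ksign_def)
      moreover have "h (swap_verts a t) = h t"
        using u(2) coord_orient[OF u(1)] s(4) by (auto simp: h a)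
      ultimately show ?thesis by (simp add: rel_swap)
    qed
  qed
  note * = this
  show "lin_form (coordL m \<pi> \<rho>) A = 0"
    using coord_renumber_std(1,3)[OF _ _ \<rho>] by (intro *[OF coordL_def]) auto
  show "lin_form (coordR m \<pi> \<rho>) A = 0"
    using coord_renumber_std(2,3)[OF _ _ \<rho>] by (intro *[OF coordR_def]) auto
qed

section \<open>Permutations of three labels and relabelled coordinates\<close>

lemma perm3_eq:
  assumes "\<rho> permutes {1..3}" "\<rho>' permutes {1..3::nat}"
    and "\<rho> 1 = \<rho>' 1 \<and> \<rho> 2 = \<rho>' 2 \<or> \<rho> 1 = \<rho>' 1 \<and> \<rho> 3 = \<rho>' 3"
  shows "\<rho> = \<rho>'"
proof
  have eq: "\<rho> 1 = \<rho>' 1" "\<rho> 2 = \<rho>' 2" "\<rho> 3 = \<rho>' 3"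
    using word3_perm[OF assms(1)] word3_perm[OF assms(2)] assms(3) by (auto simp: word3_def)
  fix k :: nat
  consider "k \<notin> {1..3}" | "k = 1" | "k = 2" | "k = 3" by fastforce
  then show "\<rho> k = \<rho>' k"
    using eq by cases (simp_all add: permutes_not_in[OF assms(1)] permutes_not_in[OF assms(2)])
qed

text \<open>The even permutations of three letters are the cyclic ones.\<close>

definition sgn3 :: "nat \<Rightarrow> nat \<Rightarrow> nat \<Rightarrow> int" where
  "sgn3 a b c = (if (a, b, c) \<in> {(1, 2, 3), (2, 3, 1), (3, 1, 2)} then 1 else - 1)"

lemma perm3_exists:
  assumes "word3 a b c"
  obtains \<rho> where "\<rho> permutes {1..3}" "\<rho> 1 = a" "\<rho> 2 = b" "\<rho> 3 = c" "sign \<rho> = sgn3 a b c"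
proof -
  let ?t = "Transposition.transpose :: nat \<Rightarrow> nat \<Rightarrow> nat \<Rightarrow> nat"
  have p: "?t 1 2 permutes {1..3}" "?t 2 3 permutes {1..3}" "?t 1 3 permutes {1..3}"
    by (simp_all add: permutes_swap_id)
  have s: "sign (?t 1 2) = -1" "sign (?t 2 3) = -1" "sign (?t 1 3) = -1" by (simp_all add: sign_swap_id)
  have c: "sign (?t 1 2 \<circ> ?t 2 3) = 1" "sign (?t 2 3 \<circ> ?t 1 2) = 1"
    by (simp_all add: sign_compose permutation_swap_id sign_swap_id)
  from assms consider "(a, b, c) = (1, 2, 3)" | "(a, b, c) = (1, 3, 2)" | "(a, b, c) = (2, 1, 3)"
    | "(a, b, c) = (2, 3, 1)" | "(a, b, c) = (3, 1, 2)" | "(a, b, c) = (3, 2, 1)"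
    unfolding word3_def by blast
  then show ?thesis
  proof cases
    case 1
    then show ?thesis by (intro that[of id]) (simp_all add: sgn3_def permutes_id)
  next
    case 2
    then show ?thesis by (intro that[of "?t 2 3"]) (simp_all add: sgn3_def p s)
  next
    case 3
    then show ?thesis by (intro that[of "?t 1 2"]) (simp_all add: sgn3_def p s)
  next
    case 4
    then show ?thesis by (intro that[of "?t 1 2 \<circ> ?t 2 3"]) (simp_all add: sgn3_def permutes_compose p c)
  next
    case 5
    then show ?thesis by (intro that[of "?t 2 3 \<circ> ?t 1 2"]) (simp_all add: sgn3_def permutes_compose p c)
  next
    case 6
    then show ?thesis by (intro that[of "?t 1 3"]) (simp_all add: sgn3_def p s)
  qed
qed

lemma sign_perm3:
  assumes "\<rho> permutes {1..3}"
  shows "sign \<rho> = sgn3 (\<rho> 1) (\<rho> 2) (\<rho> 3)"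
proof -
  obtain \<rho>' where "\<rho>' permutes {1..3}" "\<rho>' 1 = \<rho> 1" "\<rho>' 2 = \<rho> 2" "sign \<rho>' = sgn3 (\<rho> 1) (\<rho> 2) (\<rho> 3)"
    using perm3_exists[OF word3_perm[OF assms]] by metis
  moreover from this have "\<rho> = \<rho>'" by (intro perm3_eq assms) auto
  ultimately show ?thesis by simp
qed

lemma mem_relabel_edges:
  assumes "\<pi> permutes S" "\<sigma> permutes T"
  shows "(Leaf l, In b q) \<in> map_edges (relabel_src \<sigma>) (relabel_tgt \<pi>) t \<longleftrightarrow> (Leaf (\<sigma> l), In b q) \<in> edges t"
    "(Out a p, Root r) \<in> map_edges (relabel_src \<sigma>) (relabel_tgt \<pi>) t \<longleftrightarrow> (Out a p, Root (pinv \<pi> r)) \<in> edges t"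
    "(Out a p, In b q) \<in> map_edges (relabel_src \<sigma>) (relabel_tgt \<pi>) t \<longleftrightarrow> (Out a p, In b q) \<in> edges t"
proof -
  have src: "Leaf l = relabel_src \<sigma> s \<longleftrightarrow> s = Leaf (\<sigma> l)" "Out a p = relabel_src \<sigma> s \<longleftrightarrow> s = Out a p" for l a p s
    using permutes_inverses[OF assms(2)] by (cases s; auto)+
  have tgt: "Root r = relabel_tgt \<pi> u \<longleftrightarrow> u = Root (pinv \<pi> r)" "In b q = relabel_tgt \<pi> u \<longleftrightarrow> u = In b q" for r b q u
    using permutes_inverses[OF assms(1)] by (cases u; auto)+
  have mem: "(x, y) \<in> map_edges (relabel_src \<sigma>) (relabel_tgt \<pi>) t \<longleftrightarrow>
      (\<exists>s u. (s, u) \<in> edges t \<and> x = relabel_src \<sigma> s \<and> y = relabel_tgt \<pi> u)" for x y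
    by (auto simp: map_edges_def)
  show "(Leaf l, In b q) \<in> map_edges (relabel_src \<sigma>) (relabel_tgt \<pi>) t \<longleftrightarrow> (Leaf (\<sigma> l), In b q) \<in> edges t"
    "(Out a p, Root r) \<in> map_edges (relabel_src \<sigma>) (relabel_tgt \<pi>) t \<longleftrightarrow> (Out a p, Root (pinv \<pi> r)) \<in> edges t"
    "(Out a p, In b q) \<in> map_edges (relabel_src \<sigma>) (relabel_tgt \<pi>) t \<longleftrightarrow> (Out a p, In b q) \<in> edges t"
    by (auto simp: mem src tgt)
qed

lemma coord_relabel:
  assumes "\<pi>' permutes {1..m}" "\<sigma>' permutes {1..n}"
  shows "coordL m \<pi> \<rho> (relabel \<pi>' \<sigma>' t) = coordL m (pinv \<pi>' \<circ> \<pi>) (\<sigma>' \<circ> \<rho>) t"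
    "coordR m \<pi> \<rho> (relabel \<pi>' \<sigma>' t) = coordR m (pinv \<pi>' \<circ> \<pi>) (\<sigma>' \<circ> \<rho>) t"
proof -
  note mem = mem_relabel_edges[OF assms]
  have "oriented (relabel \<pi>' \<sigma>' t) = oriented t"
    by (simp add: oriented_def mem)
  then have o: "orient (relabel \<pi>' \<sigma>' t) = relabel \<pi>' \<sigma>' (orient t)"
    by (simp add: orient_def relabel_swap_verts)
  show "coordL m \<pi> \<rho> (relabel \<pi>' \<sigma>' t) = coordL m (pinv \<pi>' \<circ> \<pi>) (\<sigma>' \<circ> \<rho>) t"
    "coordR m \<pi> \<rho> (relabel \<pi>' \<sigma>' t) = coordR m (pinv \<pi>' \<circ> \<pi>) (\<sigma>' \<circ> \<rho>) t"
    by (simp_all only: coordL_def coordR_def coord_def o mem relabel_simps o_apply)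
qed

text \<open>Index set for each half of the basis, uniform in both arities: one factor is always
  trivial, leaving six orders of leaves or two orders of roots.\<close>

definition W :: "nat \<Rightarrow> nat \<Rightarrow> ((nat \<Rightarrow> nat) \<times> (nat \<Rightarrow> nat)) set" where
  "W m n = {\<pi>. \<pi> permutes {1..m}} \<times> {\<rho>. \<rho> permutes {1..n}}"

lemma finite_W [simp]: "finite (W m n)"
  by (simp add: W_def finite_permutations)

text \<open>The kernel of a linear form is a submodule of the formal sums, so vanishing on the
  relators passes to their span.\<close>

lemma coord_N:
  fixes A :: "(gen \<Rightarrow> 'k::field_char_0) dtree \<Rightarrow>\<^sub>0 'k"
  assumes A: "A \<in> V.N d (m, n, i)" and mn: "rel_arity m n" and \<rho>: "\<rho> permutes {1..n}"
  shows "lin_form (coordL m \<pi> \<rho>) A = 0" "lin_form (coordR m \<pi> \<rho>) A = 0"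
proof -
  have "lin_form h A = 0" if "\<And>B. B \<in> tree_relators (V_gens d) (m, n, i) \<Longrightarrow> lin_form h B = 0"
    for h :: "(gen \<Rightarrow> 'k) dtree \<Rightarrow> 'k"
  proof -
    have "V.N d (m, n, i) \<subseteq> {B. Poly_Mapping.keys B \<subseteq> dtrees (V_gens d) (m, n, i) \<and> lin_form h B = 0}"
    proof (rule lin_span_least)
      show "submodule {B. Poly_Mapping.keys B \<subseteq> dtrees (V_gens d) (m, n, i) \<and> lin_form h B = 0}
          ground (formal_sums (dtrees (V_gens d) (m, n, i)))"
        unfolding submodule_formal_sums_iff
      proof (intro conjI ballI allI)
        fix A B :: "(gen \<Rightarrow> 'k) dtree \<Rightarrow>\<^sub>0 'k" and c
        let ?S = "{B. Poly_Mapping.keys B \<subseteq> dtrees (V_gens d) (m, n, i) \<and> lin_form h B = 0}"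
        assume AB: "A \<in> ?S" "B \<in> ?S"
        show "A + B \<in> ?S" using AB Poly_Mapping.keys_add[of A B] by auto
        show "scale c A \<in> ?S" using AB keys_scale[of c A] by auto
      qed auto
      show "tree_relators (V_gens d) (m, n, i) \<subseteq> {B. Poly_Mapping.keys B \<subseteq> dtrees (V_gens d) (m, n, i) \<and> lin_form h B = 0}"
      proof (rule subsetI, rule CollectI, rule conjI)
        fix B :: "(gen \<Rightarrow> 'k) dtree \<Rightarrow>\<^sub>0 'k" assume B: "B \<in> tree_relators (V_gens d) (m, n, i)"
        show "Poly_Mapping.keys B \<subseteq> dtrees (V_gens d) (m, n, i)"
          using subsetD[OF V.tree_relators_carrier B] by simp
        show "lin_form h B = 0" using that[OF B] .
      qed
    qed
    then show ?thesis using A by blast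
  qed
  then show "lin_form (coordL m \<pi> \<rho>) A = 0" "lin_form (coordR m \<pi> \<rho>) A = 0"
    using coord_relators[OF _ mn \<rho>] by blast+
qed

section \<open>The basis trees and the generating relations\<close>

definition baseL :: "int \<Rightarrow> nat \<Rightarrow> (gen \<Rightarrow> 'k::field_char_0) dtree" where
  "baseL d m = (if m = 1 then tree13 (unit_gen Mu) (unit_gen Mu) 1 3 1 2 else tree21 d (unit_gen Mu) (unit_gen Nu) 1 2 2)"

definition baseR :: "int \<Rightarrow> nat \<Rightarrow> (gen \<Rightarrow> 'k::field_char_0) dtree" where
  "baseR d m = (if m = 1 then tree13 (unit_gen Mu) (unit_gen Mu) 2 1 2 3 else tree21 d (unit_gen Mu) (unit_gen Nu) 2 1 1)"

text \<open>\<open>relabel\<close> applies the inverse of its permutation to leaf labels; inserting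
  an inverse gives leaf \<open>l\<close> of the base tree the label \<open>snd w l\<close>.\<close>

definition treeL :: "int \<Rightarrow> nat \<Rightarrow> (nat \<Rightarrow> nat) \<times> (nat \<Rightarrow> nat) \<Rightarrow> (gen \<Rightarrow> 'k::field_char_0) dtree" where
  "treeL d m w = relabel (fst w) (pinv (snd w)) (baseL d m)"

definition treeR :: "int \<Rightarrow> nat \<Rightarrow> (nat \<Rightarrow> nat) \<times> (nat \<Rightarrow> nat) \<Rightarrow> (gen \<Rightarrow> 'k::field_char_0) dtree" where
  "treeR d m w = relabel (fst w) (pinv (snd w)) (baseR d m)"

lemma permutes_11: "\<pi> permutes {1..1::nat} \<longleftrightarrow> \<pi> = id"
  by simp

lemma tree_13:
  assumes "w \<in> W 1 3"
  shows "treeL d 1 w = tree13 (unit_gen Mu) (unit_gen Mu) 1 (snd w 3) (snd w 1) (snd w 2)"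
    "treeR d 1 w = tree13 (unit_gen Mu) (unit_gen Mu) 2 (snd w 1) (snd w 2) (snd w 3)"
proof -
  have "fst w = id" and p: "snd w permutes {1..3}" using assms permutes_11 by (auto simp: W_def)
  then show "treeL d 1 w = tree13 (unit_gen Mu) (unit_gen Mu) 1 (snd w 3) (snd w 1) (snd w 2)"
    "treeR d 1 w = tree13 (unit_gen Mu) (unit_gen Mu) 2 (snd w 1) (snd w 2) (snd w 3)"
    by (simp_all add: treeL_def treeR_def baseL_def baseR_def relabel_tree13 permutes_inv_inv[OF p])
qed

lemma tree_21:
  assumes "w \<in> W 2 1"
  shows "treeL d 2 w = tree21 d (unit_gen Mu) (unit_gen Nu) 1 (fst w 2) 2"
    "treeR d 2 w = tree21 d (unit_gen Mu) (unit_gen Nu) 2 (fst w 1) 1"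
proof -
  have "snd w = id" and p: "fst w permutes {1..2}" using assms permutes_11 by (auto simp: W_def)
  then show "treeL d 2 w = tree21 d (unit_gen Mu) (unit_gen Nu) 1 (fst w 2) 2"
    "treeR d 2 w = tree21 d (unit_gen Mu) (unit_gen Nu) 2 (fst w 1) 1"
    by (simp_all add: treeL_def treeR_def baseL_def baseR_def relabel_tree21[OF p])
qed

text \<open>This is the linear independence of the basis. \<open>coordL\<close> tests only
  \<open>\<rho> 3\<close> and \<open>\<rho> 1\<close>, and \<open>coordR\<close> only
  \<open>\<rho> 1\<close> and \<open>\<rho> 2\<close>, but two values determine \<rho>. The mixed
  values vanish because the head decoration \<open>Mu\<close> is then read at
  \<open>MuBar\<close>.\<close>

lemma coord_trees:
  assumes mn: "rel_arity m n" and w: "w \<in> W m n" and v: "(\<pi>, \<rho>) \<in> W m n"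
  shows "coordL m \<pi> \<rho> (treeL d m w) = (if w = (\<pi>, \<rho>) then 1 else 0 :: 'k::field_char_0)"
    "coordR m \<pi> \<rho> (treeL d m w) = (0 :: 'k)"
    "coordL m \<pi> \<rho> (treeR d m w) = (0 :: 'k)"
    "coordR m \<pi> \<rho> (treeR d m w) = (if w = (\<pi>, \<rho>) then 1 else 0 :: 'k)"
proof -
  have "coordL m \<pi> \<rho> (treeL d m w) = (if w = (\<pi>, \<rho>) then 1 else 0 :: 'k) \<and>
    coordR m \<pi> \<rho> (treeL d m w) = (0 :: 'k) \<and> coordL m \<pi> \<rho> (treeR d m w) = (0 :: 'k) \<and>
    coordR m \<pi> \<rho> (treeR d m w) = (if w = (\<pi>, \<rho>) then 1 else 0 :: 'k)"
    using mn
  proof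
    assume mn: "(m, n) = (1, 3)"
    then have w': "fst w = id" "snd w permutes {1..3}" and v': "\<pi> = id" "\<rho> permutes {1..3}"
      using w v permutes_11 by (auto simp: W_def)
    have "w = (\<pi>, \<rho>) \<longleftrightarrow> snd w = \<rho>" using w' v' by (cases w) auto
    then have 1: "w = (\<pi>, \<rho>) \<longleftrightarrow> \<rho> 1 = snd w 1 \<and> \<rho> 3 = snd w 3" and 2: "w = (\<pi>, \<rho>) \<longleftrightarrow> \<rho> 1 = snd w 1 \<and> \<rho> 2 = snd w 2"
      using perm3_eq[OF w'(2) v'(2)] by auto
    have m: "m = 1" "w \<in> W 1 3" using mn w by simp_all
    have "coordL m \<pi> \<rho> (treeL d m w) = (if w = (\<pi>, \<rho>) then 1 else 0 :: 'k)"
      unfolding m(1) tree_13[OF m(2)] coord_tree13[OF disjI1[OF refl]] 1 by (simp add: unit_gen_def)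
    moreover have "coordR m \<pi> \<rho> (treeR d m w) = (if w = (\<pi>, \<rho>) then 1 else 0 :: 'k)"
      unfolding m(1) tree_13[OF m(2)] coord_tree13[OF disjI2[OF refl]] 2 by (simp add: unit_gen_def)
    ultimately show ?thesis
      unfolding m(1) tree_13[OF m(2)] by (simp add: coord_tree13 unit_gen_def)
  next
    assume mn: "(m, n) = (2, 1)"
    then have w': "snd w = id" "fst w permutes {1..2}" and v': "\<rho> = id" "\<pi> permutes {1..2}"
      using w v permutes_11 by (auto simp: W_def)
    have "w = (\<pi>, \<rho>) \<longleftrightarrow> fst w = \<pi>" using w' v' by (cases w) auto
    then have 1: "w = (\<pi>, \<rho>) \<longleftrightarrow> \<pi> 2 = fst w 2" and 2: "w = (\<pi>, \<rho>) \<longleftrightarrow> \<pi> 1 = fst w 1"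
      using permutes_2[OF w'(2)] permutes_2[OF v'(2)] by auto
    have o: "one_two (fst w 2)" "one_two (fst w 1)" using permutes_2[OF w'(2)] by auto
    have m: "m = 2" "w \<in> W 2 1" using mn w by simp_all
    note c = coord_tree21[OF disjI1[OF refl] o(1) disjI2[OF refl]] coord_tree21[OF disjI2[OF refl] o(2) disjI1[OF refl]]
    have "coordL m \<pi> \<rho> (treeL d m w) = (if w = (\<pi>, \<rho>) then 1 else 0 :: 'k)"
      unfolding m(1) tree_21[OF m(2)] c 1 by (simp add: unit_gen_def)
    moreover have "coordR m \<pi> \<rho> (treeR d m w) = (if w = (\<pi>, \<rho>) then 1 else 0 :: 'k)"
      unfolding m(1) tree_21[OF m(2)] c 2 by (simp add: unit_gen_def)
    ultimately show ?thesis
      unfolding m(1) tree_21[OF m(2)] c by (simp add: unit_gen_def)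
  qed
  then show "coordL m \<pi> \<rho> (treeL d m w) = (if w = (\<pi>, \<rho>) then 1 else 0 :: 'k)"
    "coordR m \<pi> \<rho> (treeL d m w) = (0 :: 'k)" "coordL m \<pi> \<rho> (treeR d m w) = (0 :: 'k)"
    "coordR m \<pi> \<rho> (treeR d m w) = (if w = (\<pi>, \<rho>) then 1 else 0 :: 'k)" by blast+
qed

lemma corolla_dtrees:
  assumes "(m, n) \<in> J0" "x \<in> carrier (sp E (m, n, i))"
  shows "corolla (Vertex m n i x) \<in> dtrees E (m, n, i)"
  using is_tree_corolla[of "Vertex m n i x"] assms by (intro dtreesI) auto

lemma J0_small: "(1, 2) \<in> J0" "(2, 0) \<in> J0" "(1, 3) \<in> J0" "(2, 1) \<in> J0"
  by (simp_all add: J0_iff)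

lemma V_basis_simps [simp]: "V_basis d (1, 2, 0) = {Mu, MuBar}" "V_basis d (2, 0, d) = {Nu}"
  by (simp_all add: V_basis.simps)

text \<open>The tree is a relabelled graft of two corollas, so the tree conditions need not be
  verified on an explicit set of edges.\<close>

lemma tree13_dtrees:
  assumes "f \<in> carrier (V_space {Mu, MuBar})" "g \<in> carrier (V_space {Mu, MuBar})" "one_two i" "word3 a b c"
  shows "tree13 f g i a b c \<in> dtrees (V_gens d) (1, 3, 0)"
proof -
  have c: "corolla (Vertex 1 2 0 f) \<in> dtrees (V_gens d) (1, 2, 0)" "corolla (Vertex 1 2 0 g) \<in> dtrees (V_gens d) (1, 2, 0)"
    using assms(1,2) by (auto intro!: corolla_dtrees J0_small simp del: V_space_simps)
  have "tree13 f g 1 3 1 2 \<in> dtrees (V_gens d) (1, 3, 0)" "tree13 f g 2 1 2 3 \<in> dtrees (V_gens d) (1, 3, 0)"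
    using dtrees_graft[OF c, of 1 1] dtrees_graft[OF c, of 2 1] by (simp_all add: graft_tree13 One_nat_def[symmetric])
  moreover have "word3 b c a" using assms(4) by (auto simp: word3_def)
  then obtain \<rho> \<rho>' where \<rho>: "\<rho> permutes {1..3}" "\<rho> 1 = b" "\<rho> 2 = c" "\<rho> 3 = a"
    and \<rho>': "\<rho>' permutes {1..3}" "\<rho>' 1 = a" "\<rho>' 2 = b" "\<rho>' 3 = c"
    using perm3_exists assms(4) by metis
  ultimately have "relabel id (pinv \<rho>) (tree13 f g 1 3 1 2) \<in> dtrees (V_gens d) (1, 3, 0)"
    "relabel id (pinv \<rho>') (tree13 f g 2 1 2 3) \<in> dtrees (V_gens d) (1, 3, 0)"
    by (auto intro!: dtrees_relabel permutes_inv permutes_id)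
  then show ?thesis
    using assms(3) \<rho> \<rho>' by (auto simp: relabel_tree13 permutes_inv_inv)
qed

lemma tree21_dtrees:
  assumes "f \<in> carrier (V_space {Mu, MuBar})" "h \<in> carrier (V_space {Nu})" "one_two i" "one_two r" "one_two p"
  shows "tree21 d f h i r p \<in> dtrees (V_gens d) (2, 1, d)"
proof -
  have c: "corolla (Vertex 1 2 0 f) \<in> dtrees (V_gens d) (1, 2, 0)" "corolla (Vertex 2 0 d h) \<in> dtrees (V_gens d) (2, 0, d)"
    using assms(1,2) by (auto intro!: corolla_dtrees J0_small simp del: V_space_simps)
  have "tree21 d f h i p p \<in> dtrees (V_gens d) (2, 1, d)"
    using dtrees_graft[OF c, of i p] assms(3,5) by (auto simp: graft_tree21 One_nat_def[symmetric])
  moreover have "\<exists>\<pi>. \<pi> permutes {1..2} \<and> \<pi> p = r"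
    using assms(4,5) by (intro exI[of _ "Transposition.transpose p r"]) (auto intro: permutes_swap_id)
  then obtain \<pi> where \<pi>: "\<pi> permutes {1..2}" "\<pi> p = r" by blast
  ultimately have "relabel \<pi> id (tree21 d f h i p p) \<in> dtrees (V_gens d) (2, 1, d)"
    by (intro dtrees_relabel permutes_id)
  then show ?thesis by (simp add: relabel_tree21[OF \<pi>(1) assms(5)] \<pi>(2))
qed

lemma unit_carrier:
  "(unit_gen Mu :: gen \<Rightarrow> 'k::field_char_0) \<in> carrier (V_space {Mu, MuBar})"
  "(unit_gen MuBar :: gen \<Rightarrow> 'k) \<in> carrier (V_space {Mu, MuBar})"
  "(unit_gen Nu :: gen \<Rightarrow> 'k) \<in> carrier (V_space {Nu})"
  by (simp_all only: unit_gen_mem) simp_all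

lemma base_dtrees:
  assumes "rel_arity m n"
  shows "baseL d m \<in> dtrees (V_gens d) (m, n, rel_deg d m)" "baseR d m \<in> dtrees (V_gens d) (m, n, rel_deg d m)"
  using assms
  by (auto simp: baseL_def baseR_def rel_deg_def word3_def intro!: tree13_dtrees tree21_dtrees unit_carrier
      simp del: V_space_simps)

lemma tree_dtrees:
  assumes "rel_arity m n" "w \<in> W m n"
  shows "treeL d m w \<in> dtrees (V_gens d) (m, n, rel_deg d m)" "treeR d m w \<in> dtrees (V_gens d) (m, n, rel_deg d m)"
  using assms(2) base_dtrees[OF assms(1)] unfolding treeL_def treeR_def
  by (auto simp: W_def intro!: dtrees_relabel permutes_inv)

definition rel_elt :: "int \<Rightarrow> nat \<Rightarrow> (nat \<Rightarrow> nat) \<times> (nat \<Rightarrow> nat) \<Rightarrow> (gen \<Rightarrow> 'k::field_char_0) dtree \<Rightarrow>\<^sub>0 'k" where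
  "rel_elt d m w = Poly_Mapping.single (treeL d m w) 1 - Poly_Mapping.single (treeR d m w) 1"

lemma keys_rel_elt:
  assumes "rel_arity m n" "w \<in> W m n"
  shows "Poly_Mapping.keys (rel_elt d m w) \<subseteq> dtrees (V_gens d) (m, n, rel_deg d m)"
  unfolding rel_elt_def using tree_dtrees[OF assms] by (intro V.keys_diff_sub) auto

definition id_W :: "(nat \<Rightarrow> nat) \<times> (nat \<Rightarrow> nat)" where
  "id_W = (id, id)"

lemma id_W [simp]: "id_W \<in> W m n"
  by (simp add: id_W_def W_def permutes_id)

lemma tree_id: "treeL d m id_W = baseL d m" "treeR d m id_W = baseR d m"
proof -
  have "relabel_src id = id" "relabel_tgt id = id" by (rule ext, case_tac x; simp)+
  then show "treeL d m id_W = baseL d m" "treeR d m id_W = baseR d m"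
    by (auto simp: treeL_def treeR_def id_W_def map_edges_id intro!: dtree_eqI)
qed

lemma V_relators_eq:
  "(V_relators d (m, n, i) :: ((gen \<Rightarrow> 'k::field_char_0) dtree \<Rightarrow>\<^sub>0 'k) set set) =
    (if rel_arity m n \<and> i = rel_deg d m then {V.cls d (m, n, i) (rel_elt d m id_W)} else {})"
proof -
  let ?\<mu> = "Vertex 1 2 0 (unit_gen Mu) :: (gen \<Rightarrow> 'k) vertex" and ?\<nu> = "Vertex 2 0 d (unit_gen Nu) :: (gen \<Rightarrow> 'k) vertex"
  have cor: "corolla ?\<mu> \<in> dtrees (V_gens d) (1, 2, 0)" "corolla ?\<nu> \<in> dtrees (V_gens d) (2, 0, d)"
    using unit_carrier by (auto intro!: corolla_dtrees J0_small simp del: V_space_simps)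
  have gen: "free_gen (V_gens d) (1, 2, 0) (unit_gen Mu) = V.cls d (1, 2, 0) (Poly_Mapping.single (corolla ?\<mu>) 1)"
    "free_gen (V_gens d) (2, 0, d) (unit_gen Nu) = V.cls d (2, 0, d) (Poly_Mapping.single (corolla ?\<nu>) 1)"
    by (simp_all add: V.cls_def V.tree_sums_sp)
  have pc13: "pcomp (V.F d) (1, 2, 0) (1, 2, 0) a 1 (V.cls d (1, 2, 0) (Poly_Mapping.single (corolla ?\<mu>) 1))
      (V.cls d (1, 2, 0) (Poly_Mapping.single (corolla ?\<mu>) 1))
      = V.cls d (1, 3, 0) (Poly_Mapping.single (graft 1 2 a 1 (corolla ?\<mu>) (corolla ?\<mu>)) 1)" if "one_two a" for a
    using V.F_pcomp[of "Poly_Mapping.single (corolla ?\<mu>) 1" d 1 2 0 "Poly_Mapping.single (corolla ?\<mu>) 1" 1 2 0 a 1] cor that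
    by (auto simp: One_nat_def[symmetric])
  have pc21: "pcomp (V.F d) (1, 2, 0) (2, 0, d) a b (V.cls d (1, 2, 0) (Poly_Mapping.single (corolla ?\<mu>) 1))
      (V.cls d (2, 0, d) (Poly_Mapping.single (corolla ?\<nu>) 1))
      = V.cls d (2, 1, d) (Poly_Mapping.single (graft 1 0 a b (corolla ?\<mu>) (corolla ?\<nu>)) 1)" if "one_two a" "one_two b" for a b
    using V.F_pcomp[of "Poly_Mapping.single (corolla ?\<mu>) 1" d 1 2 0 "Poly_Mapping.single (corolla ?\<nu>) 1" 2 0 d a b] cor that
    by (auto simp: One_nat_def[symmetric])
  consider "(m, n, i) = (1, 3, 0)" | "(m, n, i) = (2, 1, d)" | "(m, n, i) \<noteq> (1, 3, 0)" "(m, n, i) \<noteq> (2, 1, d)" by blast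
  then show ?thesis
  proof cases
    case 1
    have "(V_relators d (1, 3, 0) :: ((gen \<Rightarrow> 'k) dtree \<Rightarrow>\<^sub>0 'k) set set) = {V.cls d (1, 3, 0) (Poly_Mapping.single (baseL d 1) 1)
        \<ominus>\<^bsub>sp (V.F d) (1, 3, 0)\<^esub> V.cls d (1, 3, 0) (Poly_Mapping.single (baseR d 1) 1)}"
      unfolding V_relators_def Let_def gen by (simp add: pc13 graft_tree13 baseL_def baseR_def)
    also have "\<dots> = {V.cls d (1, 3, 0) (rel_elt d 1 id_W)}"
      using base_dtrees[of 1 3 d] by (subst V.F_minus) (simp_all add: rel_deg_def rel_elt_def tree_id)
    finally show ?thesis using 1 by (simp add: rel_deg_def)
  next
    case 2
    have "(V_relators d (2, 1, d) :: ((gen \<Rightarrow> 'k) dtree \<Rightarrow>\<^sub>0 'k) set set) = {V.cls d (2, 1, d) (Poly_Mapping.single (baseL d 2) 1)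
        \<ominus>\<^bsub>sp (V.F d) (2, 1, d)\<^esub> V.cls d (2, 1, d) (Poly_Mapping.single (baseR d 2) 1)}"
      unfolding V_relators_def Let_def gen by (simp add: pc21 graft_tree21 baseL_def baseR_def)
    also have "\<dots> = {V.cls d (2, 1, d) (rel_elt d 2 id_W)}"
      using base_dtrees[of 2 1 d] by (subst V.F_minus) (simp_all add: rel_deg_def rel_elt_def tree_id)
    finally show ?thesis using 2 by (simp add: rel_deg_def)
  next
    case 3
    then have "\<not> (rel_arity m n \<and> i = rel_deg d m)" by (auto simp: rel_deg_def)
    then show ?thesis by (simp only: V_relators_def Let_def 3 if_False)
  qed
qed

text \<open>
  In the relations, two trees with equal images in the associative operad, or its analogue in
  arity \<open>(2, 1)\<close>, are identified; the values of \<open>ev\<close> are the coordinates of that image.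
\<close>

definition ev :: "nat \<Rightarrow> (nat \<Rightarrow> nat) \<times> (nat \<Rightarrow> nat) \<Rightarrow> ((gen \<Rightarrow> 'k::field_char_0) dtree \<Rightarrow>\<^sub>0 'k) \<Rightarrow> 'k" where
  "ev m w A = lin_form (coordL m (fst w) (snd w)) A + lin_form (coordR m (fst w) (snd w)) A"

lemma ev_simps [simp]:
  "ev m w (A + B) = ev m w A + ev m w B" "ev m w (A - B) = ev m w A - ev m w B"
  "ev m w (scale c A) = c * ev m w A" "ev m w 0 = 0"
  by (simp_all add: ev_def algebra_simps)

lemma ev_N: "A \<in> V.N d (m, n, i) \<Longrightarrow> rel_arity m n \<Longrightarrow> w \<in> W m n \<Longrightarrow> ev m w A = 0"
  by (simp add: ev_def coord_N W_def mem_Times_iff)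

lemma ev_relabel:
  assumes "\<pi> permutes {1..m}" "\<sigma> permutes {1..n}"
  shows "ev m w (lin_ext (relabel \<pi> \<sigma>) A) = ev m (pinv \<pi> \<circ> fst w, \<sigma> \<circ> snd w) A"
  by (simp add: ev_def lin_form_lin_ext coord_relabel[OF assms])

lemma ev_trees:
  assumes "rel_arity m n" "v \<in> W m n" "w \<in> W m n"
  shows "ev m v (Poly_Mapping.single (treeL d m w) c) = (if w = v then c else 0)"
    "ev m v (Poly_Mapping.single (treeR d m w) c) = (if w = v then c else 0)"
proof -
  obtain \<pi> \<rho> where v: "v = (\<pi>, \<rho>)" by (cases v)
  show "ev m v (Poly_Mapping.single (treeL d m w) c) = (if w = v then c else 0)"
    "ev m v (Poly_Mapping.single (treeR d m w) c) = (if w = v then c else 0)"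
    by (simp_all add: ev_def v coord_trees[OF assms(1,3) assms(2)[unfolded v]])
qed

text \<open>Zero in the other arities, to be comparable with a sub-bimodule generated in the two
  arities of the relations.\<close>

definition ev_kernel :: "int \<Rightarrow> idx \<Rightarrow> ((gen \<Rightarrow> 'k::field_char_0) dtree \<Rightarrow>\<^sub>0 'k) set set" where
  "ev_kernel d = (\<lambda>(m, n, i). if rel_arity m n
    then {C \<in> carrier (sp (V.F d) (m, n, i)). \<forall>A \<in> C. \<forall>w \<in> W m n. ev m w A = 0}
    else {\<zero>\<^bsub>sp (V.F d) (m, n, i)\<^esub>})"

lemma cls_ev_kernel:
  assumes A: "Poly_Mapping.keys A \<subseteq> dtrees (V_gens d) (m, n, i)" and mn: "rel_arity m n"
  shows "V.cls d (m, n, i) A \<in> ev_kernel d (m, n, i) \<longleftrightarrow> (\<forall>w \<in> W m n. ev m w A = 0)"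
proof -
  have "ev m w B = ev m w A" if "B \<in> V.cls d (m, n, i) A" "w \<in> W m n" for B w
    using V.mem_cls[OF A, of B] that ev_N[of "B - A" d m n i w] mn by simp
  moreover have "V.cls d (m, n, i) A \<in> carrier (sp (V.F d) (m, n, i))"
    using A V.carrier_F by blast
  ultimately show ?thesis
    using V.cls_self[OF A] unfolding ev_kernel_def prod.case if_P[OF mn] mem_Collect_eq by metis
qed

lemma ev_kernel_zero: "\<not> rel_arity m n \<Longrightarrow> ev_kernel d (m, n, i) = {\<zero>\<^bsub>sp (V.F d) (m, n, i)\<^esub>}"
  unfolding ev_kernel_def prod.case by (rule if_not_P)

lemma ev_kernel_sub: "ev_kernel d (m, n, i) \<subseteq> carrier (sp (V.F d) (m, n, i))"
proof (cases "rel_arity m n")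
  case True
  show ?thesis unfolding ev_kernel_def prod.case if_P[OF True] by (rule subsetI) simp
next
  case False
  show ?thesis
    unfolding ev_kernel_zero[OF False]
    using submoduleD(2)[OF V.F_module module.carrier_is_submodule[OF V.F_module]] by simp
qed

lemma W_relabel:
  assumes "\<pi> permutes {1..m}" "\<sigma> permutes {1..n}" "w \<in> W m n"
  shows "(pinv \<pi> \<circ> fst w, \<sigma> \<circ> snd w) \<in> W m n"
  using assms by (auto simp: W_def intro: permutes_compose permutes_inv)

text \<open>By \<open>ev_relabel\<close> the symmetric groups permute the functionals
  \<open>ev m w\<close>, so their common kernel is stable under the action.\<close>

lemma subbimodule_ev_kernel: "subbimodule (V.F d) (ev_kernel d :: idx \<Rightarrow> ((gen \<Rightarrow> 'k::field_char_0) dtree \<Rightarrow>\<^sub>0 'k) set set)"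
  unfolding subbimodule_def
proof (intro allI impI conjI ballI)
  fix m n i
  let ?M = "sp (V.F d :: ('k, _) dioperad) (m, n, i)"
  interpret M: module ground ?M by (rule V.F_module)
  have kernel: "\<exists>A. Poly_Mapping.keys A \<subseteq> dtrees (V_gens d) (m, n, i) \<and> C = V.cls d (m, n, i) A
      \<and> (\<forall>w \<in> W m n. ev m w A = 0)" if C: "C \<in> ev_kernel d (m, n, i)" and mn: "rel_arity m n"
    for C :: "((gen \<Rightarrow> 'k) dtree \<Rightarrow>\<^sub>0 'k) set"
  proof -
    have "C \<in> carrier ?M" using C ev_kernel_sub by blast
    then obtain A where A: "Poly_Mapping.keys A \<subseteq> dtrees (V_gens d) (m, n, i)" "C = V.cls d (m, n, i) A"
      unfolding V.carrier_F by blast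
    then show ?thesis using cls_ev_kernel[OF A(1) mn] C by blast
  qed
  show "submodule (ev_kernel d (m, n, i)) ground ?M"
  proof (cases "rel_arity m n")
    case True
    show ?thesis
      unfolding submodule_iff[OF V.F_module]
    proof (intro conjI ballI allI)
      show "ev_kernel d (m, n, i) \<subseteq> carrier ?M" by (rule ev_kernel_sub)
      show "\<zero>\<^bsub>?M\<^esub> \<in> ev_kernel d (m, n, i)"
        unfolding V.F_zero by (subst cls_ev_kernel[OF _ True]) simp_all
    next
      fix C D :: "((gen \<Rightarrow> 'k) dtree \<Rightarrow>\<^sub>0 'k) set" and c
      assume C: "C \<in> ev_kernel d (m, n, i)" and D: "D \<in> ev_kernel d (m, n, i)"
      obtain A where A: "Poly_Mapping.keys A \<subseteq> dtrees (V_gens d) (m, n, i)" "C = V.cls d (m, n, i) A"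
          "\<forall>w \<in> W m n. ev m w A = 0"
        using kernel[OF C True] by blast
      obtain B where B: "Poly_Mapping.keys B \<subseteq> dtrees (V_gens d) (m, n, i)" "D = V.cls d (m, n, i) B"
          "\<forall>w \<in> W m n. ev m w B = 0"
        using kernel[OF D True] by blast
      have AB: "Poly_Mapping.keys (A + B) \<subseteq> dtrees (V_gens d) (m, n, i)"
        using A(1) B(1) Poly_Mapping.keys_add[of A B] by blast
      show "C \<oplus>\<^bsub>?M\<^esub> D \<in> ev_kernel d (m, n, i)"
        unfolding A(2) B(2) V.F_add[OF A(1) B(1)] cls_ev_kernel[OF AB True] using A(3) B(3) by simp
      have cA: "Poly_Mapping.keys (scale c A) \<subseteq> dtrees (V_gens d) (m, n, i)"
        using A(1) keys_scale[of c A] by blast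
      show "c \<odot>\<^bsub>?M\<^esub> C \<in> ev_kernel d (m, n, i)"
        unfolding A(2) V.F_smult[OF A(1)] cls_ev_kernel[OF cA True] using A(3) by simp
    qed
  next
    case False
    show ?thesis
      unfolding submodule_iff[OF V.F_module] ev_kernel_zero[OF False] by (simp add: M.smult_r_null)
  qed
  fix \<pi> \<sigma> and C :: "((gen \<Rightarrow> 'k) dtree \<Rightarrow>\<^sub>0 'k) set"
  assume p: "\<pi> permutes {1..m}" "\<sigma> permutes {1..n}" and C: "C \<in> ev_kernel d (m, n, i)"
  show "act (V.F d) (m, n, i) \<pi> \<sigma> C \<in> ev_kernel d (m, n, i)"
  proof (cases "rel_arity m n")
    case True
    obtain A where A: "Poly_Mapping.keys A \<subseteq> dtrees (V_gens d) (m, n, i)" "C = V.cls d (m, n, i) A"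
        "\<forall>w \<in> W m n. ev m w A = 0"
      using kernel[OF C True] by blast
    show ?thesis
      unfolding A(2) V.F_act[OF p A(1)] cls_ev_kernel[OF V.keys_relabel[OF p A(1)] True]
      using A(3) ev_relabel[OF p] W_relabel[OF p] by metis
  next
    case False
    then have "C = V.cls d (m, n, i) 0" using C unfolding ev_kernel_zero[OF False] V.F_zero by simp
    then show ?thesis
      using V.F_act[OF p, of 0] by (simp add: ev_kernel_zero[OF False] V.F_zero)
  qed
qed

section \<open>The space of relations\<close>

abbreviation V_rel :: "int \<Rightarrow> idx \<Rightarrow> ((gen \<Rightarrow> 'k::field_char_0) dtree \<Rightarrow>\<^sub>0 'k) set set" where
  "V_rel d \<equiv> subbimodule_gen (V.F d) (V_relators d)"

lemma ev_rel_elt: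
  assumes "rel_arity m n" "v \<in> W m n" "w \<in> W m n"
  shows "ev m v (rel_elt d m w) = 0"
  by (simp add: rel_elt_def ev_trees[OF assms])

lemma V_relators_kernel:
  "(V_relators d \<tau> :: ((gen \<Rightarrow> 'k::field_char_0) dtree \<Rightarrow>\<^sub>0 'k) set set) \<subseteq> ev_kernel d \<tau>"
proof -
  obtain m n i where \<tau>: "\<tau> = (m, n, i)" by (cases \<tau>)
  show ?thesis
  proof (cases "rel_arity m n \<and> i = rel_deg d m")
    case True
    then have "V.cls d (m, n, i) (rel_elt d m id_W) \<in> ev_kernel d (m, n, i)"
      using cls_ev_kernel[OF keys_rel_elt[OF _ id_W], of m n d] ev_rel_elt[OF _ _ id_W, of m n _ d] by blast
    then show ?thesis unfolding \<tau> V_relators_eq if_P[OF True] by simp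
  next
    case False
    then show ?thesis unfolding \<tau> V_relators_eq if_not_P[OF False] by simp
  qed
qed

lemma V_rel_kernel: "V_rel d \<tau> \<subseteq> ev_kernel d \<tau>"
  using subbimodule_ev_kernel V_relators_kernel unfolding subbimodule_gen_def by blast

lemma V_rel_least: "subbimodule (V.F d) I \<Longrightarrow> (\<And>\<tau>. V_relators d \<tau> \<subseteq> I \<tau>) \<Longrightarrow> V_rel d \<tau> \<subseteq> I \<tau>"
  unfolding subbimodule_gen_def by blast

lemma V_relD: "C \<in> V_rel d \<tau> \<Longrightarrow> subbimodule (V.F d) I \<Longrightarrow> (\<And>\<tau>. V_relators d \<tau> \<subseteq> I \<tau>) \<Longrightarrow> C \<in> I \<tau>"
  using V_rel_least by blast

lemma V_relI: "(\<And>I. subbimodule (V.F d) I \<Longrightarrow> (\<And>\<tau>. V_relators d \<tau> \<subseteq> I \<tau>) \<Longrightarrow> C \<in> I \<tau>) \<Longrightarrow> C \<in> V_rel d \<tau>"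
  unfolding subbimodule_gen_def by blast

lemma V_rel_submodule:
  assumes "(m, n) \<in> J0"
  shows "submodule (V_rel d (m, n, i)) ground (sp (V.F d :: ('k::field_char_0, _) dioperad) (m, n, i))"
proof -
  have s: "submodule (I (m, n, i)) ground (sp (V.F d) (m, n, i))" if "subbimodule (V.F d) I" for I
    using that assms unfolding subbimodule_def by blast
  show ?thesis
    unfolding submodule_iff[OF V.F_module]
  proof (intro conjI ballI allI)
    show "V_rel d (m, n, i) \<subseteq> carrier (sp (V.F d) (m, n, i))"
      using V_rel_kernel ev_kernel_sub by (rule order_trans)
    show "\<zero>\<^bsub>sp (V.F d) (m, n, i)\<^esub> \<in> V_rel d (m, n, i)"
      by (rule V_relI) (rule submoduleD(2)[OF V.F_module s])
    fix C D :: "((gen \<Rightarrow> 'k) dtree \<Rightarrow>\<^sub>0 'k) set" and c :: 'k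
    assume C: "C \<in> V_rel d (m, n, i)" and D: "D \<in> V_rel d (m, n, i)"
    show "C \<oplus>\<^bsub>sp (V.F d) (m, n, i)\<^esub> D \<in> V_rel d (m, n, i)"
      by (rule V_relI) (rule submoduleD(3)[OF V.F_module s V_relD[OF C] V_relD[OF D]])
    show "c \<odot>\<^bsub>sp (V.F d) (m, n, i)\<^esub> C \<in> V_rel d (m, n, i)"
      by (rule V_relI) (rule submoduleD(4)[OF V.F_module s V_relD[OF C]])
  qed
qed

text \<open>The class is the translate of the generating relator by the group element belonging to
  \<open>w\<close>, hence lies in every sub-bimodule that contains the generator.\<close>

lemma rel_elt_V_rel:
  assumes mn: "rel_arity m n" and w: "w \<in> W m n"
  shows "V.cls d (m, n, rel_deg d m) (rel_elt d m w :: _ \<Rightarrow>\<^sub>0 'k::field_char_0) \<in> V_rel d (m, n, rel_deg d m)"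
proof (rule V_relI)
  fix I :: "idx \<Rightarrow> ((gen \<Rightarrow> 'k) dtree \<Rightarrow>\<^sub>0 'k) set set"
  assume I: "subbimodule (V.F d) I" "\<And>\<tau>. V_relators d \<tau> \<subseteq> I \<tau>"
  have J: "(m, n) \<in> J0" using mn J0_small by auto
  have p: "fst w permutes {1..m}" "pinv (snd w) permutes {1..n}"
    using w permutes_inv by (auto simp: W_def)
  have "V.cls d (m, n, rel_deg d m) (rel_elt d m id_W) \<in> I (m, n, rel_deg d m)"
    using I(2)[of "(m, n, rel_deg d m)"] unfolding V_relators_eq if_P[OF conjI[OF mn refl]] by simp
  then have act: "act (V.F d) (m, n, rel_deg d m) (fst w) (pinv (snd w)) (V.cls d (m, n, rel_deg d m) (rel_elt d m id_W))
      \<in> I (m, n, rel_deg d m)"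
    using I(1) J p unfolding subbimodule_def by blast
  have "lin_ext (relabel (fst w) (pinv (snd w))) (rel_elt d m id_W) = (rel_elt d m w :: _ \<Rightarrow>\<^sub>0 'k)"
    unfolding rel_elt_def tree_id by (simp add: treeL_def treeR_def)
  then show "V.cls d (m, n, rel_deg d m) (rel_elt d m w) \<in> I (m, n, rel_deg d m)"
    using act by (simp only: V.F_act[OF p keys_rel_elt[OF mn id_W]])
qed

section \<open>Normal forms modulo the relations\<close>

lemma set_dec_same: "a < length (verts t) \<Longrightarrow> set_dec a (dec (verts t ! a)) t = t"
  by (rule dtree_eqI) (simp_all add: vertex.expand list_update_same_conv)

lemma zero_dec_N:
  fixes t :: "(gen \<Rightarrow> 'k::field_char_0) dtree"
  assumes t: "t \<in> dtrees (V_gens d) \<tau>" and v: "v \<in> set (verts t)" "dec v = (\<lambda>_. 0)"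
  shows "Poly_Mapping.single t 1 \<in> V.N d \<tau>"
proof -
  obtain a where a: "a < length (verts t)" "verts t ! a = v" using v(1) by (auto simp: in_set_conv_nth)
  obtain m n i where \<tau>: "\<tau> = (m, n, i)" by (cases \<tau>)
  have "dec v \<in> carrier (sp (V_gens d) (vidx v))" using dtreesD(5)[OF t[unfolded \<tau>] v(1)] .
  \<comment> \<open>Scaling a zero decoration by 0 changes nothing and the subtracted term has
    coefficient 0, so this relator is \<open>t\<close> itself.\<close>
  then have "Poly_Mapping.single (set_dec a (0 \<odot>\<^bsub>sp (V_gens d) (vidx (verts t ! a))\<^esub> dec v) t) 1
      - Poly_Mapping.single (set_dec a (dec v) t) 0 \<in> V.N d \<tau>"
    using t a by (intro V.tree_relators_N tree_relators.rel_smult) auto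
  moreover have "set_dec a (0 \<odot>\<^bsub>sp (V_gens d) (vidx (verts t ! a))\<^esub> dec v) t = t"
    using set_dec_same[OF a(1)] a(2) v(2) by simp
  ultimately show ?thesis by simp
qed

lemma expand_dec_N:
  fixes t :: "(gen \<Rightarrow> 'k::field_char_0) dtree"
  assumes t: "t \<in> dtrees (V_gens d) \<tau>" and a: "a < length (verts t)" "vidx (verts t ! a) = (1, 2, 0)"
  defines "x \<equiv> dec (verts t ! a)"
  shows "Poly_Mapping.single t 1 - (scale (x Mu) (Poly_Mapping.single (set_dec a (unit_gen Mu) t) 1)
    + scale (x MuBar) (Poly_Mapping.single (set_dec a (unit_gen MuBar) t) 1)) \<in> V.N d \<tau>"
proof -
  obtain m n i where \<tau>: "\<tau> = (m, n, i)" by (cases \<tau>)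
  let ?S = "sp (V_gens d) (vidx (verts t ! a)) :: ('k, gen \<Rightarrow> 'k) module"
  have S: "?S = V_space {Mu, MuBar}" using a(2) by simp
  let ?y = "\<lambda>g. x Mu * unit_gen Mu g" and ?z = "\<lambda>g. x MuBar * unit_gen MuBar g"
  have x: "x \<in> carrier (V_space {Mu, MuBar})"
    using dtreesD(5)[OF t[unfolded \<tau>], of "verts t ! a"] a S unfolding x_def by (metis nth_mem)
  have yz: "?y \<in> carrier ?S" "?z \<in> carrier ?S" unfolding S by (auto simp: unit_gen_def)
  have "?y \<oplus>\<^bsub>?S\<^esub> ?z = x"
  proof
    show "(?y \<oplus>\<^bsub>?S\<^esub> ?z) g = x g" for g using x unfolding S by (cases g) (auto simp: unit_gen_def)
  qed
  then have 1: "Poly_Mapping.single t 1 - Poly_Mapping.single (set_dec a ?y t) 1 - Poly_Mapping.single (set_dec a ?z t) 1 \<in> V.N d \<tau>"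
    using V.tree_relators_N[OF tree_relators.rel_add[OF t a(1) yz]] set_dec_same[OF a(1)] by (simp add: x_def)
  have u: "unit_gen Mu \<in> carrier ?S" "unit_gen MuBar \<in> carrier ?S" unfolding S by (rule unit_carrier)+
  have 2: "Poly_Mapping.single (set_dec a ?y t) 1 - Poly_Mapping.single (set_dec a (unit_gen Mu) t) (x Mu) \<in> V.N d \<tau>"
    "Poly_Mapping.single (set_dec a ?z t) 1 - Poly_Mapping.single (set_dec a (unit_gen MuBar) t) (x MuBar) \<in> V.N d \<tau>"
    using V.tree_relators_N[OF tree_relators.rel_smult[OF t a(1) u(1), of "x Mu"]]
      V.tree_relators_N[OF tree_relators.rel_smult[OF t a(1) u(2), of "x MuBar"]] unfolding S by simp_all
  \<comment> \<open>The additivity relator and the two scaling relators telescope to the expansion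
    of \<open>t\<close>.\<close>
  have "(Poly_Mapping.single t 1 - Poly_Mapping.single (set_dec a ?y t) 1 - Poly_Mapping.single (set_dec a ?z t) 1)
      + ((Poly_Mapping.single (set_dec a ?y t) 1 - Poly_Mapping.single (set_dec a (unit_gen Mu) t) (x Mu))
      + (Poly_Mapping.single (set_dec a ?z t) 1 - Poly_Mapping.single (set_dec a (unit_gen MuBar) t) (x MuBar))) \<in> V.N d \<tau>"
    using 1 2 V.N_submodule[of d \<tau>] unfolding submodule_formal_sums_iff by blast
  then show ?thesis by (simp add: scale_single algebra_simps)
qed

text \<open>Sums congruent to combinations of left trees modulo the relations. The functionals
  \<open>ev\<close> separate left trees, so the converse of \<open>V_rel_kernel\<close> follows once
  all trees are known to be reducible.\<close>

definition reducible :: "int \<Rightarrow> nat \<Rightarrow> nat \<Rightarrow> int \<Rightarrow> ((gen \<Rightarrow> 'k::field_char_0) dtree \<Rightarrow>\<^sub>0 'k) set" where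
  "reducible d m n i = {A. \<exists>\<alpha>. Poly_Mapping.keys (A - (\<Sum>w \<in> W m n. Poly_Mapping.single (treeL d m w) (\<alpha> w))) \<subseteq> dtrees (V_gens d) (m, n, i)
    \<and> V.cls d (m, n, i) (A - (\<Sum>w \<in> W m n. Poly_Mapping.single (treeL d m w) (\<alpha> w))) \<in> V_rel d (m, n, i)}"

context
  fixes d :: int and m n :: nat and i :: int
  assumes mn: "rel_arity m n"
begin

lemma J: "(m, n) \<in> J0"
  using mn J0_small by auto

lemma reducible_rel:
  fixes A :: "(gen \<Rightarrow> 'k::field_char_0) dtree \<Rightarrow>\<^sub>0 'k"
  assumes "Poly_Mapping.keys A \<subseteq> dtrees (V_gens d) (m, n, i)" "V.cls d (m, n, i) A \<in> V_rel d (m, n, i)"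
  shows "A \<in> reducible d m n i"
  unfolding reducible_def by (rule CollectI, rule exI[of _ "\<lambda>_. 0"]) (use assms in simp)

lemma reducible_N:
  fixes A :: "(gen \<Rightarrow> 'k::field_char_0) dtree \<Rightarrow>\<^sub>0 'k"
  assumes "A \<in> V.N d (m, n, i)"
  shows "A \<in> reducible d m n i"
proof (rule reducible_rel)
  show k: "Poly_Mapping.keys A \<subseteq> dtrees (V_gens d) (m, n, i)"
    using assms V.N_submodule[of d "(m, n, i)"] unfolding submodule_formal_sums_iff by blast
  have "V.cls d (m, n, i) A = \<zero>\<^bsub>sp (V.F d) (m, n, i)\<^esub>"
    using V.cls_eq_iff[OF k, of 0] assms by (simp add: V.F_zero)
  then show "V.cls d (m, n, i) A \<in> V_rel d (m, n, i)"
    using submoduleD(2)[OF V.F_module V_rel_submodule[OF J]] by metis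
qed

lemma reducible_add:
  fixes A B :: "(gen \<Rightarrow> 'k::field_char_0) dtree \<Rightarrow>\<^sub>0 'k"
  assumes A: "A \<in> reducible d m n i" and B: "B \<in> reducible d m n i"
  shows "A + B \<in> reducible d m n i"
proof -
  let ?L = "\<lambda>\<alpha>. \<Sum>w \<in> W m n. Poly_Mapping.single (treeL d m w) (\<alpha> w) :: (gen \<Rightarrow> 'k) dtree \<Rightarrow>\<^sub>0 'k"
  obtain \<alpha> \<beta> where a: "Poly_Mapping.keys (A - ?L \<alpha>) \<subseteq> dtrees (V_gens d) (m, n, i)" "V.cls d (m, n, i) (A - ?L \<alpha>) \<in> V_rel d (m, n, i)"
    and b: "Poly_Mapping.keys (B - ?L \<beta>) \<subseteq> dtrees (V_gens d) (m, n, i)" "V.cls d (m, n, i) (B - ?L \<beta>) \<in> V_rel d (m, n, i)"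
    using A B unfolding reducible_def by blast
  have eq: "A + B - ?L (\<lambda>w. \<alpha> w + \<beta> w) = (A - ?L \<alpha>) + (B - ?L \<beta>)"
    by (simp add: single_add sum.distrib)
  have "Poly_Mapping.keys ((A - ?L \<alpha>) + (B - ?L \<beta>)) \<subseteq> dtrees (V_gens d) (m, n, i)"
    using Poly_Mapping.keys_add[of "A - ?L \<alpha>" "B - ?L \<beta>"] a(1) b(1) by blast
  moreover have "V.cls d (m, n, i) ((A - ?L \<alpha>) + (B - ?L \<beta>)) \<in> V_rel d (m, n, i)"
    using submoduleD(3)[OF V.F_module V_rel_submodule[OF J] a(2) b(2)] V.F_add[OF a(1) b(1)] by simp
  ultimately show ?thesis
    unfolding reducible_def by (intro CollectI exI[of _ "\<lambda>w. \<alpha> w + \<beta> w"]) (simp only: eq)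
qed

lemma reducible_scale:
  fixes A :: "(gen \<Rightarrow> 'k::field_char_0) dtree \<Rightarrow>\<^sub>0 'k"
  assumes A: "A \<in> reducible d m n i"
  shows "scale c A \<in> reducible d m n i"
proof -
  let ?L = "\<lambda>\<alpha>. \<Sum>w \<in> W m n. Poly_Mapping.single (treeL d m w) (\<alpha> w) :: (gen \<Rightarrow> 'k) dtree \<Rightarrow>\<^sub>0 'k"
  obtain \<alpha> where a: "Poly_Mapping.keys (A - ?L \<alpha>) \<subseteq> dtrees (V_gens d) (m, n, i)" "V.cls d (m, n, i) (A - ?L \<alpha>) \<in> V_rel d (m, n, i)"
    using A unfolding reducible_def by blast
  have "scale c (\<Sum>w \<in> S. Poly_Mapping.single (treeL d m w) (\<alpha> w)) = (\<Sum>w \<in> S. Poly_Mapping.single (treeL d m w :: (gen \<Rightarrow> 'k) dtree) (c * \<alpha> w))" for S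
    by (induction S rule: infinite_finite_induct) (simp_all add: scale_algebra scale_single)
  then have eq: "scale c A - ?L (\<lambda>w. c * \<alpha> w) = scale c (A - ?L \<alpha>)"
    by (simp add: scale_algebra)
  have "Poly_Mapping.keys (scale c (A - ?L \<alpha>)) \<subseteq> dtrees (V_gens d) (m, n, i)"
    using keys_scale[of c "A - ?L \<alpha>"] a(1) by blast
  moreover have "V.cls d (m, n, i) (scale c (A - ?L \<alpha>)) \<in> V_rel d (m, n, i)"
    unfolding V.F_smult[OF a(1), symmetric]
    by (rule submoduleD(4)[OF V.F_module V_rel_submodule[OF J] a(2)])
  ultimately show ?thesis
    unfolding reducible_def by (intro CollectI exI[of _ "\<lambda>w. c * \<alpha> w"]) (simp only: eq)
qed

lemma reducible_diff:
  fixes A B :: "(gen \<Rightarrow> 'k::field_char_0) dtree \<Rightarrow>\<^sub>0 'k"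
  assumes "A - B \<in> reducible d m n i" "B \<in> reducible d m n i"
  shows "A \<in> reducible d m n i"
  using reducible_add[OF assms] by simp

lemma reducible_treeL:
  assumes "i = rel_deg d m" "v \<in> W m n"
  shows "(Poly_Mapping.single (treeL d m v) 1 :: _ \<Rightarrow>\<^sub>0 'k::field_char_0) \<in> reducible d m n i"
proof -
  let ?s = "\<lambda>w. Poly_Mapping.single (treeL d m w :: (gen \<Rightarrow> 'k) dtree) :: 'k \<Rightarrow> _"
  have "(\<Sum>w \<in> W m n. ?s w (if w = v then 1 else 0))
      = (\<Sum>w \<in> W m n. if w = v then ?s v 1 else 0)"
    by (intro sum.cong) auto
  also have "\<dots> = ?s v 1" using assms(2) by simp
  finally have *: "?s v 1 - (\<Sum>w \<in> W m n. ?s w (if w = v then 1 else 0)) = 0" by simp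
  show ?thesis
    unfolding reducible_def
    by (rule CollectI, rule exI[of _ "\<lambda>w. if w = v then 1 else 0"], unfold *, fold V.F_zero)
       (intro conjI submoduleD(2)[OF V.F_module V_rel_submodule[OF J]], simp)
qed

text \<open>A right tree is the left tree of the same index minus a relation.\<close>

lemma reducible_treeR:
  assumes "i = rel_deg d m" "v \<in> W m n"
  shows "(Poly_Mapping.single (treeR d m v) 1 :: _ \<Rightarrow>\<^sub>0 'k::field_char_0) \<in> reducible d m n i"
proof -
  have "(rel_elt d m v :: _ \<Rightarrow>\<^sub>0 'k) \<in> reducible d m n i"
    by (rule reducible_rel) (simp_all only: assms(1) keys_rel_elt[OF mn assms(2)] rel_elt_V_rel[OF mn assms(2)])
  then have "scale (- 1) (rel_elt d m v :: _ \<Rightarrow>\<^sub>0 'k) + Poly_Mapping.single (treeL d m v) 1 \<in> reducible d m n i"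
    by (intro reducible_add reducible_scale reducible_treeL assms)
  then show ?thesis by (simp add: rel_elt_def scale_algebra)
qed

lemma reducible_renumber:
  fixes t :: "(gen \<Rightarrow> 'k::field_char_0) dtree"
  assumes "t \<in> dtrees (V_gens d) (m, n, i)" "a < length (verts t)"
    "\<pi> permutes {1..outs (verts t ! a)}" "\<sigma> permutes {1..ins (verts t ! a)}"
    and "Poly_Mapping.single t 1 \<in> reducible d m n i"
  shows "Poly_Mapping.single (renumber (V_gens d) a \<pi> \<sigma> t) 1 \<in> reducible d m n i"
  by (rule reducible_diff[OF reducible_N[OF V.tree_relators_N[OF tree_relators.rel_renumber[OF assms(1-4)]]] assms(5)])

lemma reducible_expand:
  fixes t :: "(gen \<Rightarrow> 'k::field_char_0) dtree"
  assumes t: "t \<in> dtrees (V_gens d) (m, n, i)" "a < length (verts t)" "vidx (verts t ! a) = (1, 2, 0)"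
    and "Poly_Mapping.single (set_dec a (unit_gen Mu) t) 1 \<in> reducible d m n i"
    "Poly_Mapping.single (set_dec a (unit_gen MuBar) t) 1 \<in> reducible d m n i"
  shows "Poly_Mapping.single t 1 \<in> reducible d m n i"
  using assms(4,5) by (intro reducible_diff[OF reducible_N[OF expand_dec_N[OF t]]] reducible_add reducible_scale)

end

lemma unit_gen_Mu_swap: "unit_gen Mu \<circ> swap_gen = unit_gen MuBar"
  by (simp add: unit_gen_swap)

lemma unit_gen_carrier: "p \<in> {Mu, MuBar} \<Longrightarrow> (unit_gen p :: gen \<Rightarrow> 'k::field_char_0) \<in> carrier (V_space {Mu, MuBar})"
  using unit_gen_mem by blast

lemma transpose_12: "Transposition.transpose 1 2 permutes {1..2::nat}"
  by (rule permutes_swap_id) auto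

text \<open>\<open>MuBar\<close> is \<open>Mu\<close> with its inputs exchanged, so it can be
  removed from one vertex at a time, at the price of changing \<open>i\<close> or the order of
  \<open>b\<close> and \<open>c\<close>.\<close>

lemma reducible_13:
  assumes i: "one_two i" and w: "word3 a b c" and p: "p \<in> {Mu, MuBar}" and q: "q \<in> {Mu, MuBar}"
  shows "(Poly_Mapping.single (tree13 (unit_gen p) (unit_gen q) i a b c) 1 :: _ \<Rightarrow>\<^sub>0 'k::field_char_0) \<in> reducible d 1 3 0"
proof -
  let ?\<tau> = "Transposition.transpose 1 2 :: nat \<Rightarrow> nat"
  let ?s = "\<lambda>p q i a b c. Poly_Mapping.single (tree13 (unit_gen p) (unit_gen q) i a b c) 1 :: _ \<Rightarrow>\<^sub>0 'k"
  have mn: "rel_arity 1 3" and deg: "0 = rel_deg d 1" by (simp_all add: rel_deg_def)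
  have MM: "?s Mu Mu i a b c \<in> reducible d 1 3 0" if i: "one_two i" and w: "word3 a b c" for i a b c
    using i
  proof
    assume i: "i = 1"
    have "word3 b c a" using w by (auto simp: word3_def)
    then obtain \<rho> where \<rho>: "\<rho> permutes {1..3}" "\<rho> 1 = b" "\<rho> 2 = c" "\<rho> 3 = a" using perm3_exists by metis
    then have W: "(id, \<rho>) \<in> W 1 3" by (simp add: W_def permutes_id)
    show ?thesis using reducible_treeL[OF mn deg W] \<rho> by (simp add: tree_13[OF W] i)
  next
    assume i: "i = 2"
    obtain \<rho> where \<rho>: "\<rho> permutes {1..3}" "\<rho> 1 = a" "\<rho> 2 = b" "\<rho> 3 = c" using perm3_exists[OF w] by metis
    then have W: "(id, \<rho>) \<in> W 1 3" by (simp add: W_def permutes_id)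
    show ?thesis using reducible_treeR[OF mn deg W] \<rho> by (simp add: tree_13[OF W] i)
  qed
  have Mq: "?s Mu q i a b c \<in> reducible d 1 3 0" if i: "one_two i" and w: "word3 a b c" for i a b c
  proof (cases "q = Mu")
    case False
    have w': "word3 a c b" using w by (auto simp: word3_def)
    have "renumber (V_gens d) 1 id ?\<tau> (tree13 (unit_gen Mu) (unit_gen Mu) i a c b)
        = tree13 (unit_gen Mu) (unit_gen MuBar :: gen \<Rightarrow> 'k) i a b c"
      by (simp add: renumber_tree13(2)[OF i transpose_12] V_gens_act unit_gen_Mu_swap)
    moreover have "Poly_Mapping.single (renumber (V_gens d) 1 id ?\<tau> (tree13 (unit_gen Mu) (unit_gen Mu :: gen \<Rightarrow> 'k) i a c b)) 1
        \<in> reducible d 1 3 0"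
      using MM[OF i w'] transpose_12
      by (intro reducible_renumber[OF mn] tree13_dtrees unit_carrier i w') (simp_all add: permutes_id)
    ultimately show ?thesis using False q by auto
  qed (use MM[OF i w] in simp)
  show ?thesis
  proof (cases "p = Mu")
    case False
    have i': "one_two (3 - i)" "?\<tau> (3 - i) = i" using i by (auto simp: One_nat_def[symmetric])
    have "renumber (V_gens d) 0 id ?\<tau> (tree13 (unit_gen Mu) (unit_gen q) (3 - i) a b c)
        = tree13 (unit_gen MuBar) (unit_gen q :: gen \<Rightarrow> 'k) i a b c"
      by (simp add: renumber_tree13(1)[OF i'(1) transpose_12] i'(2) V_gens_act unit_gen_Mu_swap)
    moreover have "Poly_Mapping.single (renumber (V_gens d) 0 id ?\<tau> (tree13 (unit_gen Mu) (unit_gen q :: gen \<Rightarrow> 'k) (3 - i) a b c)) 1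
        \<in> reducible d 1 3 0"
      using Mq[OF i'(1) w] transpose_12
      by (intro reducible_renumber[OF mn] tree13_dtrees unit_carrier(1) unit_gen_carrier[OF q] i'(1) w) (simp_all add: permutes_id)
    ultimately show ?thesis using False p by auto
  qed (use Mq[OF i w] in simp)
qed

text \<open>The basis trees have \<open>p = 3 - i\<close>. The other output is reached by the
  symmetry of \<nu>, and \<open>MuBar\<close> by exchanging the inputs of \<mu>.\<close>

lemma reducible_21:
  assumes i: "one_two i" and r: "one_two r" and p: "one_two p" and q: "q \<in> {Mu, MuBar}"
  shows "(Poly_Mapping.single (tree21 d (unit_gen q) (unit_gen Nu) i r p) 1 :: _ \<Rightarrow>\<^sub>0 'k::field_char_0) \<in> reducible d 2 1 d"
proof -
  let ?\<tau> = "Transposition.transpose 1 2 :: nat \<Rightarrow> nat"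
  let ?s = "\<lambda>q i r p. Poly_Mapping.single (tree21 d (unit_gen q) (unit_gen Nu) i r p) 1 :: _ \<Rightarrow>\<^sub>0 'k"
  have mn: "rel_arity 2 1" and deg: "d = rel_deg d 2" by (simp_all add: rel_deg_def)
  have base: "?s Mu i r (3 - i) \<in> reducible d 2 1 d" if i: "one_two i" and r: "one_two r" for i r
    using i
  proof
    assume i: "i = 1"
    \<comment> \<open>The left tree attaches the head vertex to root \<open>fst w 2\<close>, so the
      permutation has to take 2 to \<open>r\<close>.\<close>
    have W: "(Transposition.transpose 2 r, id) \<in> W 2 1"
      using r by (auto simp: W_def permutes_id intro: permutes_swap_id)
    show ?thesis using reducible_treeL[OF mn deg W] by (simp add: tree_21[OF W] i)
  next
    assume i: "i = 2"
    have W: "(Transposition.transpose 1 r, id) \<in> W 2 1"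
      using r by (auto simp: W_def permutes_id intro: permutes_swap_id)
    show ?thesis using reducible_treeR[OF mn deg W] by (simp add: tree_21[OF W] i One_nat_def[symmetric])
  qed
  have Mu: "?s Mu i r p \<in> reducible d 2 1 d" if i: "one_two i" for i
  proof (cases "p = 3 - i")
    case False
    then have p': "one_two (3 - i)" "?\<tau> (3 - i) = p" using i p by (auto simp: One_nat_def[symmetric])
    have "renumber (V_gens d) 1 ?\<tau> id (tree21 d (unit_gen Mu) (unit_gen Nu) i r (3 - i))
        = tree21 d (unit_gen Mu) (unit_gen Nu :: gen \<Rightarrow> 'k) i r p"
      by (simp add: renumber_tree21(2)[OF i p'(1) transpose_12] p'(2) V_gens_act)
    moreover have "Poly_Mapping.single (renumber (V_gens d) 1 ?\<tau> id (tree21 d (unit_gen Mu) (unit_gen Nu :: gen \<Rightarrow> 'k) i r (3 - i))) 1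
        \<in> reducible d 2 1 d"
      using base[OF i r] transpose_12
      by (intro reducible_renumber[OF mn] tree21_dtrees unit_carrier i r p'(1)) (simp_all add: permutes_id)
    ultimately show ?thesis by simp
  qed (use base[OF i r] in simp)
  show ?thesis
  proof (cases "q = Mu")
    case False
    have i': "one_two (3 - i)" "?\<tau> (3 - i) = i" using i by (auto simp: One_nat_def[symmetric])
    have "renumber (V_gens d) 0 id ?\<tau> (tree21 d (unit_gen Mu) (unit_gen Nu) (3 - i) r p)
        = tree21 d (unit_gen MuBar) (unit_gen Nu :: gen \<Rightarrow> 'k) i r p"
      by (simp add: renumber_tree21(1)[OF i'(1) p transpose_12] i'(2) V_gens_act unit_gen_Mu_swap)
    moreover have "Poly_Mapping.single (renumber (V_gens d) 0 id ?\<tau> (tree21 d (unit_gen Mu) (unit_gen Nu :: gen \<Rightarrow> 'k) (3 - i) r p)) 1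
        \<in> reducible d 2 1 d"
      using Mu[OF i'(1)] transpose_12
      by (intro reducible_renumber[OF mn] tree21_dtrees unit_carrier i'(1) r p) (simp_all add: permutes_id)
    ultimately show ?thesis using False q by auto
  qed (use Mu[OF i] in simp)
qed

text \<open>A zero decoration makes the class of the tree zero. Otherwise the decorations are
  expanded in \<open>Mu\<close>, \<open>MuBar\<close> and \<open>Nu\<close>, one vertex at a time,
  down to trees with basis decorations.\<close>

lemma reducible_tree:
  fixes t :: "(gen \<Rightarrow> 'k::field_char_0) dtree"
  assumes mn: "rel_arity m n" and t: "t \<in> dtrees (V_gens d) (m, n, i)"
  shows "Poly_Mapping.single t 1 \<in> reducible d m n i"
proof (cases "\<exists>v \<in> set (verts t). dec v = (\<lambda>_. 0)")
  case True
  then show ?thesis using reducible_N[OF mn zero_dec_N[OF t]] by blast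
next
  case False
  then obtain u where u: "std d m n u" "t = u \<or> t = swap_verts 0 u"
    using zero_dec_or_std[OF t mn] by blast
  note s = std_simps[OF u(1)]
  obtain v w where vs: "verts u = [v, w]" using s(1) by (auto simp: length_Suc_conv numeral_2_eq_2)
  have ut: "u \<in> dtrees (V_gens d) (m, n, i)"
    using u(2) dtrees_swap_verts[OF t, of 0] s(4) t by (auto simp: vs)
  have i: "i = rel_deg d m" using dtreesD(6)[OF ut] s(5) by simp
  have "Poly_Mapping.single u 1 \<in> reducible d m n i"
    using u(1)
  proof (cases rule: std_cases)
    case (tree13 f g j a b c)
    have ut': "tree13 f g j a b c \<in> dtrees (V_gens d) (1, 3, 0)" using ut tree13 i by (simp add: rel_deg_def)
    have f: "f \<in> carrier (V_space {Mu, MuBar})" "g \<in> carrier (V_space {Mu, MuBar})"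
      using dtreesD(5)[OF ut', of "Vertex 1 2 0 f"] dtreesD(5)[OF ut', of "Vertex 1 2 0 g"] by simp_all
    have mn': "rel_arity 1 3" by simp
    have 1: "Poly_Mapping.single (tree13 (unit_gen q) g j a b c) 1 \<in> reducible d 1 3 0" if "q \<in> {Mu, MuBar}" for q
    proof (rule reducible_expand[OF mn', where a = 1])
      show "tree13 (unit_gen q) g j a b c \<in> dtrees (V_gens d) (1, 3, 0)"
        by (intro tree13_dtrees unit_gen_carrier that f tree13)
      have "set_dec 1 h (tree13 (unit_gen q) g j a b c) = tree13 (unit_gen q) h j a b c" for h :: "gen \<Rightarrow> 'k"
        by (rule dtree_eqI) (simp_all add: edges_tree One_nat_def)
      then show "Poly_Mapping.single (set_dec 1 (unit_gen Mu) (tree13 (unit_gen q) g j a b c)) 1 \<in> reducible d 1 3 0"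
        "Poly_Mapping.single (set_dec 1 (unit_gen MuBar) (tree13 (unit_gen q) g j a b c)) 1 \<in> reducible d 1 3 0"
        using reducible_13[OF tree13(3,4) that, of Mu d] reducible_13[OF tree13(3,4) that, of MuBar d] by simp_all
    qed simp_all
    have "Poly_Mapping.single (tree13 f g j a b c) 1 \<in> reducible d 1 3 0"
    proof (rule reducible_expand[OF mn' ut', where a = 0])
      have "set_dec 0 h (tree13 f g j a b c) = tree13 h g j a b c" for h :: "gen \<Rightarrow> 'k"
        by (rule dtree_eqI) (simp_all add: edges_tree One_nat_def)
      then show "Poly_Mapping.single (set_dec 0 (unit_gen Mu) (tree13 f g j a b c)) 1 \<in> reducible d 1 3 0"
        "Poly_Mapping.single (set_dec 0 (unit_gen MuBar) (tree13 f g j a b c)) 1 \<in> reducible d 1 3 0"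
        using 1 by simp_all
    qed simp_all
    then show ?thesis using tree13 i by (simp add: rel_deg_def)
  next
    case (tree21 f h j r p)
    have ut': "tree21 d f h j r p \<in> dtrees (V_gens d) (2, 1, d)" using ut tree21 i by (simp add: rel_deg_def)
    have f: "f \<in> carrier (V_space {Mu, MuBar})" "h \<in> carrier (V_space {Nu})"
      using dtreesD(5)[OF ut', of "Vertex 1 2 0 f"] dtreesD(5)[OF ut', of "Vertex 2 0 d h"] by simp_all
    have mn': "rel_arity 2 1" by simp
    have h: "h = (\<lambda>g. h Nu * unit_gen Nu g)"
    proof
      show "h g = h Nu * unit_gen Nu g" for g using f(2) by (cases g) (auto simp: unit_gen_def)
    qed
    have 1: "Poly_Mapping.single (tree21 d (unit_gen q) h j r p) 1 \<in> reducible d 2 1 d" if q: "q \<in> {Mu, MuBar}" for q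
    proof -
      let ?t = "tree21 d (unit_gen q) (unit_gen Nu) j r p :: (gen \<Rightarrow> 'k) dtree"
      have t: "?t \<in> dtrees (V_gens d) (2, 1, d)"
        by (intro tree21_dtrees unit_gen_carrier[OF q] unit_carrier tree21)
      have set: "set_dec 1 x ?t = tree21 d (unit_gen q) x j r p" for x
        by (rule dtree_eqI) (simp_all add: edges_tree One_nat_def)
      have u: "unit_gen Nu \<in> carrier (V_space {Nu} :: ('k, gen \<Rightarrow> 'k) module)" by (rule unit_carrier(3))
      have "Poly_Mapping.single (set_dec 1 (h Nu \<odot>\<^bsub>sp (V_gens d) (vidx (verts ?t ! 1))\<^esub> unit_gen Nu) ?t) 1
          - Poly_Mapping.single (set_dec 1 (unit_gen Nu) ?t) (h Nu) \<in> V.N d (2, 1, d)"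
        using u by (intro V.tree_relators_N tree_relators.rel_smult t) simp_all
      then have "Poly_Mapping.single (tree21 d (unit_gen q) h j r p) 1 - scale (h Nu) (Poly_Mapping.single ?t 1) \<in> V.N d (2, 1, d)"
        unfolding set by (simp add: scale_single h[symmetric])
      then have "Poly_Mapping.single (tree21 d (unit_gen q) h j r p) 1 - scale (h Nu) (Poly_Mapping.single ?t 1) \<in> reducible d 2 1 d"
        by (rule reducible_N[OF mn'])
      moreover have "scale (h Nu) (Poly_Mapping.single ?t 1) \<in> reducible d 2 1 d"
        by (rule reducible_scale[OF mn' reducible_21[OF tree21(3-5) q]])
      ultimately show ?thesis by (rule reducible_diff[OF mn'])
    qed
    have "Poly_Mapping.single (tree21 d f h j r p) 1 \<in> reducible d 2 1 d"
    proof (rule reducible_expand[OF mn' ut', where a = 0])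
      have "set_dec 0 x (tree21 d f h j r p) = tree21 d x h j r p" for x :: "gen \<Rightarrow> 'k"
        by (rule dtree_eqI) (simp_all add: edges_tree One_nat_def)
      then show "Poly_Mapping.single (set_dec 0 (unit_gen Mu) (tree21 d f h j r p)) 1 \<in> reducible d 2 1 d"
        "Poly_Mapping.single (set_dec 0 (unit_gen MuBar) (tree21 d f h j r p)) 1 \<in> reducible d 2 1 d"
        using 1 by simp_all
    qed simp_all
    then show ?thesis using tree21 i by (simp add: rel_deg_def)
  qed
  moreover have "Poly_Mapping.single (swap_verts 0 u) 1 \<in> reducible d m n i" if "Poly_Mapping.single u 1 \<in> reducible d m n i"
  proof -
    have "ksign (vdeg (verts u ! 0) * vdeg (verts u ! Suc 0)) = (1 :: 'k)"
      using s(9) by (simp add: ksign_def)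
    then have "Poly_Mapping.single (swap_verts 0 u) 1 - Poly_Mapping.single u 1 \<in> V.N d (m, n, i)"
      using V.tree_relators_N[OF tree_relators.rel_swap[OF ut, of 0]] by (simp add: vs)
    then have "Poly_Mapping.single (swap_verts 0 u) 1 - Poly_Mapping.single u 1 \<in> reducible d m n i"
      by (rule reducible_N[OF mn])
    then show ?thesis using that by (rule reducible_diff[OF mn])
  qed
  ultimately show ?thesis using u(2) by auto
qed

text \<open>Spanning meets independence: an element of the kernel is a relation plus a combination
  of left trees, and applying \<open>ev m v\<close> to it isolates the coefficient at
  \<open>v\<close>, which must therefore be 0.\<close>

lemma V_rel_eq:
  assumes mn: "(m, n) \<in> J0"
  shows "(V_rel d (m, n, i) :: ((gen \<Rightarrow> 'k::field_char_0) dtree \<Rightarrow>\<^sub>0 'k) set set) = ev_kernel d (m, n, i)"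
proof
  show "V_rel d (m, n, i) \<subseteq> ev_kernel d (m, n, i)" by (rule V_rel_kernel)
  show "(ev_kernel d (m, n, i) :: ((gen \<Rightarrow> 'k) dtree \<Rightarrow>\<^sub>0 'k) set set) \<subseteq> V_rel d (m, n, i)"
  proof (cases "rel_arity m n")
    case True
    show ?thesis
    proof
      fix C :: "((gen \<Rightarrow> 'k) dtree \<Rightarrow>\<^sub>0 'k) set" assume C: "C \<in> ev_kernel d (m, n, i)"
      then obtain A where A: "Poly_Mapping.keys A \<subseteq> dtrees (V_gens d) (m, n, i)" "C = V.cls d (m, n, i) A"
        using subsetD[OF ev_kernel_sub C] unfolding V.carrier_F by blast
      then have ev0: "w \<in> W m n \<Longrightarrow> ev m w A = 0" for w using cls_ev_kernel[OF A(1) True] C by blast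
      have "A \<in> reducible d m n i"
      proof (rule formal_sum_mem)
        show "0 \<in> reducible d m n i"
          by (rule reducible_N[OF True submoduleD(2)[OF module_formal_sums V.N_submodule, simplified]])
        show "Poly_Mapping.single t 1 \<in> reducible d m n i" if "t \<in> Poly_Mapping.keys A" for t
          using reducible_tree[OF True] A(1) that by blast
      qed (use reducible_add[OF True] reducible_scale[OF True] in blast)+
      then obtain \<alpha> where a: "Poly_Mapping.keys (A - (\<Sum>w \<in> W m n. Poly_Mapping.single (treeL d m w) (\<alpha> w))) \<subseteq> dtrees (V_gens d) (m, n, i)"
        "V.cls d (m, n, i) (A - (\<Sum>w \<in> W m n. Poly_Mapping.single (treeL d m w) (\<alpha> w))) \<in> V_rel d (m, n, i)"
        unfolding reducible_def by blast
      have ev_sum: "ev m v (\<Sum>w \<in> S. B w) = (\<Sum>w \<in> S. ev m v (B w))" for v S and B :: "_ \<Rightarrow> (gen \<Rightarrow> 'k) dtree \<Rightarrow>\<^sub>0 'k"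
        by (induction S rule: infinite_finite_induct) simp_all
      have "\<alpha> v = 0" if v: "v \<in> W m n" for v
      proof -
        have "ev m v (A - (\<Sum>w \<in> W m n. Poly_Mapping.single (treeL d m w) (\<alpha> w))) = 0"
          using subsetD[OF V_rel_kernel a(2)] cls_ev_kernel[OF a(1) True] v by blast
        moreover have "ev m v (\<Sum>w \<in> W m n. Poly_Mapping.single (treeL d m w) (\<alpha> w)) = \<alpha> v"
          unfolding ev_sum using v by (simp add: ev_trees[OF True v] cong: sum.cong)
        ultimately show ?thesis using ev0[OF v] by simp
      qed
      then have "(\<Sum>w \<in> W m n. Poly_Mapping.single (treeL d m w :: (gen \<Rightarrow> 'k) dtree) (\<alpha> w)) = 0" by (simp cong: sum.cong)
      then show "C \<in> V_rel d (m, n, i)" using a(2) A(2) by simp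
    qed
  next
    case False
    show ?thesis
      unfolding ev_kernel_zero[OF False] using submoduleD(2)[OF V.F_module V_rel_submodule[OF mn]] by simp
  qed
qed

section \<open>The pairing in coordinates\<close>

text \<open>The minus compensates for \<open>gen_sign\<close> at \<open>MuBar\<close>.\<close>

lemma dual_eval:
  fixes f :: "(gen \<Rightarrow> 'k::field_char_0) \<Rightarrow> 'k"
  shows "f \<in> carrier (dual_module (V_space {Mu, MuBar})) \<Longrightarrow> x \<in> carrier (V_space {Mu, MuBar}) \<Longrightarrow>
      f x = x Mu * undual f Mu - x MuBar * undual f MuBar"
    "f \<in> carrier (dual_module (V_space {Nu})) \<Longrightarrow> x \<in> carrier (V_space {Nu}) \<Longrightarrow> f x = x Nu * undual f Nu"
  using dual_expand[of "{Mu, MuBar}" f x] dual_expand[of "{Nu}" f x]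
  by (auto simp: undual_def gen_sign_def simp del: V_space_simps)

text \<open>The six terms are written starting from an arbitrary word, so that they can be matched
  with the leaves of a given tree.\<close>

lemma sum_perm3:
  assumes "word3 a b c"
  shows "(\<Sum>\<rho> | \<rho> permutes {1..3}. H (\<rho> 1) (\<rho> 2) (\<rho> 3)) =
    (H a b c + H a c b + H b a c + H b c a + H c a b + H c b a :: 'a::comm_monoid_add)"
proof -
  let ?S = "{(1, 2, 3), (1, 3, 2), (2, 1, 3), (2, 3, 1), (3, 1, 2), (3, 2, 1)} :: (nat \<times> nat \<times> nat) set"
  have "bij_betw (\<lambda>\<rho>. (\<rho> 1, \<rho> 2, \<rho> 3)) {\<rho>. \<rho> permutes {1..3}} ?S"
  proof (rule bij_betw_imageI)
    show "inj_on (\<lambda>\<rho>. (\<rho> 1, \<rho> 2, \<rho> 3)) {\<rho>. \<rho> permutes {1..3::nat}}"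
      by (rule inj_onI) (use perm3_eq in auto)
    show "(\<lambda>\<rho>. (\<rho> 1, \<rho> 2, \<rho> 3)) ` {\<rho>. \<rho> permutes {1..3}} = ?S"
    proof (intro equalityI subsetI)
      fix w assume "w \<in> (\<lambda>\<rho>. (\<rho> 1, \<rho> 2, \<rho> 3)) ` {\<rho>. \<rho> permutes {1..3::nat}}"
      then show "w \<in> ?S" using word3_perm unfolding word3_def by blast
    next
      fix w assume w: "w \<in> ?S"
      obtain x y z where xyz: "w = (x, y, z)" by (cases w)
      then have "word3 x y z" using w unfolding word3_def by simp
      then show "w \<in> (\<lambda>\<rho>. (\<rho> 1, \<rho> 2, \<rho> 3)) ` {\<rho>. \<rho> permutes {1..3}}"
        unfolding xyz by (rule perm3_exists) (auto intro!: image_eqI)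
    qed
  qed
  from sum.reindex_bij_betw[OF this, of "\<lambda>(x, y, z). H x y z"]
  have "(\<Sum>\<rho> | \<rho> permutes {1..3}. H (\<rho> 1) (\<rho> 2) (\<rho> 3)) =
      H 1 2 3 + H 1 3 2 + H 2 1 3 + H 2 3 1 + H 3 1 2 + H 3 2 1"
    by (simp add: add.assoc)
  then show ?thesis using assms by (auto simp: word3_def ac_simps)
qed

lemma id_neq_transpose: "id \<noteq> Transposition.transpose 1 (2::nat)"
proof
  assume "id = Transposition.transpose 1 (2::nat)"
  then have "id 1 = Transposition.transpose 1 (2::nat) 1" by (rule fun_cong)
  then show False by simp
qed

lemma sum_perm2: "(\<Sum>\<pi> | \<pi> permutes {1..2::nat}. H (\<pi> 1) (\<pi> 2)) = (H 1 2 + H 2 1 :: 'a::comm_monoid_add)"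
proof -
  have "Transposition.transpose 1 2 permutes {1..2::nat}" by (simp add: permutes_swap_id)
  then have "{\<pi>. \<pi> permutes {1..2::nat}} = {id, Transposition.transpose 1 2}"
    using permutes_2 by (auto simp: permutes_id)
  then show ?thesis by (simp add: id_neq_transpose)
qed

text \<open>A permutation of two letters is determined by one value; this singles out the unique
  renumbering matching two trees.\<close>

lemma S2_cases:
  assumes "one_two i" "one_two i'"
  shows "\<sigma> permutes {1..2} \<and> \<sigma> i' = i \<longleftrightarrow> \<sigma> = (if i = i' then id else Transposition.transpose 1 2)"
proof (cases "\<sigma> permutes {1..2}")
  case True
  have "id \<noteq> Transposition.transpose 1 (2::nat)" by (rule id_neq_transpose)
  with permutes_2[OF True] assms True show ?thesis by (elim disjE conjE) simp_all
next
  case False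
  then show ?thesis using transpose_12 permutes_id by metis
qed

lemma sum_W:
  "(\<Sum>w \<in> W 1 3. H w) = (\<Sum>\<rho> | \<rho> permutes {1..3}. H (id, \<rho>) :: 'a::comm_monoid_add)"
  "(\<Sum>w \<in> W 2 1. H w) = (\<Sum>\<pi> | \<pi> permutes {1..2}. H (\<pi>, id) :: 'a::comm_monoid_add)"
  unfolding W_def permutes_11 by (simp_all add: sum.cartesian_product')

lemma sgn3_simps:
  assumes "word3 a b c"
  shows "sgn3 a c b = - sgn3 a b c" "sgn3 b a c = - sgn3 a b c" "sgn3 b c a = sgn3 a b c"
    "sgn3 c a b = sgn3 a b c" "sgn3 c b a = - sgn3 a b c" "a \<noteq> b" "a \<noteq> c" "b \<noteq> c"
  using assms by (auto simp: word3_def sgn3_def)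

lemma word3_same:
  assumes "word3 a b c" "word3 a b' c'"
  shows "b = b' \<and> c = c' \<and> b \<noteq> c' \<and> c \<noteq> b' \<or> b = c' \<and> c = b' \<and> b \<noteq> b' \<and> c \<noteq> c'"
proof -
  have "b \<noteq> c" "b' \<noteq> c'" "{b, c} = {1, 2, 3} - {a}" "{b', c'} = {1, 2, 3} - {a}"
    using assms by (auto simp: word3_def)
  then show ?thesis by (metis doubleton_eq_iff)
qed

section \<open>The pairing on explicit trees\<close>

lemma quadruples_eq:
  fixes a' :: 'a and b' :: 'b and c' :: 'c and e' :: 'd
  assumes "\<And>a b c e. P a \<Longrightarrow> Q b \<Longrightarrow> R c \<Longrightarrow> S e \<Longrightarrow>
      T a b c e \<longleftrightarrow> C \<and> a = a' \<and> b = b' \<and> c = c' \<and> e = e'" "P a'" "Q b'" "R c'" "S e'"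
  shows "{(a, b, c, e). P a \<and> Q b \<and> R c \<and> S e \<and> T a b c e} = (if C then {(a', b', c', e')} else {})"
proof (rule Set.set_eqI)
  fix z :: "'a \<times> 'b \<times> 'c \<times> 'd"
  obtain a b c e where z: "z = (a, b, c, e)" by (cases z)
  have "(a, b, c, e) \<in> {(a, b, c, e). P a \<and> Q b \<and> R c \<and> S e \<and> T a b c e} \<longleftrightarrow>
      (a, b, c, e) \<in> (if C then {(a', b', c', e')} else {})" for a b c e
    using assms(1)[of a b c e] assms(2-5) by (cases C) auto
  then show "z \<in> {(a, b, c, e). P a \<and> Q b \<and> R c \<and> S e \<and> T a b c e} \<longleftrightarrow> z \<in> (if C then {(a', b', c', e')} else {})"
    unfolding z .
qed

text \<open>With \<open>m1 = 1\<close> and \<open>n2 = 2\<close> the composition in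
  \<open>Omega\<close> contributes the parity of \<open>i - 1\<close>. For \<open>i = 1\<close> the
  leaves in order read \<open>b c a\<close>, a cyclic rotation of \<open>a b c\<close>, so
  \<open>sgn3 a b c\<close> is the sign of the leaf permutation in both cases.\<close>

lemma omega_tree13:
  assumes i: "one_two i" and w: "word3 a b c"
  shows "omega_coeff 1 3 (tree13 f g i a b c) = (ksign (int i - 1) * of_int (sgn3 a b c) :: 'k::field_char_0)"
proof -
  obtain \<rho> where \<rho>: "\<rho> permutes {1..3}" "(\<rho> 1, \<rho> 2, \<rho> 3) = (if i = 1 then (b, c, a) else (a, b, c))" "sign \<rho> = sgn3 a b c"
  proof -
    have "word3 b c a" using w by (auto simp: word3_def)
    then show ?thesis
      using that perm3_exists[OF w] perm3_exists[of b c a] sgn3_simps(3)[OF w] i by (cases "i = 1") (metis)+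
  qed
  let ?v = "Vertex 1 2 0 f" and ?w = "Vertex 1 2 0 g"
  have graft: "graft 1 2 i' 1 (corolla ?v) (corolla ?w) = (if i' = 1 then tree13 f g 1 3 1 2 else tree13 f g 2 1 2 3)"
    if "one_two i'" for i'
    using that by (auto simp: graft_tree13)
  have "tree13 f g i a b c = relabel \<pi> \<sigma> (graft 1 2 i' j (corolla ?v) (corolla ?w)) \<longleftrightarrow> i' = i \<and> \<sigma> = pinv \<rho>"
    if i': "i' \<in> {1..2}" and j: "j \<in> {1..1}" and \<pi>: "\<pi> permutes {1..1}" and \<sigma>: "\<sigma> permutes {1..3}" for i' j \<pi> \<sigma>
  proof -
    have i': "one_two i'" using i' by auto
    have eq: "j = 1" "\<pi> = id" using j \<pi> by auto
    have \<sigma>': "pinv \<sigma> permutes {1..3}" using \<sigma> by (rule permutes_inv)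
    have w': "word3 (pinv \<sigma> 3) (pinv \<sigma> 1) (pinv \<sigma> 2)" "word3 (pinv \<sigma> 1) (pinv \<sigma> 2) (pinv \<sigma> 3)"
      using word3_perm[OF \<sigma>'] by (auto simp: word3_def)
    have inj: "tree13 f g i a b c = tree13 f g i'' x y z \<longleftrightarrow> i = i'' \<and> a = x \<and> b = y \<and> c = z"
      if "one_two i''" "word3 x y z" for i'' x y z
      using edges_tree13_eq[OF i that(1) w that(2), of f g f g] by auto
    have "\<sigma> = pinv \<rho> \<longleftrightarrow> \<rho> = pinv \<sigma>" using permutes_inv_inv[OF \<sigma>] permutes_inv_inv[OF \<rho>(1)] by auto
    also have "\<dots> \<longleftrightarrow> \<rho> 1 = pinv \<sigma> 1 \<and> \<rho> 2 = pinv \<sigma> 2 \<and> \<rho> 3 = pinv \<sigma> 3" using perm3_eq[OF \<rho>(1) \<sigma>'] by auto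
    finally show ?thesis
      unfolding eq graft[OF i'] using i' \<rho>(2) w' by (auto simp: relabel_tree13 inj split: if_splits)
  qed
  moreover have "pinv \<rho> permutes {1..3}" "i \<in> {1..2}" using permutes_inv[OF \<rho>(1)] i by auto
  ultimately have "{(i', j, \<pi>, \<sigma>). i' \<in> {1..2} \<and> j \<in> {1..1} \<and> \<pi> permutes {1..1} \<and> \<sigma> permutes {1..3} \<and>
      tree13 f g i a b c = relabel \<pi> \<sigma> (graft 1 2 i' j (corolla ?v) (corolla ?w))} = {(i, 1, id, pinv \<rho>)}"
    by auto
  moreover have "sign (pinv \<rho>) = sgn3 a b c"
    using \<rho>(3) sign_inverse[of \<rho>] permutes_imp_permutation[OF _ \<rho>(1)] by simp
  moreover have "verts (tree13 f g i a b c) ! 0 = ?v" "verts (tree13 f g i a b c) ! 1 = ?w" by simp_all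
  ultimately show ?thesis
    unfolding omega_coeff_def Let_def by (simp only: vertex.sel) (simp add: Omega_def mult.commute)
qed

text \<open>Here \<open>n2 = 0\<close>, which replaces \<open>i - 1\<close> by its negative, of the
  same parity. Permutations of the roots act trivially on \<open>Omega\<close>, and there is only
  one leaf.\<close>

lemma omega_tree21:
  assumes i: "one_two i" and r: "one_two r" and p: "one_two p"
  shows "omega_coeff 2 1 (tree21 d f h i r p) = (ksign (int i - 1) :: 'k::field_char_0)"
proof -
  let ?v = "Vertex 1 2 0 f" and ?w = "Vertex 2 0 d h" and ?\<rho> = "Transposition.transpose p r"
  have \<rho>: "?\<rho> permutes {1..2}" "?\<rho> p = r" using r p by (auto intro: permutes_swap_id)
  have "tree21 d f h i r p = relabel \<pi> \<sigma> (graft 1 0 i' j (corolla ?v) (corolla ?w)) \<longleftrightarrow> i' = i \<and> j = p \<and> \<pi> = ?\<rho>"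
    if i': "i' \<in> {1..2}" and j: "j \<in> {1..2}" and \<pi>: "\<pi> permutes {1..2}" and \<sigma>: "\<sigma> permutes {1..1}" for i' j \<pi> \<sigma>
  proof -
    have i': "one_two i'" "one_two j" using i' j by auto
    have \<sigma>: "\<sigma> = id" using \<sigma> by simp
    have "one_two (\<pi> j)" using permutes_2_minus[OF \<pi> i'(2)] by blast
    then have "tree21 d f h i r p = tree21 d f h i' (\<pi> j) j \<longleftrightarrow> i = i' \<and> r = \<pi> j \<and> p = j"
      using edges_tree21_eq[OF i i'(1) r _ p i'(2), of "\<pi> j" d f h d f h] by auto
    moreover have "\<pi> p = r \<longleftrightarrow> \<pi> = ?\<rho>"
      using S2_cases[OF r p, of \<pi>] S2_cases[OF r p, of ?\<rho>] \<pi> \<rho> by metis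
    ultimately show ?thesis
      unfolding \<sigma> graft_tree21[OF i'] relabel_tree21[OF \<pi> i'(2)] by auto
  qed
  then have "{(i', j, \<pi>, \<sigma>). i' \<in> {1..2} \<and> j \<in> {1..2} \<and> \<pi> permutes {1..2} \<and> \<sigma> permutes {1..1} \<and>
      tree21 d f h i r p = relabel \<pi> \<sigma> (graft 1 0 i' j (corolla ?v) (corolla ?w))} = {(i, p, ?\<rho>, id)}"
    using i p \<rho>(1) by auto
  moreover have "verts (tree21 d f h i r p) ! 0 = ?v" "verts (tree21 d f h i r p) ! 1 = ?w" by simp_all
  ultimately show ?thesis
    unfolding omega_coeff_def Let_def by (simp only: vertex.sel) (simp add: Omega_def ksign_def)
qed

text \<open>Matching the edges fixes both renumberings: the first has to move the inner edge from
  \<open>i'\<close> to \<open>i\<close>, the second to bring the leaves of the other vertex into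
  order. The Koszul sign is trivial because \<open>x\<close> has degree 0.\<close>

lemma eval_tree13:
  fixes x y :: "gen \<Rightarrow> 'k::field_char_0"
  assumes i: "one_two i" "one_two i'" and w: "word3 a b c" "word3 a' b' c'"
  shows "eval_oriented (V_gens d) (tree13 f g i a b c) (tree13 x y i' a' b' c') =
    (if a = a' then f (if i = i' then x else x \<circ> swap_gen) * g (if b = b' then y else y \<circ> swap_gen) else 0)"
proof -
  let ?\<tau> = "\<lambda>Q. if Q then id else Transposition.transpose 1 2 :: nat \<Rightarrow> nat"
  let ?t = "tree13 f g i a b c" and ?s = "tree13 x y i' a' b' c'"
  let ?r = "\<lambda>(\<pi>0, \<sigma>0, \<pi>1, \<sigma>1). renumber (V_gens d) 1 \<pi>1 \<sigma>1 (renumber (V_gens d) 0 \<pi>0 \<sigma>0 ?s)"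
  have r: "?r (id, \<sigma>0, id, \<sigma>1) = tree13 (act (V_gens d) (1, 2, 0) id \<sigma>0 x) (act (V_gens d) (1, 2, 0) id \<sigma>1 y) (\<sigma>0 i') a'
      (if \<sigma>1 1 = 1 then b' else c') (if \<sigma>1 1 = 1 then c' else b')"
    if "\<sigma>0 permutes {1..2}" "\<sigma>1 permutes {1..2}" for \<sigma>0 \<sigma>1
  proof -
    have "one_two (\<sigma>0 i')" using permutes_2_minus[OF that(1) i(2)] by blast
    then show ?thesis
      by (simp only: prod.case renumber_tree13(1)[OF i(2) that(1)] renumber_tree13(2)[OF _ that(2)])
  qed
  have eq: "edges (?r (id, \<sigma>0, id, \<sigma>1)) = edges ?t \<longleftrightarrow> a = a' \<and> \<sigma>0 = ?\<tau> (i = i') \<and> \<sigma>1 = ?\<tau> (b = b')"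
    if p: "\<sigma>0 permutes {1..2}" "\<sigma>1 permutes {1..2}" for \<sigma>0 \<sigma>1
  proof -
    have o: "one_two (\<sigma>0 i')" using permutes_2_minus[OF p(1) i(2)] by blast
    have w': "word3 a' (if \<sigma>1 1 = 1 then b' else c') (if \<sigma>1 1 = 1 then c' else b')"
      using w(2) by (auto simp: word3_def)
    have "\<sigma>0 i' = i \<longleftrightarrow> \<sigma>0 = ?\<tau> (i = i')" using S2_cases[OF i] p(1) by blast
    moreover have "(if \<sigma>1 1 = 1 then b' else c') = b \<and> (if \<sigma>1 1 = 1 then c' else b') = c \<longleftrightarrow> \<sigma>1 = ?\<tau> (b = b')"
      if "a = a'"
    proof -
      have ww: "b = b' \<and> c = c' \<and> b \<noteq> c' \<and> c \<noteq> b' \<or> b = c' \<and> c = b' \<and> b \<noteq> b' \<and> c \<noteq> c'"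
        using word3_same[OF w(1)] w(2) that by simp
      from permutes_2[OF p(2)] show ?thesis
      proof (elim disjE conjE)
        assume "\<sigma>1 = id"
        then show ?thesis using ww id_neq_transpose by auto
      next
        assume "\<sigma>1 = Transposition.transpose 1 2" "\<sigma>1 1 = 2"
        then show ?thesis using ww id_neq_transpose by auto
      qed
    qed
    ultimately show ?thesis
      unfolding r[OF p] edges_tree13_eq[OF o i(1) w' w(1)] by blast
  qed
  have \<tau>: "?\<tau> Q permutes {1..2}" for Q using transpose_12 by (simp add: permutes_id)
  have S: "{(\<pi>0, \<sigma>0, \<pi>1, \<sigma>1). \<pi>0 permutes {1..1} \<and> \<sigma>0 permutes {1..2} \<and> \<pi>1 permutes {1..1} \<and> \<sigma>1 permutes {1..2} \<and>
      edges (renumber (V_gens d) 1 \<pi>1 \<sigma>1 (renumber (V_gens d) 0 \<pi>0 \<sigma>0 ?s)) = edges ?t}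
    = (if a = a' then {(id, ?\<tau> (i = i'), id, ?\<tau> (b = b'))} else {})"
  proof (rule quadruples_eq)
    fix \<pi>0 \<sigma>0 \<pi>1 \<sigma>1 :: "nat \<Rightarrow> nat"
    assume \<sigma>: "\<sigma>0 permutes {1..2}" "\<sigma>1 permutes {1..2}" and "\<pi>0 permutes {1..1}" "\<pi>1 permutes {1..1}"
    then have "\<pi>0 = id" "\<pi>1 = id" by simp_all
    then show "edges (renumber (V_gens d) 1 \<pi>1 \<sigma>1 (renumber (V_gens d) 0 \<pi>0 \<sigma>0 ?s)) = edges ?t
        \<longleftrightarrow> a = a' \<and> \<pi>0 = id \<and> \<sigma>0 = ?\<tau> (i = i') \<and> \<pi>1 = id \<and> \<sigma>1 = ?\<tau> (b = b')"
      using eq[OF \<sigma>] unfolding prod.case by blast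
  qed (rule permutes_id \<tau>)+
  have v: "verts ?t ! 0 = Vertex 1 2 0 f" "verts ?t ! 1 = Vertex 1 2 0 g"
    "verts ?s ! 0 = Vertex 1 2 0 x" "verts ?s ! 1 = Vertex 1 2 0 y" by simp_all
  have deg: "\<forall>e<2. outs (verts ?t ! e) = outs (verts ?s ! e) \<and> ins (verts ?t ! e) = ins (verts ?s ! e)
      \<and> fdeg (verts ?t ! e) = - vdeg (verts ?s ! e)"
    by (auto simp: less_2_cases_iff fdeg_def omega_deg_def)
  have act: "act (V_gens d) (1, 2, 0) id (?\<tau> Q) z = (if Q then z else z \<circ> swap_gen)" for Q z
    by (simp add: V_gens_act)
  show ?thesis
    unfolding eval_oriented_def if_P[OF deg] v vertex.sel S
    using r[OF \<tau> \<tau>, of "i = i'" "b = b'", unfolded prod.case act]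
    by (simp add: ksign_def Let_def del: renumber_simps)
qed

lemma eval_tree21:
  fixes x y :: "gen \<Rightarrow> 'k::field_char_0"
  assumes i: "one_two i" "one_two i'" and r: "one_two r" "one_two r'" and p: "one_two p" "one_two p'"
  shows "eval_oriented (V_gens d) (tree21 (- d) f h i r p) (tree21 d x y i' r' p') =
    (if r = r' then f (if i = i' then x else x \<circ> swap_gen) * h y else 0)"
proof -
  let ?\<tau> = "\<lambda>Q. if Q then id else Transposition.transpose 1 2 :: nat \<Rightarrow> nat"
  let ?t = "tree21 (- d) f h i r p" and ?s = "tree21 d x y i' r' p'"
  let ?r = "\<lambda>(\<pi>0, \<sigma>0, \<pi>1, \<sigma>1). renumber (V_gens d) 1 \<pi>1 \<sigma>1 (renumber (V_gens d) 0 \<pi>0 \<sigma>0 ?s)"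
  have rn: "?r (id, \<sigma>0, \<pi>1, id) = tree21 d (act (V_gens d) (1, 2, 0) id \<sigma>0 x) (act (V_gens d) (2, 0, d) \<pi>1 id y) (\<sigma>0 i') r' (\<pi>1 p')"
    if "\<sigma>0 permutes {1..2}" "\<pi>1 permutes {1..2}" for \<sigma>0 \<pi>1
  proof -
    have "one_two (\<sigma>0 i')" using permutes_2_minus[OF that(1) i(2)] by blast
    then show ?thesis
      by (simp only: prod.case renumber_tree21(1)[OF i(2) p(2) that(1)] renumber_tree21(2)[OF _ p(2) that(2)])
  qed
  have eq: "edges (?r (id, \<sigma>0, \<pi>1, id)) = edges ?t \<longleftrightarrow> r = r' \<and> \<sigma>0 = ?\<tau> (i = i') \<and> \<pi>1 = ?\<tau> (p = p')"
    if q: "\<sigma>0 permutes {1..2}" "\<pi>1 permutes {1..2}" for \<sigma>0 \<pi>1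
  proof -
    have o: "one_two (\<sigma>0 i')" "one_two (\<pi>1 p')"
      using permutes_2_minus[OF q(1) i(2)] permutes_2_minus[OF q(2) p(2)] by blast+
    show ?thesis
      unfolding rn[OF q] edges_tree21_eq[OF o(1) i(1) r(2,1) o(2) p(1)]
      using S2_cases[OF i, of \<sigma>0] S2_cases[OF p, of \<pi>1] q by blast
  qed
  have \<tau>: "?\<tau> Q permutes {1..2}" for Q using transpose_12 by (simp add: permutes_id)
  have S: "{(\<pi>0, \<sigma>0, \<pi>1, \<sigma>1). \<pi>0 permutes {1..1} \<and> \<sigma>0 permutes {1..2} \<and> \<pi>1 permutes {1..2} \<and> \<sigma>1 permutes {1..0} \<and>
      edges (renumber (V_gens d) 1 \<pi>1 \<sigma>1 (renumber (V_gens d) 0 \<pi>0 \<sigma>0 ?s)) = edges ?t}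
    = (if r = r' then {(id, ?\<tau> (i = i'), ?\<tau> (p = p'), id)} else {})"
  proof (rule quadruples_eq)
    fix \<pi>0 \<sigma>0 \<pi>1 \<sigma>1 :: "nat \<Rightarrow> nat"
    assume \<sigma>: "\<sigma>0 permutes {1..2}" "\<pi>1 permutes {1..2}" and "\<pi>0 permutes {1..1}" "\<sigma>1 permutes {1..0}"
    then have "\<pi>0 = id" "\<sigma>1 = id" by simp_all
    then show "edges (renumber (V_gens d) 1 \<pi>1 \<sigma>1 (renumber (V_gens d) 0 \<pi>0 \<sigma>0 ?s)) = edges ?t
        \<longleftrightarrow> r = r' \<and> \<pi>0 = id \<and> \<sigma>0 = ?\<tau> (i = i') \<and> \<pi>1 = ?\<tau> (p = p') \<and> \<sigma>1 = id"
      using eq[OF \<sigma>] unfolding prod.case by blast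
  qed (rule permutes_id \<tau>)+
  have v: "verts ?t ! 0 = Vertex 1 2 0 f" "verts ?t ! 1 = Vertex 2 0 (- d) h"
    "verts ?s ! 0 = Vertex 1 2 0 x" "verts ?s ! 1 = Vertex 2 0 d y" by simp_all
  have deg: "\<forall>e<2. outs (verts ?t ! e) = outs (verts ?s ! e) \<and> ins (verts ?t ! e) = ins (verts ?s ! e)
      \<and> fdeg (verts ?t ! e) = - vdeg (verts ?s ! e)"
    by (auto simp: less_2_cases_iff fdeg_def omega_deg_def)
  have act: "act (V_gens d) (1, 2, 0) id (?\<tau> Q) z = (if Q then z else z \<circ> swap_gen)"
    "act (V_gens d) (2, 0, d) (?\<tau> Q) id z = z" for Q z
    by (simp_all add: V_gens_act)
  show ?thesis
    unfolding eval_oriented_def if_P[OF deg] v vertex.sel S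
    using rn[OF \<tau> \<tau>, of "i = i'" "p = p'", unfolded prod.case act]
    by (simp add: ksign_def Let_def del: renumber_simps)
qed

lemma swap_gen_carrier:
  fixes z :: "gen \<Rightarrow> 'k::field_char_0"
  shows "z \<in> carrier (V_space {Mu, MuBar}) \<Longrightarrow> z \<circ> swap_gen \<in> carrier (V_space {Mu, MuBar})"
  using V_gens_act_closed[of z 0 1 2 0 id "\<lambda>_. 2"] by (simp only: V_gens_act V_basis_simps) simp

text \<open>Passing from \<open>i = 1\<close> to \<open>i = 2\<close> exchanges \<open>Mu\<close>
  and \<open>MuBar\<close> and so reverses the bracket. The prefactor correcting this is the one
  that cancels the \<open>i\<close>-dependent sign of \<open>omega_coeff\<close>.\<close>

lemma dual_eval_swap:
  fixes x :: "gen \<Rightarrow> 'k::field_char_0"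
  assumes i: "one_two i" "one_two i'" and f: "f \<in> carrier (dual_module (V_space {Mu, MuBar}))"
    and x: "x \<in> carrier (V_space {Mu, MuBar})"
  shows "f (if i = i' then x else x \<circ> swap_gen) = ksign (int i - 1) *
    (undual f (if i = 1 then Mu else MuBar) * x (if i' = 1 then Mu else MuBar)
      - undual f (if i = 1 then MuBar else Mu) * x (if i' = 1 then MuBar else Mu))"
proof -
  have "ksign (int i - 1) = (if i = 1 then 1 else - 1 :: 'k)" using i(1) by (auto simp: ksign_def)
  then show ?thesis
    using i dual_eval(1)[OF f x] dual_eval(1)[OF f swap_gen_carrier[OF x]] by (auto simp: algebra_simps)
qed

text \<open>The overall minus is \<open>identification_sign\<close>:
  \<open>omega_deg 1 2 = - 1\<close>, while the second functional has degree 0. The sign depending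
  on \<open>i\<close> occurs twice, in \<open>omega_coeff\<close> and in the evaluation, and squares
  to 1.\<close>

lemma tree_pairing_tree13:
  fixes x y :: "gen \<Rightarrow> 'k::field_char_0"
  assumes i: "one_two i" "one_two i'" and w: "word3 a b c" "word3 a' b' c'"
    and f: "f \<in> carrier (dual_module (V_space {Mu, MuBar}))" "g \<in> carrier (dual_module (V_space {Mu, MuBar}))"
    and x: "x \<in> carrier (V_space {Mu, MuBar})" "y \<in> carrier (V_space {Mu, MuBar})"
  shows "tree_pairing (V_gens d) 1 3 (tree13 f g i a b c) (tree13 x y i' a' b' c') =
    - (\<Sum>w \<in> W 1 3. of_int (sign (snd w)) *
        (coordL 1 (fst w) (snd w) (tree13 (undual f) (undual g) i a b c) * coordL 1 (fst w) (snd w) (tree13 x y i' a' b' c')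
        - coordR 1 (fst w) (snd w) (tree13 (undual f) (undual g) i a b c) * coordR 1 (fst w) (snd w) (tree13 x y i' a' b' c')))"
proof -
  let ?F = "undual f" and ?G = "undual g"
  define \<alpha> where "\<alpha> = ?F (if i = 1 then Mu else MuBar) * x (if i' = 1 then Mu else MuBar)"
  define \<beta> where "\<beta> = ?F (if i = 1 then MuBar else Mu) * x (if i' = 1 then MuBar else Mu)"
  have ev: "f (if i = i' then x else x \<circ> swap_gen) = ksign (int i - 1) * (\<alpha> - \<beta>)"
    unfolding \<alpha>_def \<beta>_def by (rule dual_eval_swap[OF i f(1) x(1)])
  have evg: "g (if b = b' then y else y \<circ> swap_gen) =
      ?G Mu * y (if b = b' then Mu else MuBar) - ?G MuBar * y (if b = b' then MuBar else Mu)"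
    using dual_eval(1)[OF f(2) x(2)] dual_eval(1)[OF f(2) swap_gen_carrier[OF x(2)]] by (simp add: mult.commute)
  have sq: "ksign (int i - 1) * ksign (int i - 1) = (1 :: 'k)" by (simp add: ksign_def)
  have lhs: "tree_pairing (V_gens d) 1 3 (tree13 f g i a b c) (tree13 x y i' a' b' c') =
      (if a = a' then - (of_int (sgn3 a b c) * (\<alpha> - \<beta>) * g (if b = b' then y else y \<circ> swap_gen)) else 0)"
    using sq by (simp add: tree_pairing_def orient_sign_def oriented_tree identification_sign_def fdeg_def
        omega_deg_def omega_tree13[OF i(1) w(1)] eval_tree13[OF i w] ev) (simp add: ksign_def algebra_simps)
  \<comment> \<open>The summand as a function of the word \<open>\<rho> 1\<close>,
    \<open>\<rho> 2\<close>, \<open>\<rho> 3\<close>, in the form needed for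
    \<open>sum_perm3\<close>.\<close>
  let ?H = "\<lambda>p q r. of_int (sgn3 p q r) *
      ((if r = a then ?F (if i = 1 then Mu else MuBar) * ?G (if p = b then Mu else MuBar) else 0)
        * (if r = a' then x (if i' = 1 then Mu else MuBar) * y (if p = b' then Mu else MuBar) else 0)
      - (if p = a then ?F (if i = 1 then MuBar else Mu) * ?G (if q = b then Mu else MuBar) else 0)
        * (if p = a' then x (if i' = 1 then MuBar else Mu) * y (if q = b' then Mu else MuBar) else 0)) :: 'k"
  have "(\<Sum>w \<in> W 1 3. of_int (sign (snd w)) *
        (coordL 1 (fst w) (snd w) (tree13 ?F ?G i a b c) * coordL 1 (fst w) (snd w) (tree13 x y i' a' b' c')
        - coordR 1 (fst w) (snd w) (tree13 ?F ?G i a b c) * coordR 1 (fst w) (snd w) (tree13 x y i' a' b' c')))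
      = (\<Sum>\<rho> | \<rho> permutes {1..3}. ?H (\<rho> 1) (\<rho> 2) (\<rho> 3))"
    unfolding sum_W fst_conv snd_conv coord_tree13[OF i(1)] coord_tree13[OF i(2)]
    by (intro sum.cong refl) (simp add: sign_perm3)
  also have "\<dots> = ?H a b c + ?H a c b + ?H b a c + ?H b c a + ?H c a b + ?H c b a"
    by (rule sum_perm3[OF w(1)])
  also have "\<dots> = (if a = a' then of_int (sgn3 a b c) * (\<alpha> - \<beta>) * g (if b = b' then y else y \<circ> swap_gen) else 0)"
  proof (cases "a = a'")
    case False
    then show ?thesis using sgn3_simps(6-8)[OF w(1)] by simp
  next
    case True
    \<comment> \<open>With the same leaf at the head, the second vertices carry the same two leaves.
      Only words with \<open>a\<close> last contribute to the left products, only those with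
      \<open>a\<close> first to the right ones.\<close>
    then have "b = b' \<and> c \<noteq> b' \<or> c = b' \<and> b \<noteq> b'" using word3_same[OF w(1)] w(2) by blast
    then show ?thesis
      unfolding evg using True sgn3_simps[OF w(1)] sgn3_simps(6-8)[OF w(1), symmetric]
      by (elim disjE conjE) (simp_all add: \<alpha>_def \<beta>_def algebra_simps)
  qed
  finally show ?thesis using lhs by simp
qed

text \<open>The overall sign does not depend on \<open>d\<close>: the second functional has degree
  \<open>- d\<close>, so the exponents in \<open>identification_sign\<close> are
  \<open>d - 1\<close> and \<open>- d\<close>, with odd sum.\<close>

lemma tree_pairing_tree21:
  fixes x y :: "gen \<Rightarrow> 'k::field_char_0"
  assumes i: "one_two i" "one_two i'" and r: "one_two r" "one_two r'" and p: "one_two p" "one_two p'"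
    and f: "f \<in> carrier (dual_module (V_space {Mu, MuBar}))" "h \<in> carrier (dual_module (V_space {Nu}))"
    and x: "x \<in> carrier (V_space {Mu, MuBar})" "y \<in> carrier (V_space {Nu})"
  shows "tree_pairing (V_gens d) 2 1 (tree21 (- d) f h i r p) (tree21 d x y i' r' p') =
    - (\<Sum>w \<in> W 2 1. of_int (sign (snd w)) *
        (coordL 2 (fst w) (snd w) (tree21 (- d) (undual f) (undual h) i r p) * coordL 2 (fst w) (snd w) (tree21 d x y i' r' p')
        - coordR 2 (fst w) (snd w) (tree21 (- d) (undual f) (undual h) i r p) * coordR 2 (fst w) (snd w) (tree21 d x y i' r' p')))"
proof -
  let ?F = "undual f" and ?G = "undual h"
  define \<alpha> where "\<alpha> = ?F (if i = 1 then Mu else MuBar) * x (if i' = 1 then Mu else MuBar)"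
  define \<beta> where "\<beta> = ?F (if i = 1 then MuBar else Mu) * x (if i' = 1 then MuBar else Mu)"
  have ev: "f (if i = i' then x else x \<circ> swap_gen) = ksign (int i - 1) * (\<alpha> - \<beta>)"
    unfolding \<alpha>_def \<beta>_def by (rule dual_eval_swap[OF i f(1) x(1)])
  have evh: "h y = ?G Nu * y Nu" using dual_eval(2)[OF f(2) x(2)] by simp
  have sq: "ksign (int i - 1) * ksign (int i - 1) = (1 :: 'k)" by (simp add: ksign_def)
  have lhs: "tree_pairing (V_gens d) 2 1 (tree21 (- d) f h i r p) (tree21 d x y i' r' p') =
      (if r = r' then - ((\<alpha> - \<beta>) * (?G Nu * y Nu)) else 0)"
    using sq by (simp add: tree_pairing_def orient_sign_def oriented_tree identification_sign_def fdeg_def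
        omega_deg_def omega_tree21[OF i(1) r(1) p(1)] eval_tree21[OF i r p] ev evh) (simp add: ksign_def algebra_simps)
  let ?H = "\<lambda>p q. (if q = r then ?F (if i = 1 then Mu else MuBar) * ?G Nu else 0)
        * (if q = r' then x (if i' = 1 then Mu else MuBar) * y Nu else 0)
      - (if p = r then ?F (if i = 1 then MuBar else Mu) * ?G Nu else 0)
        * (if p = r' then x (if i' = 1 then MuBar else Mu) * y Nu else 0) :: 'k"
  have "(\<Sum>w \<in> W 2 1. of_int (sign (snd w)) *
        (coordL 2 (fst w) (snd w) (tree21 (- d) ?F ?G i r p) * coordL 2 (fst w) (snd w) (tree21 d x y i' r' p')
        - coordR 2 (fst w) (snd w) (tree21 (- d) ?F ?G i r p) * coordR 2 (fst w) (snd w) (tree21 d x y i' r' p')))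
      = (\<Sum>\<pi> | \<pi> permutes {1..2}. ?H (\<pi> 1) (\<pi> 2))"
    unfolding sum_W fst_conv snd_conv coord_tree21[OF i(1) r(1) p(1)] coord_tree21[OF i(2) r(2) p(2)] by simp
  also have "\<dots> = ?H 1 2 + ?H 2 1" by (rule sum_perm2)
  also have "\<dots> = (if r = r' then (\<alpha> - \<beta>) * (?G Nu * y Nu) else 0)"
    using r by (elim disjE) (simp_all add: \<alpha>_def \<beta>_def algebra_simps)
  finally show ?thesis using lhs by simp
qed

section \<open>The pairing on arbitrary trees and formal sums\<close>

lemma eval_zero_dec:
  fixes s :: "(gen \<Rightarrow> 'k::field_char_0) dtree"
  assumes "verts t = [v, w]" "verts s = [v', w']"
    and z: "dec v = (\<lambda>_. 0) \<or> dec w = (\<lambda>_. 0) \<or> dec v' = (\<lambda>_. 0) \<and> dec v (\<lambda>_. 0) = 0 \<or> dec w' = (\<lambda>_. 0) \<and> dec w (\<lambda>_. 0) = 0"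
  shows "eval_oriented (V_gens d) t s = 0"
proof -
  have act: "act (V_gens d) \<tau> \<pi> \<sigma> (\<lambda>_. 0) = (\<lambda>_. 0 :: 'k)" for \<tau> \<pi> \<sigma>
    by (cases \<tau>) (auto simp: V_gens_act)
  have "dec (verts (renumber (V_gens d) 1 \<pi>1 \<sigma>1 (renumber (V_gens d) 0 \<pi>0 \<sigma>0 s)) ! 0) = act (V_gens d) (vidx v') \<pi>0 \<sigma>0 (dec v')"
    "dec (verts (renumber (V_gens d) 1 \<pi>1 \<sigma>1 (renumber (V_gens d) 0 \<pi>0 \<sigma>0 s)) ! 1) = act (V_gens d) (vidx w') \<pi>1 \<sigma>1 (dec w')"
    for \<pi>0 \<sigma>0 \<pi>1 \<sigma>1
    using assms(2) by (cases v'; cases w'; simp add: One_nat_def)+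
  note dec = this
  have v: "verts t ! 0 = v" "verts t ! 1 = w" using assms(1) by simp_all
  have zero: "k * dec v (act (V_gens d) (vidx v') \<pi>0 \<sigma>0 (dec v')) * dec w (act (V_gens d) (vidx w') \<pi>1 \<sigma>1 (dec w')) = 0"
    for k \<pi>0 \<sigma>0 \<pi>1 \<sigma>1
    using z by (auto simp: act)
  show ?thesis
    unfolding eval_oriented_def Let_def v dec split_def zero by simp
qed

lemma tree_pairing_zero_dec:
  fixes s :: "(gen \<Rightarrow> 'k::field_char_0) dtree"
  assumes z: "(\<exists>v \<in> set (verts t). dec v = (\<lambda>_. 0)) \<or>
      (\<exists>v \<in> set (verts s). dec v = (\<lambda>_. 0)) \<and> (\<forall>v \<in> set (verts t). dec v (\<lambda>_. 0) = 0)"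
  shows "tree_pairing (V_gens d) m n t s = 0"
proof (cases "length (verts t) = 2 \<and> length (verts s) = 2")
  case True
  then obtain v w v' w' where vs: "verts t = [v, w]" "verts s = [v', w']"
    by (auto simp: length_Suc_conv numeral_2_eq_2)
  obtain x y where xy: "verts (orient t) = [x, y]" "{x, y} = set (verts t)"
    using orient_verts[OF vs(1)] vs(1) by (cases "oriented t") auto
  obtain x' y' where xy': "verts (orient s) = [x', y']" "{x', y'} = set (verts s)"
    using orient_verts[OF vs(2)] vs(2) by (cases "oriented s") auto
  have "eval_oriented (V_gens d) (orient t) (orient s) = 0"
    using z unfolding xy(2)[symmetric] xy'(2)[symmetric] by (intro eval_zero_dec[OF xy(1) xy'(1)]) auto
  then show ?thesis by (simp add: tree_pairing_def)
qed (auto simp: tree_pairing_def)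

lemma orient_sign_std:
  assumes "std d m n t"
  shows "orient_sign (swap_verts 0 t) = 1" "orient_sign t = 1" "length (verts (swap_verts 0 t)) = 2"
proof -
  note s = std_simps[OF assms]
  obtain v w where "verts t = [v, w]" using s(1) by (auto simp: length_Suc_conv numeral_2_eq_2)
  then show "orient_sign (swap_verts 0 t) = 1" "orient_sign t = 1" "length (verts (swap_verts 0 t)) = 2"
    using s(7-9) by (simp_all add: orient_sign_def ksign_def One_nat_def)
qed

text \<open>The pairing sees a tree through \<open>orient\<close> and \<open>orient_sign\<close>;
  for a standard tree the latter is 1 in either order since its head vertex has degree 0.\<close>

lemma tree_pairing_swap:
  "std d m n t \<Longrightarrow> tree_pairing E m' n' (swap_verts 0 t) s = tree_pairing E m' n' t s"
  "std d m n s \<Longrightarrow> tree_pairing E m' n' t (swap_verts 0 s) = tree_pairing E m' n' t s"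
  by (simp_all only: tree_pairing_def std_simps(1-3) orient_sign_std)

lemma undual_zero:
  fixes f :: "(gen \<Rightarrow> 'k::field_char_0) \<Rightarrow> 'k"
  assumes f: "f \<in> carrier (dual_module (V_space (V_basis d \<tau>)))" and "undual f = (\<lambda>_. 0)"
  shows "f = (\<lambda>_. 0)"
proof -
  have inj: "inj_on undual (carrier (dual_module (V_space (V_basis d \<tau>) :: ('k, gen \<Rightarrow> 'k) module)))"
    using bij_undual[OF V_basis_alt] by (rule bij_betw_imp_inj_on)
  have "(\<lambda>_. 0) \<in> carrier (dual_module (V_space (V_basis d \<tau>) :: ('k, gen \<Rightarrow> 'k) module))"
    by (simp add: dual_module_def)
  moreover have "undual (\<lambda>_. 0) = (\<lambda>_. 0 :: 'k)" by (simp add: undual_def fun_eq_iff)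
  ultimately show ?thesis using assms(2) by (intro inj_onD[OF inj _ f]) simp_all
qed

lemma lin_form_fun_diff:
  "lin_form (\<lambda>t. g t - h t) A = lin_form g A - lin_form h A"
  "lin_form (\<lambda>t. h t * c) A = lin_form h A * c"
  by (simp_all add: lin_form_def right_diff_distrib sum_subtractf sum_distrib_right mult.assoc)

lemma map_vertex_eq_iff: "map_vertex f v = Vertex m n i y \<longleftrightarrow> (\<exists>x. v = Vertex m n i x \<and> y = f x)"
  by (cases v) auto

abbreviation coord_pairing :: "nat \<Rightarrow> nat \<Rightarrow> (gen \<Rightarrow> 'k::field_char_0) dtree \<Rightarrow> (gen \<Rightarrow> 'k) dtree \<Rightarrow> 'k" where
  "coord_pairing m n t s \<equiv> - (\<Sum>w \<in> W m n. of_int (sign (snd w)) *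
    (coordL m (fst w) (snd w) t * coordL m (fst w) (snd w) s - coordR m (fst w) (snd w) t * coordR m (fst w) (snd w) s))"

text \<open>Both sides vanish if some decoration is zero. Otherwise both trees are standard up to an
  exchange of vertices, which neither side notices, and the explicit formulas apply.\<close>

lemma tree_pairing_coord:
  fixes s :: "(gen \<Rightarrow> 'k::field_char_0) dtree"
  assumes mn: "rel_arity m n" and t: "t \<in> dtrees (dual_gens (V_gens d)) (m, n, i)" and s: "s \<in> dtrees (V_gens d) (m, n, q)"
  shows "tree_pairing (V_gens d) m n t s = coord_pairing m n (map_dtree undual t) s"
proof -
  let ?\<Theta> = "map_dtree undual :: ((gen \<Rightarrow> 'k) \<Rightarrow> 'k) dtree \<Rightarrow> _"
  have dec_t: "dec v \<in> carrier (dual_module (V_space (V_basis d (outs v, ins v, 1 + omega_deg (outs v) (ins v) - vdeg v))))"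
    if "v \<in> set (verts t')" "t' \<in> dtrees (dual_gens (V_gens d)) (m, n, i)" for v t'
    using dtreesD(5)[OF that(2,1)] by (simp only: dual_gens_sp V_gens_sp)
  show ?thesis
  proof (cases "(\<exists>v \<in> set (verts (?\<Theta> t)). dec v = (\<lambda>_. 0)) \<or> (\<exists>v \<in> set (verts s). dec v = (\<lambda>_. 0))")
    case True
    have "coordL m \<pi> \<rho> t' = 0" "coordR m \<pi> \<rho> t' = 0" if "\<exists>v \<in> set (verts t'). dec v = (\<lambda>_. 0)"
      for \<pi> \<rho> and t' :: "(gen \<Rightarrow> 'k) dtree"
      using that coord_zero_dec unfolding coordL_def coordR_def by blast+
    then have "coord_pairing m n (?\<Theta> t) s = 0" using True by (elim disjE) simp_all
    moreover have "\<exists>v \<in> set (verts t). dec v = (\<lambda>_. 0)" if "\<exists>v \<in> set (verts (?\<Theta> t)). dec v = (\<lambda>_. 0)"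
      using that undual_zero[OF dec_t[OF _ t]] by auto
    moreover have "dec v (\<lambda>_. 0) = 0" if "v \<in> set (verts t)" for v
      using dual_expand[OF V_basis_alt dec_t[OF that t], of "\<lambda>_. 0"] by simp
    ultimately show ?thesis using tree_pairing_zero_dec[of t s d m n] True by metis
  next
    case False
    obtain u where u: "std (- d) m n u" "?\<Theta> t = u \<or> ?\<Theta> t = swap_verts 0 u"
      using zero_dec_or_std[OF dual.\<Theta>_dtrees[OF t] mn] False by blast
    obtain u' where u': "std d m n u'" "s = u' \<or> s = swap_verts 0 u'"
      using zero_dec_or_std[OF s mn] False by blast
    \<comment> \<open>The classification applies only to the image of \<open>t\<close> under
      \<open>undual\<close>; \<open>t0\<close> is the corresponding normal form of \<open>t\<close>
      itself, reached by the same exchange.\<close>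
    obtain t0 where t0: "t0 \<in> dtrees (dual_gens (V_gens d)) (m, n, i)" "?\<Theta> t0 = u" "t = t0 \<or> t = swap_verts 0 t0"
      using u(2)
    proof
      assume "?\<Theta> t = u"
      then show ?thesis using that t by blast
    next
      assume eq: "?\<Theta> t = swap_verts 0 u"
      have "length (verts (swap_verts 0 u)) = 2" using std_simps(1)[OF u(1)] by simp
      then have len: "length (verts t) = 2" unfolding eq[symmetric] by simp
      have "?\<Theta> (swap_verts 0 t) = u"
        using map_dtree_swap_verts[of 0 t undual] len eq std_simps(4)[OF u(1)] by simp
      moreover have "swap_verts 0 t \<in> dtrees (dual_gens (V_gens d)) (m, n, i)"
        using dtrees_swap_verts[OF t, of 0] len by simp
      ultimately show ?thesis using that swap_verts_twice[OF len] by metis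
    qed
    have u's: "u' \<in> dtrees (V_gens d) (m, n, q)"
      using u'(2) dtrees_swap_verts[OF s, of 0] s std_simps(1,4)[OF u'(1)] by auto
    have main: "std (- d) m n t0 \<and> tree_pairing (V_gens d) m n t0 u' = coord_pairing m n u u'"
      using u(1)
    proof (cases rule: std_cases)
      case (tree13 F G j a b c)
      obtain f g where fg: "t0 = tree13 f g j a b c" "F = undual f" "G = undual g"
      proof -
        have "map (map_vertex undual) (verts t0) = [Vertex 1 2 0 F, Vertex 1 2 0 G]" "edges t0 = edges (tree13 F G j a b c)"
          using arg_cong[OF t0(2), of verts] arg_cong[OF t0(2), of edges] by (simp_all add: tree13(5))
        then obtain v w where "verts t0 = [v, w]" "map_vertex undual v = Vertex 1 2 0 F" "map_vertex undual w = Vertex 1 2 0 G"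
          by (auto simp: map_eq_Cons_conv)
        then obtain f g where fg: "verts t0 = [Vertex 1 2 0 f, Vertex 1 2 0 g]" "F = undual f" "G = undual g"
          unfolding map_vertex_eq_iff by blast
        have "t0 = tree13 f g j a b c"
          by (rule dtree_eqI) (simp_all add: fg(1) \<open>edges t0 = _\<close> edges_tree)
        then show ?thesis using that fg(2,3) by blast
      qed
      obtain x y j' a' b' c' where xy: "one_two j'" "word3 a' b' c'" "u' = tree13 x y j' a' b' c'"
        using u'(1) tree13(1) by (cases rule: std_cases) auto
      have "f \<in> carrier (dual_module (V_space {Mu, MuBar}))" "g \<in> carrier (dual_module (V_space {Mu, MuBar}))"
        using dec_t[OF _ t0(1), of "Vertex 1 2 0 f"] dec_t[OF _ t0(1), of "Vertex 1 2 0 g"]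
        by (simp_all add: fg(1) omega_deg_def)
      moreover have "x \<in> carrier (V_space {Mu, MuBar})" "y \<in> carrier (V_space {Mu, MuBar})"
        using dtreesD(5)[OF u's, of "Vertex 1 2 0 x"] dtreesD(5)[OF u's, of "Vertex 1 2 0 y"]
        by (simp_all add: xy(3) del: V_space_simps)
      ultimately show ?thesis
        unfolding fg tree13(1,2,5) xy(3)
        by (intro conjI std13[OF tree13(3,4)] tree_pairing_tree13[OF tree13(3) xy(1) tree13(4) xy(2)])
    next
      case (tree21 F G j r p)
      obtain f g where fg: "t0 = tree21 (- d) f g j r p" "F = undual f" "G = undual g"
      proof -
        have "map (map_vertex undual) (verts t0) = [Vertex 1 2 0 F, Vertex 2 0 (- d) G]" "edges t0 = edges (tree21 (- d) F G j r p)"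
          using arg_cong[OF t0(2), of verts] arg_cong[OF t0(2), of edges] by (simp_all add: tree21(6))
        then obtain v w where "verts t0 = [v, w]" "map_vertex undual v = Vertex 1 2 0 F" "map_vertex undual w = Vertex 2 0 (- d) G"
          by (auto simp: map_eq_Cons_conv)
        then obtain f g where fg: "verts t0 = [Vertex 1 2 0 f, Vertex 2 0 (- d) g]" "F = undual f" "G = undual g"
          unfolding map_vertex_eq_iff by blast
        have "t0 = tree21 (- d) f g j r p"
          by (rule dtree_eqI) (simp_all add: fg(1) \<open>edges t0 = _\<close> edges_tree)
        then show ?thesis using that fg(2,3) by blast
      qed
      obtain x y j' r' p' where xy: "one_two j'" "one_two r'" "one_two p'" "u' = tree21 d x y j' r' p'"
        using u'(1) tree21(1) by (cases rule: std_cases) auto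
      have "f \<in> carrier (dual_module (V_space {Mu, MuBar}))" "g \<in> carrier (dual_module (V_space {Nu}))"
        using dec_t[OF _ t0(1), of "Vertex 1 2 0 f"] dec_t[OF _ t0(1), of "Vertex 2 0 (- d) g"]
        by (simp_all add: fg(1) omega_deg_def)
      moreover have "x \<in> carrier (V_space {Mu, MuBar})" "y \<in> carrier (V_space {Nu})"
        using dtreesD(5)[OF u's, of "Vertex 1 2 0 x"] dtreesD(5)[OF u's, of "Vertex 2 0 d y"]
        by (simp_all add: xy(4) del: V_space_simps)
      ultimately show ?thesis
        unfolding fg tree21(1,2,6) xy(4)
        by (intro conjI std21[OF tree21(3-5)] tree_pairing_tree21[OF tree21(3) xy(1) tree21(4) xy(2) tree21(5) xy(3)])
    qed
    have c: "coordL m \<pi> \<rho> (?\<Theta> t) = coordL m \<pi> \<rho> u" "coordR m \<pi> \<rho> (?\<Theta> t) = coordR m \<pi> \<rho> u"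
      "coordL m \<pi> \<rho> s = coordL m \<pi> \<rho> u'" "coordR m \<pi> \<rho> s = coordR m \<pi> \<rho> u'" for \<pi> \<rho>
      using u(2) u'(2) coord_orient[OF u(1)] coord_orient[OF u'(1)] unfolding coordL_def coordR_def by auto
    have "tree_pairing (V_gens d) m n t s = tree_pairing (V_gens d) m n t0 u'"
      using t0(3) u'(2) tree_pairing_swap(1)[of "- d" m n t0] tree_pairing_swap(2)[OF u'(1)] main by metis
    then show ?thesis unfolding c using main by simp
  qed
qed

lemma sum_pairing_coord:
  fixes B :: "(gen \<Rightarrow> 'k::field_char_0) dtree \<Rightarrow>\<^sub>0 'k"
  assumes mn: "rel_arity m n" and A: "Poly_Mapping.keys A \<subseteq> dtrees (dual_gens (V_gens d)) (m, n, i)"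
    and B: "Poly_Mapping.keys B \<subseteq> dtrees (V_gens d) (m, n, q)"
  shows "sum_pairing (V_gens d) m n A B = - (\<Sum>w \<in> W m n. of_int (sign (snd w)) *
    (lin_form (coordL m (fst w) (snd w)) (lin_ext (map_dtree undual) A) * lin_form (coordL m (fst w) (snd w)) B
      - lin_form (coordR m (fst w) (snd w)) (lin_ext (map_dtree undual) A) * lin_form (coordR m (fst w) (snd w)) B))"
proof -
  have "sum_pairing (V_gens d) m n A B
      = lin_form (\<lambda>t. lin_form (\<lambda>s. coord_pairing m n (map_dtree undual t) s) B) A"
    unfolding sum_pairing_eq using A B by (intro lin_form_cong tree_pairing_coord[OF mn]) auto
  also have "\<dots> = - (\<Sum>w \<in> W m n. of_int (sign (snd w)) *
    (lin_form (coordL m (fst w) (snd w)) (lin_ext (map_dtree undual) A) * lin_form (coordL m (fst w) (snd w)) B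
      - lin_form (coordR m (fst w) (snd w)) (lin_ext (map_dtree undual) A) * lin_form (coordR m (fst w) (snd w)) B))"
    by (simp only: lin_form_fun(2,4) lin_form_fun_diff lin_form_sum_fun lin_form_lin_ext)
  finally show ?thesis .
qed

section \<open>The orthogonal complement of the relations\<close>

lemma dual_cls_image:
  fixes A :: "((gen \<Rightarrow> 'k::field_char_0) \<Rightarrow> 'k) dtree \<Rightarrow>\<^sub>0 'k"
  assumes mn: "(m, n) \<in> J0" and A: "Poly_Mapping.keys A \<subseteq> dtrees (dual_gens (V_gens d)) (m, n, i)"
  shows "lin_ext (map_dtree undual) ` dual.E1.cls d (m, n, i) A = V.cls (- d) (m, n, i) (lin_ext (map_dtree undual) A)"
proof -
  have N: "dual.E1.N d (m, n, i) \<subseteq> carrier (sp (tree_sums (dual_gens (V_gens d))) (m, n, i))"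
    using dual.E1.N_submodule[of d "(m, n, i)"] unfolding submodule_formal_sums_iff by auto
  show ?thesis
    using dual.sums.coset_image(2)[OF mn N, where x = A] A
    unfolding dual.E1.cls_def V.cls_def dual.N_image by simp
qed

text \<open>\<open>rel_elt d m w\<close> has coordinates 1 and - 1 at \<open>w\<close> and 0
  elsewhere, so pairing with it returns \<open>ev m w\<close> up to sign. Conversely, where all
  \<open>ev\<close> vanish, right coordinates are the negatives of left ones in both arguments, and
  the two products in each term cancel.\<close>

lemma perp_iff:
  fixes A :: "((gen \<Rightarrow> 'k::field_char_0) \<Rightarrow> 'k) dtree \<Rightarrow>\<^sub>0 'k"
  assumes mn: "rel_arity m n" and A: "Poly_Mapping.keys A \<subseteq> dtrees (dual_gens (V_gens d)) (m, n, i)"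
  shows "dual.E1.cls d (m, n, i) A \<in> quadratic_perp (V_gens d, V_rel d) (m, n, i)
    \<longleftrightarrow> (\<forall>w \<in> W m n. ev m w (lin_ext (map_dtree undual) A) = 0)"
proof -
  let ?\<Theta> = "lin_ext (map_dtree undual) :: (((gen \<Rightarrow> 'k) \<Rightarrow> 'k) dtree \<Rightarrow>\<^sub>0 'k) \<Rightarrow> _"
  let ?L = "\<lambda>w. lin_form (coordL m (fst w) (snd w))" and ?R = "\<lambda>w. lin_form (coordR m (fst w) (snd w))"
  have J: "(m, n) \<in> J0" using mn J0_small by auto
  have car: "dual.E1.cls d (m, n, i) A \<in> carrier (sp (dual.E1.F d) (m, n, i))"
    using A dual.E1.carrier_F by blast
  have "(\<forall>q. \<forall>D \<in> V_rel d (m, n, q). \<forall>A' \<in> dual.E1.cls d (m, n, i) A. \<forall>B \<in> D. sum_pairing (V_gens d) m n A' B = 0)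
      \<longleftrightarrow> (\<forall>w \<in> W m n. ev m w (?\<Theta> A) = 0)" (is "?P \<longleftrightarrow> _")
  proof (intro iffI ballI allI)
    fix w assume P: ?P and w: "w \<in> W m n"
    let ?B = "rel_elt d m w :: (gen \<Rightarrow> 'k) dtree \<Rightarrow>\<^sub>0 'k"
    have "sum_pairing (V_gens d) m n A ?B = 0"
      using P rel_elt_V_rel[OF mn w] dual.E1.cls_self[OF A] V.cls_self[OF keys_rel_elt[OF mn w]] by blast
    moreover have "?L v ?B = (if v = w then 1 else 0)" "?R v ?B = (if v = w then - 1 else 0)" if "v \<in> W m n" for v
      using that by (simp_all add: rel_elt_def coord_trees[OF mn w, of "fst v" "snd v"] eq_commute[of v w])
    then have "sum_pairing (V_gens d) m n A ?B = - (\<Sum>v \<in> W m n. if v = w then of_int (sign (snd w)) * ev m w (?\<Theta> A) else 0)"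
      unfolding sum_pairing_coord[OF mn A keys_rel_elt[OF mn w]]
      by (intro arg_cong[where f = uminus] sum.cong) (auto simp: ev_def)
    moreover have "of_int (sign (snd w)) \<noteq> (0 :: 'k)" by (simp add: sign_def)
    ultimately show "ev m w (?\<Theta> A) = 0" using w by simp
  next
    fix q A' and D :: "((gen \<Rightarrow> 'k) dtree \<Rightarrow>\<^sub>0 'k) set" and B :: "(gen \<Rightarrow> 'k) dtree \<Rightarrow>\<^sub>0 'k"
    assume ev: "\<forall>w \<in> W m n. ev m w (?\<Theta> A) = 0" and D: "D \<in> V_rel d (m, n, q)" "B \<in> D"
      and A': "A' \<in> dual.E1.cls d (m, n, i) A"
    have D': "D \<in> ev_kernel d (m, n, q)" using D(1) V_rel_kernel by blast
    then obtain B0 where "Poly_Mapping.keys B0 \<subseteq> dtrees (V_gens d) (m, n, q)" "D = V.cls d (m, n, q) B0"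
      using subsetD[OF ev_kernel_sub] unfolding V.carrier_F by blast
    then have B: "Poly_Mapping.keys B \<subseteq> dtrees (V_gens d) (m, n, q)" using V.mem_cls D(2) by blast
    have "ev m w B = 0" if "w \<in> W m n" for w
      using D' D(2) that unfolding ev_kernel_def prod.case if_P[OF mn] by blast
    then have RB: "?R w B = - ?L w B" if "w \<in> W m n" for w
      using that unfolding ev_def by (metis add_eq_0_iff)
    have k: "Poly_Mapping.keys A' \<subseteq> dtrees (dual_gens (V_gens d)) (m, n, i)" "A' - A \<in> dual.E1.N d (m, n, i)"
      using A' dual.E1.mem_cls[OF A] by blast+
    \<comment> \<open>The complement is defined through all representatives; \<open>ev\<close> does
      not distinguish \<open>A'\<close> from \<open>A\<close>, because their difference is mapped
      into \<open>N\<close>.\<close>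
    have "?\<Theta> (A' - A) \<in> V.N (- d) (m, n, i)" using k(2) dual.N_image by blast
    then have "ev m w (?\<Theta> A') = 0" if "w \<in> W m n" for w
      using ev_N[OF _ mn that, of "?\<Theta> (A' - A)" "- d" i] ev that by simp
    then have RA: "?R w (?\<Theta> A') = - ?L w (?\<Theta> A')" if "w \<in> W m n" for w
      using that unfolding ev_def by (metis add_eq_0_iff)
    show "sum_pairing (V_gens d) m n A' B = 0"
      unfolding sum_pairing_coord[OF mn k(1) B] using RA RB by (simp cong: sum.cong)
  qed
  then show ?thesis using car mn by auto
qed

lemma perp_carrier:
  assumes "(m, n) \<in> J0"
  shows "quadratic_perp (V_gens d, V_rel d) (m, n, i) \<subseteq> carrier (sp (dual.E1.F d) (m, n, i))"
proof -
  have "\<zero>\<^bsub>sp (dual.E1.F d) (m, n, i)\<^esub> \<in> carrier (sp (dual.E1.F d) (m, n, i))"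
    unfolding dual.E1.F_zero dual.E1.carrier_F by (rule exI[of _ 0]) simp
  then show ?thesis by auto
qed

text \<open>The complement, by \<open>perp_iff\<close>, and the relations for \<open>- d\<close>, by
  \<open>V_rel_eq\<close>, are described by the same functionals; surjectivity of the map on formal
  sums supplies the preimages.\<close>

lemma perp_image:
  fixes d :: int
  assumes J: "(m, n) \<in> J0"
  shows "image (lin_ext (map_dtree undual)) ` quadratic_perp (V_gens d, V_rel d) (m, n, i) =
    (V_rel (- d) (m, n, i) :: ((gen \<Rightarrow> 'k::field_char_0) dtree \<Rightarrow>\<^sub>0 'k) set set)"
proof (cases "rel_arity m n")
  case mn: True
  show ?thesis
    unfolding V_rel_eq[OF J]
  proof (intro equalityI subsetI)
    fix D :: "((gen \<Rightarrow> 'k) dtree \<Rightarrow>\<^sub>0 'k) set"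
    assume "D \<in> image (lin_ext (map_dtree undual)) ` quadratic_perp (V_gens d, V_rel d) (m, n, i)"
    then obtain C where C: "C \<in> quadratic_perp (V_gens d, V_rel d) (m, n, i)" "D = lin_ext (map_dtree undual) ` C" by blast
    obtain A where A: "Poly_Mapping.keys A \<subseteq> dtrees (dual_gens (V_gens d)) (m, n, i)" "C = dual.E1.cls d (m, n, i) A"
      using subsetD[OF perp_carrier[OF J] C(1)] unfolding dual.E1.carrier_F by blast
    show "D \<in> ev_kernel (- d) (m, n, i)"
      unfolding C(2) A(2) dual_cls_image[OF J A(1)] cls_ev_kernel[OF dual.keys_\<Theta>[OF A(1)] mn]
      using perp_iff[OF mn A(1)] C(1) A(2) by blast
  next
    fix D :: "((gen \<Rightarrow> 'k) dtree \<Rightarrow>\<^sub>0 'k) set" assume D: "D \<in> ev_kernel (- d) (m, n, i)"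
    obtain B where B: "Poly_Mapping.keys B \<subseteq> dtrees (V_gens (- d)) (m, n, i)" "D = V.cls (- d) (m, n, i) B"
      using subsetD[OF ev_kernel_sub D] unfolding V.carrier_F by blast
    have "B \<in> lin_ext (map_dtree undual) ` {A. Poly_Mapping.keys A \<subseteq> dtrees (dual_gens (V_gens d)) (m, n, i)}"
      using B(1) lin_ext_image[OF dual.\<Theta>_image] by blast
    then obtain A :: "((gen \<Rightarrow> 'k) \<Rightarrow> 'k) dtree \<Rightarrow>\<^sub>0 'k" where A: "Poly_Mapping.keys A \<subseteq> dtrees (dual_gens (V_gens d)) (m, n, i)"
      "B = lin_ext (map_dtree undual) A" by blast
    have "dual.E1.cls d (m, n, i) A \<in> quadratic_perp (V_gens d, V_rel d) (m, n, i)"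
      using perp_iff[OF mn A(1)] cls_ev_kernel[OF B(1) mn] D unfolding B(2) A(2) by blast
    then show "D \<in> image (lin_ext (map_dtree undual)) ` quadratic_perp (V_gens d, V_rel d) (m, n, i)"
      using dual_cls_image[OF J A(1)] unfolding B(2) A(2) by blast
  qed
next
  case False
  then have "quadratic_perp (V_gens d, V_rel d) (m, n, i) = {\<zero>\<^bsub>sp (dual.E1.F d) (m, n, i)\<^esub> :: (((gen \<Rightarrow> 'k) \<Rightarrow> 'k) dtree \<Rightarrow>\<^sub>0 'k) set}"
    unfolding quadratic_perp.simps by (rule if_not_P)
  then show ?thesis
    unfolding V_rel_eq[OF J] ev_kernel_zero[OF False] using dual.free.zero(2)[OF J, of d i] by simp
qed

theorem proposition1p1:
  fixes d :: int
  shows "quadratic_dioperad (quadratic_dual (V_data d :: ('k::field_char_0, gen \<Rightarrow> 'k) quadratic_data))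
    \<cong>\<^sub>d (V_dioperad (- d) :: ('k, ((gen \<Rightarrow> 'k) dtree \<Rightarrow>\<^sub>0 'k) set set) dioperad)"
  unfolding V_dioperad_def V_data_def quadratic_dual.simps
  by (rule dual.quotients_iso[OF perp_carrier perp_image])

end
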